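(* Let $X$ be a projective variety over a number field $K$ equipped with a big and semiample line bundle $L$, and let $dL$ ($d\in\mathbb{Z}_{>0}$) be a base point free multiple. Let $V\subset X(K)$ be a subset of its rational points. Let $a\in\mathbb{R}_{>0}$, $b\in\mathbb{R}_{\ge 1}$, and $c\in\mathbb{R}_{>0}$. Let $S$ be a finite set of places of $K$ containing the archimedean ones, with ring of $S$-integers $\mathfrak{o}_S$. Let $\mathcal{P}=\{s_0,\dots,s_n\}\subset H^0(X,dL)$ be a finite set of global sections without common zeros on $X$, and let $f=f_{\mathcal{P}}\colon X\to\mathbb{P}^n$ be the corresponding morphism. Let $\tau_{\mathcal{P}}$ be a finite measure on $X(\mathbf{A}_K)$, and for each finite set $\mathcal{P}'\subset H^0(X,dL)$ of global sections without common zeros define a measure $\tau_{\mathcal{P}'}$ on $X(\mathbf{A}_K)$ by $$\mathrm{d}\tau_{\mathcal{P}'}=\left(\frac{H_{\mathcal{P}}}{H_{\mathcal{P}'}}\right)^a\mathrm{d}\tau_{\mathcal{P}}.$$ Suppose that for each finite set $\mathcal{P}'\subset H^0(X,dL)$ such that (1) $\mathcal{P}\subset\mathcal{P}'$, and (2) every section in $\mathcal{P}'\setminus\mathcal{P}$ has the form $uh+u'h'$ with $u,u'\in\mathfrak{o}_S$ and $h,h'\in\mathcal{P}$, the asymptotic expansion $$N(\mathcal{P}',B)=c\,\tau_{\mathcal{P}'}(X(\mathbf{A}_K))\,B^a(\log B)^{b-1}(1+o_{\mathcal{P}'}(1))$$ holds for $B\to\infty$. Then the images of points in $V$ under $f$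 are equidistributed in $\prod_{v\in S}f(X)(K_v)$ with respect to the limit measure $f_*\tau_{\mathcal{P}}$ (normalized to a probability measure) when ordered by $H_{\mathcal{P}}$.
   Context: $\mathbf{A}_K$ is the ring of adeles of $K$. The absolute values $|\cdot|_v$ on the completions $K_v$ are normalized such that $\mathrm{d}x/|x|_v$ is a Haar measure on $K_v^\times$ and the product formula holds (so $|\cdot|_v$ is the square of the usual absolute value for complex $v$). Heights: for a finite set $\mathcal{P}'\subset H^0(X,dL)$ of global sections without common zeros, pulling back the standard (supremum) metric on $\mathcal{O}(1)$ along the morphism to projective space induced by $\mathcal{P}'$ gives a metric on $dL$ and hence on $L$. The associated height is $H_{\mathcal{P}'}(x)=\prod_v\max_{s\in\mathcal{P}'}|s(x)|_v^{1/d}$ for $x\in X(K)$ (evaluated using any nonzero trivialization of the fibre of $dL$ at $x$). For an adelic point $x=(x_v)_v$, the quotient is $\frac{H_{\mathcal{P}}}{H_{\mathcal{P}'}}(x)=\prod_v\left(\frac{\max_{s\in\mathcal{P}}|s(x_v)|_v}{\max_{s\in\mathcal{P}'}|s(x_v)|_v}\right)^{1/d}$, which is independent of choices of trivializations. Counting function: $N(\mathcal{P}',B)=|\{x\in V: H_{\mathcal{P}'}(x)\le B\}|$. Equidistribution: the images of points in $V$ are equidistributed in $Y=\prod_{v\in S}f(X)(K_v)$ with limit probability measure $\tau$ when ordered by $H$ if for every measurable $W\subset Y$ with $\tau(\partial W)=0$ one has $\frac{|\{x\in V: f(x)\in W,\ H(x)\le B\}|}{|\{x\in V: H(x)\le B\}|}\to\tau(W)$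 as $B\to\infty$ (where $f(x)$ is embedded diagonally in $Y$; points of $V$ with the same image under $f$ are counted with multiplicity). Here $f_*\tau_{\mathcal{P}}$ denotes the push-forward of $\tau_{\mathcal{P}}$ along $X(\mathbf{A}_K)\to\prod_{v\in S}X(K_v)\to\prod_{v\in S}f(X)(K_v)$. *)

theory Defs
  imports
    "HOL-Probability.Probability_Measure"
    "HOL-Library.Landau_Symbols"
    "HOL-Library.Poly_Mapping"
    "HOL-Algebra.QuotRing"
    "HOL-Algebra.Embedded_Algebras"
    "HOL-Algebra.Algebraic_Closure_Type"
begin

section \<open>Number fields, places and completions\<close>

class number_field = field_char_0 +
  assumes finite_over_rat: "\<exists>B. finite B \<and> (\<forall>x. \<exists>q :: 'a \<Rightarrow> rat. x = (\<Sum>b\<in>B. of_rat (q b) * b))"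

instance rat :: number_field
proof
  have "x = (\<Sum>b\<in>{1}. of_rat x * b)" for x :: rat
    by (cases x) (simp add: of_rat_rat Fract_of_int_quotient)
  then show "\<exists>B. finite B \<and> (\<forall>x::rat. \<exists>q :: rat \<Rightarrow> rat. x = (\<Sum>b\<in>B. of_rat (q b) * b))"
    by (intro exI[of _ "{1}"] conjI allI) (auto intro: exI[of _ "\<lambda>_. _"])
qed

text \<open>
  A place is identified with its normalized absolute value, i.e. the one for which
  \<open>dx / |x|\<^sub>v\<close> is a Haar measure on the multiplicative group of the completion: the usual
  absolute value for real places, its square for complex places (where the triangle
  inequality fails), and for a finite place the value \<open>1 / q\<close> on uniformizers, where \<open>q\<close> is
  the cardinality of the residue field.
\<close>

definition field_embedding :: "('k::field \<Rightarrow> complex) \<Rightarrow> bool" where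
  "field_embedding \<sigma> \<longleftrightarrow> \<sigma> 1 = 1 \<and> (\<forall>x y. \<sigma> (x + y) = \<sigma> x + \<sigma> y) \<and> (\<forall>x y. \<sigma> (x * y) = \<sigma> x * \<sigma> y)"

definition archimedean_places :: "('k::number_field \<Rightarrow> real) set" where
  "archimedean_places =
     {(\<lambda>x. cmod (\<sigma> x) ^ (if range \<sigma> \<subseteq> \<real> then 1 else 2)) | \<sigma>. field_embedding \<sigma>}"

definition nonarchimedean_absolute_value :: "('k::field \<Rightarrow> real) \<Rightarrow> bool" where
  "nonarchimedean_absolute_value v \<longleftrightarrow>
     (\<forall>x. 0 \<le> v x) \<and> (\<forall>x. v x = 0 \<longleftrightarrow> x = 0) \<and>
     (\<forall>x y. v (x * y) = v x * v y) \<and> (\<forall>x y. v (x + y) \<le> max (v x) (v y))"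

definition residue_cardinality :: "('k::field \<Rightarrow> real) \<Rightarrow> nat" where
  "residue_cardinality v = card ((\<lambda>x. {y. v (y - x) < 1}) ` {x. v x \<le> 1})"

definition finite_places :: "('k::number_field \<Rightarrow> real) set" where
  "finite_places =
     {v. nonarchimedean_absolute_value v \<and>
         (\<exists>\<pi>. \<pi> \<noteq> 0 \<and> v \<pi> < 1 \<and> v \<pi> = 1 / real (residue_cardinality v) \<and> (\<forall>x. v x < 1 \<longrightarrow> v x \<le> v \<pi>))}"

definition places :: "('k::number_field \<Rightarrow> real) set" where
  "places = archimedean_places \<union> finite_places"

definition S_integers :: "('k::number_field \<Rightarrow> real) set \<Rightarrow> 'k set" where
  "S_integers S = {u. \<forall>v\<in>places - S. v u \<le> 1}"

text \<open>
  The product over all places of a function that is 1 at all but finitely many of them.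
\<close>

definition place_prod :: "(('k::number_field \<Rightarrow> real) \<Rightarrow> real) \<Rightarrow> real" where
  "place_prod F = (\<Prod>v\<in>{v\<in>places. F v \<noteq> 1}. F v)"

text \<open>
  The completion is the ring of Cauchy sequences modulo the ideal of null sequences.
\<close>

definition cauchy_ring :: "('k::number_field \<Rightarrow> real) \<Rightarrow> (nat \<Rightarrow> 'k) ring" where
  "cauchy_ring v =
     \<lparr>carrier = {s. \<forall>\<epsilon>>0. \<exists>n0. \<forall>m\<ge>n0. \<forall>n\<ge>n0. v (s m - s n) < \<epsilon>},
      mult = (\<lambda>s t n. s n * t n), one = (\<lambda>_. 1), zero = (\<lambda>_. 0), add = (\<lambda>s t n. s n + t n)\<rparr>"

definition null_sequences :: "('k::number_field \<Rightarrow> real) \<Rightarrow> (nat \<Rightarrow> 'k) set" where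
  "null_sequences v = {s. (\<lambda>n. v (s n)) \<longlonglongrightarrow> 0}"

definition completion :: "('k::number_field \<Rightarrow> real) \<Rightarrow> (nat \<Rightarrow> 'k) set ring" where
  "completion v = cauchy_ring v Quot null_sequences v"

definition to_completion :: "('k::number_field \<Rightarrow> real) \<Rightarrow> 'k \<Rightarrow> (nat \<Rightarrow> 'k) set" where
  "to_completion v a = null_sequences v +>\<^bsub>cauchy_ring v\<^esub> (\<lambda>_. a)"

definition completion_abs :: "('k::number_field \<Rightarrow> real) \<Rightarrow> (nat \<Rightarrow> 'k) set \<Rightarrow> real" where
  "completion_abs v x = (THE r. \<forall>s\<in>x. (\<lambda>n. v (s n)) \<longlonglongrightarrow> r)"

definition completion_topology :: "('k::number_field \<Rightarrow> real) \<Rightarrow> (nat \<Rightarrow> 'k) set topology" where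
  "completion_topology v = topology (\<lambda>U. U \<subseteq> carrier (completion v) \<and>
     (\<forall>x\<in>U. \<exists>\<epsilon>>0. \<forall>y\<in>carrier (completion v).
        completion_abs v (y \<ominus>\<^bsub>completion v\<^esub> x) < \<epsilon> \<longrightarrow> y \<in> U))"


section \<open>Homogeneous polynomials\<close>

text \<open>
  Multivariate polynomials in variables indexed by the natural numbers; \<^term>\<open>mpoly_ring N\<close>
  is the subring of those that only involve the variables \<open>0, \<dots>, N\<close>.
\<close>

type_synonym 'k mpoly = "(nat \<Rightarrow>\<^sub>0 nat) \<Rightarrow>\<^sub>0 'k"

definition mpoly_ring :: "nat \<Rightarrow> 'k::field mpoly ring" where
  "mpoly_ring N = ring_of_type_algebra
     \<lparr>carrier := {p. \<forall>t\<in>Poly_Mapping.keys p. Poly_Mapping.keys t \<subseteq> {..N}}\<rparr>"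

definition mpoly_var :: "nat \<Rightarrow> 'k::field mpoly" where
  "mpoly_var j = Poly_Mapping.single (Poly_Mapping.single j 1) 1"

definition mpoly_const :: "'k::field \<Rightarrow> 'k mpoly" where
  "mpoly_const a = Poly_Mapping.single 0 a"

definition monomial_degree :: "(nat \<Rightarrow>\<^sub>0 nat) \<Rightarrow> nat" where
  "monomial_degree t = (\<Sum>j\<in>Poly_Mapping.keys t. Poly_Mapping.lookup t j)"

definition homogeneous :: "nat \<Rightarrow> 'k::field mpoly \<Rightarrow> bool" where
  "homogeneous m p \<longleftrightarrow> (\<forall>t\<in>Poly_Mapping.keys p. monomial_degree t = m)"

definition homogeneous_component :: "nat \<Rightarrow> 'k::field mpoly \<Rightarrow> 'k mpoly" where
  "homogeneous_component m p =
     (\<Sum>t\<in>{t\<in>Poly_Mapping.keys p. monomial_degree t = m}. Poly_Mapping.single t (Poly_Mapping.lookup p t))"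

text \<open>
  Evaluation at a point with coordinates in a commutative ring \<open>R\<close> that is an algebra over the
  coefficient field via \<open>\<iota>\<close>.
\<close>

definition mpoly_eval :: "'r ring \<Rightarrow> ('k::field \<Rightarrow> 'r) \<Rightarrow> (nat \<Rightarrow> 'r) \<Rightarrow> 'k mpoly \<Rightarrow> 'r" where
  "mpoly_eval R \<iota> x p =
     (\<Oplus>\<^bsub>R\<^esub>t\<in>Poly_Mapping.keys p. \<iota> (Poly_Mapping.lookup p t) \<otimes>\<^bsub>R\<^esub>
        (\<Otimes>\<^bsub>R\<^esub>j\<in>Poly_Mapping.keys t. x j [^]\<^bsub>R\<^esub> Poly_Mapping.lookup t j))"


section \<open>Projective varieties\<close>

text \<open>
  A closed subscheme of projective \<open>N\<close>-space is given by a homogeneous ideal; its points in the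
  sense of schemes are the relevant homogeneous primes containing that ideal (Proj).
\<close>

record (overloaded) 'k projective_scheme =
  ambient :: nat
  ideal_of :: "'k mpoly set"

definition scheme_points :: "'k::field projective_scheme \<Rightarrow> 'k mpoly set set" where
  "scheme_points XK =
     {Q. primeideal Q (mpoly_ring (ambient XK)) \<and> (\<forall>p\<in>Q. \<forall>m. homogeneous_component m p \<in> Q) \<and>
         ideal_of XK \<subseteq> Q \<and> \<not> (\<forall>j\<le>ambient XK. mpoly_var j \<in> Q)}"

text \<open>
  Varieties are integral: the ideal is itself a relevant homogeneous prime, the generic point.
\<close>

definition projective_variety :: "'k::field projective_scheme \<Rightarrow> bool" where
  "projective_variety XK \<longleftrightarrow> ideal_of XK \<in> scheme_points XK"

definition zariski_open :: "'k::field projective_scheme \<Rightarrow> 'k mpoly set set \<Rightarrow> bool" where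
  "zariski_open XK U \<longleftrightarrow>
     (\<exists>A. (\<forall>p\<in>A. p \<in> carrier (mpoly_ring (ambient XK)) \<and> (\<exists>m. homogeneous m p)) \<and>
          U = {Q \<in> scheme_points XK. \<not> A \<subseteq> Q})"

definition variety_dim :: "'k::field projective_scheme \<Rightarrow> nat" where
  "variety_dim XK = Sup {k. \<exists>Q :: nat \<Rightarrow> 'k mpoly set.
     (\<forall>j\<le>k. Q j \<in> scheme_points XK) \<and> (\<forall>j<k. Q j \<subset> Q (Suc j))}"

text \<open>
  The function field: fractions \<open>p / q\<close> of homogeneous polynomials of the same degree with \<open>q\<close>
  not in the ideal, modulo the ideal. Its elements are equivalence classes of pairs.
\<close>

definition is_fraction :: "'k::field projective_scheme \<Rightarrow> 'k mpoly \<Rightarrow> 'k mpoly \<Rightarrow> bool" where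
  "is_fraction XK p q \<longleftrightarrow>
     p \<in> carrier (mpoly_ring (ambient XK)) \<and> q \<in> carrier (mpoly_ring (ambient XK)) \<and>
     (\<exists>m. homogeneous m p \<and> homogeneous m q) \<and> q \<notin> ideal_of XK"

type_synonym 'k ratfun = "('k mpoly \<times> 'k mpoly) set"

definition fraction_class :: "'k::field projective_scheme \<Rightarrow> 'k mpoly \<Rightarrow> 'k mpoly \<Rightarrow> 'k ratfun" where
  "fraction_class XK p q = {(p', q'). is_fraction XK p' q' \<and> p * q' - p' * q \<in> ideal_of XK}"

definition function_field :: "'k::field projective_scheme \<Rightarrow> 'k ratfun ring" where
  "function_field XK =
     \<lparr>carrier = {fraction_class XK p q | p q. is_fraction XK p q},
      mult = (\<lambda>A B. \<Union>(p, q)\<in>A. \<Union>(p', q')\<in>B. fraction_class XK (p * p') (q * q')),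
      one = fraction_class XK 1 1, zero = fraction_class XK 0 1,
      add = (\<lambda>A B. \<Union>(p, q)\<in>A. \<Union>(p', q')\<in>B. fraction_class XK (p * q' + p' * q) (q * q'))\<rparr>"

definition constant_function :: "'k::field projective_scheme \<Rightarrow> 'k \<Rightarrow> 'k ratfun" where
  "constant_function XK a = fraction_class XK (mpoly_const a) 1"

definition regular_functions :: "'k::field projective_scheme \<Rightarrow> 'k mpoly set set \<Rightarrow> 'k ratfun set" where
  "regular_functions XK U = {A \<in> carrier (function_field XK). \<forall>Q\<in>U. \<exists>(p, q)\<in>A. q \<notin> Q}"


section \<open>Line bundles and their global sections\<close>

text \<open>
  A line bundle is given by transition functions with respect to a finite open cover
  \<open>U\<^sub>0, \<dots>, U\<^bsub>r-1\<^esub>\<close>: \<open>transition L i j\<close> is regular on \<open>U\<^sub>i \<inter> U\<^sub>j\<close> (hence, by the cocycle condition,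
  invertible there). As \<open>XK\<close> is integral, regular functions are elements of the function field.
  A section of the \<open>m\<close>-th power consists of regular functions \<open>s i\<close> on \<open>U\<^sub>i\<close> with
  \<open>s i = (transition L i j)\<^sup>m s j\<close>.
\<close>

record (overloaded) 'k line_bundle =
  num_charts :: nat
  chart :: "nat \<Rightarrow> 'k mpoly set set"
  transition :: "nat \<Rightarrow> nat \<Rightarrow> 'k ratfun"

definition line_bundle_on :: "'k::field projective_scheme \<Rightarrow> 'k line_bundle \<Rightarrow> bool" where
  "line_bundle_on XK L \<longleftrightarrow>
     (\<forall>i<num_charts L. zariski_open XK (chart L i)) \<and>
     (\<Union>i<num_charts L. chart L i) = scheme_points XK \<and>
     (\<forall>i<num_charts L. \<forall>j<num_charts L.
        transition L i j \<in> regular_functions XK (chart L i \<inter> chart L j)) \<and>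
     (\<forall>i<num_charts L. transition L i i = \<one>\<^bsub>function_field XK\<^esub>) \<and>
     (\<forall>i<num_charts L. \<forall>j<num_charts L. \<forall>k<num_charts L.
        transition L i j \<otimes>\<^bsub>function_field XK\<^esub> transition L j k = transition L i k)"

type_synonym 'k bundle_section = "nat \<Rightarrow> 'k ratfun"

definition global_sections :: "'k::field projective_scheme \<Rightarrow> 'k line_bundle \<Rightarrow> nat \<Rightarrow> 'k bundle_section set" where
  "global_sections XK L m =
     {s \<in> (\<Pi>\<^sub>E i\<in>{..<num_charts L}. regular_functions XK (chart L i)).
        \<forall>i<num_charts L. \<forall>j<num_charts L.
          s i = transition L i j [^]\<^bsub>function_field XK\<^esub> m \<otimes>\<^bsub>function_field XK\<^esub> s j}"

definition section_lincomb ::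
  "'k::field projective_scheme \<Rightarrow> 'k line_bundle \<Rightarrow> 'k \<Rightarrow> 'k bundle_section \<Rightarrow> 'k \<Rightarrow> 'k bundle_section \<Rightarrow> 'k bundle_section" where
  "section_lincomb XK L u h u' h' =
     (\<lambda>i\<in>{..<num_charts L}.
        constant_function XK u \<otimes>\<^bsub>function_field XK\<^esub> h i \<oplus>\<^bsub>function_field XK\<^esub>
        constant_function XK u' \<otimes>\<^bsub>function_field XK\<^esub> h' i)"

definition no_common_zeros :: "'k::field projective_scheme \<Rightarrow> 'k line_bundle \<Rightarrow> 'k bundle_section set \<Rightarrow> bool" where
  "no_common_zeros XK L P \<longleftrightarrow>
     (\<forall>Q\<in>scheme_points XK. \<exists>s\<in>P. \<exists>i<num_charts L. Q \<in> chart L i \<and> (\<exists>(p, q)\<in>s i. p \<notin> Q \<and> q \<notin> Q))"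

definition base_point_free :: "'k::field projective_scheme \<Rightarrow> 'k line_bundle \<Rightarrow> nat \<Rightarrow> bool" where
  "base_point_free XK L m \<longleftrightarrow> no_common_zeros XK L (global_sections XK L m)"

definition semiample :: "'k::field projective_scheme \<Rightarrow> 'k line_bundle \<Rightarrow> bool" where
  "semiample XK L \<longleftrightarrow> (\<exists>m>0. base_point_free XK L m)"

text \<open>
  A section is determined by its restriction to the chart 0, which identifies the space of global
  sections with a subspace of the function field.
\<close>

definition h0 :: "'k::field projective_scheme \<Rightarrow> 'k line_bundle \<Rightarrow> nat \<Rightarrow> nat" where
  "h0 XK L m =
     ring.dim (function_field XK) (range (constant_function XK)) ((\<lambda>s. s 0) ` global_sections XK L m)"

definition big :: "'k::field projective_scheme \<Rightarrow> 'k line_bundle \<Rightarrow> bool" where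
  "big XK L \<longleftrightarrow> limsup (\<lambda>m. ereal (real (h0 XK L m) / real m ^ variety_dim XK)) > 0"


section \<open>Rational points and values of sections\<close>

text \<open>
  Points of projective space over a field \<open>R\<close> are the classes of nonzero vectors up to scaling.
\<close>

definition projective_class :: "'r ring \<Rightarrow> nat \<Rightarrow> (nat \<Rightarrow> 'r) \<Rightarrow> (nat \<Rightarrow> 'r) set" where
  "projective_class R N x = {(\<lambda>j\<in>{..N}. c \<otimes>\<^bsub>R\<^esub> x j) | c. c \<in> carrier R - {\<zero>\<^bsub>R\<^esub>}}"

definition nonzero_vectors :: "'r ring \<Rightarrow> nat \<Rightarrow> (nat \<Rightarrow> 'r) set" where
  "nonzero_vectors R N = {x \<in> (\<Pi>\<^sub>E j\<in>{..N}. carrier R). \<exists>j\<le>N. x j \<noteq> \<zero>\<^bsub>R\<^esub>}"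

definition projective_space :: "'r ring \<Rightarrow> nat \<Rightarrow> (nat \<Rightarrow> 'r) set set" where
  "projective_space R N = projective_class R N ` nonzero_vectors R N"

definition points_over ::
  "'k::field projective_scheme \<Rightarrow> 'r ring \<Rightarrow> ('k \<Rightarrow> 'r) \<Rightarrow> (nat \<Rightarrow> 'r) set set" where
  "points_over XK R \<iota> =
     {P \<in> projective_space R (ambient XK). \<forall>x\<in>P. \<forall>p\<in>ideal_of XK. mpoly_eval R \<iota> x p = \<zero>\<^bsub>R\<^esub>}"

text \<open>
  The image in \<open>XK\<close> of a point with values in a field, as a point of the scheme.
\<close>

definition underlying_point ::
  "'k::field projective_scheme \<Rightarrow> 'r ring \<Rightarrow> ('k \<Rightarrow> 'r) \<Rightarrow> (nat \<Rightarrow> 'r) set \<Rightarrow> 'k mpoly set" where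
  "underlying_point XK R \<iota> P =
     {p \<in> carrier (mpoly_ring (ambient XK)).
        \<forall>m. \<forall>x\<in>P. mpoly_eval R \<iota> x (homogeneous_component m p) = \<zero>\<^bsub>R\<^esub>}"

definition function_value ::
  "'r ring \<Rightarrow> ('k::field \<Rightarrow> 'r) \<Rightarrow> 'k ratfun \<Rightarrow> (nat \<Rightarrow> 'r) set \<Rightarrow> 'r" where
  "function_value R \<iota> A P =
     (THE y. y \<in> carrier R \<and> (\<exists>x\<in>P. \<exists>(p, q)\<in>A.
        mpoly_eval R \<iota> x q \<noteq> \<zero>\<^bsub>R\<^esub> \<and> y \<otimes>\<^bsub>R\<^esub> mpoly_eval R \<iota> x q = mpoly_eval R \<iota> x p))"

text \<open>
  Values of sections are defined up to a common factor, the choice of a trivialization of the fibre;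
  heights and height quotients do not depend on it.
  Sections are evaluated at a point using the trivialization on the first chart containing it;
  this choice only depends on the point, so all sections are evaluated consistently.
\<close>

definition chart_at ::
  "'k::field projective_scheme \<Rightarrow> 'k line_bundle \<Rightarrow> 'r ring \<Rightarrow> ('k \<Rightarrow> 'r) \<Rightarrow> (nat \<Rightarrow> 'r) set \<Rightarrow> nat" where
  "chart_at XK L R \<iota> P = (LEAST i. i < num_charts L \<and> underlying_point XK R \<iota> P \<in> chart L i)"

definition section_value ::
  "'k::field projective_scheme \<Rightarrow> 'k line_bundle \<Rightarrow> 'r ring \<Rightarrow> ('k \<Rightarrow> 'r) \<Rightarrow> 'k bundle_section \<Rightarrow> (nat \<Rightarrow> 'r) set \<Rightarrow> 'r" where
  "section_value XK L R \<iota> s P = function_value R \<iota> (s (chart_at XK L R \<iota> P)) P"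

text \<open>
  The morphism to projective \<open>n\<close>-space given by sections \<open>s 0, \<dots>, s n\<close>, on points over \<open>R\<close>.
\<close>

definition section_morphism ::
  "'k::field projective_scheme \<Rightarrow> 'k line_bundle \<Rightarrow> nat \<Rightarrow> (nat \<Rightarrow> 'k bundle_section) \<Rightarrow>
   'r ring \<Rightarrow> ('k \<Rightarrow> 'r) \<Rightarrow> (nat \<Rightarrow> 'r) set \<Rightarrow> (nat \<Rightarrow> 'r) set" where
  "section_morphism XK L n s R \<iota> P =
     projective_class R n (\<lambda>j\<in>{..n}. section_value XK L R \<iota> (s j) P)"

text \<open>
  The image variety \<open>f(XK)\<close>, defined by all homogeneous relations between the sections. Its points
  over a field may be more than the image of the points of \<open>XK\<close> over this field.
\<close>

definition image_variety ::
  "'k::field projective_scheme \<Rightarrow> 'k line_bundle \<Rightarrow> nat \<Rightarrow> (nat \<Rightarrow> 'k bundle_section) \<Rightarrow> 'k projective_scheme" where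
  "image_variety XK L n s =
     \<lparr>ambient = n,
      ideal_of = {G \<in> carrier (mpoly_ring n). \<forall>m. \<forall>i<num_charts L.
        mpoly_eval (function_field XK) (constant_function XK) (\<lambda>j. s j i) (homogeneous_component m G)
          = \<zero>\<^bsub>function_field XK\<^esub>}\<rparr>"


section \<open>Local and adelic points\<close>

definition borel_of :: "'a topology \<Rightarrow> 'a measure" where
  "borel_of T = sigma (topspace T) {U. openin T U}"

definition projective_topology ::
  "('k::number_field \<Rightarrow> real) \<Rightarrow> nat \<Rightarrow> (nat \<Rightarrow> (nat \<Rightarrow> 'k) set) set topology" where
  "projective_topology v N = topology (\<lambda>U. U \<subseteq> projective_space (completion v) N \<and>
     openin (product_topology (\<lambda>_. completion_topology v) {..N})
       {x \<in> nonzero_vectors (completion v) N. projective_class (completion v) N x \<in> U})"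

definition local_points ::
  "'k::number_field projective_scheme \<Rightarrow> ('k \<Rightarrow> real) \<Rightarrow> (nat \<Rightarrow> (nat \<Rightarrow> 'k) set) set topology" where
  "local_points XK v = subtopology (projective_topology v (ambient XK))
     (points_over XK (completion v) (to_completion v))"

text \<open>
  The space of points over the ring of adeles. As \<open>XK\<close> is projective, every point over a completion
  at a finite place has coordinates that are integral and not all divisible by a uniformizer, so
  the restricted product is the full product over all places, with the product topology.
\<close>

type_synonym 'k adelic_point = "('k \<Rightarrow> real) \<Rightarrow> (nat \<Rightarrow> (nat \<Rightarrow> 'k) set) set"

definition adelic_points :: "'k::number_field projective_scheme \<Rightarrow> 'k adelic_point topology" where
  "adelic_points XK = product_topology (local_points XK) places"

definition rational_points :: "'k::number_field projective_scheme \<Rightarrow> (nat \<Rightarrow> 'k) set set" where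
  "rational_points XK = points_over XK ring_of_type_algebra (\<lambda>a. a)"

definition to_local_point ::
  "nat \<Rightarrow> ('k::number_field \<Rightarrow> real) \<Rightarrow> (nat \<Rightarrow> 'k) set \<Rightarrow> (nat \<Rightarrow> (nat \<Rightarrow> 'k) set) set" where
  "to_local_point N v P =
     projective_class (completion v) N (\<lambda>j\<in>{..N}. to_completion v ((SOME x. x \<in> P) j))"

definition image_points ::
  "'k::number_field projective_scheme \<Rightarrow> 'k line_bundle \<Rightarrow> nat \<Rightarrow> (nat \<Rightarrow> 'k bundle_section) \<Rightarrow>
   ('k \<Rightarrow> real) set \<Rightarrow> 'k adelic_point topology" where
  "image_points XK L n s S = product_topology (local_points (image_variety XK L n s)) S"

definition diagonal_image ::
  "'k::number_field projective_scheme \<Rightarrow> 'k line_bundle \<Rightarrow> nat \<Rightarrow> (nat \<Rightarrow> 'k bundle_section) \<Rightarrow>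
   ('k \<Rightarrow> real) set \<Rightarrow> (nat \<Rightarrow> 'k) set \<Rightarrow> 'k adelic_point" where
  "diagonal_image XK L n s S x =
     (\<lambda>v\<in>S. to_local_point n v (section_morphism XK L n s ring_of_type_algebra (\<lambda>a. a) x))"

definition adelic_image ::
  "'k::number_field projective_scheme \<Rightarrow> 'k line_bundle \<Rightarrow> nat \<Rightarrow> (nat \<Rightarrow> 'k bundle_section) \<Rightarrow>
   ('k \<Rightarrow> real) set \<Rightarrow> 'k adelic_point \<Rightarrow> 'k adelic_point" where
  "adelic_image XK L n s S x =
     (\<lambda>v\<in>S. section_morphism XK L n s (completion v) (to_completion v) (x v))"


section \<open>Heights and equidistribution\<close>

definition height ::
  "'k::number_field projective_scheme \<Rightarrow> 'k line_bundle \<Rightarrow> nat \<Rightarrow> 'k bundle_section set \<Rightarrow> (nat \<Rightarrow> 'k) set \<Rightarrow> real" where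
  "height XK L d P x =
     place_prod (\<lambda>v. (MAX s\<in>P. v (section_value XK L ring_of_type_algebra (\<lambda>a. a) s x)) powr (1 / real d))"

definition local_maximum ::
  "'k::number_field projective_scheme \<Rightarrow> 'k line_bundle \<Rightarrow> 'k bundle_section set \<Rightarrow> ('k \<Rightarrow> real) \<Rightarrow>
   (nat \<Rightarrow> (nat \<Rightarrow> 'k) set) set \<Rightarrow> real" where
  "local_maximum XK L P v x =
     (MAX s\<in>P. completion_abs v (section_value XK L (completion v) (to_completion v) s x))"

definition height_ratio ::
  "'k::number_field projective_scheme \<Rightarrow> 'k line_bundle \<Rightarrow> nat \<Rightarrow> 'k bundle_section set \<Rightarrow> 'k bundle_section set \<Rightarrow>
   'k adelic_point \<Rightarrow> real" where
  "height_ratio XK L d P P' x =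
     place_prod (\<lambda>v. (local_maximum XK L P v (x v) / local_maximum XK L P' v (x v)) powr (1 / real d))"

definition height_measure ::
  "'k::number_field projective_scheme \<Rightarrow> 'k line_bundle \<Rightarrow> nat \<Rightarrow> real \<Rightarrow> 'k bundle_section set \<Rightarrow>
   'k adelic_point measure \<Rightarrow> 'k bundle_section set \<Rightarrow> 'k adelic_point measure" where
  "height_measure XK L d a P \<tau> P' = density \<tau> (\<lambda>x. ennreal (height_ratio XK L d P P' x powr a))"

text \<open>
  Cardinalities of infinite sets are 0 in HOL. An asymptotic expansion with a positive leading
  coefficient therefore forces the counted sets to be finite.
\<close>

definition counting_function :: "'p set \<Rightarrow> ('p \<Rightarrow> real) \<Rightarrow> real \<Rightarrow> real" where
  "counting_function V H B = real (card {x \<in> V. H x \<le> B})"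

definition equidistributed ::
  "'p set \<Rightarrow> ('p \<Rightarrow> 'y) \<Rightarrow> ('p \<Rightarrow> real) \<Rightarrow> 'y topology \<Rightarrow> 'y measure \<Rightarrow> bool" where
  "equidistributed V g H Y \<mu> \<longleftrightarrow>
     prob_space \<mu> \<and> sets \<mu> = sets (borel_of Y) \<and>
     (\<forall>W\<in>sets \<mu>. measure \<mu> (Y frontier_of W) = 0 \<longrightarrow>
        ((\<lambda>B. counting_function {x \<in> V. g x \<in> W} H B / counting_function V H B)
           \<longlongrightarrow> measure \<mu> W) at_top)"

definition normalized :: "'a measure \<Rightarrow> 'a measure" where
  "normalized \<mu> = scale_measure (1 / emeasure \<mu> (space \<mu>)) \<mu>"

end

theory Submission
  imports Defs "HOL-Real_Asymp.Real_Asymp"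
begin

text \<open>
  Adding to \<open>P\<close> sections \<open>u\<^sub>v h\<close> for \<open>v \<in> S\<close>, where \<open>h\<close> runs through the \<open>s\<^sub>i\<close> and finitely many
  combinations \<open>a s\<^sub>i + b s\<^sub>j\<close> chosen for \<open>v\<close> and the \<open>S\<close>-integer \<open>u\<^sub>v\<close> is much larger at \<open>v\<close> than all
  other \<open>u\<^sub>p\<close>, multiplies the height of \<open>x\<close> by a constant and by \<open>1 / w(f(x))\<close>, where \<open>w\<close> is the
  product over \<open>v \<in> S\<close> of \<open>1 / max(1, \<phi>\<^sub>v)\<close> and \<open>\<phi>\<^sub>v\<close> is the local maximum of the combinations
  relative to that of \<open>P\<close>. So the hypothesis says that the number of \<open>x \<in> V\<close> with \<open>H(x) \<le> B w(f(x))\<close>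
  is asymptotic to \<open>c B\<^sup>a (log B)\<^sup>b\<^sup>-\<^sup>1\<close> times the integral of \<open>w\<^sup>a\<close>; call such weights good.

  Minima of the weights \<open>1 / max(1, \<phi>\<^sub>v)\<close> are again of this form, so by inclusion and exclusion maxima
  of weights that differ in one factor only are good. As the forms separate points from closed sets,
  these maxima approximate the indicator functions of \<open>\<phi>\<^sub>v < r\<close> and of \<open>\<phi>\<^sub>v > r\<close>. If \<open>\<phi>\<^sub>v = r\<close> has
  measure 0, lower bounds for the counts with both indicator functions add up to the known total, so
  the indicator functions are good. Replacing the factors one place at a time gives boxes, which form a
  basis of the topology and are stable under intersection. Another inclusion and exclusion bounds the
  counts in open sets from below, in particular those in the interior and the exterior of \<open>W\<close>.
\<close>

section \<open>Counting with weights\<close>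

text \<open>Adding sections can only raise a height, so the test functions at hand are products over
  \<open>S\<close> with one factor \<open>1 / max 1 (\<phi> v)\<close> per place. The minimum of two
  such products is of this kind again if they differ at a single place, but not in general. Hence
  inclusion and exclusion keeps the factors at the other places fixed until all factors are
  indicator functions; from then on intersections cause no trouble. Approximation from inside
  controls a count only from below, so every upper bound is obtained by bounding a complement from
  below. The coordinates are scaled by \<open>u v\<close> together with the chosen forms: this
  produces the \<open>1\<close> in \<open>max 1\<close> and lets the multipliers contribute a mere
  constant. That constant is harmless, since the logarithm varies slowly and
  \<open>rate (l * B) / rate B\<close> tends to \<open>l powr a\<close>. The coefficients are
  \<open>S\<close>-integers, so the maxima outside \<open>S\<close> do not change. Number fields are
  countable, hence so is the family of weights: maxima along a sequence of weights suffice for the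
  approximation, and a single level can be found that is null for all functions at once.\<close>

locale weighted_counting = finite_measure \<mu>
  for \<mu> :: "'y measure" +
  fixes V :: "'p set" and H :: "'p \<Rightarrow> real" and g :: "'p \<Rightarrow> 'y" and a b c :: real
  assumes a_pos: "a > 0" and c_pos: "c > 0"
    and H_pos: "x \<in> V \<Longrightarrow> H x > 0"
    and g_space: "x \<in> V \<Longrightarrow> g x \<in> space \<mu>"
    and finite_bounded: "finite {x \<in> V. H x \<le> B}"
begin

definition rate :: "real \<Rightarrow> real" where
  "rate B = c * B powr a * ln B powr (b - 1)"

text \<open>For positive weights this is the number of points with
  \<open>H x / w (g x) \<le> B\<close>, the height after a change of metric. In product form, points
  of weight 0 are simply not counted, because heights are positive.\<close>

definition weighted_count :: "('y \<Rightarrow> real) \<Rightarrow> real \<Rightarrow> real" where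
  "weighted_count w B = real (card {x \<in> V. H x \<le> B * w (g x)})"

definition good :: "('y \<Rightarrow> real) \<Rightarrow> bool" where
  "good w \<longleftrightarrow> ((\<lambda>B. weighted_count w B / rate B) \<longlongrightarrow> (\<integral>y. w y powr a \<partial>\<mu>)) at_top"

definition weight :: "('y \<Rightarrow> real) \<Rightarrow> bool" where
  "weight w \<longleftrightarrow> w \<in> borel_measurable \<mu> \<and> (\<forall>y\<in>space \<mu>. 0 \<le> w y \<and> w y \<le> 1)"

lemma rate_pos: "B > 1 \<Longrightarrow> rate B > 0"
  unfolding rate_def using c_pos by simp

lemma eventually_rate_pos: "\<forall>\<^sub>F B in at_top. rate B > 0 \<and> B > 0"
  using eventually_gt_at_top[of 1] by eventually_elim (auto intro: rate_pos)

lemma integrable_weight_powr: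
  assumes "weight w" shows "integrable \<mu> (\<lambda>y. w y powr a)"
proof (rule integrable_const_bound[where B = 1])
  show "AE y in \<mu>. norm (w y powr a) \<le> 1"
    using assms a_pos by (intro AE_I2) (auto simp: weight_def intro: powr_le1)
  show "(\<lambda>y. w y powr a) \<in> borel_measurable \<mu>"
    using assms by (auto simp: weight_def)
qed

lemma finite_weighted:
  assumes "\<forall>y\<in>space \<mu>. 0 \<le> w y \<and> w y \<le> K"
  shows "finite {x \<in> V. H x \<le> B * w (g x)}"
proof (rule finite_subset[OF _ finite_bounded[of "\<bar>B\<bar> * K"]], safe)
  fix x assume x: "x \<in> V" "H x \<le> B * w (g x)"
  have "B * w (g x) \<le> \<bar>B\<bar> * K"
    using assms g_space[OF x(1)] by (intro mult_mono) auto
  then show "H x \<le> \<bar>B\<bar> * K" using x by linarith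
qed

lemma weight_bounds: "weight w \<Longrightarrow> \<forall>y\<in>space \<mu>. 0 \<le> w y \<and> w y \<le> 1"
  by (simp add: weight_def)

lemma weighted_count_cong:
  assumes "\<And>y. y \<in> space \<mu> \<Longrightarrow> w y = w' y"
  shows "weighted_count w = weighted_count w'"
  unfolding weighted_count_def using assms g_space by (intro ext arg_cong[of _ _ "\<lambda>S. real (card S)"]) auto

lemma good_cong:
  assumes "\<And>y. y \<in> space \<mu> \<Longrightarrow> w y = w' y"
  shows "good w \<longleftrightarrow> good w'"
proof -
  have "(\<integral>y. w y powr a \<partial>\<mu>) = (\<integral>y. w' y powr a \<partial>\<mu>)"
    using assms by (intro Bochner_Integration.integral_cong) auto
  moreover have "weighted_count w = weighted_count w'"
    using assms by (rule weighted_count_cong)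
  ultimately show ?thesis by (simp add: good_def)
qed

text \<open>The quotient \<open>ln (l * B) / ln B\<close> tends to 1, so the logarithmic factor
  drops out and only the power of \<open>B\<close> reacts to the scaling.\<close>

lemma rate_scale:
  assumes "l > 0"
  shows "((\<lambda>B. rate (l * B) / rate B) \<longlongrightarrow> l powr a) at_top"
proof -
  have "((\<lambda>B. ln (l * B) / ln B) \<longlongrightarrow> 1) at_top"
    using assms by real_asymp
  then have "((\<lambda>B. l powr a * (ln (l * B) / ln B) powr (b - 1)) \<longlongrightarrow> l powr a * 1 powr (b - 1)) at_top"
    by (intro tendsto_intros) auto
  moreover have "\<forall>\<^sub>F B in at_top. l powr a * (ln (l * B) / ln B) powr (b - 1) = rate (l * B) / rate B"
    using eventually_gt_at_top[of 1] eventually_gt_at_top[of "1 / l"]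
  proof eventually_elim
    case (elim B)
    then have "l * B > 1" using assms by (simp add: field_simps)
    moreover have "B powr a > 0" using elim by simp
    ultimately show ?case
      using elim c_pos assms unfolding rate_def
      by (simp add: powr_mult powr_divide)
  qed
  ultimately show ?thesis by (simp add: tendsto_cong)
qed

text \<open>The factor \<open>l\<close> moves into the height bound. The limit \<open>J\<close> is
  left arbitrary, since the asymptotic hypothesis supplies it as a constant times an
  integral.\<close>

lemma weighted_count_scale:
  assumes lim: "((\<lambda>B. weighted_count w B / rate B) \<longlongrightarrow> J) at_top" and l: "l > 0"
  shows "((\<lambda>B. weighted_count (\<lambda>y. l * w y) B / rate B) \<longlongrightarrow> l powr a * J) at_top"
proof -
  have "filterlim (\<lambda>B. l * B) at_top at_top"
    using l by real_asymp
  from filterlim_compose[OF lim this]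
  have "((\<lambda>B. weighted_count w (l * B) / rate (l * B)) \<longlongrightarrow> J) at_top" .
  from tendsto_mult[OF rate_scale[OF l] this]
  have "((\<lambda>B. rate (l * B) / rate B * (weighted_count w (l * B) / rate (l * B))) \<longlongrightarrow> l powr a * J) at_top" .
  moreover have "\<forall>\<^sub>F B in at_top. rate (l * B) / rate B * (weighted_count w (l * B) / rate (l * B)) =
     weighted_count (\<lambda>y. l * w y) B / rate B"
    using eventually_gt_at_top[of "1 / l"]
  proof eventually_elim
    case (elim B)
    then have "rate (l * B) > 0" using l by (intro rate_pos) (simp add: field_simps)
    then show ?case by (simp add: weighted_count_def mult_ac)
  qed
  ultimately show ?thesis by (simp add: tendsto_cong)
qed

lemmas good_scale = weighted_count_scale[OF good_def[THEN iffD1]]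

text \<open>The sublevel sets of the maximum and the minimum of two weights are the union and the
  intersection of the two sublevel sets.\<close>
lemma good_max:
  assumes "weight w" "weight w'" "good w" "good w'" "good (\<lambda>y. min (w y) (w' y))"
  shows "good (\<lambda>y. max (w y) (w' y))"
proof -
  have wm: "weight (\<lambda>y. min (w y) (w' y))" "weight (\<lambda>y. max (w y) (w' y))"
    using assms(1,2) by (auto simp: weight_def min_def max_def)
  have I: "(\<integral>y. max (w y) (w' y) powr a \<partial>\<mu>) =
     (\<integral>y. w y powr a \<partial>\<mu>) + (\<integral>y. w' y powr a \<partial>\<mu>) - (\<integral>y. min (w y) (w' y) powr a \<partial>\<mu>)"
  proof -
    have "(\<integral>y. max (w y) (w' y) powr a \<partial>\<mu>) = (\<integral>y. w y powr a + w' y powr a - min (w y) (w' y) powr a \<partial>\<mu>)"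
      by (intro Bochner_Integration.integral_cong) (auto simp: max_def min_def)
    then show ?thesis
      using integrable_weight_powr assms(1,2) wm by simp
  qed
  have "\<forall>\<^sub>F B in at_top. weighted_count w B / rate B + weighted_count w' B / rate B
      - weighted_count (\<lambda>y. min (w y) (w' y)) B / rate B = weighted_count (\<lambda>y. max (w y) (w' y)) B / rate B"
    using eventually_rate_pos
  proof eventually_elim
    case (elim B)
    let ?A = "{x \<in> V. H x \<le> B * w (g x)}" and ?A' = "{x \<in> V. H x \<le> B * w' (g x)}"
    have f: "finite ?A" "finite ?A'"
      using finite_weighted[OF weight_bounds] assms(1,2) by auto
    have "{x \<in> V. H x \<le> B * min (w (g x)) (w' (g x))} = ?A \<inter> ?A'"
      "{x \<in> V. H x \<le> B * max (w (g x)) (w' (g x))} = ?A \<union> ?A'"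
      using elim by (auto simp: min_def max_def dest: mult_left_mono[of _ _ B])
         (smt (verit) mult_left_mono)+
    then have "weighted_count (\<lambda>y. min (w y) (w' y)) B + weighted_count (\<lambda>y. max (w y) (w' y)) B
       = weighted_count w B + weighted_count w' B"
      using card_Un_Int[OF f] unfolding weighted_count_def by simp
    then show ?case by (simp add: add_divide_distrib[symmetric] diff_divide_distrib[symmetric])
  qed
  moreover have "((\<lambda>B. weighted_count w B / rate B + weighted_count w' B / rate B
      - weighted_count (\<lambda>y. min (w y) (w' y)) B / rate B) \<longlongrightarrow> (\<integral>y. max (w y) (w' y) powr a \<partial>\<mu>)) at_top"
    unfolding I using assms(3-5) unfolding good_def by (intro tendsto_intros)
  ultimately show ?thesis unfolding good_def by (simp add: tendsto_cong)
qed

section \<open>Finite maxima of weights and indicator functions at one place\<close>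

primrec max_upto :: "(nat \<Rightarrow> 'y \<Rightarrow> real) \<Rightarrow> nat \<Rightarrow> 'y \<Rightarrow> real" where
  "max_upto G 0 = G 0"
| "max_upto G (Suc m) = (\<lambda>y. max (max_upto G m y) (G (Suc m) y))"

lemma max_upto_min: "max_upto (\<lambda>i y. min (G i y) (G' y)) m y = min (max_upto G m y) (G' y)"
  by (induction m) (simp_all add: min_max_distrib1)

lemma max_upto_ge: "i \<le> m \<Longrightarrow> G i y \<le> max_upto G m y"
  by (induction m) (auto simp: le_Suc_eq)

lemma max_upto_le: "(\<And>i. G i y \<le> t) \<Longrightarrow> max_upto G m y \<le> t"
  by (induction m) auto

lemma weight_max_upto: "(\<And>i. weight (G i)) \<Longrightarrow> weight (max_upto G m)"
  by (induction m) (auto simp: weight_def le_max_iff_disj intro: borel_measurable_max)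

lemma weight_mult: "weight G \<Longrightarrow> weight R \<Longrightarrow> weight (\<lambda>y. G y * R y)"
  by (auto simp: weight_def intro: mult_le_one)

text \<open>Inclusion and exclusion in the step from \<open>m\<close> to \<open>Suc m\<close> needs
  the maximum of the first members and also the maximum of their minima with the new member. Both
  are instances of the induction hypothesis, which is why it is stated for all sequences in
  \<open>\<G>\<close>. The factor \<open>R\<close> is nonnegative and can be pulled out of maxima
  and minima.\<close>

lemma good_max_upto:
  assumes R: "weight R" and \<G>: "\<And>G. G \<in> \<G> \<Longrightarrow> weight G \<and> good (\<lambda>y. G y * R y)"
    and min: "\<And>G G'. G \<in> \<G> \<Longrightarrow> G' \<in> \<G> \<Longrightarrow> (\<lambda>y. min (G y) (G' y)) \<in> \<G>"
    and "\<And>i. G i \<in> \<G>"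
  shows "good (\<lambda>y. max_upto G m y * R y)"
  using assms(4)
proof (induction m arbitrary: G)
  case 0
  then show ?case using \<G> by simp
next
  case (Suc m)
  have dist: "max s t * R y = max (s * R y) (t * R y)" "min s t * R y = min (s * R y) (t * R y)"
    if "y \<in> space \<mu>" for s t y
    using that R by (auto simp: weight_def max_mult_distrib_right min_mult_distrib_right)
  have 1: "good (\<lambda>y. max_upto G m y * R y)" by (rule Suc.IH) (rule Suc.prems)
  have "good (\<lambda>y. max_upto (\<lambda>i y. min (G i y) (G (Suc m) y)) m y * R y)"
    by (rule Suc.IH) (intro min Suc.prems)
  then have "good (\<lambda>y. min (max_upto G m y) (G (Suc m) y) * R y)"
    unfolding max_upto_min .
  then have 2: "good (\<lambda>y. min (max_upto G m y * R y) (G (Suc m) y * R y))"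
    by (subst (asm) good_cong[OF dist(2)])
  have "good (\<lambda>y. max (max_upto G m y * R y) (G (Suc m) y * R y))"
    by (intro good_max weight_mult R weight_max_upto 1 2) (use \<G> Suc.prems in auto)
  then show ?case
    by (simp add: good_cong[OF dist(1)])
qed

text \<open>Finite maxima of bumps tend to 1 on \<open>E\<close>, so by dominated convergence one of
  them carries almost the whole integral over \<open>E\<close>. Its count is known, and off
  \<open>E\<close> it is so small that few points are counted there.\<close>

lemma liminf_indicator:
  assumes R: "weight R" and \<G>: "\<And>G. G \<in> \<G> \<Longrightarrow> weight G \<and> good (\<lambda>y. G y * R y)"
    and min: "\<And>G G'. G \<in> \<G> \<Longrightarrow> G' \<in> \<G> \<Longrightarrow> (\<lambda>y. min (G y) (G' y)) \<in> \<G>"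
    and total: "good (\<lambda>_. 1)"
    and E: "E \<in> sets \<mu>" and countable: "countable \<G>"
    and bump: "\<And>y \<epsilon>. y \<in> E \<Longrightarrow> \<epsilon> > 0 \<Longrightarrow> \<exists>G\<in>\<G>. G y = 1 \<and> (\<forall>z\<in>space \<mu> - E. G z \<le> \<epsilon>)"
    and "\<eta> > 0"
  shows "\<forall>\<^sub>F B in at_top. weighted_count (\<lambda>y. indicator E y * R y) B / rate B
           \<ge> (\<integral>y. (indicator E y * R y) powr a \<partial>\<mu>) - \<eta>"
proof (cases "E = {}")
  case True
  show ?thesis using eventually_rate_pos
  proof eventually_elim
    case (elim B)
    have "weighted_count (\<lambda>y. indicator E y * R y) B / rate B \<ge> 0"
      using elim by (simp add: weighted_count_def)
    then show ?case using True \<open>\<eta> > 0\<close> by simp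
  qed
next
  case False
  \<comment> \<open>Bumps bounded by \<open>\<epsilon>\<close> off \<open>E\<close> count there only
    points of height at most \<open>\<epsilon> * B\<close>, asymptotically a multiple
    \<open>\<epsilon> powr a\<close> of all points.\<close>
  obtain \<epsilon> where \<epsilon>: "\<epsilon> > 0" "\<epsilon> powr a * measure \<mu> (space \<mu>) < \<eta> / 3"
  proof -
    have "((\<lambda>e. e powr a * measure \<mu> (space \<mu>)) \<longlongrightarrow> 0 powr a * measure \<mu> (space \<mu>)) (at_right 0)"
      using a_pos by (intro tendsto_mult tendsto_const tendsto_powr') (auto simp: eventually_at_filter)
    then have "\<forall>\<^sub>F e in at_right 0. e powr a * measure \<mu> (space \<mu>) < \<eta> / 3"
      using a_pos \<open>\<eta> > 0\<close> by (intro order_tendstoD(2)) auto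
    moreover have "\<forall>\<^sub>F e in at_right 0. e > (0::real)"
      by (simp add: eventually_at_right_less)
    ultimately have "\<forall>\<^sub>F e in at_right 0. e > 0 \<and> e powr a * measure \<mu> (space \<mu>) < \<eta> / 3"
      by eventually_elim auto
    from eventually_happens'[OF _ this] that show ?thesis by auto
  qed
  \<comment> \<open>Only the bumps that are at most \<open>\<epsilon>\<close> off \<open>E\<close>
    are kept. Enumerating them makes their finite maxima one increasing sequence.\<close>
  define C where "C = {G \<in> \<G>. \<forall>z\<in>space \<mu> - E. G z \<le> \<epsilon>}"
  have C: "C \<noteq> {}" "countable C"
    using bump[OF _ \<epsilon>(1)] False countable unfolding C_def by auto
  define G where "G = from_nat_into C"
  have GC: "G i \<in> C" for i unfolding G_def using C(1) by (rule from_nat_into)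
  then have G\<G>: "G i \<in> \<G>" for i unfolding C_def by auto
  have Gsurj: "\<exists>i. G i = G'" if "G' \<in> C" for G'
    unfolding G_def using from_nat_into_surj[OF C(2) that] .
  have wG: "weight (G i)" for i using \<G> G\<G> by auto
  have wD: "weight (max_upto G m)" for m by (rule weight_max_upto[OF wG])
  have wE: "weight (indicator E)" using E by (auto simp: weight_def indicator_def)
  define J where "J = (\<integral>y. (indicator E y * R y) powr a \<partial>\<mu>)"
  have lim: "(\<lambda>m. \<integral>y. (indicator E y * (max_upto G m y * R y)) powr a \<partial>\<mu>) \<longlonglongrightarrow> J"
    unfolding J_def
  proof (rule integral_dominated_convergence[where w = "\<lambda>_. 1"])
    show "(\<lambda>y. (indicator E y * R y) powr a) \<in> borel_measurable \<mu>"
      using integrable_weight_powr[OF weight_mult[OF wE R]] by simp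
    show "(\<lambda>y. (indicator E y * (max_upto G m y * R y)) powr a) \<in> borel_measurable \<mu>" for m
      using integrable_weight_powr[OF weight_mult[OF wE weight_mult[OF wD R]]] by simp
    show "AE y in \<mu>. norm ((indicator E y * (max_upto G m y * R y)) powr a) \<le> 1" for m
      using weight_mult[OF wE weight_mult[OF wD R], of m] a_pos
      by (intro AE_I2) (auto simp: weight_def intro!: powr_le1)
    show "AE y in \<mu>. (\<lambda>m. (indicator E y * (max_upto G m y * R y)) powr a) \<longlonglongrightarrow> (indicator E y * R y) powr a"
    proof (intro AE_I2)
      fix y assume y: "y \<in> space \<mu>"
      show "(\<lambda>m. (indicator E y * (max_upto G m y * R y)) powr a) \<longlonglongrightarrow> (indicator E y * R y) powr a"
      proof (cases "y \<in> E")
        case True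
        then obtain G' where "G' \<in> C" "G' y = 1" using bump[OF _ \<epsilon>(1)] unfolding C_def by auto
        then obtain i where i: "G i y = 1" using Gsurj by metis
        have "max_upto G m y = 1" if "m \<ge> i" for m
          using max_upto_ge[OF that, of G y] wD[of m] y i by (auto simp: weight_def intro: antisym)
        then have "\<forall>\<^sub>F m in sequentially. (indicator E y * (max_upto G m y * R y)) powr a = (indicator E y * R y) powr a"
          by (intro eventually_sequentiallyI[of i]) simp
        then show ?thesis by (rule tendsto_eventually)
      qed auto
    qed
  qed auto
  obtain m where m: "(\<integral>y. (indicator E y * (max_upto G m y * R y)) powr a \<partial>\<mu>) > J - \<eta> / 3"
    using order_tendstoD(1)[OF lim, of "J - \<eta> / 3"] \<open>\<eta> > 0\<close>
    by (auto simp: eventually_sequentially)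
  let ?D = "\<lambda>y. max_upto G m y * R y"
  have "(\<integral>y. (indicator E y * ?D y) powr a \<partial>\<mu>) \<le> (\<integral>y. ?D y powr a \<partial>\<mu>)"
    using weight_mult[OF wD R] a_pos
    by (intro integral_mono integrable_weight_powr weight_mult wE wD R)
      (auto simp: weight_def indicator_def)
  with m have ID: "(\<integral>y. ?D y powr a \<partial>\<mu>) > J - \<eta> / 3" by linarith
  have "good ?D" by (rule good_max_upto[OF R \<G> min G\<G>])
  then have e1: "\<forall>\<^sub>F B in at_top. weighted_count ?D B / rate B > J - \<eta> / 3"
    unfolding good_def using ID by (rule order_tendstoD)
  have e2: "\<forall>\<^sub>F B in at_top. weighted_count (\<lambda>_. \<epsilon> * 1) B / rate B < \<eta> / 3"
    using good_scale[OF total \<epsilon>(1)] \<epsilon>(2) by (intro order_tendstoD(2)) auto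
  show ?thesis
    using e1 e2 eventually_rate_pos
  proof eventually_elim
    case (elim B)
    \<comment> \<open>A counted point either lies over \<open>E\<close>, where the maximum is at
      most 1, or its weight is at most \<open>\<epsilon>\<close>.\<close>
    have "{x \<in> V. H x \<le> B * ?D (g x)} \<subseteq> {x \<in> V. H x \<le> B * (indicator E (g x) * R (g x))} \<union> {x \<in> V. H x \<le> B * (\<epsilon> * 1)}"
    proof safe
      fix x assume x: "x \<in> V" "H x \<le> B * ?D (g x)" "\<not> H x \<le> B * (\<epsilon> * 1)"
      have y: "g x \<in> space \<mu>" using g_space x by auto
      have R1: "0 \<le> R (g x)" "R (g x) \<le> 1" using R y by (auto simp: weight_def)
      show "H x \<le> B * (indicator E (g x) * R (g x))"
      proof (cases "g x \<in> E")
        case True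
        have "max_upto G m (g x) * R (g x) \<le> 1 * R (g x)"
          using wD[of m] y R1 by (intro mult_right_mono) (auto simp: weight_def)
        then have "B * ?D (g x) \<le> B * R (g x)" using elim by simp
        then show ?thesis using x True by simp
      next
        case False
        have "max_upto G m (g x) \<le> \<epsilon>" using GC False y unfolding C_def by (intro max_upto_le) auto
        then have "max_upto G m (g x) * R (g x) \<le> \<epsilon> * 1"
          using R1 \<epsilon>(1) by (intro mult_mono) auto
        then have "B * ?D (g x) \<le> B * (\<epsilon> * 1)" using elim by (intro mult_left_mono) auto
        then show ?thesis using x by linarith
      qed
    qed
    then have "card {x \<in> V. H x \<le> B * ?D (g x)} \<le> card ({x \<in> V. H x \<le> B * (indicator E (g x) * R (g x))} \<union> {x \<in> V. H x \<le> B * (\<epsilon> * 1)})"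
      using finite_weighted[OF weight_bounds[OF weight_mult[OF wE R]]] \<epsilon>
      by (intro card_mono finite_UnI finite_bounded) auto
    also have "\<dots> \<le> card {x \<in> V. H x \<le> B * (indicator E (g x) * R (g x))} + card {x \<in> V. H x \<le> B * (\<epsilon> * 1)}"
      by (rule card_Un_le)
    finally have "weighted_count ?D B \<le> weighted_count (\<lambda>y. indicator E y * R y) B + weighted_count (\<lambda>_. \<epsilon> * 1) B"
      unfolding weighted_count_def by linarith
    then have "weighted_count ?D B / rate B \<le> weighted_count (\<lambda>y. indicator E y * R y) B / rate B + weighted_count (\<lambda>_. \<epsilon> * 1) B / rate B"
      using elim by (simp add: add_divide_distrib[symmetric] divide_right_mono)
    then show ?case using elim \<open>\<eta> > 0\<close> unfolding J_def by linarith
  qed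
qed

text \<open>The bumps for \<open>E\<close> and for \<open>E'\<close> come from one family with one
  common factor \<open>R\<close>. The count for \<open>E\<close> is squeezed between its own lower
  bound and what the lower bound for \<open>E'\<close> leaves of the count for \<open>R\<close>; no
  mass is lost between the two sets.\<close>

lemma good_indicator:
  assumes R: "weight R" and \<G>: "\<And>G. G \<in> \<G> \<Longrightarrow> weight G \<and> good (\<lambda>y. G y * R y)"
    and min: "\<And>G G'. G \<in> \<G> \<Longrightarrow> G' \<in> \<G> \<Longrightarrow> (\<lambda>y. min (G y) (G' y)) \<in> \<G>"
    and total: "good (\<lambda>_. 1)" and countable: "countable \<G>" and gR: "good R"
    and E: "E \<in> sets \<mu>"
    and bump: "\<And>y \<epsilon>. y \<in> E \<Longrightarrow> \<epsilon> > 0 \<Longrightarrow> \<exists>G\<in>\<G>. G y = 1 \<and> (\<forall>z\<in>space \<mu> - E. G z \<le> \<epsilon>)"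
    and E': "E' \<in> sets \<mu>"
    and bump': "\<And>y \<epsilon>. y \<in> E' \<Longrightarrow> \<epsilon> > 0 \<Longrightarrow> \<exists>G\<in>\<G>. G y = 1 \<and> (\<forall>z\<in>space \<mu> - E'. G z \<le> \<epsilon>)"
    and disj: "E \<inter> E' = {}" and null: "AE y in \<mu>. y \<in> E \<union> E'"
  shows "good (\<lambda>y. indicator E y * R y)"
proof -
  let ?w = "\<lambda>y. indicator E y * R y" and ?w' = "\<lambda>y. indicator E' y * R y"
  have wE: "weight (indicator E)" "weight (indicator E')" using E E' by (auto simp: weight_def indicator_def)
  have w: "weight ?w" "weight ?w'" using wE R by (auto intro: weight_mult)
  have I: "(\<integral>y. R y powr a \<partial>\<mu>) = (\<integral>y. ?w y powr a \<partial>\<mu>) + (\<integral>y. ?w' y powr a \<partial>\<mu>)"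
  proof -
    have "(\<integral>y. R y powr a \<partial>\<mu>) = (\<integral>y. ?w y powr a + ?w' y powr a \<partial>\<mu>)"
    proof (rule integral_cong_AE)
      show "AE y in \<mu>. R y powr a = ?w y powr a + ?w' y powr a"
        by (rule AE_mp[OF null]) (use disj in \<open>auto simp: indicator_def\<close>)
    qed (use integrable_weight_powr w R in auto)
    then show ?thesis using integrable_weight_powr w by simp
  qed
  \<comment> \<open>Positivity of heights excludes points of weight 0, so the two counts concern
    points over \<open>E\<close> and over \<open>E'\<close>, which are disjoint.\<close>
  have sum: "weighted_count ?w B + weighted_count ?w' B \<le> weighted_count R B" if "B > 0" for B
  proof -
    let ?A = "{x \<in> V. H x \<le> B * ?w (g x)}" and ?A' = "{x \<in> V. H x \<le> B * ?w' (g x)}"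
    have f: "finite ?A" "finite ?A'" "finite {x \<in> V. H x \<le> B * R (g x)}"
      using finite_weighted[OF weight_bounds] w R by auto
    have E: "g x \<in> E" if "x \<in> ?A" for x
      using that H_pos[of x] by (cases "g x \<in> E") auto
    have E': "g x \<in> E'" if "x \<in> ?A'" for x
      using that H_pos[of x] by (cases "g x \<in> E'") auto
    have "?A \<inter> ?A' = {}" using E E' disj by blast
    then have "card ?A + card ?A' = card (?A \<union> ?A')" using f by (simp add: card_Un_disjoint)
    also have "\<dots> \<le> card {x \<in> V. H x \<le> B * R (g x)}"
    proof (intro card_mono f Un_least subsetI)
      fix x assume "x \<in> ?A"
      with E[OF this] show "x \<in> {x \<in> V. H x \<le> B * R (g x)}" by simp
    next
      fix x assume "x \<in> ?A'"
      with E'[OF this] show "x \<in> {x \<in> V. H x \<le> B * R (g x)}" by simp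
    qed
    finally show ?thesis unfolding weighted_count_def by linarith
  qed
  show ?thesis unfolding good_def
  proof (rule tendstoI, unfold dist_real_def)
    fix e :: real assume e: "e > 0"
    have 1: "\<forall>\<^sub>F B in at_top. weighted_count ?w B / rate B \<ge> (\<integral>y. ?w y powr a \<partial>\<mu>) - e / 3"
      by (rule liminf_indicator[OF R \<G> min total E countable bump]) (use e in auto)
    have 2: "\<forall>\<^sub>F B in at_top. weighted_count ?w' B / rate B \<ge> (\<integral>y. ?w' y powr a \<partial>\<mu>) - e / 3"
      by (rule liminf_indicator[OF R \<G> min total E' countable bump']) (use e in auto)
    have 3: "\<forall>\<^sub>F B in at_top. weighted_count R B / rate B < (\<integral>y. R y powr a \<partial>\<mu>) + e / 3"
      using gR e unfolding good_def by (intro order_tendstoD) auto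
    show "\<forall>\<^sub>F B in at_top. \<bar>weighted_count ?w B / rate B - (\<integral>y. ?w y powr a \<partial>\<mu>)\<bar> < e"
      using 1 2 3 eventually_rate_pos
    proof eventually_elim
      case (elim B)
      have "weighted_count ?w B / rate B + weighted_count ?w' B / rate B \<le> weighted_count R B / rate B"
        using elim sum by (simp add: add_divide_distrib[symmetric] divide_right_mono)
      then show ?case using elim I e by linarith
    qed
  qed
qed

section \<open>Boxes cut out by sublevel sets at all places\<close>

lemma inverse_max_le: "\<epsilon> > 0 \<Longrightarrow> 1 / \<epsilon> \<le> t \<Longrightarrow> 1 / max 1 t \<le> (\<epsilon>::real)"
  using le_imp_inverse_le[of "1 / \<epsilon>" "max 1 t"] by (simp add: inverse_eq_divide)

text \<open>At a place \<open>u\<close>, the weights \<open>1 / max 1 f\<close> with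
  \<open>f\<close> in \<open>F u\<close> form the family \<open>\<G>\<close> of
  \<open>good_indicator\<close>, and the factors at all other places form its \<open>R\<close>.
  Closure of \<open>F u\<close> under maxima becomes closure of \<open>\<G>\<close> under minima,
  and the two separation hypotheses provide the bumps for the sublevel and for the superlevel
  set.\<close>

lemma good_Int_sublevel:
  fixes F :: "'i \<Rightarrow> ('y \<Rightarrow> real) set"
  assumes S: "finite S"
    and countable: "\<And>v. v \<in> S \<Longrightarrow> countable (F v)"
    and max: "\<And>v f f'. v \<in> S \<Longrightarrow> f \<in> F v \<Longrightarrow> f' \<in> F v \<Longrightarrow> (\<lambda>y. max (f y) (f' y)) \<in> F v"
    and zero: "\<And>v. v \<in> S \<Longrightarrow> (\<lambda>_. 0) \<in> F v"
    and meas: "\<And>v f. v \<in> S \<Longrightarrow> f \<in> F v \<Longrightarrow> f \<in> borel_measurable \<mu>"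
    and good: "\<And>\<phi>. (\<And>v. v \<in> S \<Longrightarrow> \<phi> v \<in> F v) \<Longrightarrow> good (\<lambda>y. \<Prod>v\<in>S. 1 / max 1 (\<phi> v y))"
    and sep_less: "\<And>v f y M. v \<in> S \<Longrightarrow> f \<in> F v \<Longrightarrow> y \<in> space \<mu> \<Longrightarrow> f y < r \<Longrightarrow> M > 0 \<Longrightarrow>
        \<exists>f'\<in>F v. f' y \<le> 1 \<and> (\<forall>z\<in>space \<mu>. f z \<ge> r \<longrightarrow> f' z \<ge> M)"
    and sep_greater: "\<And>v f y M. v \<in> S \<Longrightarrow> f \<in> F v \<Longrightarrow> y \<in> space \<mu> \<Longrightarrow> f y > r \<Longrightarrow> M > 0 \<Longrightarrow>
        \<exists>f'\<in>F v. f' y \<le> 1 \<and> (\<forall>z\<in>space \<mu>. f z \<le> r \<longrightarrow> f' z \<ge> M)"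
    and null: "\<And>v f. v \<in> S \<Longrightarrow> f \<in> F v \<Longrightarrow> AE y in \<mu>. f y \<noteq> r"
    and \<phi>: "\<And>v. v \<in> S \<Longrightarrow> \<phi> v \<in> F v"
  shows "good (indicator {y \<in> space \<mu>. \<forall>v\<in>S. \<phi> v y < r})"
proof -
  define w where "w A \<phi> v y = (if v \<in> A then indicator {y \<in> space \<mu>. \<phi> v y < r} y else 1 / max 1 (\<phi> v y :: real))"
    for A :: "'i set" and \<phi> :: "'i \<Rightarrow> 'y \<Rightarrow> real" and v y
  have w_weight: "weight (w A \<phi> v)" if "v \<in> S" "\<phi> v \<in> F v" for A \<phi> v
  proof -
    have [measurable]: "\<phi> v \<in> borel_measurable \<mu>" using meas that by auto
    show ?thesis unfolding w_def weight_def by (auto simp: indicator_def)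
  qed
  have prod_weight: "weight (\<lambda>y. \<Prod>v\<in>T. w A \<phi> v y)" if "\<And>v. v \<in> S \<Longrightarrow> \<phi> v \<in> F v" "T \<subseteq> S" for A \<phi> T
  proof -
    have "finite T" using S that(2) finite_subset by blast
    then show ?thesis using that(2)
    proof (induction T)
      case empty then show ?case by (simp add: weight_def)
    next
      case (insert v T)
      then show ?case using weight_mult[OF w_weight[of v \<phi> A]] that(1) by simp
    qed
  qed
  have total: "good (\<lambda>_. 1)"
    using good[of "\<lambda>_ _. 0"] zero by simp
  \<comment> \<open>\<open>A\<close> contains the places where the indicator function has already
    replaced the weight. \<open>\<phi>\<close> stays arbitrary in the induction, because treating a
    new place \<open>u\<close> requires goodness for all functions of \<open>F u\<close> in that
    factor.\<close>
  have main: "good (\<lambda>y. \<Prod>v\<in>S. w A \<phi> v y)" if "A \<subseteq> S" "\<And>v. v \<in> S \<Longrightarrow> \<phi> v \<in> F v" for A \<phi>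
  proof -
    have "finite A" using S that(1) finite_subset by blast
    then show ?thesis using that
    proof (induction A arbitrary: \<phi>)
      case empty
      then show ?case using good[of \<phi>] by (simp add: w_def)
    next
      case (insert u A)
      have u: "u \<in> S" "u \<notin> A" and f: "\<phi> u \<in> F u" using insert by auto
      have [measurable]: "\<phi> u \<in> borel_measurable \<mu>" using meas u(1) f by auto
      define R where "R y = (\<Prod>v\<in>S - {u}. w A \<phi> v y)" for y
      define \<G> where "\<G> = (\<lambda>f y. 1 / max 1 (f y)) ` F u"
      have wR: "weight R" unfolding R_def by (rule prod_weight) (use insert in auto)
      have upd: "good (\<lambda>y. 1 / max 1 (f y) * R y)" if "f \<in> F u" for f
      proof -
        have "good (\<lambda>y. \<Prod>v\<in>S. w A (\<phi>(u := f)) v y)"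
          by (rule insert.IH) (use insert that in auto)
        also have "(\<lambda>y. \<Prod>v\<in>S. w A (\<phi>(u := f)) v y) = (\<lambda>y. 1 / max 1 (f y) * R y)"
        proof
          fix y
          have "(\<Prod>v\<in>S - {u}. w A (\<phi>(u := f)) v y) = R y"
            unfolding R_def by (intro prod.cong) (auto simp: w_def)
          then show "(\<Prod>v\<in>S. w A (\<phi>(u := f)) v y) = 1 / max 1 (f y) * R y"
            using u S by (subst prod.remove[of S u]) (auto simp: w_def)
        qed
        finally show ?thesis .
      qed
      let ?E = "{y \<in> space \<mu>. \<phi> u y < r}" and ?E' = "{y \<in> space \<mu>. \<phi> u y > r}"
      have "good (\<lambda>y. indicator ?E y * R y)"
      proof (rule good_indicator[where \<G> = \<G> and E' = ?E', OF wR _ _ total])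
        show "weight G \<and> good (\<lambda>y. G y * R y)" if G: "G \<in> \<G>" for G
        proof -
          obtain f where f: "f \<in> F u" "G = (\<lambda>y. 1 / max 1 (f y))" using G unfolding \<G>_def by blast
          have [measurable]: "f \<in> borel_measurable \<mu>" using meas u(1) f by auto
          show ?thesis using upd[OF f(1)] f(2) by (auto simp: weight_def)
        qed
        show "(\<lambda>y. min (G y) (G' y)) \<in> \<G>" if G: "G \<in> \<G>" "G' \<in> \<G>" for G G'
        proof -
          obtain f f' where f: "f \<in> F u" "f' \<in> F u" "G = (\<lambda>y. 1 / max 1 (f y))" "G' = (\<lambda>y. 1 / max 1 (f' y))"
            using G unfolding \<G>_def by blast
          have "(\<lambda>y. min (G y) (G' y)) = (\<lambda>y. 1 / max 1 (max (f y) (f' y)))"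
            unfolding f by (auto simp: fun_eq_iff min_def max_def field_simps)
          then show ?thesis using max[OF u(1) f(1,2)] unfolding \<G>_def by auto
        qed
        show "countable \<G>" unfolding \<G>_def using countable u by auto
        \<comment> \<open>The zero function at \<open>u\<close> has weight 1, which removes the
          factor at \<open>u\<close>.\<close>
        show "good R" using upd[OF zero[OF u(1)]] by simp
        show "?E \<in> sets \<mu>" "?E' \<in> sets \<mu>" by measurable
        show "?E \<inter> ?E' = {}" by auto
        show "AE y in \<mu>. y \<in> ?E \<union> ?E'" using null[OF u(1) f] by (auto simp: AE_space)
      next
        fix y \<epsilon> :: real and y' assume y: "y' \<in> ?E" "\<epsilon> > 0"
        \<comment> \<open>The value at most 1 at \<open>y'\<close> turns into weight exactly 1
          there, and the bound \<open>1 / \<epsilon>\<close> off the set into weight at most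
          \<open>\<epsilon>\<close>.\<close>
        then obtain f' where "f' \<in> F u" "f' y' \<le> 1" "\<forall>z\<in>space \<mu>. \<phi> u z \<ge> r \<longrightarrow> f' z \<ge> 1 / \<epsilon>"
          using sep_less[OF u(1) f, of y' "1 / \<epsilon>"] by auto
        then show "\<exists>G\<in>\<G>. G y' = 1 \<and> (\<forall>z\<in>space \<mu> - ?E. G z \<le> \<epsilon>)" using y
          unfolding \<G>_def by (intro bexI[of _ "\<lambda>y. 1 / max 1 (f' y)"]) (auto intro: inverse_max_le)
      next
        fix y \<epsilon> :: real and y' assume y: "y' \<in> ?E'" "\<epsilon> > 0"
        then obtain f' where "f' \<in> F u" "f' y' \<le> 1" "\<forall>z\<in>space \<mu>. \<phi> u z \<le> r \<longrightarrow> f' z \<ge> 1 / \<epsilon>"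
          using sep_greater[OF u(1) f, of y' "1 / \<epsilon>"] by auto
        then show "\<exists>G\<in>\<G>. G y' = 1 \<and> (\<forall>z\<in>space \<mu> - ?E'. G z \<le> \<epsilon>)" using y
          unfolding \<G>_def by (intro bexI[of _ "\<lambda>y. 1 / max 1 (f' y)"]) (auto intro: inverse_max_le)
      qed
      also have "(\<lambda>y. indicator ?E y * R y) = (\<lambda>y. \<Prod>v\<in>S. w (insert u A) \<phi> v y)"
      proof
        fix y
        have "(\<Prod>v\<in>S - {u}. w (insert u A) \<phi> v y) = R y"
          unfolding R_def by (intro prod.cong) (auto simp: w_def)
        then show "indicator ?E y * R y = (\<Prod>v\<in>S. w (insert u A) \<phi> v y)"
          using u S by (subst prod.remove[of S u]) (auto simp: w_def)
      qed
      finally show ?case .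
    qed
  qed
  have "(\<Prod>v\<in>S. w S \<phi> v y) = indicator {y \<in> space \<mu>. \<forall>v\<in>S. \<phi> v y < r} y" if "y \<in> space \<mu>" for y
  proof -
    have "(\<Prod>v\<in>S. w S \<phi> v y) = (\<Prod>v\<in>S. indicator {v. \<phi> v y < r} v)"
      using that by (intro prod.cong) (auto simp: w_def indicator_def)
    also have "\<dots> = (if \<forall>v\<in>S. \<phi> v y < r then 1 else 0)"
      using S by (auto simp: indicator_def intro: prod_zero prod.neutral)
    finally show ?thesis using that by (auto simp: indicator_def)
  qed
  from good_cong[OF this] main[of S \<phi>] \<phi> show ?thesis by auto
qed

section \<open>From boxes to open sets and to sets with null frontier\<close>

lemma integral_indicator_powr:
  "E \<in> sets \<mu> \<Longrightarrow> (\<integral>y. indicator E y powr a \<partial>\<mu>) = measure \<mu> E"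
proof -
  assume E: "E \<in> sets \<mu>"
  have "(\<integral>y. indicator E y powr a \<partial>\<mu>) = (\<integral>y. indicator E y \<partial>\<mu>)"
    by (intro Bochner_Integration.integral_cong) (auto simp: indicator_def)
  then show ?thesis using E by simp
qed

lemma weight_indicator: "E \<in> sets \<mu> \<Longrightarrow> weight (indicator E)"
  by (auto simp: weight_def indicator_def)

text \<open>The union of the first sets meets the last one in a union of sets from
  \<open>\<P>\<close> again, so the induction hypothesis covers this intersection as well.\<close>

lemma good_Un_upto:
  assumes sets: "\<And>E. E \<in> \<P> \<Longrightarrow> E \<in> sets \<mu> \<and> good (indicator E)"
    and Int: "\<And>E E'. E \<in> \<P> \<Longrightarrow> E' \<in> \<P> \<Longrightarrow> E \<inter> E' \<in> \<P>"
    and "\<And>i. E i \<in> \<P>"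
  shows "good (indicator (\<Union>i\<le>m::nat. E i))"
  using assms(3)
proof (induction m arbitrary: E)
  case 0 then show ?case using sets by simp
next
  case (Suc m)
  let ?U = "\<Union>i\<le>m. E i"
  have U: "?U \<in> sets \<mu>" by (intro sets.finite_UN) (simp_all add: Suc.prems sets)
  have E: "E (Suc m) \<in> sets \<mu>" by (simp add: Suc.prems sets)
  have "good (indicator (\<Union>i\<le>m. E i \<inter> E (Suc m)))"
    by (rule Suc.IH) (intro Int Suc.prems)
  moreover have "indicator (\<Union>i\<le>m. E i \<inter> E (Suc m)) = (\<lambda>y. min (indicator ?U y) (indicator (E (Suc m)) y :: real))"
    by (auto simp: indicator_def fun_eq_iff)
  ultimately have "good (\<lambda>y. max (indicator ?U y) (indicator (E (Suc m)) y))"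
    using Suc.IH[of E, OF Suc.prems] sets[OF Suc.prems[of "Suc m"]] by (intro good_max weight_indicator U E) simp_all
  also have "(\<lambda>y. max (indicator ?U y) (indicator (E (Suc m)) y)) = (indicator (\<Union>i\<le>Suc m. E i) :: _ \<Rightarrow> real)"
    by (auto simp: indicator_def fun_eq_iff atMost_Suc)
  finally show ?case .
qed

text \<open>Finite unions of members of \<open>\<P>\<close> exhaust \<open>U\<close> from inside up
  to arbitrarily small measure. Nothing controls the number of points in the part of
  \<open>U\<close> left out, so only a lower bound results.\<close>

lemma liminf_open:
  assumes sets: "\<And>E. E \<in> \<P> \<Longrightarrow> E \<in> sets \<mu> \<and> good (indicator E)"
    and Int: "\<And>E E'. E \<in> \<P> \<Longrightarrow> E' \<in> \<P> \<Longrightarrow> E \<inter> E' \<in> \<P>"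
    and countable: "countable \<P>"
    and basis: "\<And>y. y \<in> U \<Longrightarrow> \<exists>E\<in>\<P>. y \<in> E \<and> E \<subseteq> U"
    and \<eta>: "\<eta> > 0"
  shows "\<forall>\<^sub>F B in at_top. weighted_count (indicator U) B / rate B \<ge> measure \<mu> U - \<eta>"
proof (cases "U = {}")
  case True
  show ?thesis using eventually_rate_pos
  proof eventually_elim
    case (elim B)
    have "weighted_count (indicator U) B / rate B \<ge> 0"
      using elim by (simp add: weighted_count_def)
    then show ?case using True \<eta> by simp
  qed
next
  case False
  define C where "C = {E\<in>\<P>. E \<subseteq> U}"
  have C: "C \<noteq> {}" "countable C" using False basis countable unfolding C_def by auto
  define E where "E = from_nat_into C"
  have EC: "E i \<in> C" for i unfolding E_def using C(1) by (rule from_nat_into)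
  have E\<P>: "E i \<in> \<P>" for i using EC unfolding C_def by auto
  have UE: "(\<Union>i. E i) = U"
  proof -
    have "(\<Union>i. E i) = \<Union>C" unfolding E_def using range_from_nat_into[OF C] by simp
    also have "\<dots> = U" using basis unfolding C_def by blast
    finally show ?thesis .
  qed
  have UEm: "(\<Union>m. \<Union>i\<le>m. E i) = U" using UE by blast
  have "(\<lambda>m. measure \<mu> (\<Union>i\<le>m. E i)) \<longlonglongrightarrow> measure \<mu> (\<Union>m. \<Union>i\<le>m. E i)"
  proof (intro finite_Lim_measure_incseq)
    show "range (\<lambda>m. \<Union>i\<le>m. E i) \<subseteq> sets \<mu>" by (auto intro!: sets.finite_UN simp: sets E\<P>)
    show "incseq (\<lambda>m. \<Union>i\<le>m. E i)" by (intro incseq_SucI UN_mono) auto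
  qed
  then have "\<forall>\<^sub>F m in sequentially. measure \<mu> (\<Union>i\<le>m. E i) > measure \<mu> U - \<eta>"
    unfolding UEm using \<eta> by (intro order_tendstoD) auto
  then obtain m where m: "measure \<mu> (\<Union>i\<le>m. E i) > measure \<mu> U - \<eta>"
    by (auto simp: eventually_sequentially)
  have "good (indicator (\<Union>i\<le>m. E i))" by (rule good_Un_upto[OF sets Int E\<P>])
  then have "\<forall>\<^sub>F B in at_top. weighted_count (indicator (\<Union>i\<le>m. E i)) B / rate B > measure \<mu> U - \<eta>"
    unfolding good_def using m by (intro order_tendstoD) (simp_all add: integral_indicator_powr sets.finite_UN sets E\<P>)
  then show ?thesis using eventually_rate_pos
  proof eventually_elim
    case (elim B)
    have "weighted_count (indicator (\<Union>i\<le>m. E i)) B \<le> weighted_count (indicator U) B"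
      unfolding weighted_count_def
    proof (intro of_nat_mono card_mono finite_weighted)
      show "{x \<in> V. H x \<le> B * indicator (\<Union>i\<le>m. E i) (g x)} \<subseteq> {x \<in> V. H x \<le> B * indicator U (g x)}"
        using UE elim by (auto simp: indicator_def)
    qed (auto simp: indicator_def)
    then show ?case using elim divide_right_mono[of _ _ "rate B"] by fastforce
  qed
qed

lemma weighted_count_indicator:
  "B > 0 \<Longrightarrow> weighted_count (indicator W) B = real (card {x \<in> V. g x \<in> W \<and> H x \<le> B})"
proof -
  assume B: "B > 0"
  have "{x \<in> V. H x \<le> B * indicator W (g x)} = {x \<in> V. g x \<in> W \<and> H x \<le> B}"
    using H_pos by (force simp: indicator_def split: if_splits)
  then show ?thesis by (simp add: weighted_count_def)
qed

text \<open>The interior and the exterior of \<open>W\<close> are open and together carry all the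
  mass, so their lower bounds leave no room for a surplus of points in \<open>W\<close>.\<close>

lemma good_Jordan_measurable:
  assumes Y: "topspace Y = space \<mu>" and op_sets: "\<And>U. openin Y U \<Longrightarrow> U \<in> sets \<mu>"
    and op: "\<And>U \<eta>. openin Y U \<Longrightarrow> \<eta> > 0 \<Longrightarrow>
       \<forall>\<^sub>F B in at_top. weighted_count (indicator U) B / rate B \<ge> measure \<mu> U - \<eta>"
    and total: "good (\<lambda>_. 1)"
    and W: "W \<in> sets \<mu>" "measure \<mu> (Y frontier_of W) = 0"
  shows "good (indicator W)"
proof -
  let ?I = "Y interior_of W" and ?K = "topspace Y - Y closure_of W"
  have WY: "W \<subseteq> space \<mu>" using W sets.sets_into_space by auto
  have oI: "openin Y ?I" and oK: "openin Y ?K" by (simp_all add: openin_diff)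
  have s: "?I \<in> sets \<mu>" "?K \<in> sets \<mu>" using op_sets oI oK by auto
  have sub: "?I \<subseteq> W" "W \<inter> ?K = {}"
    using closure_of_subset[of W Y] WY Y by (auto dest: interior_of_subset[THEN subsetD])
  have fr: "space \<mu> - (?I \<union> ?K) = Y frontier_of W"
    using closure_of_subset_topspace[of Y W] Y by (auto simp: frontier_of_def)
  have sf: "Y frontier_of W \<in> sets \<mu>"
    unfolding fr[symmetric] by (intro sets.compl_sets sets.Un s)
  have disj: "?I \<inter> ?K = {}" using sub by blast
  have tot: "measure \<mu> ?I + measure \<mu> ?K = measure \<mu> (space \<mu>)"
  proof -
    have "measure \<mu> (space \<mu>) = measure \<mu> ((?I \<union> ?K) \<union> Y frontier_of W)"
      using fr s[THEN sets.sets_into_space] by (intro arg_cong[of _ _ "measure \<mu>"]) blast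
    also have "\<dots> = measure \<mu> (?I \<union> ?K) + measure \<mu> (Y frontier_of W)"
      by (intro finite_measure_Union sets.Un s sf) (use fr in blast)
    also have "\<dots> = measure \<mu> ?I + measure \<mu> ?K" using W(2) finite_measure_Union[OF s disj] by simp
    finally show ?thesis by simp
  qed
  have mW: "measure \<mu> W = measure \<mu> ?I"
  proof (rule antisym)
    have "W \<subseteq> ?I \<union> Y frontier_of W" using fr sub WY by blast
    then have "measure \<mu> W \<le> measure \<mu> (?I \<union> Y frontier_of W)"
      by (intro finite_measure_mono sets.Un s sf)
    also have "\<dots> \<le> measure \<mu> ?I + measure \<mu> (Y frontier_of W)"
      by (intro measure_Un_le s sf)
    finally show "measure \<mu> W \<le> measure \<mu> ?I" using W by simp
    show "measure \<mu> ?I \<le> measure \<mu> W" using sub W by (intro finite_measure_mono)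
  qed
  show ?thesis unfolding good_def integral_indicator_powr[OF W(1)]
  proof (rule tendstoI, unfold dist_real_def)
    fix e :: real assume e: "e > 0"
    have 1: "\<forall>\<^sub>F B in at_top. weighted_count (indicator ?I) B / rate B \<ge> measure \<mu> ?I - e / 3"
      using op[OF oI] e by simp
    have 2: "\<forall>\<^sub>F B in at_top. weighted_count (indicator ?K) B / rate B \<ge> measure \<mu> ?K - e / 3"
      using op[OF oK] e by simp
    have 3: "\<forall>\<^sub>F B in at_top. weighted_count (\<lambda>_. 1) B / rate B < measure \<mu> (space \<mu>) + e / 3"
      using total e unfolding good_def by (intro order_tendstoD) auto
    show "\<forall>\<^sub>F B in at_top. \<bar>weighted_count (indicator W) B / rate B - measure \<mu> W\<bar> < e"
      using 1 2 3 eventually_rate_pos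
    proof eventually_elim
      case (elim B)
      have B: "B > 0" using elim by auto
      have f: "finite {x \<in> V. g x \<in> W \<and> H x \<le> B}" for W
        by (rule finite_subset[OF _ finite_bounded[of B]]) auto
      have a: "weighted_count (indicator ?I) B \<le> weighted_count (indicator W) B"
        unfolding weighted_count_indicator[OF B]
        using sub by (intro of_nat_mono card_mono f) auto
      have "card {x \<in> V. g x \<in> W \<and> H x \<le> B} + card {x \<in> V. g x \<in> ?K \<and> H x \<le> B} =
          card ({x \<in> V. g x \<in> W \<and> H x \<le> B} \<union> {x \<in> V. g x \<in> ?K \<and> H x \<le> B})"
        using sub by (intro card_Un_disjoint[symmetric] f) auto
      also have "\<dots> \<le> card {x \<in> V. H x \<le> B}" by (intro card_mono finite_bounded) blast
      finally have b: "weighted_count (indicator W) B + weighted_count (indicator ?K) B \<le> weighted_count (\<lambda>_. 1) B"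
        unfolding weighted_count_indicator[OF B] unfolding weighted_count_def by simp
      have "weighted_count (indicator ?I) B / rate B \<le> weighted_count (indicator W) B / rate B"
        using a elim by (simp add: divide_right_mono)
      moreover have "weighted_count (indicator W) B / rate B + weighted_count (indicator ?K) B / rate B \<le> weighted_count (\<lambda>_. 1) B / rate B"
        using b elim by (simp add: add_divide_distrib[symmetric] divide_right_mono)
      ultimately show ?case using elim mW tot e by linarith
    qed
  qed
qed

text \<open>The separation hypotheses are asked for at every level \<open>r\<close>, because the
  level can be fixed only after the atoms of all functions are known.\<close>

theorem good_of_frontier_null:
  fixes F :: "'i \<Rightarrow> ('y \<Rightarrow> real) set"
  assumes Y: "topspace Y = space \<mu>" and op_sets: "\<And>U. openin Y U \<Longrightarrow> U \<in> sets \<mu>"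
    and S: "finite S"
    and countable: "\<And>v. v \<in> S \<Longrightarrow> countable (F v)"
    and max: "\<And>v f f'. v \<in> S \<Longrightarrow> f \<in> F v \<Longrightarrow> f' \<in> F v \<Longrightarrow> (\<lambda>y. max (f y) (f' y)) \<in> F v"
    and zero: "\<And>v. v \<in> S \<Longrightarrow> (\<lambda>_. 0) \<in> F v"
    and meas: "\<And>v f. v \<in> S \<Longrightarrow> f \<in> F v \<Longrightarrow> f \<in> borel_measurable \<mu>"
    and good: "\<And>\<phi>. (\<And>v. v \<in> S \<Longrightarrow> \<phi> v \<in> F v) \<Longrightarrow> good (\<lambda>y. \<Prod>v\<in>S. 1 / max 1 (\<phi> v y))"
    and sep_less: "\<And>v f y M r. v \<in> S \<Longrightarrow> f \<in> F v \<Longrightarrow> y \<in> space \<mu> \<Longrightarrow> f y < r \<Longrightarrow> M > 0 \<Longrightarrow>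
        \<exists>f'\<in>F v. f' y \<le> 1 \<and> (\<forall>z\<in>space \<mu>. f z \<ge> r \<longrightarrow> f' z \<ge> M)"
    and sep_greater: "\<And>v f y M r. v \<in> S \<Longrightarrow> f \<in> F v \<Longrightarrow> y \<in> space \<mu> \<Longrightarrow> f y > r \<Longrightarrow> M > 0 \<Longrightarrow>
        \<exists>f'\<in>F v. f' y \<le> 1 \<and> (\<forall>z\<in>space \<mu>. f z \<le> r \<longrightarrow> f' z \<ge> M)"
    and basis: "\<And>U y. openin Y U \<Longrightarrow> y \<in> U \<Longrightarrow> \<exists>\<phi>. (\<forall>v\<in>S. \<phi> v \<in> F v \<and> \<phi> v y \<le> 1) \<and>
        {z \<in> space \<mu>. \<forall>v\<in>S. \<phi> v z < 2} \<subseteq> U"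
    and W: "W \<in> sets \<mu>" "measure \<mu> (Y frontier_of W) = 0"
  shows "good (indicator W)"
proof -
  \<comment> \<open>\<open>bad\<close> collects the atoms of the distributions of all functions
    involved. A finite measure has countably many of them, so some level strictly between 1 and 2
    avoids them all; 1 and 2 are the two bounds in the hypothesis \<open>basis\<close>, and every
    level in between keeps the inclusion in \<open>U\<close>.\<close>
  define bad where "bad = (\<Union>v\<in>S. \<Union>f\<in>F v. {r. measure (distr \<mu> borel f) {r} \<noteq> 0})"
  have cb: "countable {r. measure (distr \<mu> borel f) {r} \<noteq> 0}" if "v \<in> S" "f \<in> F v" for v f
  proof -
    interpret D: finite_measure "distr \<mu> borel f"
      using finite_measure_distr[OF meas[OF that]] .
    show ?thesis by (rule D.countable_support)
  qed
  have "countable bad"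
    unfolding bad_def by (intro countable_UN countable_finite[OF S] countable cb)
  then have "\<not> {1<..<2::real} \<subseteq> bad"
    using uncountable_open_interval[of 1 "2::real"] countable_subset by auto
  then obtain r where "r \<in> {1<..<2::real}" "r \<notin> bad" by (meson subsetI)
  then have r: "1 < r" "r < 2" "r \<notin> bad" by simp_all
  have null: "AE y in \<mu>. f y \<noteq> r" if "v \<in> S" "f \<in> F v" for v f
  proof -
    have [measurable]: "f \<in> borel_measurable \<mu>" using meas that by auto
    have "measure (distr \<mu> borel f) {r} = 0" using r(3) that unfolding bad_def by auto
    then have "measure \<mu> (f -` {r} \<inter> space \<mu>) = 0"
      by (simp add: measure_distr)
    moreover have "f -` {r} \<inter> space \<mu> \<in> sets \<mu>" by measurable
    ultimately have "f -` {r} \<inter> space \<mu> \<in> null_sets \<mu>"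
      by (auto simp: null_sets_def emeasure_eq_measure)
    then show ?thesis by (rule AE_I') auto
  qed
  \<comment> \<open>Indexing by extensional families keeps \<open>\<P>\<close> countable, as
    \<open>S\<close> is finite and each \<open>F v\<close> is countable.\<close>
  define \<P> where "\<P> = (\<lambda>\<phi>. {y \<in> space \<mu>. \<forall>v\<in>S. \<phi> v y < r}) ` PiE S F"
  have \<P>I: "{y \<in> space \<mu>. \<forall>v\<in>S. \<phi> v y < r} \<in> \<P>" if "\<And>v. v \<in> S \<Longrightarrow> \<phi> v \<in> F v" for \<phi>
    unfolding \<P>_def using that by (intro image_eqI[of _ _ "restrict \<phi> S"]) auto
  have good\<P>: "E \<in> sets \<mu> \<and> good (indicator E)" if E: "E \<in> \<P>" for E
  proof -
    obtain \<phi> where \<phi>: "\<phi> \<in> PiE S F" "E = {y \<in> space \<mu>. \<forall>v\<in>S. \<phi> v y < r}"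
      using E unfolding \<P>_def by blast
    have m: "\<phi> v \<in> borel_measurable \<mu>" if "v \<in> S" for v using meas \<phi>(1) that by auto
    have "{y \<in> space \<mu>. \<forall>v\<in>S. \<phi> v y < r} \<in> sets \<mu>"
      using S m by (intro sets.sets_Collect_finite_All borel_measurable_less) auto
    moreover have "good (indicator {y \<in> space \<mu>. \<forall>v\<in>S. \<phi> v y < r})"
      by (rule good_Int_sublevel[OF S countable max zero meas good sep_less sep_greater null])
        (use \<phi> in auto)
    ultimately show ?thesis using \<phi>(2) by simp
  qed
  have Int: "E \<inter> E' \<in> \<P>" if E: "E \<in> \<P>" "E' \<in> \<P>" for E E'
  proof -
    obtain \<phi> \<phi>' where \<phi>: "\<phi> \<in> PiE S F" "E = {y \<in> space \<mu>. \<forall>v\<in>S. \<phi> v y < r}"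
        "\<phi>' \<in> PiE S F" "E' = {y \<in> space \<mu>. \<forall>v\<in>S. \<phi>' v y < r}"
      using E unfolding \<P>_def by blast
    have "E \<inter> E' = {y \<in> space \<mu>. \<forall>v\<in>S. (\<lambda>y. max (\<phi> v y) (\<phi>' v y)) y < r}"
      unfolding \<phi>(2,4) max_less_iff_conj by blast
    also have "\<dots> \<in> \<P>"
    proof (rule \<P>I)
      fix v assume "v \<in> S"
      with max[OF this] \<phi>(1,3) show "(\<lambda>y. max (\<phi> v y) (\<phi>' v y)) \<in> F v" by (auto dest: PiE_mem)
    qed
    finally show ?thesis .
  qed
  have total: "good (\<lambda>_. 1)" using good[of "\<lambda>_ _. 0"] zero by simp
  show ?thesis
  proof (rule good_Jordan_measurable[OF Y op_sets _ total W])
    fix U and \<eta> :: real assume U: "openin Y U" "\<eta> > 0"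
    show "\<forall>\<^sub>F B in at_top. weighted_count (indicator U) B / rate B \<ge> measure \<mu> U - \<eta>"
    proof (rule liminf_open[OF good\<P> Int _ _ U(2)])
      show "countable \<P>" unfolding \<P>_def using S countable by (intro countable_image countable_PiE)
      fix y assume y: "y \<in> U"
      obtain \<phi> where "(\<forall>v\<in>S. \<phi> v \<in> F v \<and> \<phi> v y \<le> 1) \<and> {z \<in> space \<mu>. \<forall>v\<in>S. \<phi> v z < 2} \<subseteq> U"
        using basis[OF U(1) y] by (elim exE)
      then have \<phi>: "\<And>v. v \<in> S \<Longrightarrow> \<phi> v \<in> F v \<and> \<phi> v y \<le> 1"
        "{z \<in> space \<mu>. \<forall>v\<in>S. \<phi> v z < 2} \<subseteq> U" by simp_all
      have "y \<in> space \<mu>" using openin_subset[OF U(1)] y unfolding Y by (rule subsetD)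
      then have "y \<in> {y \<in> space \<mu>. \<forall>v\<in>S. \<phi> v y < r}" using le_less_trans[OF _ r(1)] \<phi>(1) by simp
      moreover have "{y \<in> space \<mu>. \<forall>v\<in>S. \<phi> v y < r} \<subseteq> U"
        by (rule order_trans[OF _ \<phi>(2)]) (use less_trans[OF _ r(2)] in blast)
      ultimately show "\<exists>E\<in>\<P>. y \<in> E \<and> E \<subseteq> U"
        by (intro bexI[OF _ \<P>I[of \<phi>]] conjI) (use \<phi>(1) in auto)
    qed
  qed
qed

end

hide_const (open) Divisibility.prime

section \<open>Places of number fields\<close>

text \<open>At a complex place the normalized absolute value is a square and violates the triangle
  inequality, but its square root satisfies it. The square root does so at real and finite places
  too, which gives one axiom for all places.\<close>

locale place_value =
  fixes v :: "'k::field \<Rightarrow> real"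
  assumes nonneg [simp]: "0 \<le> v x"
    and eq_0_iff [simp]: "v x = 0 \<longleftrightarrow> x = 0"
    and mult: "v (x * y) = v x * v y"
    and sqrt_add_le: "sqrt (v (x + y)) \<le> sqrt (v x) + sqrt (v y)"
begin

lemma zero [simp]: "v 0 = 0" by simp

lemma one [simp]: "v 1 = 1"
  using mult[of 1 1] eq_0_iff[of 1] by (metis mult_cancel_left1 mult_1 zero_neq_one)

lemma pos_iff [simp]: "0 < v x \<longleftrightarrow> x \<noteq> 0"
  using nonneg[of x] eq_0_iff[of x] by linarith

lemma minus [simp]: "v (- x) = v x"
proof -
  have "v (-1) * v (-1) = 1" using mult[of "-1" "-1"] by simp
  then have "v (-1) = 1" using nonneg[of "-1"] by (simp add: square_eq_1_iff) linarith?
  then show ?thesis using mult[of "-1" x] by simp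
qed

lemma diff_commute: "v (x - y) = v (y - x)"
  using minus[of "x - y"] by simp

lemma power: "v (x ^ n) = v x ^ n"
  by (induction n) (simp_all add: mult)

lemma inverse: "v (inverse x) = inverse (v x)"
proof (cases "x = 0")
  case False
  then have "v x * v (inverse x) = 1" using mult[of x "inverse x"] by simp
  then show ?thesis by (simp add: inverse_unique)
qed simp

lemma divide: "v (x / y) = v x / v y"
  by (simp add: divide_inverse mult inverse)

lemma sqrt_diff_le: "\<bar>sqrt (v x) - sqrt (v y)\<bar> \<le> sqrt (v (x - y))"
  using sqrt_add_le[of "x - y" y] sqrt_add_le[of "y - x" x] diff_commute[of x y] by simp

lemma tendsto_one_add:
  assumes "(\<lambda>n. v (s n)) \<longlonglongrightarrow> 0" shows "(\<lambda>n. v (1 + s n)) \<longlonglongrightarrow> 1"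
proof -
  have "(\<lambda>n. sqrt (v (s n))) \<longlonglongrightarrow> 0" using tendsto_real_sqrt[OF assms] by simp
  then have "(\<lambda>n. sqrt (v (1 + s n)) - 1) \<longlonglongrightarrow> 0"
  proof (rule tendsto_rabs_zero_cancel[OF tendsto_sandwich[OF _ _ tendsto_const], rotated 2])
    show "\<forall>\<^sub>F n in sequentially. \<bar>sqrt (v (1 + s n)) - 1\<bar> \<le> sqrt (v (s n))"
      using sqrt_diff_le[of "1 + s _" 1] by auto
  qed auto
  then have "(\<lambda>n. sqrt (v (1 + s n))) \<longlonglongrightarrow> 1" by (simp add: LIM_zero_iff)
  from tendsto_power[OF this, of 2] show ?thesis by simp
qed

lemma power_tendsto_zero: "v x < 1 \<Longrightarrow> (\<lambda>n. v (x ^ n)) \<longlonglongrightarrow> 0"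
  by (simp add: power LIMSEQ_realpow_zero)

text \<open>The classical device of weak approximation: \<open>x ^ n / (1 + x ^ n)\<close> tends to
  0 where \<open>x\<close> is small and to 1 where \<open>x\<close> is large, so multiplication by
  it corrects an element at some places and hardly changes it at others.\<close>

lemma fraction_tendsto_zero:
  assumes "v x < 1" shows "(\<lambda>n. v (x ^ n / (1 + x ^ n))) \<longlonglongrightarrow> 0"
  using tendsto_divide[OF power_tendsto_zero[OF assms] tendsto_one_add[OF power_tendsto_zero[OF assms]]]
  by (simp add: divide)

lemma fraction_tendsto_one:
  assumes "v x > 1" shows "(\<lambda>n. v (x ^ n / (1 + x ^ n))) \<longlonglongrightarrow> 1"
proof -
  have x: "x \<noteq> 0" using assms by auto
  have "v (inverse x) < 1" using assms by (simp add: inverse inverse_less_1_iff)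
  from tendsto_one_add[OF power_tendsto_zero[OF this]]
  have "(\<lambda>n. 1 / v (1 + inverse x ^ n)) \<longlonglongrightarrow> 1 / 1" by (intro tendsto_divide tendsto_const) auto
  moreover have "1 / v (1 + inverse x ^ n) = v (x ^ n / (1 + x ^ n))" for n
  proof -
    have "x ^ n / (1 + x ^ n) = 1 / (1 + inverse x ^ n)" using x by (simp add: field_simps)
    then show ?thesis by (simp add: divide)
  qed
  ultimately show ?thesis by simp
qed

end

section \<open>Archimedean and finite places\<close>

lemma field_embedding_props:
  assumes "field_embedding \<sigma>"
  shows "\<sigma> 0 = 0" "\<sigma> x = 0 \<longleftrightarrow> x = 0" "\<sigma> (x * y) = \<sigma> x * \<sigma> y" "\<sigma> (x + y) = \<sigma> x + \<sigma> y" "\<sigma> 1 = 1"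
    "\<sigma> (of_nat n) = of_nat n"
proof -
  show a: "\<sigma> (x * y) = \<sigma> x * \<sigma> y" "\<sigma> (x + y) = \<sigma> x + \<sigma> y" "\<sigma> 1 = 1" for x y
    using assms by (auto simp: field_embedding_def)
  show z: "\<sigma> 0 = 0" using a(2)[of 0 0] by simp
  show "\<sigma> x = 0 \<longleftrightarrow> x = 0"
    using a(1)[of x "inverse x"] a(3) z by (cases "x = 0") auto
  show "\<sigma> (of_nat n) = of_nat n" by (induction n) (simp_all add: a z)
qed

lemma place_value_archimedean:
  assumes "v \<in> archimedean_places" shows "place_value v"
proof -
  obtain \<sigma> where \<sigma>: "field_embedding \<sigma>" "v = (\<lambda>x. cmod (\<sigma> x) ^ (if range \<sigma> \<subseteq> \<real> then 1 else 2))"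
    using assms by (auto simp: archimedean_places_def)
  note p = field_embedding_props[OF \<sigma>(1)]
  show ?thesis
  proof (cases "range \<sigma> \<subseteq> \<real>")
    case True
    show ?thesis unfolding \<sigma>(2)
    proof unfold_locales
      fix x y
      have "sqrt (cmod (\<sigma> x + \<sigma> y)) \<le> sqrt (cmod (\<sigma> x) + cmod (\<sigma> y))"
        by (intro real_sqrt_le_mono norm_triangle_ineq)
      also have "\<dots> \<le> sqrt (cmod (\<sigma> x)) + sqrt (cmod (\<sigma> y))"
        by (intro sqrt_add_le_add_sqrt) auto
      finally show "sqrt (cmod (\<sigma> (x + y)) ^ (if range \<sigma> \<subseteq> \<real> then 1 else 2)) \<le>
          sqrt (cmod (\<sigma> x) ^ (if range \<sigma> \<subseteq> \<real> then 1 else 2)) + sqrt (cmod (\<sigma> y) ^ (if range \<sigma> \<subseteq> \<real> then 1 else 2))"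
        using True by (simp add: p)
    qed (auto simp: p norm_mult power_mult_distrib)
  next
    case False
    show ?thesis unfolding \<sigma>(2)
      by unfold_locales (use False in \<open>auto simp: p norm_mult power_mult_distrib intro: norm_triangle_ineq\<close>)
  qed
qed

lemma place_value_finite:
  assumes "v \<in> finite_places" shows "place_value v"
proof -
  have n: "nonarchimedean_absolute_value v" using assms by (auto simp: finite_places_def)
  show ?thesis
  proof
    show "0 \<le> v x" "v x = 0 \<longleftrightarrow> x = 0" "v (x * y) = v x * v y" for x y
      using n by (auto simp: nonarchimedean_absolute_value_def)
    fix x y
    have "sqrt (v (x + y)) \<le> sqrt (max (v x) (v y))"
      using n by (auto simp: nonarchimedean_absolute_value_def)
    also have "\<dots> \<le> sqrt (v x) + sqrt (v y)"
      using n by (auto simp: nonarchimedean_absolute_value_def max_def)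
    finally show "sqrt (v (x + y)) \<le> sqrt (v x) + sqrt (v y)" .
  qed
qed

lemma place_value_places: "v \<in> places \<Longrightarrow> place_value v"
  by (auto simp: places_def place_value_archimedean place_value_finite)

lemma finite_place_add_le:
  "v \<in> finite_places \<Longrightarrow> v (x + y) \<le> max (v x) (v y)"
  by (auto simp: finite_places_def nonarchimedean_absolute_value_def)

lemma finite_place_sum_le:
  assumes "v \<in> finite_places" "M \<ge> 0" "\<And>i. i \<in> I \<Longrightarrow> v (f i) \<le> M"
  shows "v (\<Sum>i\<in>I. f i) \<le> M"
  using assms(3)
proof (induction I rule: infinite_finite_induct)
  case (insert i I)
  have "v (f i + sum f I) \<le> max (v (f i)) (v (sum f I))"
    using assms(1) by (rule finite_place_add_le)
  also have "\<dots> \<le> M" using insert by auto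
  finally show ?case using insert by simp
qed (use assms(2) in \<open>simp_all add: place_value.zero[OF place_value_finite[OF assms(1)]]\<close>)

lemma finite_place_of_nat_le: "v \<in> finite_places \<Longrightarrow> v (of_nat n) \<le> 1"
proof (induction n)
  case 0 then show ?case by (simp add: place_value.zero[OF place_value_finite])
next
  case (Suc n)
  interpret place_value v using Suc.prems by (rule place_value_finite)
  show ?case using finite_place_add_le[OF Suc.prems, of 1 "of_nat n"] Suc by simp
qed

lemma finite_place_of_int_le: "v \<in> finite_places \<Longrightarrow> v (of_int n) \<le> 1"
  using finite_place_of_nat_le[of v "nat \<bar>n\<bar>"] place_value.minus[OF place_value_finite, of v "of_int n"]
  by (cases "n \<ge> 0") simp_all

lemma archimedean_place_of_nat:
  assumes "v \<in> archimedean_places" "n > 0" shows "v (of_nat n) \<ge> real n"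
proof -
  obtain \<sigma> where \<sigma>: "field_embedding \<sigma>" "v = (\<lambda>x. cmod (\<sigma> x) ^ (if range \<sigma> \<subseteq> \<real> then 1 else 2))"
    using assms by (auto simp: archimedean_places_def)
  have "real n ^ 1 \<le> real n ^ 2" using assms(2) by (intro power_increasing) auto
  then show ?thesis using \<sigma> by (simp add: field_embedding_props)
qed

section \<open>Denominators and residue characteristics\<close>

lemma common_denominator:
  "\<exists>N>0. \<forall>i\<in>I. \<exists>z. of_nat N * (of_rat (q i) :: 'k::field_char_0) = of_int z" if "finite I"
  using that
proof induction
  case empty then show ?case by (intro exI[of _ 1]) auto
next
  case (insert i I)
  then obtain N where N: "N > 0" "\<forall>i\<in>I. \<exists>z. of_nat N * (of_rat (q i) :: 'k) = of_int z" by auto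
  obtain a b where ab: "quotient_of (q i) = (a, b)" by fastforce
  have b: "b > 0" using quotient_of_denom_pos[OF ab] .
  have q: "(of_rat (q i) :: 'k) = of_int a / of_int b"
    using quotient_of_div[OF ab] by (simp add: of_rat_divide)
  have nb: "of_nat (N * nat b) = (of_nat N * of_int b :: 'k)" using b by simp
  have "\<exists>z. of_nat (N * nat b) * (of_rat (q j) :: 'k) = of_int z" if j: "j \<in> insert i I" for j
  proof (cases "j = i")
    case True
    have "of_nat (N * nat b) * (of_rat (q j) :: 'k) = of_int (int N * a)"
      unfolding nb True q using b by simp
    then show ?thesis by blast
  next
    case False
    then obtain z where z: "of_nat N * (of_rat (q j) :: 'k) = of_int z" using N j by auto
    have "of_nat (N * nat b) * (of_rat (q j) :: 'k) = of_int (z * b)"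
      unfolding nb by (simp add: z[symmetric] mult_ac)
    then show ?thesis by blast
  qed
  moreover have "N * nat b > 0" using N b by simp
  ultimately show ?case by blast
qed

text \<open>Multiplication by \<open>x\<close> is given by a rational matrix with respect to a finite spanning
  set; clear its denominators and compare values at a spanning vector of maximal value.\<close>
lemma integral_multiple:
  fixes x :: "'k::number_field"
  shows "\<exists>N>0. \<forall>v\<in>finite_places. v (of_nat N * x) \<le> 1"
proof -
  obtain B :: "'k set" where B: "finite B" "\<And>x. \<exists>q :: 'k \<Rightarrow> rat. x = (\<Sum>b\<in>B. of_rat (q b) * b)"
    using finite_over_rat by blast
  obtain q where q: "\<And>b. x * b = (\<Sum>b'\<in>B. of_rat (q b b') * b')"
    using B(2)[of "x * _"] by metis
  obtain N where N: "N > 0" "\<forall>(b, b')\<in>B \<times> B. \<exists>z. of_nat N * (of_rat (q b b') :: 'k) = of_int z"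
    using common_denominator[of "B \<times> B" "\<lambda>(b, b'). q b b'"] B(1) by auto
  have "v (of_nat N * x) \<le> 1" if v: "v \<in> finite_places" for v
  proof -
    interpret place_value v using v by (rule place_value_finite)
    have "B \<noteq> {}" using B(2)[of 1] by auto
    then have "Max (v ` B) \<in> v ` B" using B(1) by (intro Max_in) auto
    then obtain b where b0: "b \<in> B" "Max (v ` B) = v b" by auto
    have b: "b \<in> B" "\<And>b'. b' \<in> B \<Longrightarrow> v b' \<le> v b"
      using b0 B(1) Max_ge[of "v ` B"] by auto
    have "b \<noteq> 0"
    proof
      assume "b = 0"
      then have "v b' = 0" if "b' \<in> B" for b' using b(2)[OF that] nonneg[of b'] by (simp only: zero)
      then have "b' = 0" if "b' \<in> B" for b' using that by simp
      then have "(\<Sum>b\<in>B. of_rat (q' b) * b) = 0" for q' by (intro sum.neutral) simp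
      then show False using B(2)[of 1] by (metis zero_neq_one)
    qed
    have "of_nat N * x * b = (\<Sum>b'\<in>B. of_nat N * of_rat (q b b') * b')"
      unfolding mult.assoc q by (simp add: sum_distrib_left mult.assoc)
    also have "v \<dots> \<le> v b"
    proof (rule finite_place_sum_le[OF v])
      fix b' assume b': "b' \<in> B"
      obtain z where "of_nat N * (of_rat (q b b') :: 'k) = of_int z" using N(2) b(1) b' by fastforce
      then show "v (of_nat N * of_rat (q b b') * b') \<le> v b"
        using b(2)[OF b'] finite_place_of_int_le[OF v, of z] mult_mono[of "v (of_int z)" 1 "v b'" "v b"]
        by (simp add: mult)
    qed simp
    finally have "v (of_nat N * x) * v b \<le> 1 * v b" by (simp add: mult)
    then show ?thesis using \<open>b \<noteq> 0\<close> pos_iff[of b] mult_right_le_imp_le by blast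
  qed
  then show ?thesis using N(1) by blast
qed

lemma common_integral_multiple:
  fixes Q :: "'k::number_field set"
  assumes "finite Q"
  shows "\<exists>N>0. \<forall>x\<in>Q. \<forall>v\<in>finite_places. v (of_nat N * x) \<le> 1"
  using assms
proof induction
  case empty then show ?case by (intro exI[of _ 1]) auto
next
  case (insert x Q)
  obtain N where N: "N > 0" "\<forall>x\<in>Q. \<forall>v\<in>finite_places. v (of_nat N * x) \<le> 1" using insert by auto
  obtain M where M: "M > 0" "\<forall>v\<in>finite_places. v (of_nat M * x) \<le> 1" using integral_multiple by blast
  have "v (of_nat (N * M) * y) \<le> 1" if "y \<in> insert x Q" "v \<in> finite_places" for y v
  proof -
    interpret place_value v using that(2) by (rule place_value_finite)
    have "v (of_nat N) \<le> 1" "v (of_nat M) \<le> 1" using that(2) by (auto intro: finite_place_of_nat_le)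
    moreover have "v (of_nat N * y) \<le> 1 \<or> v (of_nat M * y) \<le> 1" using that N M by auto
    ultimately show ?thesis using mult_le_one[of "v (of_nat N)" "v (of_nat M * y)"]
        mult_le_one[of "v (of_nat M)" "v (of_nat N * y)"] by (auto simp: mult mult_ac)
  qed
  moreover have "N * M > 0" using N M by simp
  ultimately show ?case by blast
qed

text \<open>By Bezout, 1 would otherwise be a sum of two elements of value less than 1, contrary to
  the ultrametric inequality.\<close>

lemma finite_place_coprime:
  assumes v: "v \<in> finite_places" and "v (of_nat m) < 1" "coprime m n" shows "v (of_nat n) = 1"
proof (rule ccontr)
  interpret place_value v using v by (rule place_value_finite)
  assume "v (of_nat n) \<noteq> 1"
  then have n: "v (of_nat n) < 1" using finite_place_of_nat_le[OF v, of n] by simp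
  obtain x y where "x * int m + y * int n = 1"
    using assms(3) bezout_int[of "int m" "int n"] by (auto simp: coprime_iff_gcd_eq_1)
  then have "1 = of_int x * of_nat m + of_int y * (of_nat n :: 'a)"
    by (metis of_int_1 of_int_add of_int_mult of_int_of_nat_eq)
  moreover have "v (of_int x * of_nat m) < 1" "v (of_int y * of_nat n) < 1"
    using assms(2) n finite_place_of_int_le[OF v]
      mult_le_less_imp_less[of "v (of_int x)" 1 "v (of_nat m)" 1] mult_left_le_one_le[of "v (of_nat m)" "v (of_int x)"]
      mult_left_le_one_le[of "v (of_nat n)" "v (of_int y)"]
    by (simp_all add: mult)
  ultimately show False using finite_place_add_le[OF v, of "of_int x * of_nat m" "of_int y * of_nat n"] by auto
qed

lemma finite_place_prime_factor:
  assumes v: "v \<in> finite_places" and n: "v (of_nat n) < 1" "n > 0"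
  shows "\<exists>p\<in>prime_factors n. v (of_nat p) < 1"
  using n
proof (induction n rule: less_induct)
  case (less n)
  interpret place_value v using v by (rule place_value_finite)
  have "n \<noteq> 1" using less.prems by auto
  then obtain p where p: "prime p" "p dvd n" using prime_factor_nat by blast
  then obtain m where m: "n = p * m" by auto
  have pn: "p \<in> prime_factors n" using p less.prems by (auto simp: prime_factors_dvd)
  show ?case
  proof (cases "v (of_nat p) < 1")
    case False
    then have "v (of_nat p) = 1" using finite_place_of_nat_le[OF v, of p] by simp
    then have "v (of_nat m) < 1" using less.prems m by (simp add: mult)
    moreover have "m < n" "m > 0" using m p less.prems prime_gt_1_nat[of p] by auto
    ultimately obtain p' where "p' \<in> prime_factors m" "v (of_nat p') < 1" using less.IH by blast
    then show ?thesis using m less.prems by (auto simp: prime_factors_dvd)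
  qed (use pn in auto)
qed

text \<open>A positive integer \<open>N\<close> such that \<open>N / \<pi>\<close> is integral at
  \<open>v\<close> has value at most \<open>v \<pi>\<close>, hence less than 1, and one of its prime
  factors inherits this.\<close>

lemma finite_place_above_prime:
  fixes v :: "'k::number_field \<Rightarrow> real"
  assumes v: "v \<in> finite_places"
  shows "\<exists>p. prime p \<and> v (of_nat p) < 1"
proof -
  interpret place_value v using v by (rule place_value_finite)
  obtain \<pi> where \<pi>: "\<pi> \<noteq> 0" "v \<pi> < 1" using v by (auto simp: finite_places_def)
  obtain N where N: "N > 0" "v (of_nat N * inverse \<pi>) \<le> 1" using integral_multiple v by blast
  have "v (of_nat N) < 1"
    using N(2) \<pi> pos_iff[of \<pi>] by (simp add: divide divide_inverse[symmetric] divide_le_eq del: pos_iff)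
  then show ?thesis using finite_place_prime_factor[OF v _ N(1)] by auto
qed

section \<open>Equivalence of absolute values and weak approximation\<close>

lemma equivalent_place_values:
  fixes v w :: "'k::field \<Rightarrow> real"
  assumes "place_value v" "place_value w" and z: "v z > 1" and imp: "\<And>x. v x < 1 \<Longrightarrow> w x < 1"
  obtains s where "s > 0" "\<And>x. x \<noteq> 0 \<Longrightarrow> w x = v x powr s"
proof -
  interpret v: place_value v by fact
  interpret w: place_value w by fact
  have z0: "z \<noteq> 0" using z by auto
  have wz: "w z > 1"
    using imp[of "inverse z"] z z0 w.pos_iff[of z]
    by (simp add: v.inverse w.inverse inverse_less_1_iff del: w.pos_iff)
  \<comment> \<open>A rational number \<open>m / n\<close> exceeds
    \<open>ln (v x) / ln (v z)\<close> exactly if \<open>x ^ n / z ^ m\<close> has value less than 1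
    at \<open>v\<close>. This condition passes to \<open>w\<close>, and rational numbers close
    enough from above give the inequality.\<close>
  have le: "ln (w x) / ln (w z) \<le> ln (v x) / ln (v z)" if x: "x \<noteq> 0" for x
  proof (rule dense_ge)
    fix t assume t: "ln (v x) / ln (v z) < t"
    obtain q where q: "ln (v x) / ln (v z) < of_rat q" "of_rat q < t" using of_rat_dense[OF t] by auto
    obtain m n where mn: "quotient_of q = (m, n)" by fastforce
    have n: "n > 0" using quotient_of_denom_pos[OF mn] .
    have qq: "of_rat q = real_of_int m / of_int n" using quotient_of_div[OF mn] by (simp add: of_rat_divide)
    have key: "u (x ^ nat n * (if m \<ge> 0 then inverse z ^ nat m else z ^ nat (- m))) < 1 \<longleftrightarrow>
        ln (u x) / ln (u z) < of_rat q" if u: "place_value u" "u z > 1" for u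
    proof -
      interpret u: place_value u by fact
      have px: "u x > 0" "u z > 0" using x z0 by auto
      let ?y = "x ^ nat n * (if m \<ge> 0 then inverse z ^ nat m else z ^ nat (- m))"
      have y: "u ?y > 0" using x z0 by (simp add: u.mult u.power u.inverse)
      have "ln (u ?y) = of_int n * ln (u x) - of_int m * ln (u z)"
        using px n by (auto simp: u.mult u.power u.inverse ln_mult ln_realpow ln_inverse)
      moreover have "u ?y < 1 \<longleftrightarrow> ln (u ?y) < 0" using y by simp
      moreover have "ln (u x) / ln (u z) < of_rat q \<longleftrightarrow> of_int n * ln (u x) < of_int m * ln (u z)"
      proof -
        have lz: "ln (u z) > 0" using u(2) by (rule ln_gt_zero)
        show ?thesis unfolding qq
          by (subst pos_divide_less_eq[OF lz]) (use n in \<open>simp add: field_simps\<close>)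
      qed
      ultimately show ?thesis by simp
    qed
    have "ln (w x) / ln (w z) < of_rat q"
      using key[OF assms(1) z] key[OF assms(2) wz] q(1) imp by blast
    then show "ln (w x) / ln (w z) \<le> t" using q(2) by linarith
  qed
  \<comment> \<open>Passing to the inverse of \<open>x\<close> changes the sign of both logarithms
    and reverses the inequality.\<close>
  have eq: "ln (w x) / ln (w z) = ln (v x) / ln (v z)" if x: "x \<noteq> 0" for x
  proof (rule antisym[OF le[OF x]])
    have "ln (w (inverse x)) / ln (w z) \<le> ln (v (inverse x)) / ln (v z)" using le[of "inverse x"] x by simp
    then show "ln (v x) / ln (v z) \<le> ln (w x) / ln (w z)"
      using x by (simp add: v.inverse w.inverse ln_inverse)
  qed
  show ?thesis
  proof (rule that)
    show "ln (w z) / ln (v z) > 0" using z wz by (intro divide_pos_pos ln_gt_zero)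
    fix x :: 'k assume x: "x \<noteq> 0"
    have "ln (w x) = ln (w z) / ln (v z) * ln (v x)"
    proof -
      have "ln (w z) > 0" using wz by (rule ln_gt_zero)
      then have "ln (w x) = ln (w x) / ln (w z) * ln (w z)" by simp
      then show ?thesis unfolding eq[OF x] by (simp add: mult.commute)
    qed
    then have "exp (ln (w x)) = v x powr (ln (w z) / ln (v z))" using x by (simp add: powr_def)
    then show "w x = v x powr (ln (w z) / ln (v z))" using x by simp
  qed
qed

text \<open>The absolute values of \<open>\<sigma> x\<close> and \<open>\<sigma> x + 1\<close>
  determine the real part of \<open>\<sigma> x\<close>, hence also the square of its imaginary part.
  So the exponent in the normalization depends only on the usual absolute value.\<close>

lemma real_place_iff_of_cmod_eq:
  assumes "field_embedding \<sigma>" "field_embedding \<tau>" "\<And>x. cmod (\<sigma> x) = cmod (\<tau> x)"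
  shows "range \<sigma> \<subseteq> \<real> \<longleftrightarrow> range \<tau> \<subseteq> \<real>"
proof -
  have "Im (\<sigma> x) = 0 \<longleftrightarrow> Im (\<tau> x) = 0" for x
  proof -
    have a: "(cmod (\<sigma> x))\<^sup>2 = (cmod (\<tau> x))\<^sup>2" using assms(3) by simp
    have "(cmod (\<sigma> x + 1))\<^sup>2 = (cmod (\<tau> x + 1))\<^sup>2"
      using assms(3)[of "x + 1"] field_embedding_props[OF assms(1)] field_embedding_props[OF assms(2)] by simp
    then have "Re (\<sigma> x) = Re (\<tau> x)" using a by (simp add: cmod_power2) (simp add: power2_eq_square algebra_simps)
    then have "(Im (\<sigma> x))\<^sup>2 = (Im (\<tau> x))\<^sup>2" using a by (simp add: cmod_power2)
    then show ?thesis by (metis zero_eq_power2)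
  qed
  then show ?thesis by (auto simp: image_subset_iff complex_is_Real_iff)
qed

text \<open>Otherwise \<open>w\<close> would be a power of \<open>v\<close>, which the
  normalizations rule out. At finite places the value of a uniformizer is prescribed by the residue
  field; at archimedean places the value of 2 shows that the usual absolute values coincide. A
  finite and an archimedean place are told apart by an integer that is small at one of them
  only.\<close>

lemma distinct_places:
  fixes v w :: "'k::number_field \<Rightarrow> real"
  assumes vw: "v \<in> places" "w \<in> places" "v \<noteq> w"
  shows "\<exists>x. v x < 1 \<and> w x \<ge> 1"
proof (rule ccontr)
  assume "\<not> ?thesis"
  then have imp: "\<And>x. v x < 1 \<Longrightarrow> w x < 1" by force
  interpret v: place_value v using vw(1) by (rule place_value_places)
  interpret w: place_value w using vw(2) by (rule place_value_places)
  have half: "u (inverse (of_nat 2)) < 1" if "u \<in> archimedean_places" for u :: "'k \<Rightarrow> real"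
  proof -
    interpret u: place_value u using that by (rule place_value_archimedean)
    have "u (of_nat 2) \<ge> 2" using archimedean_place_of_nat[OF that, of 2] by simp
    then show ?thesis unfolding u.inverse by (intro inverse_less_1_iff[THEN iffD2]) auto
  qed
  consider (fin) "v \<in> finite_places" "w \<in> finite_places" | (arch) "v \<in> archimedean_places" "w \<in> archimedean_places"
    | (af) "v \<in> archimedean_places" "w \<in> finite_places" | (fa) "v \<in> finite_places" "w \<in> archimedean_places"
    using vw by (auto simp: places_def)
  then show False
  proof cases
    case af
    have "w (inverse (of_nat 2)) < 1" using half[OF af(1)] imp by blast
    moreover have "w (of_nat 2) \<le> 1" using finite_place_of_nat_le[OF af(2)] .
    moreover have "w (of_nat 2) > 0" by simp
    ultimately show False unfolding w.inverse inverse_less_1_iff by linarith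
  next
    case fa
    obtain p where "prime p" "v (of_nat p) < 1" using finite_place_above_prime[OF fa(1)] by auto
    then show False using imp[of "of_nat p"] archimedean_place_of_nat[OF fa(2), of p] prime_gt_1_nat[of p] by auto
  next
    case fin
    obtain \<pi> where \<pi>: "\<pi> \<noteq> 0" "v \<pi> < 1" "v \<pi> = 1 / real (residue_cardinality v)" "\<forall>x. v x < 1 \<longrightarrow> v x \<le> v \<pi>"
      using fin by (auto simp: finite_places_def)
    obtain \<pi>' where \<pi>': "\<pi>' \<noteq> 0" "w \<pi>' < 1" "w \<pi>' = 1 / real (residue_cardinality w)" "\<forall>x. w x < 1 \<longrightarrow> w x \<le> w \<pi>'"
      using fin by (auto simp: finite_places_def)
    have "v (inverse \<pi>) > 1" using \<pi>(1,2) by (simp add: v.inverse one_less_inverse_iff)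
    then obtain s where s: "s > 0" "\<And>x. x \<noteq> 0 \<Longrightarrow> w x = v x powr s"
      using equivalent_place_values[OF v.place_value_axioms w.place_value_axioms _ imp] by metis
    have lt: "v x < 1 \<longleftrightarrow> w x < 1" for x
    proof (cases "x = 0")
      case False
      then show ?thesis using s(2)[OF False] powr_less_iff[of "v x" 1 s] powr_less_mono2[OF s(1), of "v x" 1] powr_mono2[of s 1 "v x"] s(1)
        by (cases "v x < 1") (auto simp: not_less intro: imp)
    qed simp
    have "v x \<le> 1 \<longleftrightarrow> w x \<le> 1" for x
    proof (cases "x = 0")
      case False
      then have "v x > 0" "w x > 0" by simp_all
      then show ?thesis using lt[of "inverse x"] unfolding v.inverse w.inverse inverse_less_1_iff by linarith
    qed simp
    \<comment> \<open>Both places have the same valuation ring and the same maximal ideal, hence the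
      same residue field.\<close>
    then have "residue_cardinality v = residue_cardinality w"
      unfolding residue_cardinality_def lt by simp
    then have e: "v \<pi> = w \<pi>'" using \<pi>(3) \<pi>'(3) by simp
    have "w \<pi>' = w \<pi>"
    proof (rule antisym)
      show "w \<pi> \<le> w \<pi>'" using \<pi>' \<pi> lt by blast
      have "v \<pi>' \<le> v \<pi>" using \<pi>' \<pi> lt by blast
      then show "w \<pi>' \<le> w \<pi>" using s \<pi>(1) \<pi>'(1) by (simp add: powr_mono2)
    qed
    then have "v \<pi> powr s = v \<pi> powr 1" using s(2)[OF \<pi>(1)] e by simp
    then have "s = 1" using \<pi>(1,2) by (subst (asm) powr_inj) auto
    then have "v = w" using s(2) by (intro ext) (metis powr_one v.nonneg v.zero w.zero)
    then show False using vw by simp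
  next
    case arch
    obtain \<sigma> where \<sigma>: "field_embedding \<sigma>" "v = (\<lambda>x. cmod (\<sigma> x) ^ (if range \<sigma> \<subseteq> \<real> then 1 else 2))"
      using arch by (auto simp: archimedean_places_def)
    obtain \<tau> where \<tau>: "field_embedding \<tau>" "w = (\<lambda>x. cmod (\<tau> x) ^ (if range \<tau> \<subseteq> \<real> then 1 else 2))"
      using arch by (auto simp: archimedean_places_def)
    define e f :: nat where "e = (if range \<sigma> \<subseteq> \<real> then 1 else 2)" and "f = (if range \<tau> \<subseteq> \<real> then 1 else 2)"
    have "v (of_nat 2) > 1" using archimedean_place_of_nat[OF arch(1), of 2] by simp
    then obtain s where s: "s > 0" "\<And>x. x \<noteq> 0 \<Longrightarrow> w x = v x powr s"
      using equivalent_place_values[OF v.place_value_axioms w.place_value_axioms _ imp] by metis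
    have ev: "cmod (\<tau> x) powr real f = cmod (\<sigma> x) powr (real e * s)" if x: "x \<noteq> 0" for x
    proof -
      have "cmod (\<sigma> x) > 0" "cmod (\<tau> x) > 0" using x by (simp_all add: field_embedding_props \<sigma>(1) \<tau>(1))
      then have "v x = cmod (\<sigma> x) powr real e" "w x = cmod (\<tau> x) powr real f"
        unfolding \<sigma>(2) \<tau>(2) e_def f_def by (simp_all add: powr_realpow)
      then show ?thesis using s(2)[OF x] by (simp add: powr_powr)
    qed
    \<comment> \<open>The absolute value of 2 is the same under every embedding, which determines
      the exponent \<open>s\<close>.\<close>
    have "(2::real) powr real f = 2 powr (real e * s)"
      using ev[of "of_nat 2"] by (simp only: field_embedding_props(6)[OF \<sigma>(1)] field_embedding_props(6)[OF \<tau>(1)]) simp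
    then have fe: "real f = real e * s" by (subst (asm) powr_inj) auto
    have f0: "real f > 0" by (simp add: f_def)
    have cm: "cmod (\<sigma> x) = cmod (\<tau> x)" for x
    proof (cases "x = 0")
      case False
      have "cmod (\<sigma> x) > 0" "cmod (\<tau> x) > 0" using False by (simp_all add: field_embedding_props \<sigma>(1) \<tau>(1))
      moreover have "cmod (\<tau> x) powr real f = cmod (\<sigma> x) powr real f" using ev[OF False] fe by simp
      ultimately have "ln (cmod (\<tau> x)) = ln (cmod (\<sigma> x))" using f0 by (simp add: powr_def)
      then show ?thesis using \<open>cmod (\<sigma> x) > 0\<close> \<open>cmod (\<tau> x) > 0\<close> by simp
    qed (simp add: field_embedding_props \<sigma>(1) \<tau>(1))
    have "v = w" unfolding \<sigma>(2) \<tau>(2) using real_place_iff_of_cmod_eq[OF \<sigma>(1) \<tau>(1) cm] cm by simp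
    then show False using vw by simp
  qed
qed

text \<open>In the induction step, \<open>y\<close> is right at \<open>v\<close> and at the new
  place \<open>w\<close>, while \<open>x\<close> is right at \<open>v\<close> and on
  \<open>T\<close>. A factor \<open>t\<close> makes \<open>y\<close> small on \<open>T\<close>
  without spoiling it at \<open>v\<close> and \<open>w\<close>: a power of \<open>x\<close> if
  \<open>w x \<le> 1\<close>, and otherwise \<open>x ^ n / (1 + x ^ n)\<close>, which is close to 1
  at both.\<close>

lemma weak_approximation:
  fixes T :: "('k::number_field \<Rightarrow> real) set"
  assumes "finite T" "T \<subseteq> places" "v \<in> places" "v \<notin> T"
  shows "\<exists>x. v x > 1 \<and> (\<forall>w\<in>T. w x < 1)"
  using assms
proof (induction T)
  case empty
  interpret v: place_value v using empty by (intro place_value_places) auto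
  have "\<exists>x. v x > 1"
  proof (cases "v \<in> finite_places")
    case True
    then obtain \<pi> where \<pi>: "\<pi> \<noteq> 0" "v \<pi> < 1" by (auto simp: finite_places_def)
    then show ?thesis by (intro exI[of _ "inverse \<pi>"]) (simp add: v.inverse one_less_inverse_iff)
  next
    case False
    then have "v (of_nat 2) \<ge> 2" using empty archimedean_place_of_nat[of v 2] by (auto simp: places_def)
    then show ?thesis by (intro exI[of _ "of_nat 2"]) auto
  qed
  then show ?case by simp
next
  case (insert w T)
  interpret v: place_value v using insert by (intro place_value_places) auto
  interpret w: place_value w using insert by (intro place_value_places) auto
  have pv: "place_value u" if "u \<in> T" for u using insert that by (intro place_value_places) auto
  obtain x where x: "v x > 1" "\<forall>u\<in>T. u x < 1" using insert by auto
  obtain y1 where y1: "v y1 < 1" "w y1 \<ge> 1" using distinct_places[of v w] insert by auto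
  obtain y2 where y2: "w y2 < 1" "v y2 \<ge> 1" using distinct_places[of w v] insert by auto
  have "y1 \<noteq> 0" using y1 by auto
  then have v1: "v y1 > 0" by simp
  \<comment> \<open>\<open>y1\<close> and \<open>y2\<close> satisfy one strict and one weak
    inequality each; in the quotient both inequalities become strict.\<close>
  define y where "y = y2 / y1"
  have y: "v y > 1" "w y < 1"
    using y1 y2 v1 unfolding y_def by (simp_all add: v.divide w.divide field_simps)
  have "\<exists>t. v (t * y) > 1 \<and> w (t * y) < 1 \<and> (\<forall>u\<in>T. u (t * y) < 1)"
  proof (cases "w x \<le> 1")
    case True
    have "\<forall>\<^sub>F n in sequentially. \<forall>u\<in>T. u (x ^ n * y) < 1"
    proof (intro eventually_ball_finite[OF insert(1)] ballI)
      fix u assume u: "u \<in> T"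
      interpret u: place_value u using pv[OF u] .
      have "(\<lambda>n. u (x ^ n) * u y) \<longlonglongrightarrow> 0 * u y" using u x(2) by (intro tendsto_mult tendsto_const u.power_tendsto_zero) auto
      then show "\<forall>\<^sub>F n in sequentially. u (x ^ n * y) < 1" unfolding u.mult by (intro order_tendstoD) auto
    qed
    then obtain n where n: "\<forall>u\<in>T. u (x ^ n * y) < 1" by (auto simp: eventually_sequentially)
    have "v (x ^ n * y) > 1" using y x one_le_power[of "v x" n] less_le_trans[of 1 "v y"] mult_right_mono[of 1 "v x ^ n" "v y"]
      by (simp add: v.mult v.power)
    moreover have "w (x ^ n * y) < 1"
      using y True power_le_one[of "w x" n] mult_right_mono[of "w x ^ n" 1 "w y"] by (simp add: w.mult w.power)
    ultimately show ?thesis using n by blast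
  next
    case False
    then have wx: "w x > 1" by simp
    let ?t = "\<lambda>n. x ^ n / (1 + x ^ n)"
    have "\<forall>\<^sub>F n in sequentially. \<forall>u\<in>T. u (?t n * y) < 1"
    proof (intro eventually_ball_finite[OF insert(1)] ballI)
      fix u assume u: "u \<in> T"
      interpret u: place_value u using pv[OF u] .
      have "(\<lambda>n. u (?t n) * u y) \<longlonglongrightarrow> 0 * u y" using u x(2) by (intro tendsto_mult tendsto_const u.fraction_tendsto_zero) auto
      then show "\<forall>\<^sub>F n in sequentially. u (?t n * y) < 1" unfolding u.mult by (intro order_tendstoD) auto
    qed
    moreover have "(\<lambda>n. v (?t n) * v y) \<longlonglongrightarrow> 1 * v y" using x by (intro tendsto_mult tendsto_const v.fraction_tendsto_one)
    then have "\<forall>\<^sub>F n in sequentially. v (?t n * y) > 1" unfolding v.mult using y by (intro order_tendstoD) auto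
    moreover have "(\<lambda>n. w (?t n) * w y) \<longlonglongrightarrow> 1 * w y" using wx by (intro tendsto_mult tendsto_const w.fraction_tendsto_one)
    then have "\<forall>\<^sub>F n in sequentially. w (?t n * y) < 1" unfolding w.mult using y by (intro order_tendstoD) auto
    ultimately have "\<forall>\<^sub>F n in sequentially. v (?t n * y) > 1 \<and> w (?t n * y) < 1 \<and> (\<forall>u\<in>T. u (?t n * y) < 1)"
      by eventually_elim auto
    then show ?thesis unfolding eventually_sequentially by blast
  qed
  then show ?case by auto
qed

section \<open>Finiteness of the set of places above a prime\<close>

lemma finite_place_of_rat_le_iff:
  assumes v: "v \<in> finite_places" and p: "prime p" "v (of_nat p) < 1"
  shows "v (of_rat q) \<le> 1 \<longleftrightarrow> \<not> int p dvd snd (quotient_of q)"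
proof -
  interpret place_value v using v by (rule place_value_finite)
  obtain a b where ab: "quotient_of q = (a, b)" by fastforce
  have b: "b > 0" using quotient_of_denom_pos[OF ab] .
  have cop: "coprime a b" using quotient_of_coprime[OF ab] .
  have q: "v (of_rat q) = v (of_int a) / v (of_int b)"
    using quotient_of_div[OF ab] by (simp add: of_rat_divide divide)
  have unit: "v (of_int z) = 1" if "\<not> int p dvd z" for z
  proof -
    have "\<not> p dvd nat \<bar>z\<bar>" using that by (metis int_dvd_int_iff abs_of_nonneg dvd_abs_iff int_nat_eq abs_ge_zero)
    then have "v (of_nat (nat \<bar>z\<bar>)) = 1"
      using p by (intro finite_place_coprime[OF v p(2)] prime_imp_coprime) auto
    moreover have "(of_nat (nat \<bar>z\<bar>) :: 'a) = of_int z \<or> (of_nat (nat \<bar>z\<bar>) :: 'a) = - of_int z"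
      by (cases "z \<ge> 0") auto
    ultimately show ?thesis by (metis minus)
  qed
  have nonunit: "v (of_int z) < 1" if z: "int p dvd z" for z
  proof -
    obtain k where "z = int p * k" using z by auto
    then show ?thesis using p(2) finite_place_of_int_le[OF v, of k] mult_right_le_one_le[of "v (of_nat p)" "v (of_int k)"]
      by (simp add: mult)
  qed
  show ?thesis
  proof (cases "int p dvd b")
    case True
    then have "\<not> int p dvd a" using cop p(1)
      by (meson coprime_common_divisor not_prime_unit prime_nat_int_transfer)
    then have "v (of_rat q) = 1 / v (of_int b)" using q unit by simp
    moreover have "v (of_int b) > 0" using b by simp
    ultimately show ?thesis using nonunit[OF True] True ab by (simp add: divide_le_eq)
  next
    case False
    then show ?thesis using q unit[OF False] finite_place_of_int_le[OF v, of a] ab by simp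
  qed
qed

text \<open>If there were more such places than elements in a finite spanning set, elements
  \<open>x v\<close> that are large at \<open>v\<close> and small at the other chosen places would
  be linearly dependent over the rationals. Dividing the relation by a coefficient that is largest
  at places above \<open>p\<close> writes one \<open>x v\<close> as a combination of the others with
  coefficients integral at \<open>v\<close>, which contradicts \<open>v (x v) > 1\<close>.\<close>

lemma finite_places_above_prime:
  assumes p: "prime p"
  shows "finite {v :: 'k::number_field \<Rightarrow> real. v \<in> finite_places \<and> v (of_nat p) < 1}"
proof (rule ccontr)
  let ?Z = "{v :: 'k \<Rightarrow> real. v \<in> finite_places \<and> v (of_nat p) < 1}"
  assume inf: "infinite ?Z"
  interpret Q: vector_space "\<lambda>q (x::'k). of_rat q * x"
    by unfold_locales (simp_all add: of_rat_add of_rat_mult algebra_simps)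
  obtain B :: "'k set" where B: "finite B" "\<And>x. \<exists>q :: 'k \<Rightarrow> rat. x = (\<Sum>b\<in>B. of_rat (q b) * b)"
    using finite_over_rat by blast
  have span: "Q.span B = UNIV"
  proof -
    have "x \<in> Q.span B" for x
    proof -
      obtain q where "x = (\<Sum>b\<in>B. of_rat (q b) * b)" using B(2) by blast
      moreover have "(\<Sum>b\<in>B. of_rat (q b) * b) \<in> Q.span B"
        by (intro Q.span_sum Q.span_scale Q.span_base)
      ultimately show ?thesis by (simp only:)
    qed
    then show ?thesis by auto
  qed
  obtain T where T: "finite T" "card T = Suc (card B)" "T \<subseteq> ?Z"
    using infinite_arbitrarily_large[OF inf, of "Suc (card B)"] by auto
  have Tp: "T \<subseteq> places" using T by (auto simp: places_def)
  have "\<exists>x. v x > 1 \<and> (\<forall>w\<in>T - {v}. w x < 1)" if "v \<in> T" for v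
    using that T Tp by (intro weak_approximation) auto
  then obtain x where x: "\<And>v. v \<in> T \<Longrightarrow> v (x v) > 1" "\<And>v w. v \<in> T \<Longrightarrow> w \<in> T \<Longrightarrow> w \<noteq> v \<Longrightarrow> w (x v) < 1"
    by (metis DiffI singletonD)
  have inj: "inj_on x T"
    by (rule inj_onI) (metis x not_less_iff_gr_or_eq)
  then have cx: "card (x ` T) = Suc (card B)" using T by (simp add: card_image)
  have "Q.dependent (x ` T)"
  proof (rule ccontr)
    assume "\<not> Q.dependent (x ` T)"
    then have "card (x ` T) \<le> card B"
      using Q.independent_span_bound[OF B(1), of "x ` T"] span by auto
    then show False using cx by simp
  qed
  then obtain u v0 where u: "v0 \<in> T" "u (x v0) \<noteq> 0" "(\<Sum>b\<in>x ` T. of_rat (u b) * b) = 0"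
    using Q.dependent_finite[of "x ` T"] T(1) by auto
  have sum0: "(\<Sum>v\<in>T. of_rat (u (x v)) * x v) = 0"
    using u(3) by (subst (asm) sum.reindex[OF inj]) simp
  interpret v0: place_value v0 using u(1) Tp by (intro place_value_places) auto
  have "finite ((\<lambda>v. v0 (of_rat (u (x v)))) ` T)" "(\<lambda>v. v0 (of_rat (u (x v)))) ` T \<noteq> {}" using T u by auto
  from Max_in[OF this] obtain v where v: "v \<in> T"
    "Max ((\<lambda>v. v0 (of_rat (u (x v)))) ` T) = v0 (of_rat (u (x v)))" by auto
  have vmax: "v0 (of_rat (u (x w))) \<le> v0 (of_rat (u (x v)))" if "w \<in> T" for w
    using Max_ge[of "(\<lambda>v. v0 (of_rat (u (x v)))) ` T"] that T(1) unfolding v(2)[symmetric] by auto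
  have v0v: "v0 (of_rat (u (x v))) > 0"
  proof -
    have "v0 (of_rat (u (x v0))) > 0" unfolding v0.pos_iff using u(2) by simp
    then show ?thesis using vmax[OF u(1)] by linarith
  qed
  then have uv: "u (x v) \<noteq> 0" by (metis of_rat_0 v0.pos_iff)
  interpret v: place_value v using v(1) Tp by (intro place_value_places) auto
  have vf: "v \<in> finite_places" "v (of_nat p) < 1" "v0 \<in> finite_places" "v0 (of_nat p) < 1" using v(1) u(1) T by auto
  \<comment> \<open>The coefficient was chosen by means of \<open>v0\<close>, but integrality of a
    rational number means the same at every place above \<open>p\<close>.\<close>
  have le: "v (of_rat (u (x w) / u (x v))) \<le> 1" if "w \<in> T" for w
  proof -
    have "v0 (of_rat (u (x w) / u (x v))) \<le> 1"
      using vmax[OF that] v0v by (simp add: of_rat_divide v0.divide)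
    then show ?thesis using finite_place_of_rat_le_iff[OF vf(1) p vf(2)] finite_place_of_rat_le_iff[OF vf(3) p vf(4)] by simp
  qed
  have "(\<Sum>w\<in>T. of_rat (u (x w) / u (x v)) * x w) = (\<Sum>w\<in>T. of_rat (u (x w)) * x w) / of_rat (u (x v))"
    by (simp add: sum_divide_distrib of_rat_divide)
  then have "x v + (\<Sum>w\<in>T - {v}. of_rat (u (x w) / u (x v)) * x w) = 0"
    using uv T(1) v(1) by (simp add: sum0 sum.remove[of T v])
  then have "x v = - (\<Sum>w\<in>T - {v}. of_rat (u (x w) / u (x v)) * x w)" by (simp add: eq_neg_iff_add_eq_0)
  then have "v (x v) = v (- (\<Sum>w\<in>T - {v}. of_rat (u (x w) / u (x v)) * x w))" by (rule arg_cong)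
  then have "v (x v) = v (\<Sum>w\<in>T - {v}. of_rat (u (x w) / u (x v)) * x w)" unfolding v.minus .
  also have "\<dots> \<le> 1"
  proof (rule finite_place_sum_le[OF vf(1)])
    fix w assume w: "w \<in> T - {v}"
    then show "v (of_rat (u (x w) / u (x v)) * x w) \<le> 1"
      unfolding v.mult using le[of w] x(2)[of w v] v(1) by (intro mult_le_one) auto
  qed simp
  finally show False using x(1)[OF v(1)] by simp
qed

lemma finite_places_dividing:
  assumes "n > 0"
  shows "finite {v :: 'k::number_field \<Rightarrow> real. v \<in> finite_places \<and> v (of_nat n) < 1}"
proof (rule finite_subset)
  show "{v :: 'k \<Rightarrow> real. v \<in> finite_places \<and> v (of_nat n) < 1} \<subseteq>
      (\<Union>p\<in>prime_factors n. {v. v \<in> finite_places \<and> v (of_nat p) < 1})"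
    using finite_place_prime_factor assms by blast
  show "finite (\<Union>p\<in>prime_factors n. {v :: 'k \<Rightarrow> real. v \<in> finite_places \<and> v (of_nat p) < 1})"
    by (intro finite_UN_I finite_places_above_prime) auto
qed

text \<open>Let \<open>N\<close> be a common denominator of \<open>x\<close> and its inverse. At a
  finite place where \<open>N\<close> is a unit both are integral, so \<open>x\<close> is a unit
  there.\<close>

lemma finite_nonunit_places:
  fixes x :: "'k::number_field"
  assumes "x \<noteq> 0" and "finite (archimedean_places :: ('k \<Rightarrow> real) set)"
  shows "finite {v \<in> places. v x \<noteq> 1}"
proof -
  obtain N where N: "N > 0" "\<forall>y\<in>{x, inverse x}. \<forall>v\<in>finite_places. v (of_nat N * y) \<le> 1"
    using common_integral_multiple[of "{x, inverse x}"] by auto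
  have "{v \<in> places. v x \<noteq> 1} \<subseteq> archimedean_places \<union> {v. v \<in> finite_places \<and> v (of_nat N) < 1}"
  proof
    fix v assume v: "v \<in> {v \<in> places. v x \<noteq> 1}"
    show "v \<in> archimedean_places \<union> {v. v \<in> finite_places \<and> v (of_nat N) < 1}"
    proof (cases "v \<in> archimedean_places")
      case False
      then have vf: "v \<in> finite_places" using v by (auto simp: places_def)
      interpret place_value v using vf by (rule place_value_finite)
      have "v (of_nat N) < 1"
      proof (rule ccontr)
        assume "\<not> v (of_nat N) < 1"
        then have "v (of_nat N) = 1" using finite_place_of_nat_le[OF vf, of N] by linarith
        then have "v x \<le> 1" "inverse (v x) \<le> 1" using N(2) vf by (auto simp: mult inverse)
        moreover have "v x > 0" using assms(1) by simp
        ultimately show False using v unfolding inverse_le_1_iff by simp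
      qed
      then show ?thesis using vf by simp
    qed simp
  qed
  then show ?thesis using finite_subset finite_places_dividing[OF N(1)] assms(2) by blast
qed

section \<open>\<open>S\<close>-integers that dominate at one place\<close>

lemma coprime_part:
  "(n::nat) > 0 \<Longrightarrow> \<exists>a m. n = a * m \<and> coprime m r \<and> (\<forall>p. prime p \<and> p dvd a \<longrightarrow> p dvd r)"
proof (induction n rule: less_induct)
  case (less n)
  show ?case
  proof (cases "coprime n r")
    case True
    then show ?thesis by (intro exI[of _ 1] exI[of _ n]) auto
  next
    case False
    then obtain p where p: "prime p" "p dvd n" "p dvd r"
      using prime_factor_nat[of "gcd n r"] by (auto simp: coprime_iff_gcd_eq_1)
    then obtain n' where n': "n = p * n'" by auto
    have "n' < n" "n' > 0" using n' p less.prems prime_gt_1_nat[of p] by auto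
    then obtain a m where am: "n' = a * m" "coprime m r" "\<forall>p. prime p \<and> p dvd a \<longrightarrow> p dvd r" using less.IH by blast
    have "\<forall>q. prime q \<and> q dvd p * a \<longrightarrow> q dvd r" using am(3) p by (metis prime_dvd_mult_nat primes_dvd_imp_eq)
    then show ?thesis using am n' by (intro exI[of _ "p * a"] exI[of _ m]) auto
  qed
qed

text \<open>A common denominator of the elements given by weak approximation is made prime to the
  residue characteristics of the finite places in \<open>S\<close>. As it is the same for all elements, it does
  not affect the comparison of their values.\<close>
lemma dominant_S_integers:
  fixes S :: "('k::number_field \<Rightarrow> real) set"
  assumes S: "finite S" "S \<subseteq> places" "archimedean_places \<subseteq> S"
  obtains e where "\<And>v. v \<in> S \<Longrightarrow> e v \<in> S_integers S" "\<And>v. v \<in> S \<Longrightarrow> v (e v) > 1"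
    "\<And>v w. v \<in> S \<Longrightarrow> w \<in> S \<Longrightarrow> w \<noteq> v \<Longrightarrow> v (e w) < v (e v)"
proof -
  have "\<exists>p. prime p \<and> v (of_nat p) < 1" if "v \<in> S \<inter> finite_places" for v
    using finite_place_above_prime that by blast
  then obtain pr where pr: "\<And>v. v \<in> S \<inter> finite_places \<Longrightarrow> prime (pr v) \<and> v (of_nat (pr v)) < 1" by metis
  define r where "r = (\<Prod>v\<in>S \<inter> finite_places. pr v)"
  have r0: "r > 0" unfolding r_def using pr by (intro prod_pos) (auto simp: prime_gt_0_nat)
  \<comment> \<open>\<open>T\<close> also contains the places outside \<open>S\<close> that share a
    residue characteristic with a finite place of \<open>S\<close>. The part of the denominator
    belonging to these primes will be dropped, so integrality at these places has to come from
    \<open>x v\<close> being small there.\<close>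
  define T where "T = S \<union> {v \<in> finite_places. v (of_nat r) < 1}"
  have T: "finite T" "T \<subseteq> places" unfolding T_def using S finite_places_dividing[OF r0] by (auto simp: places_def)
  have "\<exists>x. v x > 1 \<and> (\<forall>w\<in>T - {v}. w x < 1)" if "v \<in> S" for v
    using that T S by (intro weak_approximation) auto
  then obtain x where x: "\<And>v. v \<in> S \<Longrightarrow> v (x v) > 1" "\<And>v w. v \<in> S \<Longrightarrow> w \<in> T \<Longrightarrow> w \<noteq> v \<Longrightarrow> w (x v) < 1"
    by (metis DiffI singletonD)
  obtain N0 where N0: "N0 > 0" "\<forall>y\<in>x ` S. \<forall>v\<in>finite_places. v (of_nat N0 * y) \<le> 1"
    using common_integral_multiple[of "x ` S"] S by auto
  \<comment> \<open>\<open>A\<close> carries the primes below the finite places of \<open>S\<close>.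
    Only \<open>N\<close> is kept as denominator: it is a unit at the finite places of
    \<open>S\<close>, and where \<open>r\<close> is a unit \<open>A\<close> is a unit too, so that
    \<open>N\<close> clears the same denominators as \<open>N0\<close>.\<close>
  obtain A N where AN: "N0 = A * N" "coprime N r" "\<forall>p. prime p \<and> p dvd A \<longrightarrow> p dvd r"
    using coprime_part[OF N0(1)] by blast
  have AN0: "A > 0" "N > 0" using AN N0 by auto
  \<comment> \<open>Multiplication by \<open>N\<close> must not destroy
    \<open>v (x v) > 1\<close>.\<close>
  have Nge: "v (of_nat N) \<ge> 1" if v: "v \<in> S" for v
  proof (cases "v \<in> finite_places")
    case True
    then have "pr v dvd r" unfolding r_def using v S by (intro dvd_prodI) auto
    then have "coprime (pr v) N" using AN(2) by (meson coprime_commute coprime_divisors dvd_refl)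
    then show ?thesis using finite_place_coprime[OF True, of "pr v" N] pr[of v] v True by auto
  next
    case False
    then have "v \<in> archimedean_places" using v S by (auto simp: places_def)
    then show ?thesis using archimedean_place_of_nat[of v N] AN0 by auto
  qed
  show ?thesis
  proof (rule that)
    fix v assume v: "v \<in> S"
    interpret v: place_value v using v S by (intro place_value_places) auto
    show "of_nat N * x v \<in> S_integers S"
      unfolding S_integers_def
    proof safe
      fix w assume w: "w \<in> places" "w \<notin> S"
      then have wf: "w \<in> finite_places" using S by (auto simp: places_def)
      interpret w: place_value w using wf by (rule place_value_finite)
      show "w (of_nat N * x v) \<le> 1"
      proof (cases "w (of_nat r) < 1")
        case True
        then have "w (x v) < 1" using x(2)[OF v, of w] w v wf unfolding T_def by auto
        then show ?thesis using finite_place_of_nat_le[OF wf, of N] unfolding w.mult by (intro mult_le_one) auto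
      next
        case False
        have "w (of_nat A) = 1"
        proof (rule ccontr)
          assume "w (of_nat A) \<noteq> 1"
          then have "w (of_nat A) < 1" using finite_place_of_nat_le[OF wf, of A] by auto
          then obtain p where p: "p \<in> prime_factors A" "w (of_nat p) < 1" using finite_place_prime_factor[OF wf _ AN0(1)] by blast
          then have "p dvd r" using AN(3) by (auto simp: prime_factors_dvd)
          then obtain k where "r = p * k" by auto
          then have "w (of_nat r) < 1" using p(2) finite_place_of_nat_le[OF wf, of k] mult_right_le_one_le[of "w (of_nat p)" "w (of_nat k)"]
            by (simp add: w.mult)
          then show False using False by simp
        qed
        moreover have "w (of_nat N0 * x v) \<le> 1" using N0 v wf by auto
        ultimately show ?thesis unfolding AN(1) by (simp add: w.mult)
      qed
    qed
    show "v (of_nat N * x v) > 1"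
      using Nge[OF v] x(1)[OF v] mult_right_mono[of 1 "v (of_nat N)" "v (x v)"] by (simp add: v.mult)
    fix w assume w: "w \<in> S" "w \<noteq> v"
    have "v (x w) < v (x v)" using x(1)[OF v] x(2)[OF w(1), of v] v w unfolding T_def by auto
    then show "v (of_nat N * x w) < v (of_nat N * x v)" using AN0 unfolding v.mult by simp
  qed
qed

lemma S_integers_mult:
  assumes "x \<in> S_integers S" "y \<in> S_integers S" shows "x * y \<in> S_integers S"
  unfolding S_integers_def
proof safe
  fix v assume v: "v \<in> places" "v \<notin> S"
  interpret place_value v using v by (intro place_value_places)
  show "v (x * y) \<le> 1" using assms v unfolding mult by (intro mult_le_one) (auto simp: S_integers_def)
qed

lemma S_integers_power:
  assumes "x \<in> S_integers S" shows "x ^ n \<in> S_integers S"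
  unfolding S_integers_def
proof safe
  fix v assume v: "v \<in> places" "v \<notin> S"
  interpret place_value v using v by (intro place_value_places)
  show "v (x ^ n) \<le> 1" using assms v unfolding power by (intro power_le_one) (auto simp: S_integers_def)
qed

lemma S_integral_multiple:
  fixes Q :: "'k::number_field set"
  assumes "finite Q" "archimedean_places \<subseteq> S"
  obtains D where "D > 0" "\<And>x. x \<in> Q \<Longrightarrow> of_nat D * x \<in> S_integers S"
  using common_integral_multiple[OF assms(1)] assms(2) by (auto simp: S_integers_def places_def)

section \<open>Evaluation of polynomials\<close>

lemma mpoly_ring_simps [simp]:
  "mult (mpoly_ring N) = (*)" "one (mpoly_ring N) = 1" "zero (mpoly_ring N) = 0" "add (mpoly_ring N) = (+)"
  by (simp_all add: mpoly_ring_def ring_of_type_algebra_def)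

lemma carrier_mpoly_ring:
  "p \<in> carrier (mpoly_ring N) \<longleftrightarrow> (\<forall>t\<in>Poly_Mapping.keys p. Poly_Mapping.keys t \<subseteq> {..N})"
  by (simp add: mpoly_ring_def)

section \<open>Degrees and homogeneous components\<close>

lemma monomial_degree_eq_sum:
  "finite A \<Longrightarrow> Poly_Mapping.keys t \<subseteq> A \<Longrightarrow> monomial_degree t = (\<Sum>j\<in>A. Poly_Mapping.lookup t j)"
  unfolding monomial_degree_def by (intro sum.mono_neutral_left) (auto simp: Poly_Mapping.in_keys_iff)

lemma monomial_degree_add: "monomial_degree (s + t) = monomial_degree s + monomial_degree t"
proof -
  let ?A = "Poly_Mapping.keys s \<union> Poly_Mapping.keys t"
  have "Poly_Mapping.keys (s + t) \<subseteq> ?A" by (rule Poly_Mapping.keys_add)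
  then show ?thesis by (simp add: monomial_degree_eq_sum[of ?A] lookup_add sum.distrib)
qed

lemma monomial_degree_0 [simp]: "monomial_degree 0 = 0"
  by (simp add: monomial_degree_def)

lemma lookup_homogeneous_component:
  "Poly_Mapping.lookup (homogeneous_component m p) t = (if monomial_degree t = m then Poly_Mapping.lookup p t else 0)"
proof -
  let ?K = "{t \<in> Poly_Mapping.keys p. monomial_degree t = m}"
  have "Poly_Mapping.lookup (homogeneous_component m p) t = (\<Sum>s\<in>?K. if s = t then Poly_Mapping.lookup p t else 0)"
    unfolding homogeneous_component_def lookup_sum
    by (intro sum.cong) (auto simp: lookup_single when_def)
  then show ?thesis by (auto simp: Poly_Mapping.in_keys_iff)
qed

lemma homogeneous_component_add: "homogeneous_component m (p + q) = homogeneous_component m p + homogeneous_component m q"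
  by (rule poly_mapping_eqI) (simp add: lookup_homogeneous_component lookup_add)

lemma homogeneous_component_0 [simp]: "homogeneous_component m 0 = 0"
  by (rule poly_mapping_eqI) (simp add: lookup_homogeneous_component)

lemma homogeneous_component_sum:
  "homogeneous_component m (sum f A) = (\<Sum>a\<in>A. homogeneous_component m (f a))"
  by (induction A rule: infinite_finite_induct) (simp_all add: homogeneous_component_add)

lemma homogeneous_component_single:
  "homogeneous_component m (Poly_Mapping.single t a) = (if monomial_degree t = m then Poly_Mapping.single t a else 0)"
  by (rule poly_mapping_eqI) (auto simp: lookup_homogeneous_component lookup_single when_def)

lemma homogeneous_iff_lookup:
  "homogeneous m p \<longleftrightarrow> (\<forall>t. Poly_Mapping.lookup p t \<noteq> 0 \<longrightarrow> monomial_degree t = m)"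
  by (auto simp: homogeneous_def Poly_Mapping.in_keys_iff)

lemma homogeneous_homogeneous_component: "homogeneous m (homogeneous_component m p)"
  by (auto simp: homogeneous_iff_lookup lookup_homogeneous_component)

lemma homogeneous_component_of_homogeneous:
  "homogeneous m p \<Longrightarrow> homogeneous_component k p = (if k = m then p else 0)"
  by (rule poly_mapping_eqI) (auto simp: homogeneous_iff_lookup lookup_homogeneous_component)

lemma poly_mapping_sum_singles:
  "p = (\<Sum>t\<in>Poly_Mapping.keys p. Poly_Mapping.single t (Poly_Mapping.lookup p t))"
proof (rule poly_mapping_eqI)
  fix k
  have "(\<Sum>t\<in>Poly_Mapping.keys p. Poly_Mapping.lookup (Poly_Mapping.single t (Poly_Mapping.lookup p t)) k)
    = (\<Sum>t\<in>Poly_Mapping.keys p. if t = k then Poly_Mapping.lookup p k else 0)"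
    by (intro sum.cong) (auto simp: lookup_single when_def)
  then show "Poly_Mapping.lookup p k = Poly_Mapping.lookup (\<Sum>t\<in>Poly_Mapping.keys p. Poly_Mapping.single t (Poly_Mapping.lookup p t)) k"
    by (auto simp: lookup_sum Poly_Mapping.in_keys_iff)
qed

lemma mult_sum_singles:
  fixes p q :: "('a::monoid_add \<Rightarrow>\<^sub>0 'b::semiring_0)"
  shows "p * q = (\<Sum>s\<in>Poly_Mapping.keys p. \<Sum>t\<in>Poly_Mapping.keys q.
     Poly_Mapping.single (s + t) (Poly_Mapping.lookup p s * Poly_Mapping.lookup q t))"
proof -
  have "p * q = (\<Sum>t\<in>Poly_Mapping.keys p. Poly_Mapping.single t (Poly_Mapping.lookup p t)) *
     (\<Sum>t\<in>Poly_Mapping.keys q. Poly_Mapping.single t (Poly_Mapping.lookup q t))"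
    by (simp flip: poly_mapping_sum_singles)
  then show ?thesis by (simp add: sum_product mult_single)
qed

text \<open>Products of terms are sorted by the degree of the first factor, which determines that of
  the second.\<close>

lemma homogeneous_component_mult:
  "homogeneous_component m (p * q) = (\<Sum>i\<le>m. homogeneous_component i p * homogeneous_component (m - i) q)"
proof -
  let ?s = "\<lambda>s t. Poly_Mapping.single (s + t) (Poly_Mapping.lookup p s * Poly_Mapping.lookup q t)"
  let ?kp = "Poly_Mapping.keys p" and ?kq = "Poly_Mapping.keys q"
  have hc: "homogeneous_component i r = (\<Sum>s\<in>Poly_Mapping.keys r. if monomial_degree s = i then Poly_Mapping.single s (Poly_Mapping.lookup r s) else 0)"
    for i and r :: "'a mpoly"
    by (subst poly_mapping_sum_singles[of r]) (simp only: homogeneous_component_sum homogeneous_component_single)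
  have "homogeneous_component m (p * q) = (\<Sum>s\<in>?kp. \<Sum>t\<in>?kq. if monomial_degree s + monomial_degree t = m then ?s s t else 0)"
    by (subst mult_sum_singles) (simp only: homogeneous_component_sum homogeneous_component_single monomial_degree_add)
  also have "\<dots> = (\<Sum>s\<in>?kp. \<Sum>t\<in>?kq. \<Sum>i\<le>m. if monomial_degree s = i \<and> monomial_degree t = m - i then ?s s t else 0)"
  proof (intro sum.cong refl)
    fix s t
    have "(\<Sum>i\<le>m. if monomial_degree s = i \<and> monomial_degree t = m - i then ?s s t else 0) =
       (\<Sum>i\<le>m. if monomial_degree s = i then (if monomial_degree t = m - monomial_degree s then ?s s t else 0) else 0)"
      by (intro sum.cong) auto
    then show "(if monomial_degree s + monomial_degree t = m then ?s s t else 0) =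
      (\<Sum>i\<le>m. if monomial_degree s = i \<and> monomial_degree t = m - i then ?s s t else 0)"
      by auto
  qed
  also have "\<dots> = (\<Sum>s\<in>?kp. \<Sum>i\<le>m. \<Sum>t\<in>?kq. if monomial_degree s = i \<and> monomial_degree t = m - i then ?s s t else 0)"
    by (intro sum.cong refl sum.swap)
  also have "\<dots> = (\<Sum>i\<le>m. \<Sum>s\<in>?kp. \<Sum>t\<in>?kq. if monomial_degree s = i \<and> monomial_degree t = m - i then ?s s t else 0)"
    by (rule sum.swap)
  also have "\<dots> = (\<Sum>i\<le>m. homogeneous_component i p * homogeneous_component (m - i) q)"
    unfolding hc sum_product by (intro sum.cong refl) (auto simp: mult_single)
  finally show ?thesis .
qed

lemma sum_homogeneous_components:
  "p = (\<Sum>m\<in>monomial_degree ` Poly_Mapping.keys p. homogeneous_component m p)"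
proof (rule poly_mapping_eqI)
  fix t
  have "(\<Sum>m\<in>monomial_degree ` Poly_Mapping.keys p. if monomial_degree t = m then Poly_Mapping.lookup p t else 0) = Poly_Mapping.lookup p t"
    by (auto simp: Poly_Mapping.in_keys_iff image_iff)
  then show "Poly_Mapping.lookup p t = Poly_Mapping.lookup (\<Sum>m\<in>monomial_degree ` Poly_Mapping.keys p. homogeneous_component m p) t"
    by (simp add: lookup_sum lookup_homogeneous_component)
qed

lemma homogeneous_mult:
  assumes "homogeneous m p" "homogeneous k q" shows "homogeneous (m + k) (p * q)"
proof -
  have "monomial_degree u = m + k" if "u \<in> Poly_Mapping.keys (p * q)" for u
  proof -
    obtain s t where "u = s + t" "s \<in> Poly_Mapping.keys p" "t \<in> Poly_Mapping.keys q"
      using \<open>u \<in> _\<close> Poly_Mapping.keys_mult[of p q] by blast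
    then show ?thesis using assms by (auto simp: homogeneous_def monomial_degree_add)
  qed
  then show ?thesis by (auto simp: homogeneous_def)
qed

lemma homogeneous_add: "homogeneous m p \<Longrightarrow> homogeneous m q \<Longrightarrow> homogeneous m (p + q)"
  by (auto simp: homogeneous_iff_lookup lookup_add) (metis add.right_neutral)

lemma homogeneous_uminus: "homogeneous m p \<Longrightarrow> homogeneous m (- p)"
  by (auto simp: homogeneous_iff_lookup)

lemma homogeneous_0 [simp]: "homogeneous m 0"
  by (simp add: homogeneous_def)

lemma homogeneous_1 [simp]: "homogeneous 0 1"
  by (simp add: homogeneous_def)

lemma homogeneous_const [simp]: "homogeneous 0 (mpoly_const a)"
  by (auto simp: homogeneous_def mpoly_const_def)

lemma homogeneous_prod:
  "finite A \<Longrightarrow> (\<And>a. a \<in> A \<Longrightarrow> homogeneous (m a) (f a)) \<Longrightarrow> homogeneous (sum m A) (prod f A)"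
  by (induction A rule: finite_induct) (auto intro: homogeneous_mult)

context
  fixes N :: nat and p q :: "'k::field mpoly"
  assumes p: "p \<in> carrier (mpoly_ring N)"
begin

lemma mpoly_carrier_homogeneous_component: "homogeneous_component m p \<in> carrier (mpoly_ring N)"
  using p by (auto simp: carrier_mpoly_ring Poly_Mapping.in_keys_iff lookup_homogeneous_component split: if_splits)

lemma mpoly_carrier_uminus: "- p \<in> carrier (mpoly_ring N)"
  using p by (auto simp: carrier_mpoly_ring Poly_Mapping.in_keys_iff)

lemma mpoly_carrier_add:
  "q \<in> carrier (mpoly_ring N) \<Longrightarrow> p + q \<in> carrier (mpoly_ring N)"
  using p Poly_Mapping.keys_add[of p q] by (auto simp: carrier_mpoly_ring)

lemma mpoly_carrier_mult:
  assumes q: "q \<in> carrier (mpoly_ring N)"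
  shows "p * q \<in> carrier (mpoly_ring N)"
  unfolding carrier_mpoly_ring
proof
  fix u assume "u \<in> Poly_Mapping.keys (p * q)"
  then obtain s t where st: "u = s + t" "s \<in> Poly_Mapping.keys p" "t \<in> Poly_Mapping.keys q"
    using Poly_Mapping.keys_mult[of p q] by blast
  have "Poly_Mapping.keys u \<subseteq> Poly_Mapping.keys s \<union> Poly_Mapping.keys t" unfolding st by (rule Poly_Mapping.keys_add)
  then show "Poly_Mapping.keys u \<subseteq> {..N}" using st p q by (auto simp: carrier_mpoly_ring)
qed

end

lemma mpoly_carrier_diff:
  "p \<in> carrier (mpoly_ring N) \<Longrightarrow> q \<in> carrier (mpoly_ring N) \<Longrightarrow> p - q \<in> carrier (mpoly_ring N)"
  unfolding diff_conv_add_uminus by (intro mpoly_carrier_add mpoly_carrier_uminus)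

lemma mpoly_carrier_const:
  "0 \<in> carrier (mpoly_ring N)" "1 \<in> carrier (mpoly_ring N)" "mpoly_const a \<in> carrier (mpoly_ring N)"
  "j \<le> N \<Longrightarrow> mpoly_var j \<in> carrier (mpoly_ring N)"
  by (auto simp: carrier_mpoly_ring mpoly_const_def mpoly_var_def)

lemmas mpoly_carrier_closed = mpoly_carrier_const mpoly_carrier_homogeneous_component
  mpoly_carrier_uminus mpoly_carrier_add mpoly_carrier_mult mpoly_carrier_diff

lemma mpoly_carrier_prod:
  "(\<And>a. a \<in> A \<Longrightarrow> f a \<in> carrier (mpoly_ring N)) \<Longrightarrow> prod f A \<in> carrier (mpoly_ring N)"
  by (induction A rule: infinite_finite_induct) (auto intro: mpoly_carrier_closed)

lemma mpoly_carrier_sum: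
  "(\<And>a. a \<in> A \<Longrightarrow> f a \<in> carrier (mpoly_ring N)) \<Longrightarrow> sum f A \<in> carrier (mpoly_ring N)"
  by (induction A rule: infinite_finite_induct) (auto intro: mpoly_carrier_closed)

text \<open>One calculus of evaluation for three targets: the number field itself for rational
  points, a completion for local points, and the function field for the relations between sections
  that cut out the image.\<close>

locale algebra_over = cring R for R :: "'r ring" (structure) +
  fixes \<iota> :: "'k::field \<Rightarrow> 'r"
  assumes coeff_closed [simp, intro]: "\<iota> a \<in> carrier R"
    and coeff_add: "\<iota> (a + b) = \<iota> a \<oplus> \<iota> b"
    and coeff_mult: "\<iota> (a * b) = \<iota> a \<otimes> \<iota> b"
    and coeff_one [simp]: "\<iota> 1 = \<one>"
begin

lemma coeff_zero [simp]: "\<iota> 0 = \<zero>"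
proof -
  have "\<iota> 0 \<oplus> \<iota> 0 = \<iota> 0 \<oplus> \<zero>" using coeff_add[of 0 0] by simp
  then show ?thesis using add.l_cancel[of "\<iota> 0" "\<iota> 0" \<zero>] by simp
qed

definition monomial_value :: "(nat \<Rightarrow> 'r) \<Rightarrow> (nat \<Rightarrow>\<^sub>0 nat) \<Rightarrow> 'r" where
  "monomial_value x t = (\<Otimes>j\<in>Poly_Mapping.keys t. x j [^] Poly_Mapping.lookup t j)"

text \<open>Trivial factors extend the product to a fixed range of variables, so that products of
  monomials can be compared factor by factor.\<close>

lemma monomial_value_eq:
  assumes "\<forall>j\<le>N. x j \<in> carrier R" "Poly_Mapping.keys t \<subseteq> {..N}"
  shows "monomial_value x t = (\<Otimes>j\<in>{..N}. x j [^] Poly_Mapping.lookup t j)"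
  unfolding monomial_value_def using assms
  by (intro finprod_mono_neutral_cong_left) (auto simp: Poly_Mapping.in_keys_iff)

lemma monomial_value_closed:
  assumes "\<forall>j\<le>N. x j \<in> carrier R" "Poly_Mapping.keys t \<subseteq> {..N}"
  shows "monomial_value x t \<in> carrier R"
  unfolding monomial_value_eq[OF assms] using assms by (intro finprod_closed) auto

lemma monomial_value_add:
  assumes "\<forall>j\<le>N. x j \<in> carrier R" "Poly_Mapping.keys s \<subseteq> {..N}" "Poly_Mapping.keys t \<subseteq> {..N}"
  shows "monomial_value x (s + t) = monomial_value x s \<otimes> monomial_value x t"
proof -
  have st: "Poly_Mapping.keys (s + t) \<subseteq> {..N}" using Poly_Mapping.keys_add[of s t] assms by blast
  have "monomial_value x (s + t) = (\<Otimes>j\<in>{..N}. (x j [^] Poly_Mapping.lookup s j) \<otimes> (x j [^] Poly_Mapping.lookup t j))"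
    unfolding monomial_value_eq[OF assms(1) st] using assms
    by (intro finprod_cong') (auto simp: lookup_add nat_pow_mult)
  also have "\<dots> = monomial_value x s \<otimes> monomial_value x t"
    unfolding monomial_value_eq[OF assms(1,2)] monomial_value_eq[OF assms(1,3)] using assms
    by (intro finprod_multf) auto
  finally show ?thesis .
qed

lemma monomial_value_0 [simp]: "monomial_value x 0 = \<one>"
  by (simp add: monomial_value_def)

lemma monomial_value_scale:
  assumes x: "\<forall>j\<le>N. x j \<in> carrier R" and t: "Poly_Mapping.keys t \<subseteq> {..N}" and c: "c \<in> carrier R"
    and y: "\<forall>j\<le>N. y j = c \<otimes> x j"
  shows "monomial_value y t = c [^] monomial_degree t \<otimes> monomial_value x t"
proof -
  have y': "\<forall>j\<le>N. y j \<in> carrier R" using x y c by simp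
  have "monomial_value y t = (\<Otimes>j\<in>{..N}. (c [^] Poly_Mapping.lookup t j) \<otimes> (x j [^] Poly_Mapping.lookup t j))"
    unfolding monomial_value_eq[OF y' t] using x y c
    by (intro finprod_cong') (auto simp: nat_pow_distrib)
  also have "\<dots> = (\<Otimes>j\<in>{..N}. c [^] Poly_Mapping.lookup t j) \<otimes> monomial_value x t"
    unfolding monomial_value_eq[OF x t] using x c by (intro finprod_multf) auto
  also have "(\<Otimes>j\<in>A. c [^] Poly_Mapping.lookup t j) = c [^] (\<Sum>j\<in>A. Poly_Mapping.lookup t j)" if "finite A" for A
    using that by induction (use c in \<open>auto simp: nat_pow_mult\<close>)
  then have "(\<Otimes>j\<in>{..N}. c [^] Poly_Mapping.lookup t j) = c [^] monomial_degree t"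
    using t by (simp add: monomial_degree_eq_sum[of "{..N}"])
  finally show ?thesis .
qed

abbreviation ev :: "(nat \<Rightarrow> 'r) \<Rightarrow> 'k mpoly \<Rightarrow> 'r" where
  "ev \<equiv> mpoly_eval R \<iota>"

lemma eval_eq:
  "ev x p = (\<Oplus>t\<in>Poly_Mapping.keys p. \<iota> (Poly_Mapping.lookup p t) \<otimes> monomial_value x t)"
  by (simp add: mpoly_eval_def monomial_value_def)

context
  fixes N :: nat and x :: "nat \<Rightarrow> 'r"
  assumes x: "\<forall>j\<le>N. x j \<in> carrier R"
begin

lemma eval_superset:
  assumes "finite T" "Poly_Mapping.keys p \<subseteq> T" "\<forall>t\<in>T. Poly_Mapping.keys t \<subseteq> {..N}"
  shows "ev x p = (\<Oplus>t\<in>T. \<iota> (Poly_Mapping.lookup p t) \<otimes> monomial_value x t)"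
  unfolding eval_eq using assms monomial_value_closed[OF x]
  by (intro add.finprod_mono_neutral_cong_left) (auto simp: Poly_Mapping.in_keys_iff Pi_iff)

lemma eval_closed: "p \<in> carrier (mpoly_ring N) \<Longrightarrow> ev x p \<in> carrier R"
  unfolding eval_eq using monomial_value_closed[OF x]
  by (intro finsum_closed) (auto simp: carrier_mpoly_ring)

lemma eval_add:
  assumes "p \<in> carrier (mpoly_ring N)" "q \<in> carrier (mpoly_ring N)"
  shows "ev x (p + q) = ev x p \<oplus> ev x q"
proof -
  let ?T = "Poly_Mapping.keys p \<union> Poly_Mapping.keys q"
  have T: "finite ?T" "\<forall>t\<in>?T. Poly_Mapping.keys t \<subseteq> {..N}" using assms by (auto simp: carrier_mpoly_ring)
  have m: "monomial_value x t \<in> carrier R" if "t \<in> ?T" for t using monomial_value_closed[OF x] T that by blast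
  have "ev x (p + q) = (\<Oplus>t\<in>?T. \<iota> (Poly_Mapping.lookup p t) \<otimes> monomial_value x t \<oplus> \<iota> (Poly_Mapping.lookup q t) \<otimes> monomial_value x t)"
  proof (subst eval_superset[OF T(1) Poly_Mapping.keys_add T(2)], intro finsum_cong' refl)
    fix t assume "t \<in> ?T"
    from m[OF this] show "\<iota> (Poly_Mapping.lookup (p + q) t) \<otimes> monomial_value x t =
        \<iota> (Poly_Mapping.lookup p t) \<otimes> monomial_value x t \<oplus> \<iota> (Poly_Mapping.lookup q t) \<otimes> monomial_value x t"
      by (simp add: lookup_add coeff_add l_distr)
  qed (use m in blast)
  also have "\<dots> = ev x p \<oplus> ev x q"
    using m by (subst (1 2) eval_superset[OF T(1) _ T(2)]) (auto intro!: finsum_addf)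
  finally show ?thesis .
qed

lemma eval_0 [simp]: "ev x 0 = \<zero>"
  by (simp add: eval_eq)

lemma eval_sum:
  assumes "\<And>a. a \<in> A \<Longrightarrow> f a \<in> carrier (mpoly_ring N)" "finite A"
  shows "ev x (sum f A) = (\<Oplus>a\<in>A. ev x (f a))"
  using assms(2,1)
proof (induction A)
  case (insert a A)
  then show ?case by (simp add: eval_add mpoly_carrier_sum eval_closed Pi_iff)
qed simp

lemma eval_single:
  "Poly_Mapping.keys t \<subseteq> {..N} \<Longrightarrow> ev x (Poly_Mapping.single t a) = \<iota> a \<otimes> monomial_value x t"
  by (subst eval_superset[of "{t}"]) (auto simp: monomial_value_closed[OF x])

lemma single_closed: "Poly_Mapping.keys t \<subseteq> {..N} \<Longrightarrow> Poly_Mapping.single t a \<in> carrier (mpoly_ring N)"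
  by (simp add: carrier_mpoly_ring)

lemma eval_mult:
  assumes p: "p \<in> carrier (mpoly_ring N)" and q: "q \<in> carrier (mpoly_ring N)"
  shows "ev x (p * q) = ev x p \<otimes> ev x q"
proof -
  let ?kp = "Poly_Mapping.keys p" and ?kq = "Poly_Mapping.keys q"
  have k: "Poly_Mapping.keys s \<subseteq> {..N}" if "s \<in> ?kp \<or> s \<in> ?kq" for s using that p q by (auto simp: carrier_mpoly_ring)
  have kst: "Poly_Mapping.keys (s + t) \<subseteq> {..N}" if "s \<in> ?kp" "t \<in> ?kq" for s t
    using Poly_Mapping.keys_add[of s t] k that by blast
  have mc: "monomial_value x s \<in> carrier R" if "s \<in> ?kp \<or> s \<in> ?kq" for s
    using k[OF that] by (rule monomial_value_closed[OF x])
  let ?a = "\<lambda>s. \<iota> (Poly_Mapping.lookup p s) \<otimes> monomial_value x s" and ?b = "\<lambda>s. \<iota> (Poly_Mapping.lookup q s) \<otimes> monomial_value x s"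
  have ac: "?a \<in> ?kp \<rightarrow> carrier R" "?b \<in> ?kq \<rightarrow> carrier R" using mc by auto
  have "ev x (p * q) = (\<Oplus>s\<in>?kp. \<Oplus>t\<in>?kq. ev x (Poly_Mapping.single (s + t) (Poly_Mapping.lookup p s * Poly_Mapping.lookup q t)))"
  proof (subst mult_sum_singles, subst eval_sum)
    show "(\<Sum>t\<in>?kq. Poly_Mapping.single (s + t) (Poly_Mapping.lookup p s * Poly_Mapping.lookup q t)) \<in> carrier (mpoly_ring N)"
      if "s \<in> ?kp" for s
      using that by (intro mpoly_carrier_sum single_closed kst)
    show "(\<Oplus>s\<in>?kp. ev x (\<Sum>t\<in>?kq. Poly_Mapping.single (s + t) (Poly_Mapping.lookup p s * Poly_Mapping.lookup q t))) =
       (\<Oplus>s\<in>?kp. \<Oplus>t\<in>?kq. ev x (Poly_Mapping.single (s + t) (Poly_Mapping.lookup p s * Poly_Mapping.lookup q t)))"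
      using kst by (intro finsum_cong' refl eval_sum finsum_closed single_closed) (auto intro!: finsum_closed eval_closed single_closed)
  qed simp
  also have "\<dots> = (\<Oplus>s\<in>?kp. \<Oplus>t\<in>?kq. ?a s \<otimes> ?b t)"
  proof (intro finsum_cong' refl)
    fix s t assume st: "s \<in> ?kp" "t \<in> ?kq"
    show "ev x (Poly_Mapping.single (s + t) (Poly_Mapping.lookup p s * Poly_Mapping.lookup q t)) = ?a s \<otimes> ?b t"
      using st k by (simp add: eval_single[OF kst[OF st]] coeff_mult monomial_value_add[OF x] m_ac mc)
  qed (use ac in \<open>auto intro!: finsum_closed\<close>)
  also have "\<dots> = (\<Oplus>s\<in>?kp. ?a s \<otimes> (\<Oplus>t\<in>?kq. ?b t))"
    using ac by (intro finsum_cong' refl finsum_rdistr[symmetric]) (auto intro!: finsum_closed)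
  also have "\<dots> = (\<Oplus>s\<in>?kp. ?a s) \<otimes> (\<Oplus>t\<in>?kq. ?b t)"
    using ac by (intro finsum_ldistr[symmetric]) (auto intro!: finsum_closed)
  finally show ?thesis by (simp add: eval_eq)
qed

lemma eval_const [simp]: "ev x (mpoly_const a) = \<iota> a"
  unfolding mpoly_const_def by (subst eval_single) auto

lemma eval_1 [simp]: "ev x 1 = \<one>"
  using eval_const[of 1] by (simp add: mpoly_const_def)

lemma eval_uminus:
  assumes "p \<in> carrier (mpoly_ring N)" shows "ev x (- p) = \<ominus> ev x p"
proof -
  have "ev x (- p) \<oplus> ev x p = \<zero>" using assms eval_add[of "- p" p] by (simp add: mpoly_carrier_closed)
  then show ?thesis using assms by (intro minus_equality[symmetric]) (auto intro: eval_closed mpoly_carrier_closed)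
qed

lemma eval_diff:
  assumes "p \<in> carrier (mpoly_ring N)" "q \<in> carrier (mpoly_ring N)"
  shows "ev x (p - q) = ev x p \<ominus> ev x q"
  using eval_add[of p "- q"] assms by (simp add: eval_uminus mpoly_carrier_closed minus_eq)

lemma eval_var: "j \<le> N \<Longrightarrow> ev x (mpoly_var j) = x j"
  unfolding mpoly_var_def using x by (subst eval_single) (auto simp: monomial_value_def)

lemma eval_prod:
  assumes "\<And>a. a \<in> A \<Longrightarrow> f a \<in> carrier (mpoly_ring N)" "finite A"
  shows "ev x (prod f A) = (\<Otimes>a\<in>A. ev x (f a))"
  using assms(2,1)
proof (induction A)
  case (insert a A)
  then show ?case by (simp add: eval_mult mpoly_carrier_prod eval_closed Pi_iff)
qed simp

lemma eval_scale:
  assumes p: "p \<in> carrier (mpoly_ring N)" "homogeneous m p" and c: "c \<in> carrier R"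
    and y: "\<forall>j\<le>N. y j = c \<otimes> x j"
  shows "ev y p = c [^] m \<otimes> ev x p"
proof -
  have k: "Poly_Mapping.keys t \<subseteq> {..N}" if "t \<in> Poly_Mapping.keys p" for t using that p by (auto simp: carrier_mpoly_ring)
  have mc: "monomial_value x t \<in> carrier R" if "t \<in> Poly_Mapping.keys p" for t
    using k[OF that] by (rule monomial_value_closed[OF x])
  have "ev y p = (\<Oplus>t\<in>Poly_Mapping.keys p. c [^] m \<otimes> (\<iota> (Poly_Mapping.lookup p t) \<otimes> monomial_value x t))"
    unfolding eval_eq
  proof (intro finsum_cong' refl)
    fix t assume t: "t \<in> Poly_Mapping.keys p"
    then have "monomial_degree t = m" using p by (auto simp: homogeneous_def)
    then show "\<iota> (Poly_Mapping.lookup p t) \<otimes> monomial_value y t = c [^] m \<otimes> (\<iota> (Poly_Mapping.lookup p t) \<otimes> monomial_value x t)"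
      using monomial_value_scale[OF x k[OF t] c y] mc[OF t] c by (simp add: m_ac)
  qed (use mc c in auto)
  also have "\<dots> = c [^] m \<otimes> ev x p"
    unfolding eval_eq using mc c by (intro finsum_rdistr[symmetric]) auto
  finally show ?thesis .
qed

lemma eval_homogeneous_component_mult:
  assumes "p \<in> carrier (mpoly_ring N)" "q \<in> carrier (mpoly_ring N)"
  shows "ev x (homogeneous_component m (p * q)) =
     (\<Oplus>i\<in>{..m}. ev x (homogeneous_component i p) \<otimes> ev x (homogeneous_component (m - i) q))"
  unfolding homogeneous_component_mult using assms
  by (subst eval_sum) (auto intro!: mpoly_carrier_closed simp: eval_mult mpoly_carrier_closed)

lemma eval_eq_zero_of_components:
  assumes "p \<in> carrier (mpoly_ring N)" "\<And>m. ev x (homogeneous_component m p) = \<zero>"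
  shows "ev x p = \<zero>"
  by (subst sum_homogeneous_components, subst eval_sum)
    (use assms in \<open>auto intro: mpoly_carrier_closed\<close>)

end

end

text \<open>Evaluation commutes with every relation that is compatible with the ring operations, in
  particular with the one between functions that are regular at a point and their values.\<close>
lemma mpoly_eval_related:
  assumes "algebra_over R \<iota>" "algebra_over R' \<iota>'"
    and rel_closed: "\<And>x y. rel x y \<Longrightarrow> x \<in> carrier R \<and> y \<in> carrier R'"
    and rel_coeff: "\<And>a. rel (\<iota> a) (\<iota>' a)"
    and rel_add: "\<And>x y x' y'. rel x y \<Longrightarrow> rel x' y' \<Longrightarrow> rel (x \<oplus>\<^bsub>R\<^esub> x') (y \<oplus>\<^bsub>R'\<^esub> y')"
    and rel_mult: "\<And>x y x' y'. rel x y \<Longrightarrow> rel x' y' \<Longrightarrow> rel (x \<otimes>\<^bsub>R\<^esub> x') (y \<otimes>\<^bsub>R'\<^esub> y')"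
    and p: "p \<in> carrier (mpoly_ring N)" and xy: "\<And>j. j \<le> N \<Longrightarrow> rel (x j) (y j)"
  shows "rel (mpoly_eval R \<iota> x p) (mpoly_eval R' \<iota>' y p)"
proof -
  interpret A: algebra_over R \<iota> by fact
  interpret B: algebra_over R' \<iota>' by fact
  have zero: "rel \<zero>\<^bsub>R\<^esub> \<zero>\<^bsub>R'\<^esub>" using rel_coeff[of 0] by simp
  have one: "rel \<one>\<^bsub>R\<^esub> \<one>\<^bsub>R'\<^esub>" using rel_coeff[of 1] by simp
  have sum: "rel (\<Oplus>\<^bsub>R\<^esub>t\<in>T. f t) (\<Oplus>\<^bsub>R'\<^esub>t\<in>T. g t)" if "finite T" "\<And>t. t \<in> T \<Longrightarrow> rel (f t) (g t)"
    for T :: "(nat \<Rightarrow>\<^sub>0 nat) set" and f g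
    using that
  proof (induction T)
    case (insert t T)
    have "f \<in> insert t T \<rightarrow> carrier R" "g \<in> insert t T \<rightarrow> carrier R'" using insert.prems rel_closed by blast+
    then show ?case using insert by (auto intro!: rel_add)
  qed (use zero in simp)
  have prod: "rel (\<Otimes>\<^bsub>R\<^esub>t\<in>T. f t) (\<Otimes>\<^bsub>R'\<^esub>t\<in>T. g t)" if "finite T" "\<And>t. t \<in> T \<Longrightarrow> rel (f t) (g t)"
    for T :: "nat set" and f g
    using that
  proof (induction T)
    case (insert t T)
    have "f \<in> insert t T \<rightarrow> carrier R" "g \<in> insert t T \<rightarrow> carrier R'" using insert.prems rel_closed by blast+
    then show ?case using insert by (auto intro!: rel_mult)
  qed (use one in simp)
  have pow: "rel (u [^]\<^bsub>R\<^esub> k) (w [^]\<^bsub>R'\<^esub> k)" if "rel u w" for u w and k :: nat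
    by (induction k) (use that one in \<open>auto intro: rel_mult\<close>)
  show ?thesis unfolding mpoly_eval_def
    using p xy by (intro sum rel_mult rel_coeff prod pow) (auto simp: carrier_mpoly_ring)
qed

section \<open>The function field and its values at points\<close>

text \<open>Members of \<open>nonzero_vectors\<close> are extensional, so scaling by one reproduces
  them as functions on all indices.\<close>

lemma nonzero_vector_in_class:
  fixes R :: "'r ring" (structure)
  assumes "field R" "x \<in> nonzero_vectors R n" shows "x \<in> projective_class R n x"
proof -
  interpret field R by fact
  have "x = (\<lambda>j\<in>{..n}. \<one> \<otimes> x j)"
    using assms(2) by (auto simp: nonzero_vectors_def fun_eq_iff PiE_def Pi_iff extensional_def)
  then show ?thesis unfolding projective_class_def using one_closed one_not_zero by blast
qed

context
  fixes Q :: "'k::field mpoly set" and N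
  assumes Q: "primeideal Q (mpoly_ring N)"
begin

lemma primeideal_mpoly:
  shows prime_subset: "Q \<subseteq> carrier (mpoly_ring N)"
    and prime_0: "0 \<in> Q"
    and prime_1: "1 \<notin> Q"
    and prime_add: "p \<in> Q \<Longrightarrow> q \<in> Q \<Longrightarrow> p + q \<in> Q"
    and prime_mult_left: "p \<in> Q \<Longrightarrow> r \<in> carrier (mpoly_ring N) \<Longrightarrow> r * p \<in> Q"
    and prime_mult: "p \<in> carrier (mpoly_ring N) \<Longrightarrow> q \<in> carrier (mpoly_ring N) \<Longrightarrow> p * q \<in> Q \<Longrightarrow> p \<in> Q \<or> q \<in> Q"
proof -
  interpret primeideal Q "mpoly_ring N" by (rule Q)
  show "Q \<subseteq> carrier (mpoly_ring N)" by (rule a_subset)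
  show "0 \<in> Q" using additive_subgroup.zero_closed[OF additive_subgroup_axioms] by simp
  show "1 \<notin> Q" using one_imp_carrier I_notcarr by auto
  show "p \<in> Q \<Longrightarrow> q \<in> Q \<Longrightarrow> p + q \<in> Q" using additive_subgroup.a_closed[OF additive_subgroup_axioms, of p q] by simp
  show "p \<in> Q \<Longrightarrow> r \<in> carrier (mpoly_ring N) \<Longrightarrow> r * p \<in> Q" using I_l_closed[of p r] by simp
  show "p \<in> carrier (mpoly_ring N) \<Longrightarrow> q \<in> carrier (mpoly_ring N) \<Longrightarrow> p * q \<in> Q \<Longrightarrow> p \<in> Q \<or> q \<in> Q"
    using I_prime[of p q] by simp
qed

lemma prime_uminus: "p \<in> Q \<Longrightarrow> - p \<in> Q"
  using prime_mult_left[of p "-1"] by (simp add: mpoly_carrier_closed)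

lemma prime_diff: "p \<in> Q \<Longrightarrow> q \<in> Q \<Longrightarrow> p - q \<in> Q"
  using prime_add[of p "- q"] prime_uminus[of q] by simp

end

section \<open>The function field of a projective variety\<close>

locale variety =
  fixes XK :: "'k::field projective_scheme"
  assumes variety: "projective_variety XK"
begin

abbreviation polys :: "'k mpoly set" where "polys \<equiv> carrier (mpoly_ring (ambient XK))"
abbreviation I where "I \<equiv> ideal_of XK"
abbreviation F where "F \<equiv> function_field XK"
abbreviation frac where "frac \<equiv> fraction_class XK"

lemma scheme_point_prime: "Q \<in> scheme_points XK \<Longrightarrow> primeideal Q (mpoly_ring (ambient XK))"
  by (simp add: scheme_points_def)

lemma I_prime: "primeideal I (mpoly_ring (ambient XK))"
  using variety by (simp add: projective_variety_def scheme_point_prime)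

lemma I_homogeneous: "p \<in> I \<Longrightarrow> homogeneous_component m p \<in> I"
  using variety by (simp add: projective_variety_def scheme_points_def)

lemmas I_closed = prime_0[OF I_prime] prime_1[OF I_prime] prime_add[OF I_prime] prime_mult_left[OF I_prime]
  prime_uminus[OF I_prime] prime_diff[OF I_prime]

lemma I_combination:
  assumes "u \<in> I" "w \<in> I" "r \<in> polys" "t \<in> polys"
  shows "r * u + t * w \<in> I" "r * u - t * w \<in> I" "- (r * u + t * w) \<in> I"
  using assms by (simp_all add: I_closed)

lemma I_polys: "p \<in> I \<Longrightarrow> p \<in> polys"
  using prime_subset[OF I_prime] by auto

lemma is_fractionD:
  assumes "is_fraction XK p q"
  shows "p \<in> polys" "q \<in> polys" "q \<notin> I" "\<exists>m. homogeneous m p \<and> homogeneous m q"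
  using assms by (auto simp: is_fraction_def)

lemma is_fraction_mult: "is_fraction XK p q \<Longrightarrow> is_fraction XK p' q' \<Longrightarrow> is_fraction XK (p * p') (q * q')"
  using prime_mult[OF I_prime, of q q'] by (auto simp: is_fraction_def intro: mpoly_carrier_closed homogeneous_mult)

lemma is_fraction_add:
  assumes "is_fraction XK p q" "is_fraction XK p' q'"
  shows "is_fraction XK (p * q' + p' * q) (q * q')"
proof -
  obtain m k where "homogeneous m p" "homogeneous m q" "homogeneous k p'" "homogeneous k q'"
    using is_fractionD(4)[OF assms(1)] is_fractionD(4)[OF assms(2)] by auto
  then have "homogeneous (m + k) (p * q' + p' * q)" "homogeneous (m + k) (q * q')"
    using homogeneous_mult[of m p k q'] homogeneous_mult[of k p' m q] homogeneous_mult[of m q k q']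
    by (simp_all add: add.commute homogeneous_add)
  then show ?thesis using assms prime_mult[OF I_prime, of q q']
    unfolding is_fraction_def by (auto intro!: mpoly_carrier_closed)
qed

lemma is_fraction_const: "is_fraction XK (mpoly_const a) 1" "is_fraction XK 1 1" "is_fraction XK 0 1"
  using homogeneous_const[of a] homogeneous_1 I_closed(2)
  by (auto simp: is_fraction_def intro!: mpoly_carrier_closed exI[of _ 0])

lemma is_fraction_uminus: "is_fraction XK p q \<Longrightarrow> is_fraction XK (- p) q"
  by (auto simp: is_fraction_def intro: mpoly_carrier_closed homogeneous_uminus)

lemma mem_frac: "(a, b) \<in> frac p q \<longleftrightarrow> is_fraction XK a b \<and> p * b - a * q \<in> I"
  by (simp add: fraction_class_def)

lemma frac_self: "is_fraction XK p q \<Longrightarrow> (p, q) \<in> frac p q"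
  by (simp add: mem_frac I_closed)

text \<open>Transitivity of cross-multiplied equality: the denominator \<open>q\<close> in the
  middle lies outside the prime ideal and can be cancelled.\<close>

lemma frac_subset:
  assumes "is_fraction XK p q" "is_fraction XK p' q'" "p * q' - p' * q \<in> I"
  shows "frac p q \<subseteq> frac p' q'"
proof
  fix ab assume ab: "ab \<in> frac p q"
  obtain a b where [simp]: "ab = (a, b)" by force
  have f: "is_fraction XK a b" "p * b - a * q \<in> I" using ab by (auto simp: mem_frac)
  have "q * (p' * b - a * q') = q' * (p * b - a * q) - b * (p * q' - p' * q)" by (simp add: algebra_simps)
  also have "\<dots> \<in> I"
    using is_fractionD(2)[OF assms(2)] is_fractionD(2)[OF f(1)] by (rule I_combination(2)[OF f(2) assms(3)])
  finally have "p' * b - a * q' \<in> I"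
    using prime_mult[OF I_prime, of q "p' * b - a * q'"] is_fractionD(1-3) f assms
    by (meson mpoly_carrier_diff mpoly_carrier_mult)
  then show "ab \<in> frac p' q'" using f by (simp add: mem_frac)
qed

lemma frac_eq_iff:
  assumes "is_fraction XK p q" "is_fraction XK p' q'"
  shows "frac p q = frac p' q' \<longleftrightarrow> p * q' - p' * q \<in> I"
proof
  assume "frac p q = frac p' q'"
  then have "(p', q') \<in> frac p q" using frac_self[OF assms(2)] by simp
  then show "p * q' - p' * q \<in> I" by (simp add: mem_frac)
next
  assume a: "p * q' - p' * q \<in> I"
  then have "p' * q - p * q' \<in> I" using I_closed(5)[OF a] by simp
  then show "frac p q = frac p' q'" using a assms by (intro antisym frac_subset)
qed

lemma frac_eqI:
  "is_fraction XK p q \<Longrightarrow> is_fraction XK p' q' \<Longrightarrow> p * q' = p' * q \<Longrightarrow> frac p q = frac p' q'"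
  by (simp add: frac_eq_iff I_closed)

lemma frac_closed: "is_fraction XK p q \<Longrightarrow> frac p q \<in> carrier F"
  by (auto simp: function_field_def)

lemma carrier_F_cases:
  assumes "A \<in> carrier F" obtains p q where "is_fraction XK p q" "A = frac p q"
  using assms by (auto simp: function_field_def)

lemma carrier_F_mem:
  assumes "A \<in> carrier F" "(p, q) \<in> A" shows "is_fraction XK p q" "A = frac p q"
proof -
  obtain a b where ab: "is_fraction XK a b" "A = frac a b" using carrier_F_cases[OF assms(1)] .
  then show f: "is_fraction XK p q" using assms(2) by (simp add: mem_frac)
  show "A = frac p q" using ab f assms(2) by (simp add: frac_eq_iff mem_frac)
qed

text \<open>The operations of the function field are unions over representatives; they collapse to
  one class once all representatives give the same result.\<close>

lemma UN_UN_const: "A \<noteq> {} \<Longrightarrow> B \<noteq> {} \<Longrightarrow> (\<And>x y. x \<in> A \<Longrightarrow> y \<in> B \<Longrightarrow> f x y = C) \<Longrightarrow> (\<Union>x\<in>A. \<Union>y\<in>B. f x y) = C"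
  by blast

lemma frac_mult:
  assumes "is_fraction XK p q" "is_fraction XK p' q'"
  shows "frac p q \<otimes>\<^bsub>F\<^esub> frac p' q' = frac (p * p') (q * q')"
proof -
  have "frac p q \<otimes>\<^bsub>F\<^esub> frac p' q' = (\<Union>x\<in>frac p q. \<Union>y\<in>frac p' q'. frac (fst x * fst y) (snd x * snd y))"
    by (simp add: function_field_def case_prod_unfold)
  also have "\<dots> = frac (p * p') (q * q')"
  proof (rule UN_UN_const)
    fix x y assume xy: "x \<in> frac p q" "y \<in> frac p' q'"
    obtain a b a' b' where [simp]: "x = (a, b)" "y = (a', b')" by force
    have f: "is_fraction XK a b" "p * b - a * q \<in> I" "is_fraction XK a' b'" "p' * b' - a' * q' \<in> I"
      using xy by (auto simp: mem_frac)
    have "(a * a') * (q * q') - (p * p') * (b * b') = - ((p' * b') * (p * b - a * q) + (a * q) * (p' * b' - a' * q'))"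
      by (simp add: algebra_simps)
    also have "\<dots> \<in> I"
      using f is_fractionD(1,2)[OF assms(1)] is_fractionD(1,2)[OF assms(2)] is_fractionD(1,2)[OF f(1)] is_fractionD(1,2)[OF f(3)]
      by (intro I_combination(3)[OF f(2,4)] mpoly_carrier_mult)
    finally show "frac (fst x * fst y) (snd x * snd y) = frac (p * p') (q * q')"
      using f assms by (simp add: frac_eq_iff is_fraction_mult)
  qed (use frac_self assms in blast)+
  finally show ?thesis .
qed

lemma frac_add:
  assumes "is_fraction XK p q" "is_fraction XK p' q'"
  shows "frac p q \<oplus>\<^bsub>F\<^esub> frac p' q' = frac (p * q' + p' * q) (q * q')"
proof -
  have "frac p q \<oplus>\<^bsub>F\<^esub> frac p' q' = (\<Union>x\<in>frac p q. \<Union>y\<in>frac p' q'. frac (fst x * snd y + fst y * snd x) (snd x * snd y))"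
    by (simp add: function_field_def case_prod_unfold)
  also have "\<dots> = frac (p * q' + p' * q) (q * q')"
  proof (rule UN_UN_const)
    fix x y assume xy: "x \<in> frac p q" "y \<in> frac p' q'"
    obtain a b a' b' where [simp]: "x = (a, b)" "y = (a', b')" by force
    have f: "is_fraction XK a b" "p * b - a * q \<in> I" "is_fraction XK a' b'" "p' * b' - a' * q' \<in> I"
      using xy by (auto simp: mem_frac)
    have "(a * b' + a' * b) * (q * q') - (p * q' + p' * q) * (b * b') = - ((q' * b') * (p * b - a * q) + (q * b) * (p' * b' - a' * q'))"
      by (simp add: algebra_simps)
    also have "\<dots> \<in> I"
      using f is_fractionD(1,2)[OF assms(1)] is_fractionD(1,2)[OF assms(2)] is_fractionD(1,2)[OF f(1)] is_fractionD(1,2)[OF f(3)]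
      by (intro I_combination(3)[OF f(2,4)] mpoly_carrier_mult)
    finally show "frac (fst x * snd y + fst y * snd x) (snd x * snd y) = frac (p * q' + p' * q) (q * q')"
      using f assms by (simp add: frac_eq_iff is_fraction_mult is_fraction_add)
  qed (use frac_self assms in blast)+
  finally show ?thesis .
qed

lemma F_one: "\<one>\<^bsub>F\<^esub> = frac 1 1" and F_zero: "\<zero>\<^bsub>F\<^esub> = frac 0 1"
  by (simp_all add: function_field_def)

lemma cring_function_field: "cring F"
proof (rule cringI)
  show "abelian_group F"
  proof (rule abelian_groupI)
    fix A B assume "A \<in> carrier F" "B \<in> carrier F"
    then show "A \<oplus>\<^bsub>F\<^esub> B \<in> carrier F"
      by (elim carrier_F_cases) (simp add: frac_add frac_closed is_fraction_add)
    show "A \<oplus>\<^bsub>F\<^esub> B = B \<oplus>\<^bsub>F\<^esub> A" using \<open>A \<in> _\<close> \<open>B \<in> _\<close>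
      by (elim carrier_F_cases) (simp add: frac_add mult.commute add.commute)
  next
    fix A B C assume "A \<in> carrier F" "B \<in> carrier F" "C \<in> carrier F"
    then show "A \<oplus>\<^bsub>F\<^esub> B \<oplus>\<^bsub>F\<^esub> C = A \<oplus>\<^bsub>F\<^esub> (B \<oplus>\<^bsub>F\<^esub> C)"
      by (elim carrier_F_cases) (simp add: frac_add is_fraction_add, simp add: algebra_simps)
  next
    show "\<zero>\<^bsub>F\<^esub> \<in> carrier F" by (simp add: F_zero frac_closed is_fraction_const)
  next
    fix A assume "A \<in> carrier F"
    then show "\<zero>\<^bsub>F\<^esub> \<oplus>\<^bsub>F\<^esub> A = A"
      by (elim carrier_F_cases) (simp add: F_zero frac_add is_fraction_const)
    show "\<exists>B\<in>carrier F. B \<oplus>\<^bsub>F\<^esub> A = \<zero>\<^bsub>F\<^esub>" using \<open>A \<in> _\<close>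
    proof (elim carrier_F_cases)
      fix p q assume pq: "is_fraction XK p q" "A = frac p q"
      have "frac (- p) q \<oplus>\<^bsub>F\<^esub> A = frac (- p * q + p * q) (q * q)"
        unfolding pq(2) by (intro frac_add is_fraction_uminus pq)
      also have "\<dots> = frac 0 1"
        using is_fraction_add[OF is_fraction_uminus[OF pq(1)] pq(1)] by (intro frac_eqI is_fraction_const) simp_all
      finally show ?thesis using frac_closed[OF is_fraction_uminus[OF pq(1)]] by (auto simp: F_zero)
    qed
  qed
next
  show "comm_monoid F"
  proof (rule comm_monoidI)
    fix A B assume "A \<in> carrier F" "B \<in> carrier F"
    then show "A \<otimes>\<^bsub>F\<^esub> B \<in> carrier F"
      by (elim carrier_F_cases) (simp add: frac_mult frac_closed is_fraction_mult)
    show "A \<otimes>\<^bsub>F\<^esub> B = B \<otimes>\<^bsub>F\<^esub> A" using \<open>A \<in> _\<close> \<open>B \<in> _\<close>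
      by (elim carrier_F_cases) (simp add: frac_mult mult.commute)
  next
    fix A B C assume "A \<in> carrier F" "B \<in> carrier F" "C \<in> carrier F"
    then show "A \<otimes>\<^bsub>F\<^esub> B \<otimes>\<^bsub>F\<^esub> C = A \<otimes>\<^bsub>F\<^esub> (B \<otimes>\<^bsub>F\<^esub> C)"
      by (elim carrier_F_cases) (simp add: frac_mult is_fraction_mult mult.assoc)
  next
    show "\<one>\<^bsub>F\<^esub> \<in> carrier F" by (simp add: F_one frac_closed is_fraction_const)
  next
    fix A assume "A \<in> carrier F"
    then show "\<one>\<^bsub>F\<^esub> \<otimes>\<^bsub>F\<^esub> A = A"
      by (elim carrier_F_cases) (simp add: F_one frac_mult is_fraction_const)
  qed
next
  fix A B C assume "A \<in> carrier F" "B \<in> carrier F" "C \<in> carrier F"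
  then show "(A \<oplus>\<^bsub>F\<^esub> B) \<otimes>\<^bsub>F\<^esub> C = A \<otimes>\<^bsub>F\<^esub> C \<oplus>\<^bsub>F\<^esub> B \<otimes>\<^bsub>F\<^esub> C"
  proof (elim carrier_F_cases)
    fix p q p' q' p'' q'' assume f: "is_fraction XK p q" "A = frac p q" "is_fraction XK p' q'" "B = frac p' q'"
      "is_fraction XK p'' q''" "C = frac p'' q''"
    show ?thesis unfolding f using f(1,3,5)
      by (simp add: frac_add frac_mult is_fraction_add is_fraction_mult)
        (intro frac_eqI is_fraction_mult is_fraction_add, simp_all add: algebra_simps is_fraction_mult)
  qed
qed

sublocale F: cring F by (rule cring_function_field)

lemma constant_function_closed: "constant_function XK a \<in> carrier F"
  by (simp add: constant_function_def frac_closed is_fraction_const)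

lemma mpoly_const_add: "mpoly_const (a + b) = mpoly_const a + mpoly_const b"
  and mpoly_const_mult: "mpoly_const (a * b) = mpoly_const a * mpoly_const b"
  and mpoly_const_1: "mpoly_const 1 = 1"
  by (simp_all add: mpoly_const_def single_add mult_single)

sublocale constants: algebra_over F "constant_function XK"
proof
  show "constant_function XK a \<in> carrier F" for a by (rule constant_function_closed)
  show "constant_function XK (a + b) = constant_function XK a \<oplus>\<^bsub>F\<^esub> constant_function XK b" for a b
    by (simp add: constant_function_def frac_add is_fraction_const mpoly_const_add)
  show "constant_function XK (a * b) = constant_function XK a \<otimes>\<^bsub>F\<^esub> constant_function XK b" for a b
    by (simp add: constant_function_def frac_mult is_fraction_const mpoly_const_mult)
  show "constant_function XK 1 = \<one>\<^bsub>F\<^esub>"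
    by (simp add: constant_function_def F_one mpoly_const_1)
qed

definition regular_at :: "'k mpoly set \<Rightarrow> 'k ratfun \<Rightarrow> bool" where
  "regular_at Q A \<longleftrightarrow> A \<in> carrier F \<and> (\<exists>p q. (p, q) \<in> A \<and> q \<notin> Q)"

lemma regular_functions_iff: "A \<in> regular_functions XK U \<longleftrightarrow> A \<in> carrier F \<and> (\<forall>Q\<in>U. regular_at Q A)"
  by (auto simp: regular_functions_def regular_at_def)

context
  fixes Q assumes Q: "Q \<in> scheme_points XK"
begin

lemma regular_at_add:
  assumes "regular_at Q A" "regular_at Q B" shows "regular_at Q (A \<oplus>\<^bsub>F\<^esub> B)"
proof -
  obtain p q p' q' where pq: "(p, q) \<in> A" "q \<notin> Q" "(p', q') \<in> B" "q' \<notin> Q" and AB: "A \<in> carrier F" "B \<in> carrier F"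
    using assms by (auto simp: regular_at_def)
  note f = carrier_F_mem[OF AB(1) pq(1)] carrier_F_mem[OF AB(2) pq(3)]
  have "(p * q' + p' * q, q * q') \<in> A \<oplus>\<^bsub>F\<^esub> B"
    unfolding f(2,4) frac_add[OF f(1,3)] by (intro frac_self is_fraction_add f)
  moreover have "q * q' \<notin> Q" using prime_mult[OF scheme_point_prime[OF Q]] pq f(1,3) is_fractionD(2) by blast
  ultimately show ?thesis using AB by (auto simp: regular_at_def)
qed

lemma regular_at_mult:
  assumes "regular_at Q A" "regular_at Q B" shows "regular_at Q (A \<otimes>\<^bsub>F\<^esub> B)"
proof -
  obtain p q p' q' where pq: "(p, q) \<in> A" "q \<notin> Q" "(p', q') \<in> B" "q' \<notin> Q" and AB: "A \<in> carrier F" "B \<in> carrier F"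
    using assms by (auto simp: regular_at_def)
  note f = carrier_F_mem[OF AB(1) pq(1)] carrier_F_mem[OF AB(2) pq(3)]
  have "(p * p', q * q') \<in> A \<otimes>\<^bsub>F\<^esub> B"
    unfolding f(2,4) frac_mult[OF f(1,3)] by (intro frac_self is_fraction_mult f)
  moreover have "q * q' \<notin> Q" using prime_mult[OF scheme_point_prime[OF Q]] pq f(1,3) is_fractionD(2) by blast
  ultimately show ?thesis using AB by (auto simp: regular_at_def)
qed

lemma regular_at_const: "regular_at Q (constant_function XK a)"
  using frac_self[OF is_fraction_const(1)] prime_1[OF scheme_point_prime[OF Q]]
  by (auto simp: regular_at_def constant_function_closed) (auto simp: constant_function_def)

end

end

section \<open>Points with values in a field and values of functions at them\<close>

locale variety_point = variety XK + algebra_over R \<iota> + field R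
  for XK :: "'k::field projective_scheme" and R :: "'r ring" (structure) and \<iota> :: "'k \<Rightarrow> 'r" +
  fixes x :: "nat \<Rightarrow> 'r"
  assumes x_nonzero: "x \<in> nonzero_vectors R (ambient XK)"
    and vanishing: "p \<in> ideal_of XK \<Longrightarrow> mpoly_eval R \<iota> x p = \<zero>"
begin

abbreviation point where "point \<equiv> projective_class R (ambient XK) x"
abbreviation Q where "Q \<equiv> underlying_point XK R \<iota> point"

lemma x_closed: "\<forall>j\<le>ambient XK. x j \<in> carrier R"
  using x_nonzero by (auto simp: nonzero_vectors_def)

lemmas ev = eval_closed[OF x_closed] eval_add[OF x_closed] eval_mult[OF x_closed] eval_diff[OF x_closed]

lemma nonzero_pow: "c \<in> carrier R \<Longrightarrow> c \<noteq> \<zero> \<Longrightarrow> c [^] (m::nat) \<noteq> \<zero>"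
  using field_Units Units_pow_closed by (metis DiffD2 DiffI insertI1 singletonD)

lemma eval_scaled:
  assumes "c \<in> carrier R" "p \<in> polys" "homogeneous m p"
  shows "mpoly_eval R \<iota> (\<lambda>j\<in>{..ambient XK}. c \<otimes> x j) p = c [^] m \<otimes> mpoly_eval R \<iota> x p"
  using assms by (intro eval_scale[OF x_closed]) auto

lemma eval_scaled_zero_iff:
  assumes "c \<in> carrier R - {\<zero>}" "p \<in> polys" "homogeneous m p"
  shows "mpoly_eval R \<iota> (\<lambda>j\<in>{..ambient XK}. c \<otimes> x j) p = \<zero> \<longleftrightarrow> mpoly_eval R \<iota> x p = \<zero>"
  using assms nonzero_pow[of c m] by (simp add: eval_scaled[OF _ assms(2,3)] integral_iff ev)

lemma x_in_point: "x \<in> point"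
  by (rule nonzero_vector_in_class[OF field_axioms x_nonzero])

text \<open>The value of a homogeneous polynomial only changes by a power of the scaling factor, so
  a single representative decides membership.\<close>

lemma underlying_point_eq:
  "Q = {p \<in> polys. \<forall>m. mpoly_eval R \<iota> x (homogeneous_component m p) = \<zero>}"
proof -
  have "(\<forall>y\<in>point. mpoly_eval R \<iota> y (homogeneous_component m p) = \<zero>) \<longleftrightarrow> mpoly_eval R \<iota> x (homogeneous_component m p) = \<zero>"
    if "p \<in> polys" for m p
  proof
    assume "mpoly_eval R \<iota> x (homogeneous_component m p) = \<zero>"
    then show "\<forall>y\<in>point. mpoly_eval R \<iota> y (homogeneous_component m p) = \<zero>"
      using eval_scaled_zero_iff[OF _ mpoly_carrier_homogeneous_component[OF that] homogeneous_homogeneous_component]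
      by (auto simp: projective_class_def)
  qed (use x_in_point in blast)
  then show ?thesis by (auto simp: underlying_point_def)
qed

lemma homogeneous_mem_underlying_point:
  "p \<in> polys \<Longrightarrow> homogeneous m p \<Longrightarrow> p \<in> Q \<longleftrightarrow> mpoly_eval R \<iota> x p = \<zero>"
  by (auto simp: underlying_point_eq homogeneous_component_of_homogeneous eval_0[OF x_closed] split: if_splits)

text \<open>If neither factor vanishes, then the product of the lowest nonvanishing components is the
  value of a component of the product.\<close>
lemma underlying_point_prime:
  assumes ab: "a \<in> polys" "b \<in> polys" "a * b \<in> Q" shows "a \<in> Q \<or> b \<in> Q"
proof (rule ccontr)
  assume "\<not> ?thesis"
  then have ex: "\<exists>m. mpoly_eval R \<iota> x (homogeneous_component m a) \<noteq> \<zero>" "\<exists>m. mpoly_eval R \<iota> x (homogeneous_component m b) \<noteq> \<zero>"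
    using ab by (auto simp: underlying_point_eq)
  define k where "k = (LEAST m. mpoly_eval R \<iota> x (homogeneous_component m a) \<noteq> \<zero>)"
  define l where "l = (LEAST m. mpoly_eval R \<iota> x (homogeneous_component m b) \<noteq> \<zero>)"
  have k: "mpoly_eval R \<iota> x (homogeneous_component k a) \<noteq> \<zero>" "\<And>i. i < k \<Longrightarrow> mpoly_eval R \<iota> x (homogeneous_component i a) = \<zero>"
    unfolding k_def using LeastI_ex[OF ex(1)] not_less_Least by blast+
  have l: "mpoly_eval R \<iota> x (homogeneous_component l b) \<noteq> \<zero>" "\<And>i. i < l \<Longrightarrow> mpoly_eval R \<iota> x (homogeneous_component i b) = \<zero>"
    unfolding l_def using LeastI_ex[OF ex(2)] not_less_Least by blast+
  have c: "mpoly_eval R \<iota> x (homogeneous_component i a) \<in> carrier R" "mpoly_eval R \<iota> x (homogeneous_component i b) \<in> carrier R" for i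
    using ab by (auto intro: ev mpoly_carrier_closed)
  have "mpoly_eval R \<iota> x (homogeneous_component (k + l) (a * b)) =
     (\<Oplus>i\<in>{..k + l}. mpoly_eval R \<iota> x (homogeneous_component i a) \<otimes> mpoly_eval R \<iota> x (homogeneous_component (k + l - i) b))"
    using ab by (intro eval_homogeneous_component_mult[OF x_closed])
  also have "\<dots> = (\<Oplus>i\<in>{..k + l}. if k = i then mpoly_eval R \<iota> x (homogeneous_component i a) \<otimes> mpoly_eval R \<iota> x (homogeneous_component l b) else \<zero>)"
  proof (intro finsum_cong' refl)
    fix i assume "i \<in> {..k + l}"
    then show "mpoly_eval R \<iota> x (homogeneous_component i a) \<otimes> mpoly_eval R \<iota> x (homogeneous_component (k + l - i) b) =
        (if k = i then mpoly_eval R \<iota> x (homogeneous_component i a) \<otimes> mpoly_eval R \<iota> x (homogeneous_component l b) else \<zero>)"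
      using k(2)[of i] l(2)[of "k + l - i"] c by (cases i k rule: linorder_cases) auto
  qed (use c in auto)
  also have "\<dots> = mpoly_eval R \<iota> x (homogeneous_component k a) \<otimes> mpoly_eval R \<iota> x (homogeneous_component l b)"
    using c by (intro finsum_singleton) auto
  finally have "mpoly_eval R \<iota> x (homogeneous_component k a) \<otimes> mpoly_eval R \<iota> x (homogeneous_component l b) = \<zero>"
    using ab by (simp add: underlying_point_eq)
  then show False using k(1) l(1) c by (simp add: integral_iff)
qed

lemma I_subset_underlying_point: "I \<subseteq> Q"
  using I_homogeneous vanishing I_polys by (auto simp: underlying_point_eq)

lemma Q_polys: "p \<in> Q \<Longrightarrow> p \<in> polys" by (simp add: underlying_point_eq)

lemma underlying_point_ideal: "ideal Q (mpoly_ring (ambient XK))"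
proof (rule idealI)
  interpret P: primeideal I "mpoly_ring (ambient XK)" by (rule I_prime)
  show "ring (mpoly_ring (ambient XK) :: 'k mpoly ring)" by (rule P.ring_axioms)
  have um: "- p \<in> Q" if p: "p \<in> Q" for p
  proof -
    have "homogeneous_component m (- p) = - homogeneous_component m p" for m
      by (rule poly_mapping_eqI) (simp add: lookup_homogeneous_component)
    then show ?thesis using p by (simp add: underlying_point_eq mpoly_carrier_closed eval_uminus[OF x_closed])
  qed
  have 0: "0 \<in> Q" using eval_0[OF x_closed] by (simp add: underlying_point_eq mpoly_carrier_closed)
  have add: "p + q \<in> Q" if "p \<in> Q" "q \<in> Q" for p q
    using that by (simp add: underlying_point_eq mpoly_carrier_closed homogeneous_component_add ev)
  show "subgroup Q (add_monoid (mpoly_ring (ambient XK)))"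
  proof (rule P.add.subgroupI)
    show "Q \<subseteq> carrier (mpoly_ring (ambient XK))" using Q_polys by auto
    show "Q \<noteq> {}" using 0 by auto
    fix p assume p: "p \<in> Q"
    have "\<ominus>\<^bsub>mpoly_ring (ambient XK)\<^esub> p = - p"
      using Q_polys[OF p] by (intro P.minus_equality) (auto simp: mpoly_carrier_closed)
    then show "\<ominus>\<^bsub>mpoly_ring (ambient XK)\<^esub> p \<in> Q" using um[OF p] by simp
  qed (use add in simp)
  have mult: "r * p \<in> Q" if "p \<in> Q" "r \<in> polys" for p r
  proof -
    have "mpoly_eval R \<iota> x (homogeneous_component m (r * p)) = \<zero>" for m
      using that by (subst eval_homogeneous_component_mult[OF x_closed])
        (auto simp: underlying_point_eq mpoly_carrier_closed ev intro!: add.finprod_one_eqI)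
    then show ?thesis using that by (simp add: underlying_point_eq mpoly_carrier_closed)
  qed
  fix p r :: "'k mpoly" assume "p \<in> Q" "r \<in> carrier (mpoly_ring (ambient XK))"
  then show "r \<otimes>\<^bsub>mpoly_ring (ambient XK)\<^esub> p \<in> Q" "p \<otimes>\<^bsub>mpoly_ring (ambient XK)\<^esub> r \<in> Q"
    using mult by (simp_all add: mult.commute)
qed

text \<open>Makes statements about scheme points, such as the covering by charts and the absence of
  common zeros, available at rational and local points.\<close>

lemma underlying_point_scheme_point: "Q \<in> scheme_points XK"
proof -
  have c: "cring (mpoly_ring (ambient XK) :: 'k mpoly ring)"
    using I_prime by (rule primeideal.axioms(2))
  have "1 \<notin> Q" using homogeneous_mem_underlying_point[of 1 0] by (simp add: mpoly_carrier_closed eval_1[OF x_closed])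
  then have "primeideal Q (mpoly_ring (ambient XK))"
    using underlying_point_prime mpoly_carrier_closed(2)[of "ambient XK"]
    by (intro primeidealI underlying_point_ideal c) auto
  moreover have "homogeneous_component m p \<in> Q" if "p \<in> Q" for p m
    using that homogeneous_homogeneous_component[of m p] eval_0[OF x_closed]
    by (auto simp: underlying_point_eq mpoly_carrier_closed homogeneous_component_of_homogeneous)
  moreover have "\<exists>j\<le>ambient XK. mpoly_var j \<notin> Q"
  proof -
    obtain j where j: "j \<le> ambient XK" "x j \<noteq> \<zero>" using x_nonzero by (auto simp: nonzero_vectors_def)
    have "homogeneous 1 (mpoly_var j)" by (simp add: homogeneous_def mpoly_var_def monomial_degree_def)
    then show ?thesis using j homogeneous_mem_underlying_point[of "mpoly_var j"]
      by (auto simp: mpoly_carrier_closed eval_var[OF x_closed])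
  qed
  ultimately show ?thesis using I_subset_underlying_point by (auto simp: scheme_points_def)
qed

text \<open>\<open>function_value\<close> is a description that only makes sense where the function
  is regular. As a relation, having a value is compatible with sums and products without side
  conditions and can be used in \<open>mpoly_eval_related\<close>.\<close>

definition has_value :: "'k ratfun \<Rightarrow> 'r \<Rightarrow> bool" where
  "has_value A y \<longleftrightarrow> A \<in> carrier F \<and> y \<in> carrier R \<and>
     (\<exists>p q. (p, q) \<in> A \<and> mpoly_eval R \<iota> x q \<noteq> \<zero> \<and> y \<otimes> mpoly_eval R \<iota> x q = mpoly_eval R \<iota> x p)"

lemma fraction_denominator_iff:
  "is_fraction XK p q \<Longrightarrow> q \<in> Q \<longleftrightarrow> mpoly_eval R \<iota> x q = \<zero>"
  "is_fraction XK p q \<Longrightarrow> p \<in> Q \<longleftrightarrow> mpoly_eval R \<iota> x p = \<zero>"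
  using is_fractionD homogeneous_mem_underlying_point by metis+

text \<open>Two representatives agree after cross-multiplication up to an element of the ideal,
  which vanishes at \<open>x\<close>; the nonvanishing denominators then cancel.\<close>

lemma has_value_unique:
  assumes "has_value A y" and A: "(p', q') \<in> A" "mpoly_eval R \<iota> x q' \<noteq> \<zero>"
    and y': "y' \<in> carrier R" "y' \<otimes> mpoly_eval R \<iota> x q' = mpoly_eval R \<iota> x p'"
  shows "y' = y"
proof -
  obtain p q where pq: "(p, q) \<in> A" "mpoly_eval R \<iota> x q \<noteq> \<zero>" "y \<otimes> mpoly_eval R \<iota> x q = mpoly_eval R \<iota> x p"
    and AF: "A \<in> carrier F" and y: "y \<in> carrier R" using assms by (auto simp: has_value_def)
  note f = carrier_F_mem[OF AF pq(1)] and f' = carrier_F_mem[OF AF A(1)]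
  note pol = is_fractionD(1,2)[OF f(1)] is_fractionD(1,2)[OF f'(1)]
  note c = pol[THEN ev(1)]
  have "p * q' - p' * q \<in> I" using f f' frac_eq_iff by blast
  from vanishing[OF this] have "mpoly_eval R \<iota> x p \<otimes> mpoly_eval R \<iota> x q' = mpoly_eval R \<iota> x p' \<otimes> mpoly_eval R \<iota> x q"
    using pol c by (simp add: ev mpoly_carrier_closed)
  then have "(mpoly_eval R \<iota> x q \<otimes> mpoly_eval R \<iota> x q') \<otimes> y = (mpoly_eval R \<iota> x q \<otimes> mpoly_eval R \<iota> x q') \<otimes> y'"
  proof -
    assume e: "mpoly_eval R \<iota> x p \<otimes> mpoly_eval R \<iota> x q' = mpoly_eval R \<iota> x p' \<otimes> mpoly_eval R \<iota> x q"
    have "(mpoly_eval R \<iota> x q \<otimes> mpoly_eval R \<iota> x q') \<otimes> y = (y \<otimes> mpoly_eval R \<iota> x q) \<otimes> mpoly_eval R \<iota> x q'"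
      using c y by (simp add: m_ac)
    also have "\<dots> = (y' \<otimes> mpoly_eval R \<iota> x q') \<otimes> mpoly_eval R \<iota> x q"
      unfolding pq(3) y'(2) by (rule e)
    also have "\<dots> = (mpoly_eval R \<iota> x q \<otimes> mpoly_eval R \<iota> x q') \<otimes> y'"
      using c y'(1) by (simp add: m_ac)
    finally show ?thesis .
  qed
  then show ?thesis using c y y'(1) pq(2) A(2) m_lcancel[of "mpoly_eval R \<iota> x q \<otimes> mpoly_eval R \<iota> x q'"]
    by (simp add: integral_iff)
qed

lemma function_value_eq:
  assumes "has_value A y" shows "function_value R \<iota> A point = y"
  unfolding function_value_def
proof (rule the_equality)
  obtain p q where pq: "(p, q) \<in> A" "mpoly_eval R \<iota> x q \<noteq> \<zero>" "y \<otimes> mpoly_eval R \<iota> x q = mpoly_eval R \<iota> x p"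
    and AF: "A \<in> carrier F" and y: "y \<in> carrier R" using assms by (auto simp: has_value_def)
  then show "y \<in> carrier R \<and> (\<exists>x\<in>point. \<exists>(p, q)\<in>A. mpoly_eval R \<iota> x q \<noteq> \<zero> \<and> y \<otimes> mpoly_eval R \<iota> x q = mpoly_eval R \<iota> x p)"
    using x_in_point by blast
  fix y' assume "y' \<in> carrier R \<and> (\<exists>x\<in>point. \<exists>(p, q)\<in>A. mpoly_eval R \<iota> x q \<noteq> \<zero> \<and> y' \<otimes> mpoly_eval R \<iota> x q = mpoly_eval R \<iota> x p)"
  then obtain c p' q' where y': "y' \<in> carrier R" and c: "c \<in> carrier R - {\<zero>}" and A: "(p', q') \<in> A"
    and eq: "mpoly_eval R \<iota> (\<lambda>j\<in>{..ambient XK}. c \<otimes> x j) q' \<noteq> \<zero>"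
      "y' \<otimes> mpoly_eval R \<iota> (\<lambda>j\<in>{..ambient XK}. c \<otimes> x j) q' = mpoly_eval R \<iota> (\<lambda>j\<in>{..ambient XK}. c \<otimes> x j) p'"
    unfolding projective_class_def by auto
  note f' = carrier_F_mem[OF AF A]
  \<comment> \<open>Numerator and denominator have the same degree, so another representative of the
    point multiplies both values by the same power of \<open>c\<close>.\<close>
  obtain m where m: "homogeneous m p'" "homogeneous m q'" using is_fractionD(4)[OF f'(1)] by auto
  note pol = is_fractionD(1,2)[OF f'(1)]
  note cc = pol[THEN ev(1)]
  have "mpoly_eval R \<iota> x q' \<noteq> \<zero>" using eval_scaled_zero_iff[OF c pol(2) m(2)] eq(1) by simp
  moreover have "c [^] m \<otimes> (y' \<otimes> mpoly_eval R \<iota> x q') = c [^] m \<otimes> mpoly_eval R \<iota> x p'"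
    using eq(2) c y' cc by (simp add: eval_scaled[OF _ pol(1) m(1)] eval_scaled[OF _ pol(2) m(2)] m_ac)
  then have "y' \<otimes> mpoly_eval R \<iota> x q' = mpoly_eval R \<iota> x p'"
    using c y' cc nonzero_pow[of c m] m_lcancel[of "c [^] m"] by simp
  ultimately show "y' = y" using has_value_unique[OF assms A _ y'] by blast
qed

lemma has_value_exists:
  assumes "regular_at Q A" shows "has_value A (function_value R \<iota> A point)"
proof -
  obtain p q where pq: "(p, q) \<in> A" "q \<notin> Q" and A: "A \<in> carrier F" using assms by (auto simp: regular_at_def)
  note f = carrier_F_mem[OF A pq(1)]
  have q: "mpoly_eval R \<iota> x q \<noteq> \<zero>" using pq(2) fraction_denominator_iff[OF f(1)] by simp
  note c = is_fractionD(1,2)[OF f(1), THEN ev(1)]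
  have u: "mpoly_eval R \<iota> x q \<in> Units R" using q c by (simp add: field_Units)
  have "has_value A (mpoly_eval R \<iota> x p \<otimes> inv (mpoly_eval R \<iota> x q))"
    unfolding has_value_def using A pq(1) q c u
    by (intro conjI exI[of _ p] exI[of _ q]) (auto simp: m_assoc)
  then show ?thesis using function_value_eq by simp
qed

text \<open>\<open>has_value\<close> provides some representative; from it the value passes to every
  other one whose denominator does not vanish at \<open>x\<close>.\<close>

lemma has_value_fraction:
  assumes "has_value A y" "(p, q) \<in> A" "mpoly_eval R \<iota> x q \<noteq> \<zero>"
  shows "y \<otimes> mpoly_eval R \<iota> x q = mpoly_eval R \<iota> x p"
proof -
  have A: "A \<in> carrier F" using assms by (simp add: has_value_def)
  note f = carrier_F_mem[OF A assms(2)]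
  note c = is_fractionD(1,2)[OF f(1), THEN ev(1)]
  have u: "mpoly_eval R \<iota> x q \<in> Units R" using assms c by (simp add: field_Units)
  have e: "(mpoly_eval R \<iota> x p \<otimes> inv (mpoly_eval R \<iota> x q)) \<otimes> mpoly_eval R \<iota> x q = mpoly_eval R \<iota> x p"
    using c u by (simp add: m_assoc)
  then show ?thesis using has_value_unique[OF assms(1-3) _ e] c u by simp
qed

lemma has_value_add:
  assumes "has_value A y" "has_value B z" shows "has_value (A \<oplus>\<^bsub>F\<^esub> B) (y \<oplus> z)"
proof -
  obtain p q where pq: "(p, q) \<in> A" "mpoly_eval R \<iota> x q \<noteq> \<zero>" "y \<otimes> mpoly_eval R \<iota> x q = mpoly_eval R \<iota> x p"
    and AF: "A \<in> carrier F" and y: "y \<in> carrier R" using assms(1) by (auto simp: has_value_def)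
  obtain p' q' where pq': "(p', q') \<in> B" "mpoly_eval R \<iota> x q' \<noteq> \<zero>" "z \<otimes> mpoly_eval R \<iota> x q' = mpoly_eval R \<iota> x p'"
    and BF: "B \<in> carrier F" and z: "z \<in> carrier R" using assms(2) by (auto simp: has_value_def)
  note f = carrier_F_mem[OF AF pq(1)] carrier_F_mem[OF BF pq'(1)]
  note pol = is_fractionD(1,2)[OF f(1)] is_fractionD(1,2)[OF f(3)]
  note c = pol[THEN ev(1)]
  have "(p * q' + p' * q, q * q') \<in> A \<oplus>\<^bsub>F\<^esub> B"
    unfolding f(2,4) frac_add[OF f(1,3)] by (intro frac_self is_fraction_add f)
  moreover have "(y \<oplus> z) \<otimes> mpoly_eval R \<iota> x (q * q') = mpoly_eval R \<iota> x (p * q' + p' * q)"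
    using pol c y z by (simp add: ev mpoly_carrier_closed pq(3)[symmetric] pq'(3)[symmetric] l_distr m_ac)
  moreover have "mpoly_eval R \<iota> x (q * q') \<noteq> \<zero>" using pol c pq(2) pq'(2) by (simp add: ev integral_iff)
  ultimately show ?thesis using AF BF y z by (auto simp: has_value_def)
qed

lemma has_value_mult:
  assumes "has_value A y" "has_value B z" shows "has_value (A \<otimes>\<^bsub>F\<^esub> B) (y \<otimes> z)"
proof -
  obtain p q where pq: "(p, q) \<in> A" "mpoly_eval R \<iota> x q \<noteq> \<zero>" "y \<otimes> mpoly_eval R \<iota> x q = mpoly_eval R \<iota> x p"
    and AF: "A \<in> carrier F" and y: "y \<in> carrier R" using assms(1) by (auto simp: has_value_def)
  obtain p' q' where pq': "(p', q') \<in> B" "mpoly_eval R \<iota> x q' \<noteq> \<zero>" "z \<otimes> mpoly_eval R \<iota> x q' = mpoly_eval R \<iota> x p'"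
    and BF: "B \<in> carrier F" and z: "z \<in> carrier R" using assms(2) by (auto simp: has_value_def)
  note f = carrier_F_mem[OF AF pq(1)] carrier_F_mem[OF BF pq'(1)]
  note pol = is_fractionD(1,2)[OF f(1)] is_fractionD(1,2)[OF f(3)]
  note c = pol[THEN ev(1)]
  have "(p * p', q * q') \<in> A \<otimes>\<^bsub>F\<^esub> B"
    unfolding f(2,4) frac_mult[OF f(1,3)] by (intro frac_self is_fraction_mult f)
  moreover have "(y \<otimes> z) \<otimes> mpoly_eval R \<iota> x (q * q') = mpoly_eval R \<iota> x (p * p')"
    using pol c y z by (simp add: ev mpoly_carrier_closed pq(3)[symmetric] pq'(3)[symmetric] m_ac)
  moreover have "mpoly_eval R \<iota> x (q * q') \<noteq> \<zero>" using pol c pq(2) pq'(2) by (simp add: ev integral_iff)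
  ultimately show ?thesis using AF BF y z by (auto simp: has_value_def)
qed

lemma has_value_const: "has_value (constant_function XK a) (\<iota> a)"
  unfolding has_value_def
  using frac_self[OF is_fraction_const(1), of a] constant_function_closed
  by (intro conjI exI[of _ "mpoly_const a"] exI[of _ 1])
    (auto simp: constant_function_def eval_1[OF x_closed] eval_const[OF x_closed] frac_closed is_fraction_const)

lemma has_value_one: "has_value \<one>\<^bsub>F\<^esub> \<one>"
  using has_value_const[of 1] by simp

lemma has_value_functional: "has_value A y \<Longrightarrow> has_value A z \<Longrightarrow> y = z"
  using function_value_eq by blast

lemma has_value_pow: "has_value A y \<Longrightarrow> has_value (A [^]\<^bsub>F\<^esub> (m::nat)) (y [^] m)"
  by (induction m) (auto intro: has_value_one has_value_mult)

lemma has_value_closed: "has_value A y \<Longrightarrow> A \<in> carrier F \<and> y \<in> carrier R"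
  by (simp add: has_value_def)

end

lemma points_over_cases:
  assumes "projective_variety XK" "algebra_over R \<iota>" "field R" "P \<in> points_over XK R \<iota>"
  obtains x where "P = projective_class R (ambient XK) x" "variety_point XK R \<iota> x"
proof -
  interpret A: algebra_over R \<iota> by fact
  interpret f: field R by fact
  obtain x where x: "x \<in> nonzero_vectors R (ambient XK)" "P = projective_class R (ambient XK) x"
    using assms(4) by (auto simp: points_over_def projective_space_def)
  have "x = (\<lambda>j\<in>{..ambient XK}. \<one>\<^bsub>R\<^esub> \<otimes>\<^bsub>R\<^esub> x j)"
    using x(1) by (auto simp: nonzero_vectors_def fun_eq_iff PiE_def Pi_iff extensional_def)
  then have "x \<in> P" unfolding x(2) projective_class_def using A.one_closed f.one_not_zero by blast
  then have "mpoly_eval R \<iota> x p = \<zero>\<^bsub>R\<^esub>" if "p \<in> ideal_of XK" for p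
    using assms(4) that by (auto simp: points_over_def)
  then have "variety_point XK R \<iota> x"
    using assms(1) x(1) by unfold_locales auto
  then show ?thesis using that x(2) by blast
qed

section \<open>Values of sections\<close>

lemma projective_class_scale:
  fixes R :: "'r ring" (structure)
  assumes "field R" and x: "\<forall>j\<le>n. x j \<in> carrier R" and c: "c \<in> carrier R" "c \<noteq> \<zero>" and y: "\<forall>j\<le>n. y j = c \<otimes> x j"
  shows "projective_class R n y = projective_class R n x"
proof -
  interpret field R by fact
  have cu: "c \<in> Units R" using c by (simp add: field_Units)
  show ?thesis unfolding projective_class_def
  proof (intro antisym subsetI)
    fix w assume "w \<in> {(\<lambda>j\<in>{..n}. e \<otimes> y j) | e. e \<in> carrier R - {\<zero>}}"
    then obtain e where w: "w = (\<lambda>j\<in>{..n}. e \<otimes> y j)" and e: "e \<in> carrier R" "e \<noteq> \<zero>" by blast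
    have "(\<lambda>j\<in>{..n}. e \<otimes> y j) = (\<lambda>j\<in>{..n}. (e \<otimes> c) \<otimes> x j)"
      using x y c e by (auto simp: fun_eq_iff m_assoc)
    moreover have "e \<otimes> c \<in> carrier R" "e \<otimes> c \<noteq> \<zero>" using e c by (auto simp: integral_iff)
    ultimately show "w \<in> {(\<lambda>j\<in>{..n}. f \<otimes> x j) | f. f \<in> carrier R - {\<zero>}}" unfolding w by blast
  next
    fix w assume "w \<in> {(\<lambda>j\<in>{..n}. e \<otimes> x j) | e. e \<in> carrier R - {\<zero>}}"
    then obtain e where w: "w = (\<lambda>j\<in>{..n}. e \<otimes> x j)" and e: "e \<in> carrier R" "e \<noteq> \<zero>" by blast
    have "(e \<otimes> inv c) \<otimes> y j = e \<otimes> x j" if "j \<le> n" for j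
    proof -
      have "(e \<otimes> inv c) \<otimes> (c \<otimes> x j) = e \<otimes> (inv c \<otimes> c) \<otimes> x j"
        using x c cu e that Units_inv_closed[OF cu] by (simp add: m_assoc del: Units_l_inv)
      then show ?thesis using y that e cu x by simp
    qed
    then have "(\<lambda>j\<in>{..n}. e \<otimes> x j) = (\<lambda>j\<in>{..n}. (e \<otimes> inv c) \<otimes> y j)"
      by (auto simp: fun_eq_iff)
    moreover have "e \<otimes> inv c \<in> carrier R" "e \<otimes> inv c \<noteq> \<zero>"
      using e cu Units_inv_closed[OF cu] Units_inv_Units[OF cu] by (auto simp: integral_iff field_Units)
    ultimately show "w \<in> {(\<lambda>j\<in>{..n}. f \<otimes> y j) | f. f \<in> carrier R - {\<zero>}}" unfolding w by blast
  qed
qed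

section \<open>Line bundles and values of their sections\<close>

locale bundled_variety = variety XK for XK :: "'k::field projective_scheme" +
  fixes L :: "'k line_bundle"
  assumes line_bundle: "line_bundle_on XK L"
begin

lemma chart_subset: "i < num_charts L \<Longrightarrow> Q \<in> chart L i \<Longrightarrow> Q \<in> scheme_points XK"
  using line_bundle unfolding line_bundle_on_def by blast

lemma transition_closed: "i < num_charts L \<Longrightarrow> j < num_charts L \<Longrightarrow> transition L i j \<in> carrier F"
  using line_bundle unfolding line_bundle_on_def regular_functions_def by blast

lemma transition_regular:
  "i < num_charts L \<Longrightarrow> j < num_charts L \<Longrightarrow> Q \<in> chart L i \<Longrightarrow> Q \<in> chart L j \<Longrightarrow> regular_at Q (transition L i j)"
  using line_bundle unfolding line_bundle_on_def regular_functions_iff by blast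

lemma transition_inverse:
  "i < num_charts L \<Longrightarrow> j < num_charts L \<Longrightarrow> transition L i j \<otimes>\<^bsub>F\<^esub> transition L j i = \<one>\<^bsub>F\<^esub>"
  using line_bundle unfolding line_bundle_on_def by metis

lemma section_regular:
  "s \<in> global_sections XK L m \<Longrightarrow> i < num_charts L \<Longrightarrow> s i \<in> carrier F \<and> (\<forall>Q\<in>chart L i. regular_at Q (s i))"
  unfolding global_sections_def using regular_functions_iff by blast

lemma section_transition:
  "s \<in> global_sections XK L m \<Longrightarrow> i < num_charts L \<Longrightarrow> j < num_charts L \<Longrightarrow>
    s i = transition L i j [^]\<^bsub>F\<^esub> m \<otimes>\<^bsub>F\<^esub> s j"
  unfolding global_sections_def by blast

lemma section_lincomb_global:
  assumes h: "h \<in> global_sections XK L m" "h' \<in> global_sections XK L m"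
  shows "section_lincomb XK L u h u' h' \<in> global_sections XK L m"
proof -
  let ?t = "section_lincomb XK L u h u' h'" and ?c = "constant_function XK"
  have t: "?t i = ?c u \<otimes>\<^bsub>F\<^esub> h i \<oplus>\<^bsub>F\<^esub> ?c u' \<otimes>\<^bsub>F\<^esub> h' i" if "i < num_charts L" for i
    using that by (simp add: section_lincomb_def)
  have "?t \<in> (\<Pi>\<^sub>E i\<in>{..<num_charts L}. regular_functions XK (chart L i))"
  proof (rule PiE_I)
    fix i assume "i \<in> {..<num_charts L}"
    then have i: "i < num_charts L" by simp
    show "?t i \<in> regular_functions XK (chart L i)"
      unfolding regular_functions_iff t[OF i]
      using section_regular[OF h(1) i] section_regular[OF h(2) i] chart_subset[OF i]
      by (auto intro!: regular_at_add regular_at_mult regular_at_const constant_function_closed)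
  qed (auto simp: section_lincomb_def)
  moreover have "?t i = transition L i j [^]\<^bsub>F\<^esub> m \<otimes>\<^bsub>F\<^esub> ?t j" if ij: "i < num_charts L" "j < num_charts L" for i j
  proof -
    have c: "h j \<in> carrier F" "h' j \<in> carrier F" "transition L i j [^]\<^bsub>F\<^esub> m \<in> carrier F"
      using section_regular h ij transition_closed by auto
    show ?thesis
      unfolding t[OF ij(1)] t[OF ij(2)] section_transition[OF h(1) ij] section_transition[OF h(2) ij]
      using c constant_function_closed[of u] constant_function_closed[of u'] by (simp add: F.r_distr F.m_ac)
  qed
  ultimately show ?thesis unfolding global_sections_def by blast
qed

end

locale section_point = bundled_variety XK L + variety_point XK R \<iota> x
  for XK :: "'k::field projective_scheme" and L and R :: "'r ring" (structure) and \<iota> :: "'k \<Rightarrow> 'r" and x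
begin

abbreviation i0 where "i0 \<equiv> chart_at XK L R \<iota> point"

lemma chart_at_props: "i0 < num_charts L" "Q \<in> chart L i0"
proof -
  have "\<exists>i. i < num_charts L \<and> Q \<in> chart L i"
    using underlying_point_scheme_point line_bundle unfolding line_bundle_on_def by blast
  from LeastI_ex[OF this] show "i0 < num_charts L" "Q \<in> chart L i0" unfolding chart_at_def by auto
qed

lemma section_has_value:
  "s \<in> global_sections XK L m \<Longrightarrow> i < num_charts L \<Longrightarrow> Q \<in> chart L i \<Longrightarrow>
    has_value (s i) (function_value R \<iota> (s i) point)"
  using section_regular has_value_exists by blast

lemma section_value_has_value:
  "s \<in> global_sections XK L m \<Longrightarrow> has_value (s i0) (section_value XK L R \<iota> s point)"
  unfolding section_value_def by (rule section_has_value[OF _ chart_at_props])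

lemma section_value_closed [intro]: "s \<in> global_sections XK L m \<Longrightarrow> section_value XK L R \<iota> s point \<in> carrier R"
  using section_value_has_value has_value_closed by blast

lemma section_value_lincomb:
  assumes h: "h \<in> global_sections XK L m" "h' \<in> global_sections XK L m"
  shows "section_value XK L R \<iota> (section_lincomb XK L u h u' h') point =
     \<iota> u \<otimes> section_value XK L R \<iota> h point \<oplus> \<iota> u' \<otimes> section_value XK L R \<iota> h' point"
proof (rule has_value_functional)
  show "has_value (section_lincomb XK L u h u' h' i0) (section_value XK L R \<iota> (section_lincomb XK L u h u' h') point)"
    by (rule section_value_has_value[OF section_lincomb_global[OF h]])
  show "has_value (section_lincomb XK L u h u' h' i0)
      (\<iota> u \<otimes> section_value XK L R \<iota> h point \<oplus> \<iota> u' \<otimes> section_value XK L R \<iota> h' point)"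
    using chart_at_props(1) unfolding section_lincomb_def
    by (simp add: has_value_add has_value_mult has_value_const section_value_has_value[OF h(1)] section_value_has_value[OF h(2)])
qed

text \<open>The factor \<open>t\<close> is the value of the power of the transition function. It is
  nonzero because the opposite transition is inverse to it, and it is the same for all sections, so
  a change of chart only scales the vector of values.\<close>

lemma transition_value:
  assumes i: "i < num_charts L" "Q \<in> chart L i" and j: "j < num_charts L" "Q \<in> chart L j"
  obtains t where "t \<in> carrier R" "t \<noteq> \<zero>"
    "\<And>s. s \<in> global_sections XK L m \<Longrightarrow> function_value R \<iota> (s i) point = t \<otimes> function_value R \<iota> (s j) point"
proof -
  let ?v = "\<lambda>i j. function_value R \<iota> (transition L i j) point"
  have hv: "has_value (transition L i j) (?v i j)" "has_value (transition L j i) (?v j i)"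
    using i j by (auto intro!: has_value_exists transition_regular)
  have c: "?v i j \<in> carrier R" "?v j i \<in> carrier R" using hv has_value_closed by auto
  have "?v i j \<otimes> ?v j i = \<one>"
    using has_value_functional[OF _ has_value_one] has_value_mult[OF hv] transition_inverse[OF i(1) j(1)] by simp
  then have nz: "?v i j \<noteq> \<zero>" using c by auto
  show ?thesis
  proof (rule that)
    show "?v i j [^] m \<in> carrier R" "?v i j [^] m \<noteq> \<zero>" using c nz nonzero_pow by auto
    fix s assume s: "s \<in> global_sections XK L m"
    show "function_value R \<iota> (s i) point = ?v i j [^] m \<otimes> function_value R \<iota> (s j) point"
      using section_transition[OF s i(1) j(1)]
      by (metis has_value_functional section_has_value[OF s i] has_value_mult has_value_pow hv(1) section_has_value[OF s j])
  qed
qed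

text \<open>The absence of common zeros yields a nonvanishing section on some chart around the
  point, which need not be the chart used for evaluation. The transition factor carries the
  nonvanishing over.\<close>

lemma section_value_nonzero:
  assumes "no_common_zeros XK L P" "P \<subseteq> global_sections XK L m"
  shows "\<exists>s\<in>P. section_value XK L R \<iota> s point \<noteq> \<zero>"
proof -
  obtain s i p q where s: "s \<in> P" "i < num_charts L" "Q \<in> chart L i" "(p, q) \<in> s i" "p \<notin> Q" "q \<notin> Q"
    using assms(1) underlying_point_scheme_point unfolding no_common_zeros_def by blast
  have sg: "s \<in> global_sections XK L m" using s assms by auto
  have hv: "has_value (s i) (function_value R \<iota> (s i) point)" by (rule section_has_value[OF sg s(2,3)])
  have f: "is_fraction XK p q" using carrier_F_mem(1) section_regular[OF sg s(2)] s(4) by blast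
  have pq: "mpoly_eval R \<iota> x p \<noteq> \<zero>" "mpoly_eval R \<iota> x q \<noteq> \<zero>" using fraction_denominator_iff[OF f] s by auto
  note c = is_fractionD(1,2)[OF f, THEN ev(1)]
  obtain t where t: "t \<in> carrier R" "function_value R \<iota> (s i) point = t \<otimes> function_value R \<iota> (s i0) point"
    using transition_value[OF s(2,3) chart_at_props] sg by metis
  have "function_value R \<iota> (s i) point \<noteq> \<zero>"
    using has_value_fraction[OF hv s(4) pq(2)] pq c by auto
  then show ?thesis using t s(1) unfolding section_value_def by (metis r_null)
qed

end

section \<open>The morphism given by sections without common zeros\<close>

locale morphism_point = section_point XK L R \<iota> x
  for XK :: "'k::field projective_scheme" and L and R :: "'r ring" (structure) and \<iota> :: "'k \<Rightarrow> 'r" and x +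
  fixes n d :: nat and s :: "nat \<Rightarrow> 'k bundle_section"
  assumes sections: "s ` {..n} \<subseteq> global_sections XK L d" and nonvanishing: "no_common_zeros XK L (s ` {..n})"
begin

abbreviation image_vector where "image_vector \<equiv> \<lambda>j\<in>{..n}. section_value XK L R \<iota> (s j) point"

lemma s_global: "j \<le> n \<Longrightarrow> s j \<in> global_sections XK L d"
  using sections by auto

lemma image_vector_nonzero: "image_vector \<in> nonzero_vectors R n"
  using section_value_nonzero[OF nonvanishing sections] section_value_closed[OF s_global]
  by (auto simp: nonzero_vectors_def)

lemma image_vector_closed: "\<forall>j\<le>n. image_vector j \<in> carrier R"
  using section_value_closed[OF s_global] by auto

lemma section_morphism_eq: "section_morphism XK L n s R \<iota> point = projective_class R n image_vector"
  by (simp add: section_morphism_def)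

text \<open>Relations between the sections hold in the function field, and the relation
  \<open>has_value\<close> transports them to the values at the point.\<close>

lemma section_morphism_image:
  "section_morphism XK L n s R \<iota> point \<in> points_over (image_variety XK L n s) R \<iota>"
proof -
  have "mpoly_eval R \<iota> y G = \<zero>" if y: "y \<in> projective_class R n image_vector" and G: "G \<in> ideal_of (image_variety XK L n s)" for y G
  proof -
    have GC: "G \<in> carrier (mpoly_ring n)"
      and G0: "mpoly_eval F (constant_function XK) (\<lambda>j. s j i0) (homogeneous_component m G) = \<zero>\<^bsub>F\<^esub>" for m
      using G chart_at_props(1) by (auto simp: image_variety_def)
    obtain c where c: "c \<in> carrier R" "y = (\<lambda>j\<in>{..n}. c \<otimes> image_vector j)"
      using y unfolding projective_class_def by blast
    have yc: "\<forall>j\<le>n. y j \<in> carrier R" using c image_vector_closed by simp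
    have G1: "mpoly_eval R \<iota> image_vector (homogeneous_component m G) = \<zero>" for m
    proof (rule has_value_functional)
      show "has_value (mpoly_eval F (constant_function XK) (\<lambda>j. s j i0) (homogeneous_component m G))
          (mpoly_eval R \<iota> image_vector (homogeneous_component m G))"
      proof (rule mpoly_eval_related[OF constants.algebra_over_axioms algebra_over_axioms])
        show "homogeneous_component m G \<in> carrier (mpoly_ring n)" using GC by (rule mpoly_carrier_closed)
        show "has_value (s j i0) (image_vector j)" if "j \<le> n" for j
          using section_value_has_value[OF s_global[OF that]] that by simp
      qed (auto intro: has_value_const has_value_add has_value_mult dest: has_value_closed)
      show "has_value (mpoly_eval F (constant_function XK) (\<lambda>j. s j i0) (homogeneous_component m G)) \<zero>"
        unfolding G0 using has_value_const[of 0] by simp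
    qed
    show ?thesis
    proof (rule eval_eq_zero_of_components[OF yc GC])
      fix m
      show "mpoly_eval R \<iota> y (homogeneous_component m G) = \<zero>"
        using c G1 by (subst eval_scale[OF image_vector_closed mpoly_carrier_homogeneous_component[OF GC] homogeneous_homogeneous_component c(1)])
          auto
    qed
  qed
  then show ?thesis
    using image_vector_nonzero by (auto simp: section_morphism_eq points_over_def projective_space_def image_variety_def)
qed

text \<open>Near a point, the morphism is given by homogeneous polynomials: on a chart containing the
  point, write the sections as fractions and multiply by all denominators.\<close>
lemma section_morphism_locally_polynomial:
  obtains r D m where "r \<in> polys" "\<exists>k. homogeneous k r" "mpoly_eval R \<iota> x r \<noteq> \<zero>"
    "\<And>j. j \<le> n \<Longrightarrow> D j \<in> polys \<and> homogeneous m (D j)"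
    "\<And>y. variety_point XK R \<iota> y \<Longrightarrow> mpoly_eval R \<iota> y r \<noteq> \<zero> \<Longrightarrow>
       (\<lambda>j\<in>{..n}. mpoly_eval R \<iota> y (D j)) \<in> nonzero_vectors R n \<and>
       section_morphism XK L n s R \<iota> (projective_class R (ambient XK) y) =
         projective_class R n (\<lambda>j\<in>{..n}. mpoly_eval R \<iota> y (D j))"
proof -
  have "\<exists>p q. (p, q) \<in> s j i0 \<and> q \<notin> Q" if "j \<le> n" for j
    using section_regular[OF s_global[OF that] chart_at_props(1)] chart_at_props(2) by (auto simp: regular_at_def)
  then obtain p q where pq: "\<And>j. j \<le> n \<Longrightarrow> (p j, q j) \<in> s j i0 \<and> q j \<notin> Q" by metis
  have f: "is_fraction XK (p j) (q j)" if "j \<le> n" for j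
    using carrier_F_mem(1) section_regular[OF s_global[OF that] chart_at_props(1)] pq[OF that] by blast
  then have "\<exists>k. homogeneous k (p j) \<and> homogeneous k (q j)" if "j \<le> n" for j using is_fractionD(4) that by blast
  then obtain k where k: "\<And>j. j \<le> n \<Longrightarrow> homogeneous (k j) (p j) \<and> homogeneous (k j) (q j)" by metis
  have pol: "p j \<in> polys" "q j \<in> polys" if "j \<le> n" for j using is_fractionD[OF f[OF that]] by auto
  have "zariski_open XK (chart L i0)"
    using line_bundle chart_at_props(1) unfolding line_bundle_on_def by blast
  then obtain A where A0: "\<forall>a\<in>A. a \<in> polys \<and> (\<exists>m. homogeneous m a)" and A1: "chart L i0 = {Q \<in> scheme_points XK. \<not> A \<subseteq> Q}"
    unfolding zariski_open_def by (elim exE conjE)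
  have "\<not> A \<subseteq> Q" using chart_at_props(2) unfolding A1 by blast
  then obtain a ka where a: "a \<in> A" "a \<notin> Q" "a \<in> polys" "homogeneous ka a" using A0 by blast
  define q' where "q' = (\<Prod>j\<le>n. q j)"
  \<comment> \<open>Nonvanishing of \<open>a\<close> keeps a point in the chart, and nonvanishing of
    \<open>q'\<close> keeps it away from the zeros of all denominators. \<open>D j\<close> is the
    fraction \<open>p j / q j\<close> multiplied by \<open>q'\<close>.\<close>
  define r where "r = a * q'"
  define D where "D j = p j * (\<Prod>l\<in>{..n} - {j}. q l)" for j
  have q': "q' \<in> polys" "homogeneous (\<Sum>j\<le>n. k j) q'"
    unfolding q'_def using pol k by (auto intro!: mpoly_carrier_prod homogeneous_prod)
  have ql: "(\<Prod>l\<in>{..n} - {j}. q l) \<in> polys" for j using pol by (intro mpoly_carrier_prod) auto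
  show ?thesis
  proof (rule that)
    show "r \<in> polys" unfolding r_def by (intro mpoly_carrier_mult a q')
    show "\<exists>k. homogeneous k r" unfolding r_def using homogeneous_mult[OF a(4) q'(2)] by blast
    have nz: "mpoly_eval R \<iota> x (q j) \<noteq> \<zero>" if "j \<le> n" for j
      using pq[OF that] fraction_denominator_iff[OF f[OF that]] by simp
    have "(\<Otimes>j\<in>T. mpoly_eval R \<iota> x (q j)) \<noteq> \<zero>" if "finite T" "T \<subseteq> {..n}" for T
      using that
    proof induction
      case (insert j T)
      have "(\<lambda>j. mpoly_eval R \<iota> x (q j)) \<in> insert j T \<rightarrow> carrier R" using insert pol ev(1) by auto
      then show ?case using insert nz[of j] by (simp add: integral_iff)
    qed simp
    then have "mpoly_eval R \<iota> x q' \<noteq> \<zero>" unfolding q'_def using pol by (subst eval_prod[OF x_closed]) auto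
    moreover have "mpoly_eval R \<iota> x a \<noteq> \<zero>" using a homogeneous_mem_underlying_point by blast
    ultimately show "mpoly_eval R \<iota> x r \<noteq> \<zero>" unfolding r_def using a(3) q' by (simp add: ev integral_iff)
    show "D j \<in> polys \<and> homogeneous (\<Sum>j\<le>n. k j) (D j)" if "j \<le> n" for j
    proof -
      have "homogeneous (k j + (\<Sum>l\<in>{..n} - {j}. k l)) (D j)"
        unfolding D_def using k that by (intro homogeneous_mult homogeneous_prod) auto
      moreover have "k j + (\<Sum>l\<in>{..n} - {j}. k l) = (\<Sum>j\<le>n. k j)"
        using that by (intro sum.remove[symmetric]) auto
      ultimately show ?thesis unfolding D_def using pol[OF that] ql[of j] by (auto intro: mpoly_carrier_mult)
    qed
    fix y assume vp: "variety_point XK R \<iota> y" and ry: "mpoly_eval R \<iota> y r \<noteq> \<zero>"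
    interpret y: variety_point XK R \<iota> y by fact
    interpret y: morphism_point XK L R \<iota> y n d s by unfold_locales (rule sections nonvanishing)+
    have aq: "mpoly_eval R \<iota> y a \<noteq> \<zero>" "mpoly_eval R \<iota> y q' \<noteq> \<zero>"
      using ry a(3) q'(1) unfolding r_def by (auto simp: y.ev integral_iff)
    have "a \<notin> y.Q" using aq(1) a y.homogeneous_mem_underlying_point by blast
    then have Qy: "y.Q \<in> chart L i0" unfolding A1 using a(1) y.underlying_point_scheme_point by blast
    let ?v = "\<lambda>j. function_value R \<iota> (s j i0) y.point"
    have vc: "?v j \<in> carrier R" if "j \<le> n" for j
      using y.section_has_value[OF s_global[OF that] chart_at_props(1) Qy] has_value_closed y.has_value_closed by blast
    have Dv: "mpoly_eval R \<iota> y (D j) = mpoly_eval R \<iota> y q' \<otimes> ?v j" if j: "j \<le> n" for j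
    proof -
      have qq: "q' = q j * (\<Prod>l\<in>{..n} - {j}. q l)" unfolding q'_def using j by (intro prod.remove) auto
      then have "mpoly_eval R \<iota> y (q j) \<noteq> \<zero>" using aq(2) pol[OF j] ql[of j] by (auto simp: y.ev)
      then have e: "?v j \<otimes> mpoly_eval R \<iota> y (q j) = mpoly_eval R \<iota> y (p j)"
        using y.has_value_fraction[OF y.section_has_value[OF s_global[OF j] chart_at_props(1) Qy]] pq[OF j] by blast
      show ?thesis unfolding D_def qq using pol[OF j] ql[of j] vc[OF j]
        by (simp add: y.ev e[symmetric] m_ac)
    qed
    \<comment> \<open>The evaluation at \<open>y\<close> may use another chart than the one at
      \<open>x\<close>; the factor \<open>t\<close> accounts for this and disappears in projective
      space.\<close>
    obtain t where t: "t \<in> carrier R" "t \<noteq> \<zero>" "\<And>s. s \<in> global_sections XK L d \<Longrightarrow>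
        function_value R \<iota> (s i0) y.point = t \<otimes> function_value R \<iota> (s y.i0) y.point"
    proof (rule y.transition_value[OF chart_at_props(1) Qy y.chart_at_props, where m = d])
      fix t assume "t \<in> carrier R" "t \<noteq> \<zero>" "\<And>s. s \<in> global_sections XK L d \<Longrightarrow>
        function_value R \<iota> (s i0) y.point = t \<otimes> function_value R \<iota> (s y.i0) y.point"
      then show thesis by (rule that)
    qed
    let ?c = "mpoly_eval R \<iota> y q' \<otimes> t"
    have c: "?c \<in> carrier R" "?c \<noteq> \<zero>" using t aq y.ev(1)[OF q'(1)] by (auto simp: integral_iff)
    have Dw: "mpoly_eval R \<iota> y (D j) = ?c \<otimes> y.image_vector j" if "j \<le> n" for j
      using Dv[OF that] t(3)[OF s_global[OF that]] t(1) y.ev(1)[OF q'(1)] y.section_value_closed[OF s_global[OF that]] that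
      by (simp add: section_value_def m_assoc)
    have "(\<lambda>j\<in>{..n}. mpoly_eval R \<iota> y (D j)) \<in> nonzero_vectors R n"
      using y.image_vector_nonzero c Dw by (auto simp: nonzero_vectors_def integral_iff Pi_iff PiE_iff)
    moreover have "projective_class R n (\<lambda>j\<in>{..n}. mpoly_eval R \<iota> y (D j)) = projective_class R n y.image_vector"
      by (rule projective_class_scale[OF field_axioms y.image_vector_closed c]) (simp add: Dw)
    ultimately show "(\<lambda>j\<in>{..n}. mpoly_eval R \<iota> y (D j)) \<in> nonzero_vectors R n \<and>
       section_morphism XK L n s R \<iota> (projective_class R (ambient XK) y) =
         projective_class R n (\<lambda>j\<in>{..n}. mpoly_eval R \<iota> y (D j))"
      using y.section_morphism_eq by simp
  qed
qed

end

section \<open>Completions\<close>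

locale place_completion = place_value v for v :: "'k::number_field \<Rightarrow> real"
begin

abbreviation C where "C \<equiv> cauchy_ring v"
abbreviation null where "null \<equiv> null_sequences v"
abbreviation K where "K \<equiv> completion v"
abbreviation cl where "cl s \<equiv> null +>\<^bsub>C\<^esub> s"
abbreviation vabs where "vabs \<equiv> completion_abs v"

text \<open>The inequality \<open>(p + q)^2 \<le> 2 (p^2 + q^2)\<close>, applied to square roots,
  replaces the triangle inequality at all places. It is the source of the factors 2 and 4 in the
  estimates below.\<close>

lemma add_le: "v (x + y) \<le> 2 * (v x + v y)"
proof -
  have "v (x + y) = (sqrt (v (x + y)))\<^sup>2" by simp
  also have "\<dots> \<le> (sqrt (v x) + sqrt (v y))\<^sup>2" using sqrt_add_le by (intro power_mono) auto
  also have "\<dots> \<le> 2 * ((sqrt (v x))\<^sup>2 + (sqrt (v y))\<^sup>2)"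
    using sum_squares_bound[of "sqrt (v x)" "sqrt (v y)"] by (simp add: power2_sum)
  finally show ?thesis by simp
qed

lemma C_simps [simp]:
  "s \<otimes>\<^bsub>C\<^esub> t = (\<lambda>n. s n * t n)" "\<one>\<^bsub>C\<^esub> = (\<lambda>_. 1)" "\<zero>\<^bsub>C\<^esub> = (\<lambda>_. 0)" "s \<oplus>\<^bsub>C\<^esub> t = (\<lambda>n. s n + t n)"
  by (simp_all add: cauchy_ring_def)

lemma cauchy_iff: "s \<in> carrier C \<longleftrightarrow> (\<forall>\<epsilon>>0. \<exists>n0. \<forall>m\<ge>n0. \<forall>n\<ge>n0. v (s m - s n) < \<epsilon>)"
  by (simp add: cauchy_ring_def)

lemma cauchyD: "s \<in> carrier C \<Longrightarrow> \<epsilon> > 0 \<Longrightarrow> \<exists>n0. \<forall>m\<ge>n0. \<forall>n\<ge>n0. v (s m - s n) < \<epsilon>"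
  by (simp add: cauchy_iff)

lemma null_iff: "s \<in> null \<longleftrightarrow> (\<lambda>n. v (s n)) \<longlonglongrightarrow> 0"
  by (simp add: null_sequences_def)

text \<open>Square roots of values obey the reverse triangle inequality, so they form a real Cauchy
  sequence.\<close>

lemma cauchy_convergent:
  assumes s: "s \<in> carrier C" obtains r where "r \<ge> 0" "(\<lambda>n. v (s n)) \<longlonglongrightarrow> r"
proof -
  have "Cauchy (\<lambda>n. sqrt (v (s n)))"
  proof (rule metric_CauchyI)
    fix e :: real assume e: "e > 0"
    obtain n0 where n0: "\<forall>m\<ge>n0. \<forall>n\<ge>n0. v (s m - s n) < e\<^sup>2" using cauchyD[OF s, of "e\<^sup>2"] e by auto
    have "dist (sqrt (v (s m))) (sqrt (v (s n))) < e" if "m \<ge> n0" "n \<ge> n0" for m n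
    proof -
      have "sqrt (v (s m - s n)) < e" using n0 that e real_sqrt_less_mono[of "v (s m - s n)" "e\<^sup>2"] by simp
      then show ?thesis using sqrt_diff_le[of "s m" "s n"] by (simp add: dist_real_def)
    qed
    then show "\<exists>M. \<forall>m\<ge>M. \<forall>n\<ge>M. dist (sqrt (v (s m))) (sqrt (v (s n))) < e" by blast
  qed
  then obtain l where l: "(\<lambda>n. sqrt (v (s n))) \<longlonglongrightarrow> l" using Cauchy_convergent convergent_def by blast
  from tendsto_power[OF l, of 2] have "(\<lambda>n. v (s n)) \<longlonglongrightarrow> l\<^sup>2" by simp
  then show ?thesis by (rule that[rotated]) simp
qed

lemma cauchy_bounded: assumes "s \<in> carrier C" obtains b where "b > 0" "\<And>n. v (s n) \<le> b"
proof -
  obtain r where "(\<lambda>n. v (s n)) \<longlonglongrightarrow> r" using cauchy_convergent[OF assms] .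
  then have "Bseq (\<lambda>n. v (s n))" by (meson convergent_def convergent_imp_Bseq)
  then show ?thesis using that by (auto simp: Bseq_def)
qed

lemma cauchy_add: assumes "s \<in> carrier C" "t \<in> carrier C" shows "(\<lambda>n. s n + t n) \<in> carrier C"
  unfolding cauchy_iff
proof (intro allI impI)
  fix e :: real assume e: "e > 0"
  obtain n1 where n1: "\<forall>m\<ge>n1. \<forall>n\<ge>n1. v (s m - s n) < e / 4" using cauchyD[OF assms(1), of "e / 4"] e by auto
  obtain n2 where n2: "\<forall>m\<ge>n2. \<forall>n\<ge>n2. v (t m - t n) < e / 4" using cauchyD[OF assms(2), of "e / 4"] e by auto
  have "v (s m + t m - (s n + t n)) < e" if "m \<ge> max n1 n2" "n \<ge> max n1 n2" for m n
  proof -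
    have "v (s m - s n) < e / 4" "v (t m - t n) < e / 4" using n1 n2 that by auto
    then show ?thesis using add_le[of "s m - s n" "t m - t n"] by (simp add: algebra_simps)
  qed
  then show "\<exists>n0. \<forall>m\<ge>n0. \<forall>n\<ge>n0. v (s m + t m - (s n + t n)) < e" by blast
qed

lemma cauchy_mult: assumes "s \<in> carrier C" "t \<in> carrier C" shows "(\<lambda>n. s n * t n) \<in> carrier C"
  unfolding cauchy_iff
proof (intro allI impI)
  fix e :: real assume e: "e > 0"
  obtain b1 where b1: "b1 > 0" "\<And>n. v (s n) \<le> b1" using cauchy_bounded[OF assms(1)] by blast
  obtain b2 where b2: "b2 > 0" "\<And>n. v (t n) \<le> b2" using cauchy_bounded[OF assms(2)] by blast
  obtain n1 where n1: "\<forall>m\<ge>n1. \<forall>n\<ge>n1. v (s m - s n) < e / (4 * b2)" using cauchyD[OF assms(1), of "e / (4 * b2)"] e b2 by auto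
  obtain n2 where n2: "\<forall>m\<ge>n2. \<forall>n\<ge>n2. v (t m - t n) < e / (4 * b1)" using cauchyD[OF assms(2), of "e / (4 * b1)"] e b1 by auto
  have "v (s m * t m - s n * t n) < e" if "m \<ge> max n1 n2" "n \<ge> max n1 n2" for m n
  proof -
    have 1: "v (s m - s n) < e / (4 * b2)" "v (t m - t n) < e / (4 * b1)" using n1 n2 that by auto
    have "v ((s m - s n) * t m) \<le> v (s m - s n) * b2" unfolding mult using b2 by (intro mult_left_mono) auto
    also have "\<dots> < e / (4 * b2) * b2" using 1 b2 by (intro mult_strict_right_mono) auto
    finally have a: "v ((s m - s n) * t m) < e / 4" using b2 by simp
    have "v (s n * (t m - t n)) \<le> b1 * v (t m - t n)" unfolding mult using b1 by (intro mult_right_mono) auto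
    also have "\<dots> < b1 * (e / (4 * b1))" using 1 b1 by (intro mult_strict_left_mono) auto
    finally have b: "v (s n * (t m - t n)) < e / 4" using b1 by simp
    have "s m * t m - s n * t n = (s m - s n) * t m + s n * (t m - t n)" by (simp add: algebra_simps)
    then show ?thesis using add_le[of "(s m - s n) * t m" "s n * (t m - t n)"] a b by simp
  qed
  then show "\<exists>n0. \<forall>m\<ge>n0. \<forall>n\<ge>n0. v (s m * t m - s n * t n) < e" by blast
qed

lemma cauchy_const [simp]: "(\<lambda>_. a) \<in> carrier C"
  by (simp add: cauchy_iff)

lemma cauchy_uminus: "s \<in> carrier C \<Longrightarrow> (\<lambda>n. - s n) \<in> carrier C"
  using cauchy_mult[OF cauchy_const[of "-1"], of s] by simp

lemma cauchy_diff: "s \<in> carrier C \<Longrightarrow> t \<in> carrier C \<Longrightarrow> (\<lambda>n. s n - t n) \<in> carrier C"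
  using cauchy_add[OF _ cauchy_uminus, of s t] by simp

lemma cring_C: "cring C"
proof (rule cringI)
  show "abelian_group C"
    by (rule abelian_groupI) (auto simp: cauchy_add algebra_simps intro!: bexI[of _ "\<lambda>n. - _ n"] cauchy_uminus)
  show "comm_monoid C"
    by (rule comm_monoidI) (auto simp: cauchy_mult algebra_simps)
qed (auto simp: algebra_simps)

lemma null_add: "s \<in> null \<Longrightarrow> t \<in> null \<Longrightarrow> (\<lambda>n. s n + t n) \<in> null"
  unfolding null_iff
proof -
  assume "(\<lambda>n. v (s n)) \<longlonglongrightarrow> 0" "(\<lambda>n. v (t n)) \<longlonglongrightarrow> 0"
  from tendsto_mult[OF tendsto_const[of 2] tendsto_add[OF this]]
  have "(\<lambda>n. 2 * (v (s n) + v (t n))) \<longlonglongrightarrow> 0" by simp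
  then show "(\<lambda>n. v (s n + t n)) \<longlonglongrightarrow> 0"
    by (rule Lim_null_comparison[rotated]) (rule always_eventually, use add_le in simp)
qed

lemma null_cauchy: assumes "s \<in> null" shows "s \<in> carrier C"
  unfolding cauchy_iff
proof (intro allI impI)
  fix e :: real assume e: "e > 0"
  then have "\<forall>\<^sub>F n in sequentially. v (s n) < e / 4" using assms unfolding null_iff by (intro order_tendstoD) auto
  then obtain n0 where "\<forall>n\<ge>n0. v (s n) < e / 4" by (auto simp: eventually_sequentially)
  then have "v (s m) < e / 4" "v (s n) < e / 4" if "m \<ge> n0" "n \<ge> n0" for m n using that by auto
  then have "v (s m - s n) < e" if "m \<ge> n0" "n \<ge> n0" for m n
    using that add_le[of "s m" "- s n"] by fastforce
  then show "\<exists>n0. \<forall>m\<ge>n0. \<forall>n\<ge>n0. v (s m - s n) < e" by blast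
qed

lemma null_mult: assumes "s \<in> null" "t \<in> carrier C" shows "(\<lambda>n. t n * s n) \<in> null"
proof -
  obtain r where "(\<lambda>n. v (t n)) \<longlonglongrightarrow> r" using cauchy_convergent[OF assms(2)] .
  from tendsto_mult[OF this assms(1)[unfolded null_iff]] show ?thesis by (simp add: null_iff mult)
qed

lemma ideal_null: "ideal null C"
proof -
  interpret C: cring C by (rule cring_C)
  show ?thesis
  proof (rule idealI)
    show "ring C" by (rule C.ring_axioms)
    show "subgroup null (add_monoid C)"
    proof (rule C.add.subgroupI)
      show "null \<subseteq> carrier C" using null_cauchy by auto
      show "null \<noteq> {}" using null_iff[of "\<lambda>_. 0"] by auto
      fix s assume s: "s \<in> null"
      have "\<ominus>\<^bsub>C\<^esub> s = (\<lambda>n. - s n)"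
        using null_cauchy[OF s] by (intro C.minus_equality) (auto intro: cauchy_uminus)
      then show "\<ominus>\<^bsub>C\<^esub> s \<in> null" using s by (simp add: null_iff)
    qed (simp add: null_add)
    fix s t assume st: "s \<in> null" "t \<in> carrier C"
    then show "t \<otimes>\<^bsub>C\<^esub> s \<in> null" "s \<otimes>\<^bsub>C\<^esub> t \<in> null" using null_mult by (simp_all add: mult.commute)
  qed
qed

sublocale K: cring K
  unfolding completion_def using ideal.quotient_is_cring[OF ideal_null cring_C] .

lemma hom: "ring_hom_cring C K ((+>\<^bsub>C\<^esub>) null)"
  unfolding completion_def using ideal.rcos_ring_hom_cring[OF ideal_null cring_C] .

lemma cl_closed [simp]: "s \<in> carrier C \<Longrightarrow> cl s \<in> carrier K"
  and cl_add: "s \<in> carrier C \<Longrightarrow> t \<in> carrier C \<Longrightarrow> cl s \<oplus>\<^bsub>K\<^esub> cl t = cl (\<lambda>n. s n + t n)"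
  and cl_mult: "s \<in> carrier C \<Longrightarrow> t \<in> carrier C \<Longrightarrow> cl s \<otimes>\<^bsub>K\<^esub> cl t = cl (\<lambda>n. s n * t n)"
  and cl_one: "cl (\<lambda>_. 1) = \<one>\<^bsub>K\<^esub>" and cl_zero: "cl (\<lambda>_. 0) = \<zero>\<^bsub>K\<^esub>"
proof -
  interpret h: ring_hom_cring C K "(+>\<^bsub>C\<^esub>) null" by (rule hom)
  show "s \<in> carrier C \<Longrightarrow> cl s \<in> carrier K" by (rule h.hom_closed)
  show "s \<in> carrier C \<Longrightarrow> t \<in> carrier C \<Longrightarrow> cl s \<oplus>\<^bsub>K\<^esub> cl t = cl (\<lambda>n. s n + t n)" using h.hom_add[of s t] by simp
  show "s \<in> carrier C \<Longrightarrow> t \<in> carrier C \<Longrightarrow> cl s \<otimes>\<^bsub>K\<^esub> cl t = cl (\<lambda>n. s n * t n)" using h.hom_mult[of s t] by simp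
  show "cl (\<lambda>_. 1) = \<one>\<^bsub>K\<^esub>" using h.hom_one by simp
  show "cl (\<lambda>_. 0) = \<zero>\<^bsub>K\<^esub>" using h.hom_zero by simp
qed

lemma carrier_K_cases: assumes "x \<in> carrier K" obtains s where "s \<in> carrier C" "x = cl s"
  using assms unfolding completion_def FactRing_def A_RCOSETS_defs a_r_coset_def[symmetric] by auto

lemma mem_cl: "t \<in> cl s \<longleftrightarrow> (\<exists>z\<in>null. t = (\<lambda>n. z n + s n))"
  by (auto simp: a_r_coset_def' image_iff)

lemma cl_self: "s \<in> cl s"
  unfolding mem_cl by (intro bexI[of _ "\<lambda>_. 0"]) (auto simp: null_iff)

text \<open>A null sequence changes the square roots of the values only by a null sequence. So all
  representatives have the same limit and the description in \<open>completion_abs\<close> is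
  met.\<close>

lemma vabs_cl: assumes s: "(\<lambda>n. v (s n)) \<longlonglongrightarrow> r" shows "vabs (cl s) = r"
  unfolding completion_abs_def
proof (rule the_equality)
  show "\<forall>t\<in>cl s. (\<lambda>n. v (t n)) \<longlonglongrightarrow> r"
  proof
    fix t assume "t \<in> cl s"
    then obtain z where z: "z \<in> null" "t = (\<lambda>n. z n + s n)" by (auto simp: mem_cl)
    have z0: "(\<lambda>n. sqrt (v (z n))) \<longlonglongrightarrow> 0" using tendsto_real_sqrt[OF z(1)[unfolded null_iff]] by simp
    have "(\<lambda>n. sqrt (v (t n)) - sqrt (v (s n))) \<longlonglongrightarrow> 0"
    proof (rule Lim_null_comparison[OF _ z0])
      show "\<forall>\<^sub>F n in sequentially. norm (sqrt (v (t n)) - sqrt (v (s n))) \<le> sqrt (v (z n))"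
      proof (rule always_eventually, rule allI)
        fix n show "norm (sqrt (v (t n)) - sqrt (v (s n))) \<le> sqrt (v (z n))"
          using sqrt_diff_le[of "t n" "s n"] by (simp add: z(2))
      qed
    qed
    from tendsto_add[OF this tendsto_real_sqrt[OF s]] have "(\<lambda>n. sqrt (v (t n))) \<longlonglongrightarrow> sqrt r" by simp
    from tendsto_power[OF this, of 2] show "(\<lambda>n. v (t n)) \<longlonglongrightarrow> r"
      using LIMSEQ_le_const[OF s] by simp
  qed
  fix r' assume "\<forall>t\<in>cl s. (\<lambda>n. v (t n)) \<longlonglongrightarrow> r'"
  then show "r' = r" using cl_self LIMSEQ_unique s by blast
qed

lemma vabs_lim: "s \<in> carrier C \<Longrightarrow> (\<lambda>n. v (s n)) \<longlonglongrightarrow> vabs (cl s)"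
  using cauchy_convergent vabs_cl by metis

lemma vabs_nonneg [simp]: "x \<in> carrier K \<Longrightarrow> 0 \<le> vabs x"
  by (elim carrier_K_cases) (auto intro: LIMSEQ_le_const[OF vabs_lim])

lemma cl_eq_zero_iff: "s \<in> carrier C \<Longrightarrow> cl s = \<zero>\<^bsub>K\<^esub> \<longleftrightarrow> s \<in> null"
proof -
  assume s: "s \<in> carrier C"
  interpret I: ideal null C by (rule ideal_null)
  have z: "\<zero>\<^bsub>K\<^esub> = null" by (simp add: completion_def FactRing_def)
  show ?thesis
  proof
    assume "cl s = \<zero>\<^bsub>K\<^esub>"
    then show "s \<in> null" using cl_self[of s] z by simp
  next
    assume "s \<in> null"
    then show "cl s = \<zero>\<^bsub>K\<^esub>" unfolding z using I.a_rcos_zero[OF ideal_null] by simp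
  qed
qed

lemma vabs_eq_0_iff [simp]: "x \<in> carrier K \<Longrightarrow> vabs x = 0 \<longleftrightarrow> x = \<zero>\<^bsub>K\<^esub>"
proof (elim carrier_K_cases)
  fix s assume s: "s \<in> carrier C" "x = cl s"
  then show ?thesis using vabs_lim[OF s(1)] LIMSEQ_unique vabs_cl unfolding s(2) cl_eq_zero_iff[OF s(1)] null_iff
    by metis
qed

lemma vabs_mult: "x \<in> carrier K \<Longrightarrow> y \<in> carrier K \<Longrightarrow> vabs (x \<otimes>\<^bsub>K\<^esub> y) = vabs x * vabs y"
proof (elim carrier_K_cases)
  fix s t assume s: "s \<in> carrier C" "x = cl s" and t: "t \<in> carrier C" "y = cl t"
  show ?thesis unfolding s t cl_mult[OF s(1) t(1)]
    by (rule vabs_cl) (use tendsto_mult[OF vabs_lim[OF s(1)] vabs_lim[OF t(1)]] in \<open>simp add: mult\<close>)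
qed

lemma vabs_sqrt_add_le:
  "x \<in> carrier K \<Longrightarrow> y \<in> carrier K \<Longrightarrow> sqrt (vabs (x \<oplus>\<^bsub>K\<^esub> y)) \<le> sqrt (vabs x) + sqrt (vabs y)"
proof (elim carrier_K_cases)
  fix s t assume s: "s \<in> carrier C" "x = cl s" and t: "t \<in> carrier C" "y = cl t"
  show ?thesis unfolding s t cl_add[OF s(1) t(1)]
  proof (rule LIMSEQ_le)
    show "(\<lambda>n. sqrt (v (s n + t n))) \<longlonglongrightarrow> sqrt (vabs (cl (\<lambda>n. s n + t n)))"
      by (intro tendsto_real_sqrt vabs_lim cauchy_add s t)
    show "(\<lambda>n. sqrt (v (s n)) + sqrt (v (t n))) \<longlonglongrightarrow> sqrt (vabs (cl s)) + sqrt (vabs (cl t))"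
      by (intro tendsto_add tendsto_real_sqrt vabs_lim s t)
  qed (use sqrt_add_le in auto)
qed

lemma vabs_add_le_max:
  assumes "v \<in> finite_places"
  shows "x \<in> carrier K \<Longrightarrow> y \<in> carrier K \<Longrightarrow> vabs (x \<oplus>\<^bsub>K\<^esub> y) \<le> max (vabs x) (vabs y)"
proof (elim carrier_K_cases)
  fix s t assume s: "s \<in> carrier C" "x = cl s" and t: "t \<in> carrier C" "y = cl t"
  show ?thesis unfolding s t cl_add[OF s(1) t(1)]
  proof (rule LIMSEQ_le)
    show "(\<lambda>n. v (s n + t n)) \<longlonglongrightarrow> vabs (cl (\<lambda>n. s n + t n))"
      by (intro vabs_lim cauchy_add s t)
    show "(\<lambda>n. max (v (s n)) (v (t n))) \<longlonglongrightarrow> max (vabs (cl s)) (vabs (cl t))"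
      by (intro tendsto_max vabs_lim s t)
  qed (use finite_place_add_le[OF assms] in auto)
qed

lemma one_neq_zero: "\<one>\<^bsub>K\<^esub> \<noteq> \<zero>\<^bsub>K\<^esub>"
  using cl_eq_zero_iff[of "\<lambda>_. 1"] by (simp add: cl_one null_iff LIMSEQ_const_iff)

text \<open>A Cauchy sequence with nonzero class is eventually bounded away from 0. Its termwise
  inverse is therefore Cauchy, and the product of both is eventually equal to 1.\<close>

lemma field_K: "field K"
proof (rule K.cring_fieldI2)
  show "\<zero>\<^bsub>K\<^esub> \<noteq> \<one>\<^bsub>K\<^esub>" using one_neq_zero by simp
  fix x assume x: "x \<in> carrier K" "x \<noteq> \<zero>\<^bsub>K\<^esub>"
  obtain s where s: "s \<in> carrier C" "x = cl s" using carrier_K_cases[OF x(1)] .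
  define r where "r = vabs x"
  have r: "r > 0" unfolding r_def using x vabs_nonneg[of x] vabs_eq_0_iff[of x] by linarith
  have "(\<lambda>n. v (s n)) \<longlonglongrightarrow> r" unfolding r_def s(2) by (rule vabs_lim[OF s(1)])
  then have "\<forall>\<^sub>F n in sequentially. v (s n) > r / 2" using r by (intro order_tendstoD) auto
  then obtain n1 where n1: "\<And>n. n \<ge> n1 \<Longrightarrow> v (s n) > r / 2" by (auto simp: eventually_sequentially)
  have nz: "s n \<noteq> 0" if "n \<ge> n1" for n using n1[OF that] r by auto
  \<comment> \<open>The convention \<open>inverse 0 = 0\<close> can only matter before
    \<open>n1\<close>, and finitely many terms do not change a class.\<close>
  define t where "t n = inverse (s n)" for n
  have t: "t \<in> carrier C" unfolding cauchy_iff
  proof (intro allI impI)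
    fix e :: real assume e: "e > 0"
    obtain n2 where n2: "\<forall>m\<ge>n2. \<forall>n\<ge>n2. v (s m - s n) < e * (r / 2 * (r / 2))"
      using cauchyD[OF s(1), of "e * (r / 2 * (r / 2))"] e r by auto
    have "v (t m - t n) < e" if mn: "m \<ge> max n1 n2" "n \<ge> max n1 n2" for m n
    proof -
      have gt: "v (s m) > r / 2" "v (s n) > r / 2" and nz': "s m \<noteq> 0" "s n \<noteq> 0" using n1 nz mn by auto
      have "t m - t n = (s n - s m) / (s m * s n)" unfolding t_def using nz' by (simp add: field_simps)
      then have "v (t m - t n) = v (s m - s n) / (v (s m) * v (s n))" by (simp add: divide mult diff_commute[of "s n"])
      also have "\<dots> < e"
      proof -
        have "r / 2 * (r / 2) \<le> v (s m) * v (s n)" using gt r by (intro mult_mono) auto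
        then have "e * (r / 2 * (r / 2)) \<le> e * (v (s m) * v (s n))" using e by (intro mult_left_mono) auto
        moreover have "v (s m - s n) < e * (r / 2 * (r / 2))" using n2 mn by auto
        moreover have "v (s m) * v (s n) > 0" using nz' by simp
        ultimately show ?thesis by (simp add: pos_divide_less_eq)
      qed
      finally show ?thesis .
    qed
    then show "\<exists>n0. \<forall>m\<ge>n0. \<forall>n\<ge>n0. v (t m - t n) < e" by blast
  qed
  show "\<exists>y\<in>carrier K. x \<otimes>\<^bsub>K\<^esub> y = \<one>\<^bsub>K\<^esub>"
  proof (rule bexI)
    show "cl t \<in> carrier K" using t by simp
    have "(\<lambda>n. s n * t n - 1) \<in> null" unfolding null_iff
    proof (rule tendsto_eventually)
      show "\<forall>\<^sub>F n in sequentially. v (s n * t n - 1) = 0"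
        unfolding t_def using nz by (intro eventually_sequentiallyI[of n1]) simp
    qed
    moreover have st: "(\<lambda>n. s n * t n) \<in> carrier C" by (intro cauchy_mult s t)
    ultimately have "cl (\<lambda>n. s n * t n - 1) = \<zero>\<^bsub>K\<^esub>" using cl_eq_zero_iff null_cauchy by blast
    moreover have "cl (\<lambda>n. s n * t n) = cl (\<lambda>n. s n * t n - 1) \<oplus>\<^bsub>K\<^esub> cl (\<lambda>_. 1)"
      using st by (subst cl_add) (auto intro: cauchy_diff)
    ultimately show "x \<otimes>\<^bsub>K\<^esub> cl t = \<one>\<^bsub>K\<^esub>"
      unfolding s(2) cl_mult[OF s(1) t] by (simp add: cl_one)
  qed
qed

sublocale K: field K by (rule field_K)

abbreviation \<iota> where "\<iota> \<equiv> to_completion v"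

sublocale Ka: algebra_over K "to_completion v"
proof
  fix a b
  show "to_completion v a \<in> carrier K" by (simp add: to_completion_def)
  show "to_completion v (a + b) = to_completion v a \<oplus>\<^bsub>K\<^esub> to_completion v b" by (simp add: to_completion_def cl_add)
  show "to_completion v (a * b) = to_completion v a \<otimes>\<^bsub>K\<^esub> to_completion v b" by (simp add: to_completion_def cl_mult)
  show "to_completion v 1 = \<one>\<^bsub>K\<^esub>" by (simp add: to_completion_def cl_one)
qed

lemma vabs_to_completion [simp]: "vabs (to_completion v a) = v a"
  unfolding to_completion_def by (rule vabs_cl) simp

lemma vabs_one [simp]: "vabs \<one>\<^bsub>K\<^esub> = 1"
  using vabs_to_completion[of 1] by simp

lemma vabs_zero [simp]: "vabs \<zero>\<^bsub>K\<^esub> = 0"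
  by simp

lemma vabs_uminus: "x \<in> carrier K \<Longrightarrow> vabs (\<ominus>\<^bsub>K\<^esub> x) = vabs x"
proof -
  assume x: "x \<in> carrier K"
  have m: "\<ominus>\<^bsub>K\<^esub> \<one>\<^bsub>K\<^esub> = to_completion v (-1)"
    using Ka.coeff_add[of "-1" 1] by (intro K.minus_equality) auto
  have "\<ominus>\<^bsub>K\<^esub> x = to_completion v (-1) \<otimes>\<^bsub>K\<^esub> x" using x by (simp add: K.l_minus flip: m)
  then show ?thesis using x by (simp add: vabs_mult)
qed

lemma vabs_minus_commute: "x \<in> carrier K \<Longrightarrow> y \<in> carrier K \<Longrightarrow> vabs (x \<ominus>\<^bsub>K\<^esub> y) = vabs (y \<ominus>\<^bsub>K\<^esub> x)"
  using vabs_uminus[of "x \<ominus>\<^bsub>K\<^esub> y"] by (simp add: K.minus_eq K.minus_add K.a_comm)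

lemma vabs_add_le:
  assumes "x \<in> carrier K" "y \<in> carrier K" shows "vabs (x \<oplus>\<^bsub>K\<^esub> y) \<le> 2 * (vabs x + vabs y)"
proof -
  have "vabs (x \<oplus>\<^bsub>K\<^esub> y) = (sqrt (vabs (x \<oplus>\<^bsub>K\<^esub> y)))\<^sup>2" using assms by simp
  also have "\<dots> \<le> (sqrt (vabs x) + sqrt (vabs y))\<^sup>2" using vabs_sqrt_add_le assms by (intro power_mono) auto
  also have "\<dots> \<le> 2 * ((sqrt (vabs x))\<^sup>2 + (sqrt (vabs y))\<^sup>2)"
    using sum_squares_bound[of "sqrt (vabs x)" "sqrt (vabs y)"] by (simp add: power2_sum)
  finally show ?thesis using assms by simp
qed

text \<open>A sufficiently late term of a representing Cauchy sequence is the approximation.\<close>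

lemma to_completion_dense:
  assumes "x \<in> carrier K" "\<epsilon> > 0"
  shows "\<exists>a. vabs (x \<ominus>\<^bsub>K\<^esub> to_completion v a) < \<epsilon>"
proof -
  obtain s where s: "s \<in> carrier C" "x = cl s" using carrier_K_cases[OF assms(1)] .
  obtain n0 where n0: "\<forall>m\<ge>n0. \<forall>n\<ge>n0. v (s m - s n) < \<epsilon> / 2" using cauchyD[OF s(1), of "\<epsilon> / 2"] assms by auto
  have d: "(\<lambda>n. s n - s n0) \<in> carrier C" using s by (intro cauchy_diff) auto
  have "x = cl (\<lambda>n. s n - s n0) \<oplus>\<^bsub>K\<^esub> to_completion v (s n0)"
    unfolding s(2) to_completion_def using d by (subst cl_add) auto
  then have "x \<ominus>\<^bsub>K\<^esub> to_completion v (s n0) = cl (\<lambda>n. s n - s n0)"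
    using d by (simp add: K.minus_eq K.a_assoc K.r_neg)
  moreover have "vabs (cl (\<lambda>n. s n - s n0)) \<le> \<epsilon> / 2"
    by (rule LIMSEQ_le_const2[OF vabs_lim[OF d]]) (use n0 in \<open>auto intro!: exI[of _ n0] less_imp_le\<close>)
  ultimately show ?thesis using assms(2) by (intro exI[of _ "s n0"]) simp
qed

subsection \<open>The topology of a completion\<close>

text \<open>The absolute value itself need not give a metric at a complex place; its square root
  always does and induces the same topology.\<close>

definition cdist where "cdist x y = sqrt (vabs (x \<ominus>\<^bsub>K\<^esub> y))"

text \<open>The default 0 off the carrier is there because \<open>Metric_space\<close> demands
  nonnegativity and symmetry for all arguments.\<close>

sublocale M: Metric_space "carrier K" "\<lambda>x y. if x \<in> carrier K \<and> y \<in> carrier K then cdist x y else 0"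
proof
  fix x y
  show "0 \<le> (if x \<in> carrier K \<and> y \<in> carrier K then cdist x y else 0)" by (simp add: cdist_def)
  show "(if x \<in> carrier K \<and> y \<in> carrier K then cdist x y else 0) = (if y \<in> carrier K \<and> x \<in> carrier K then cdist y x else 0)"
    using vabs_minus_commute[of x y] by (simp add: cdist_def)
  show "x \<in> carrier K \<Longrightarrow> y \<in> carrier K \<Longrightarrow> (if x \<in> carrier K \<and> y \<in> carrier K then cdist x y else 0) = 0 \<longleftrightarrow> x = y"
    by (simp add: cdist_def K.r_right_minus_eq)
  fix z assume xyz: "x \<in> carrier K" "y \<in> carrier K" "z \<in> carrier K"
  have "x \<ominus>\<^bsub>K\<^esub> z = (x \<ominus>\<^bsub>K\<^esub> y) \<oplus>\<^bsub>K\<^esub> (y \<ominus>\<^bsub>K\<^esub> z)"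
    using xyz by (simp add: K.minus_eq K.a_ac K.r_neg1 K.r_neg2 K.l_neg K.r_neg)
  then show "(if x \<in> carrier K \<and> z \<in> carrier K then cdist x z else 0) \<le>
      (if x \<in> carrier K \<and> y \<in> carrier K then cdist x y else 0) + (if y \<in> carrier K \<and> z \<in> carrier K then cdist y z else 0)"
    using vabs_sqrt_add_le[of "x \<ominus>\<^bsub>K\<^esub> y" "y \<ominus>\<^bsub>K\<^esub> z"] xyz by (simp add: cdist_def)
qed

abbreviation top where "top \<equiv> completion_topology v"

text \<open>Balls of radius \<open>r\<close> for \<open>cdist\<close> are balls of radius
  \<open>r^2\<close> for \<open>vabs\<close>.\<close>

lemma top_eq: "top = M.mtopology"
proof -
  have "(\<exists>\<epsilon>>0. \<forall>y\<in>carrier K. vabs (y \<ominus>\<^bsub>K\<^esub> x) < \<epsilon> \<longrightarrow> y \<in> U) \<longleftrightarrow> (\<exists>r>0. M.mball x r \<subseteq> U)" if x: "x \<in> carrier K" for x U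
  proof safe
    fix e :: real assume e: "e > 0" "\<forall>y\<in>carrier K. vabs (y \<ominus>\<^bsub>K\<^esub> x) < e \<longrightarrow> y \<in> U"
    have "M.mball x (sqrt e) \<subseteq> U"
      using e x vabs_minus_commute by (auto simp: M.in_mball cdist_def)
    then show "\<exists>r>0. M.mball x r \<subseteq> U" using e by (intro exI[of _ "sqrt e"]) auto
  next
    fix r :: real assume r: "r > 0" "M.mball x r \<subseteq> U"
    have "y \<in> U" if y: "y \<in> carrier K" "vabs (y \<ominus>\<^bsub>K\<^esub> x) < r\<^sup>2" for y
    proof -
      have "sqrt (vabs (y \<ominus>\<^bsub>K\<^esub> x)) < sqrt (r\<^sup>2)" using y(2) by (intro real_sqrt_less_mono)
      then have "y \<in> M.mball x r" using r(1) x y vabs_minus_commute[of x y] by (simp add: M.in_mball cdist_def)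
      then show ?thesis using r by blast
    qed
    then show "\<exists>\<epsilon>>0. \<forall>y\<in>carrier K. vabs (y \<ominus>\<^bsub>K\<^esub> x) < \<epsilon> \<longrightarrow> y \<in> U"
      using r(1) by (intro exI[of _ "r\<^sup>2"]) auto
  qed
  then have "(U \<subseteq> carrier K \<and> (\<forall>x\<in>U. \<exists>\<epsilon>>0. \<forall>y\<in>carrier K. vabs (y \<ominus>\<^bsub>K\<^esub> x) < \<epsilon> \<longrightarrow> y \<in> U)) = openin M.mtopology U" for U
    unfolding M.openin_mtopology by blast
  then show ?thesis unfolding completion_topology_def by (simp add: openin_inverse)
qed

lemma topspace_top [simp]: "topspace top = carrier K"
  by (simp add: top_eq)

lemma openin_top_ball: "x \<in> carrier K \<Longrightarrow> openin top {y \<in> carrier K. vabs (y \<ominus>\<^bsub>K\<^esub> x) < \<epsilon>}"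
proof -
  assume x: "x \<in> carrier K"
  have "{y \<in> carrier K. vabs (y \<ominus>\<^bsub>K\<^esub> x) < \<epsilon>} = M.mball x (sqrt \<epsilon>)"
    using x vabs_minus_commute[of x] by (auto simp: M.in_mball cdist_def)
  then show ?thesis by (simp add: top_eq)
qed

lemma continuous_map_top_iff:
  "continuous_map Z top f \<longleftrightarrow> (\<forall>x\<in>topspace Z. f x \<in> carrier K) \<and>
     (\<forall>x\<in>topspace Z. \<forall>\<epsilon>>0. \<exists>U. openin Z U \<and> x \<in> U \<and> (\<forall>y\<in>U. vabs (f y \<ominus>\<^bsub>K\<^esub> f x) < \<epsilon>))"
proof
  assume f: "continuous_map Z top f"
  then have fc: "\<forall>x\<in>topspace Z. f x \<in> carrier K" by (auto simp: continuous_map_def)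
  moreover have "\<exists>U. openin Z U \<and> x \<in> U \<and> (\<forall>y\<in>U. vabs (f y \<ominus>\<^bsub>K\<^esub> f x) < \<epsilon>)" if x: "x \<in> topspace Z" "\<epsilon> > 0" for x \<epsilon>
  proof -
    have "openin Z {y \<in> topspace Z. f y \<in> {y \<in> carrier K. vabs (y \<ominus>\<^bsub>K\<^esub> f x) < \<epsilon>}}"
      by (rule openin_continuous_map_preimage[OF f openin_top_ball]) (use fc x in blast)
    then show ?thesis using fc x by (intro exI[of _ "{y \<in> topspace Z. f y \<in> {y \<in> carrier K. vabs (y \<ominus>\<^bsub>K\<^esub> f x) < \<epsilon>}}"])
      (auto simp: K.minus_eq K.r_neg)
  qed
  ultimately show "(\<forall>x\<in>topspace Z. f x \<in> carrier K) \<and>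
     (\<forall>x\<in>topspace Z. \<forall>\<epsilon>>0. \<exists>U. openin Z U \<and> x \<in> U \<and> (\<forall>y\<in>U. vabs (f y \<ominus>\<^bsub>K\<^esub> f x) < \<epsilon>))" by blast
next
  assume f: "(\<forall>x\<in>topspace Z. f x \<in> carrier K) \<and>
     (\<forall>x\<in>topspace Z. \<forall>\<epsilon>>0. \<exists>U. openin Z U \<and> x \<in> U \<and> (\<forall>y\<in>U. vabs (f y \<ominus>\<^bsub>K\<^esub> f x) < \<epsilon>))"
  show "continuous_map Z top f"
    unfolding top_eq M.continuous_map_to_metric
  proof (intro ballI allI impI)
    fix x and e :: real assume x: "x \<in> topspace Z" "e > 0"
    then obtain U where U: "openin Z U" "x \<in> U" "\<forall>y\<in>U. vabs (f y \<ominus>\<^bsub>K\<^esub> f x) < e\<^sup>2" using f by (metis zero_less_power)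
    have "f y \<in> M.mball (f x) e" if y: "y \<in> U" for y
    proof -
      have c: "f y \<in> carrier K" "f x \<in> carrier K" using f x openin_subset[OF U(1)] y by auto
      have "sqrt (vabs (f y \<ominus>\<^bsub>K\<^esub> f x)) < sqrt (e\<^sup>2)" using U(3) y by (intro real_sqrt_less_mono) auto
      then show ?thesis using c x(2) vabs_minus_commute[of "f x" "f y"] by (simp add: M.in_mball cdist_def)
    qed
    then show "\<exists>U. openin Z U \<and> x \<in> U \<and> (\<forall>y\<in>U. f y \<in> M.mball (f x) e)" using U by blast
  qed
qed

lemma continuous_map_add:
  assumes f: "continuous_map Z top f" and g: "continuous_map Z top g"
  shows "continuous_map Z top (\<lambda>x. f x \<oplus>\<^bsub>K\<^esub> g x)"
  unfolding continuous_map_top_iff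
proof (intro conjI ballI allI impI)
  have c: "x \<in> topspace Z \<Longrightarrow> f x \<in> carrier K" "x \<in> topspace Z \<Longrightarrow> g x \<in> carrier K" for x
    using f g by (auto simp: continuous_map_top_iff)
  then show "x \<in> topspace Z \<Longrightarrow> f x \<oplus>\<^bsub>K\<^esub> g x \<in> carrier K" for x by simp
  fix x and e :: real assume x: "x \<in> topspace Z" "e > 0"
  obtain U where U: "openin Z U" "x \<in> U" "\<forall>y\<in>U. vabs (f y \<ominus>\<^bsub>K\<^esub> f x) < e / 4"
    using f x unfolding continuous_map_top_iff by (metis divide_pos_pos zero_less_numeral)
  obtain U' where U': "openin Z U'" "x \<in> U'" "\<forall>y\<in>U'. vabs (g y \<ominus>\<^bsub>K\<^esub> g x) < e / 4"
    using g x unfolding continuous_map_top_iff by (metis divide_pos_pos zero_less_numeral)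
  have "vabs ((f y \<oplus>\<^bsub>K\<^esub> g y) \<ominus>\<^bsub>K\<^esub> (f x \<oplus>\<^bsub>K\<^esub> g x)) < e" if y: "y \<in> U \<inter> U'" for y
  proof -
    have yc: "f y \<in> carrier K" "g y \<in> carrier K" "f x \<in> carrier K" "g x \<in> carrier K"
      using c x y openin_subset[OF U(1)] by auto
    have "(f y \<oplus>\<^bsub>K\<^esub> g y) \<ominus>\<^bsub>K\<^esub> (f x \<oplus>\<^bsub>K\<^esub> g x) = (f y \<ominus>\<^bsub>K\<^esub> f x) \<oplus>\<^bsub>K\<^esub> (g y \<ominus>\<^bsub>K\<^esub> g x)"
      using yc by (simp add: K.minus_eq K.minus_add K.a_ac)
    then show ?thesis using vabs_add_le[of "f y \<ominus>\<^bsub>K\<^esub> f x" "g y \<ominus>\<^bsub>K\<^esub> g x"] U(3) U'(3) y yc by fastforce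
  qed
  then show "\<exists>U. openin Z U \<and> x \<in> U \<and> (\<forall>y\<in>U. vabs ((f y \<oplus>\<^bsub>K\<^esub> g y) \<ominus>\<^bsub>K\<^esub> (f x \<oplus>\<^bsub>K\<^esub> g x)) < e)"
    using U U' by (intro exI[of _ "U \<inter> U'"]) auto
qed

lemma continuous_map_mult:
  assumes f: "continuous_map Z top f" and g: "continuous_map Z top g"
  shows "continuous_map Z top (\<lambda>x. f x \<otimes>\<^bsub>K\<^esub> g x)"
  unfolding continuous_map_top_iff
proof (intro conjI ballI allI impI)
  have c: "x \<in> topspace Z \<Longrightarrow> f x \<in> carrier K" "x \<in> topspace Z \<Longrightarrow> g x \<in> carrier K" for x
    using f g by (auto simp: continuous_map_top_iff)
  then show "x \<in> topspace Z \<Longrightarrow> f x \<otimes>\<^bsub>K\<^esub> g x \<in> carrier K" for x by simp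
  fix x and e :: real assume x: "x \<in> topspace Z" "e > 0"
  \<comment> \<open>\<open>B\<close> bounds \<open>g y\<close> near \<open>x\<close>: the distance
    of \<open>g y\<close> from \<open>g x\<close> is less than 1, and \<open>vabs_add_le\<close>
    contributes the factor 2. The same factor is why each of the two error terms has to stay below a
    quarter of \<open>e\<close>.\<close>
  define A B where "A = vabs (f x) + 1" and "B = 2 * (1 + vabs (g x)) + 1"
  have AB: "A > 0" "B > 0" unfolding A_def B_def using vabs_nonneg[OF c(1)[OF x(1)]] vabs_nonneg[OF c(2)[OF x(1)]]
    by (simp_all add: add_nonneg_pos)
  obtain U where U: "openin Z U" "x \<in> U" "\<forall>y\<in>U. vabs (f y \<ominus>\<^bsub>K\<^esub> f x) < e / (4 * B)"
    using f x AB unfolding continuous_map_top_iff by (metis divide_pos_pos zero_less_numeral mult_pos_pos)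
  obtain U' where U': "openin Z U'" "x \<in> U'" "\<forall>y\<in>U'. vabs (g y \<ominus>\<^bsub>K\<^esub> g x) < min 1 (e / (4 * A))"
    using g x AB unfolding continuous_map_top_iff by (metis divide_pos_pos zero_less_numeral mult_pos_pos min_less_iff_conj zero_less_one)
  have "vabs ((f y \<otimes>\<^bsub>K\<^esub> g y) \<ominus>\<^bsub>K\<^esub> (f x \<otimes>\<^bsub>K\<^esub> g x)) < e" if y: "y \<in> U \<inter> U'" for y
  proof -
    have yc: "f y \<in> carrier K" "g y \<in> carrier K" "f x \<in> carrier K" "g x \<in> carrier K"
      using c x y openin_subset[OF U(1)] by auto
    have 1: "vabs (f y \<ominus>\<^bsub>K\<^esub> f x) < e / (4 * B)" "vabs (g y \<ominus>\<^bsub>K\<^esub> g x) < 1" "vabs (g y \<ominus>\<^bsub>K\<^esub> g x) < e / (4 * A)"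
      using U(3) U'(3) y by auto
    have "g y = (g y \<ominus>\<^bsub>K\<^esub> g x) \<oplus>\<^bsub>K\<^esub> g x" using yc by (simp add: K.minus_eq K.a_assoc K.l_neg)
    then have gB: "vabs (g y) < B"
      using vabs_add_le[of "g y \<ominus>\<^bsub>K\<^esub> g x" "g x"] 1 yc unfolding B_def by simp
    have "vabs ((f y \<ominus>\<^bsub>K\<^esub> f x) \<otimes>\<^bsub>K\<^esub> g y) \<le> vabs (f y \<ominus>\<^bsub>K\<^esub> f x) * B"
      using yc gB by (simp add: vabs_mult mult_left_mono)
    also have "\<dots> < e / (4 * B) * B" using 1 AB by (intro mult_strict_right_mono) auto
    finally have a: "vabs ((f y \<ominus>\<^bsub>K\<^esub> f x) \<otimes>\<^bsub>K\<^esub> g y) < e / 4" using AB by simp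
    have "vabs (f x \<otimes>\<^bsub>K\<^esub> (g y \<ominus>\<^bsub>K\<^esub> g x)) \<le> A * vabs (g y \<ominus>\<^bsub>K\<^esub> g x)"
      using yc unfolding A_def by (simp add: vabs_mult mult_right_mono)
    also have "\<dots> < A * (e / (4 * A))" using 1 AB by (intro mult_strict_left_mono) auto
    finally have b: "vabs (f x \<otimes>\<^bsub>K\<^esub> (g y \<ominus>\<^bsub>K\<^esub> g x)) < e / 4" using AB by simp
    have "(f y \<otimes>\<^bsub>K\<^esub> g y) \<ominus>\<^bsub>K\<^esub> (f x \<otimes>\<^bsub>K\<^esub> g x) = (f y \<ominus>\<^bsub>K\<^esub> f x) \<otimes>\<^bsub>K\<^esub> g y \<oplus>\<^bsub>K\<^esub> f x \<otimes>\<^bsub>K\<^esub> (g y \<ominus>\<^bsub>K\<^esub> g x)"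
      using yc by algebra
    then show ?thesis using vabs_add_le[of "(f y \<ominus>\<^bsub>K\<^esub> f x) \<otimes>\<^bsub>K\<^esub> g y" "f x \<otimes>\<^bsub>K\<^esub> (g y \<ominus>\<^bsub>K\<^esub> g x)"] a b yc by simp
  qed
  then show "\<exists>U. openin Z U \<and> x \<in> U \<and> (\<forall>y\<in>U. vabs ((f y \<otimes>\<^bsub>K\<^esub> g y) \<ominus>\<^bsub>K\<^esub> (f x \<otimes>\<^bsub>K\<^esub> g x)) < e)"
    using U U' by (intro exI[of _ "U \<inter> U'"]) auto
qed

lemma continuous_map_const_K: "a \<in> carrier K \<Longrightarrow> continuous_map Z top (\<lambda>_. a)"
  by simp

lemma continuous_map_pow: "continuous_map Z top f \<Longrightarrow> continuous_map Z top (\<lambda>x. f x [^]\<^bsub>K\<^esub> (m::nat))"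
  by (induction m) (auto intro: continuous_map_mult)

lemma continuous_map_cong_finsum:
  assumes "finite A" "\<And>a. a \<in> A \<Longrightarrow> continuous_map Z top (f a)"
  shows "continuous_map Z top (\<lambda>x. \<Oplus>\<^bsub>K\<^esub>a\<in>A. f a x)"
  using assms
proof (induction A)
  case (insert a A)
  have cm: "continuous_map Z top (\<lambda>x. f a x \<oplus>\<^bsub>K\<^esub> (\<Oplus>\<^bsub>K\<^esub>a\<in>A. f a x))" using insert by (intro continuous_map_add) auto
  have "f b x \<in> carrier K" if "x \<in> topspace Z" "b \<in> insert a A" for b x
    using insert.prems[OF that(2)] that(1) by (auto simp: continuous_map_top_iff)
  note fc = this
  show ?case
    by (rule continuous_map_eq[OF cm]) (use insert fc in \<open>auto simp: Pi_iff intro!: K.finsum_insert[symmetric]\<close>)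
qed simp

lemma continuous_map_finprod:
  assumes "finite A" "\<And>a. a \<in> A \<Longrightarrow> continuous_map Z top (f a)"
  shows "continuous_map Z top (\<lambda>x. \<Otimes>\<^bsub>K\<^esub>a\<in>A. f a x)"
  using assms
proof (induction A)
  case (insert a A)
  have cm: "continuous_map Z top (\<lambda>x. f a x \<otimes>\<^bsub>K\<^esub> (\<Otimes>\<^bsub>K\<^esub>a\<in>A. f a x))" using insert by (intro continuous_map_mult) auto
  have "f b x \<in> carrier K" if "x \<in> topspace Z" "b \<in> insert a A" for b x
    using insert.prems[OF that(2)] that(1) by (auto simp: continuous_map_top_iff)
  note fc = this
  show ?case
    by (rule continuous_map_eq[OF cm]) (use insert fc in \<open>auto simp: Pi_iff intro!: K.finprod_insert[symmetric]\<close>)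
qed simp

lemma continuous_map_eval:
  assumes "p \<in> carrier (mpoly_ring N)" "\<And>j. j \<le> N \<Longrightarrow> continuous_map Z top (\<lambda>x. f x j)"
  shows "continuous_map Z top (\<lambda>x. mpoly_eval K (to_completion v) (f x) p)"
  unfolding mpoly_eval_def using assms
  by (intro continuous_map_cong_finsum continuous_map_mult continuous_map_finprod continuous_map_pow continuous_map_const_K)
    (auto simp: carrier_mpoly_ring)

lemma vabs_sqrt_diff_le:
  assumes "x \<in> carrier K" "y \<in> carrier K"
  shows "\<bar>sqrt (vabs x) - sqrt (vabs y)\<bar> \<le> sqrt (vabs (x \<ominus>\<^bsub>K\<^esub> y))"
proof -
  have "x = (x \<ominus>\<^bsub>K\<^esub> y) \<oplus>\<^bsub>K\<^esub> y" "y = (y \<ominus>\<^bsub>K\<^esub> x) \<oplus>\<^bsub>K\<^esub> x"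
    using assms by (simp_all add: K.minus_eq K.a_assoc K.l_neg)
  then show ?thesis
    using vabs_sqrt_add_le[of "x \<ominus>\<^bsub>K\<^esub> y" y] vabs_sqrt_add_le[of "y \<ominus>\<^bsub>K\<^esub> x" x] vabs_minus_commute[OF assms] assms
    by simp
qed

lemma continuous_map_vabs:
  assumes f: "continuous_map Z top f" shows "continuous_map Z euclideanreal (\<lambda>x. vabs (f x))"
proof -
  have c: "x \<in> topspace Z \<Longrightarrow> f x \<in> carrier K" for x using f by (auto simp: continuous_map_top_iff)
  have "continuous_map Z euclideanreal (\<lambda>x. sqrt (vabs (f x)))"
    unfolding mtopology_is_euclidean[symmetric] Met_TC.continuous_map_to_metric
  proof (intro ballI allI impI)
    fix x and e :: real assume x: "x \<in> topspace Z" "e > 0"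
    then obtain U where U: "openin Z U" "x \<in> U" "\<forall>y\<in>U. vabs (f y \<ominus>\<^bsub>K\<^esub> f x) < e\<^sup>2"
      using f unfolding continuous_map_top_iff by (metis zero_less_power)
    have "sqrt (vabs (f y)) \<in> Met_TC.mball (sqrt (vabs (f x))) e" if y: "y \<in> U" for y
    proof -
      have yc: "f y \<in> carrier K" "f x \<in> carrier K" using c x openin_subset[OF U(1)] y by auto
      have "sqrt (vabs (f y \<ominus>\<^bsub>K\<^esub> f x)) < sqrt (e\<^sup>2)" using U(3) y by (intro real_sqrt_less_mono) auto
      then show ?thesis using vabs_sqrt_diff_le[OF yc] x(2) by (simp add: dist_real_def)
    qed
    then show "\<exists>U. openin Z U \<and> x \<in> U \<and> (\<forall>y\<in>U. sqrt (vabs (f y)) \<in> Met_TC.mball (sqrt (vabs (f x))) e)" using U by blast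
  qed
  from continuous_map_real_pow[OF this, of 2] show ?thesis
    by (rule continuous_map_eq) (use c in simp)
qed

end

section \<open>Projective spaces over completions\<close>

text \<open>A tuple \<open>(a, i, b, j)\<close> stands for the linear form \<open>a x\<^sub>i + b x\<^sub>j\<close>.\<close>
type_synonym 'k form = "'k \<times> nat \<times> 'k \<times> nat"

definition forms :: "nat \<Rightarrow> 'k form set" where
  "forms n = UNIV \<times> {..n} \<times> UNIV \<times> {..n}"

definition form_value :: "('k::number_field \<Rightarrow> real) \<Rightarrow> (nat \<Rightarrow> (nat \<Rightarrow> 'k) set) \<Rightarrow> 'k form \<Rightarrow> (nat \<Rightarrow> 'k) set" where
  "form_value v x = (\<lambda>(a, i, b, j).
     to_completion v a \<otimes>\<^bsub>completion v\<^esub> x i \<oplus>\<^bsub>completion v\<^esub> to_completion v b \<otimes>\<^bsub>completion v\<^esub> x j)"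

text \<open>Inserting 0 admits the empty set of forms, whose maximum is then 0.\<close>

definition forms_abs :: "('k::number_field \<Rightarrow> real) \<Rightarrow> 'k form set \<Rightarrow> (nat \<Rightarrow> (nat \<Rightarrow> 'k) set) \<Rightarrow> real" where
  "forms_abs v T x = Max (insert 0 ((\<lambda>t. completion_abs v (form_value v x t)) ` T))"

definition max_abs :: "('k::number_field \<Rightarrow> real) \<Rightarrow> nat \<Rightarrow> (nat \<Rightarrow> (nat \<Rightarrow> 'k) set) \<Rightarrow> real" where
  "max_abs v n x = (MAX j\<in>{..n}. completion_abs v (x j))"

text \<open>Numerator and denominator are homogeneous of degree 1, so for vectors and forms in the
  right range the quotient does not depend on the representative picked from the class.\<close>

definition forms_ratio :: "('k::number_field \<Rightarrow> real) \<Rightarrow> nat \<Rightarrow> 'k form set \<Rightarrow> (nat \<Rightarrow> (nat \<Rightarrow> 'k) set) set \<Rightarrow> real" where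
  "forms_ratio v n T y = (let x = SOME x. x \<in> y in forms_abs v T x / max_abs v n x)"

section \<open>The quotient topology and local maxima of linear forms\<close>

context place_completion
begin

abbreviation PT where "PT N \<equiv> projective_topology v N"
abbreviation PS where "PS N \<equiv> projective_space K N"
abbreviation NV where "NV N \<equiv> nonzero_vectors K N"
abbreviation pc where "pc N \<equiv> projective_class K N"
abbreviation vectors where "vectors N \<equiv> product_topology (\<lambda>_. top) {..N::nat}"

lemma NV_closed: "x \<in> NV N \<Longrightarrow> j \<le> N \<Longrightarrow> x j \<in> carrier K"
  by (auto simp: nonzero_vectors_def)

lemma openin_PT: "openin (PT N) U \<longleftrightarrow> U \<subseteq> PS N \<and> openin (vectors N) {x \<in> NV N. pc N x \<in> U}"
proof -
  have "istopology (\<lambda>U. U \<subseteq> PS N \<and> openin (vectors N) {x \<in> NV N. pc N x \<in> U})"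
    unfolding istopology_def
  proof (intro conjI allI impI)
    fix U W assume UW: "U \<subseteq> PS N \<and> openin (vectors N) {x \<in> NV N. pc N x \<in> U}"
      "W \<subseteq> PS N \<and> openin (vectors N) {x \<in> NV N. pc N x \<in> W}"
    have "{x \<in> NV N. pc N x \<in> U \<inter> W} = {x \<in> NV N. pc N x \<in> U} \<inter> {x \<in> NV N. pc N x \<in> W}" by auto
    then show "openin (vectors N) {x \<in> NV N. pc N x \<in> U \<inter> W}" using UW by auto
    show "U \<inter> W \<subseteq> PS N" using UW by auto
  next
    fix \<U> assume U: "\<forall>U\<in>\<U>. U \<subseteq> PS N \<and> openin (vectors N) {x \<in> NV N. pc N x \<in> U}"
    have "{x \<in> NV N. pc N x \<in> \<Union>\<U>} = (\<Union>U\<in>\<U>. {x \<in> NV N. pc N x \<in> U})" by auto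
    then show "openin (vectors N) {x \<in> NV N. pc N x \<in> \<Union>\<U>}" using U by auto
    show "\<Union>\<U> \<subseteq> PS N" using U by auto
  qed
  then show ?thesis unfolding projective_topology_def by (simp add: topology_inverse')
qed

lemma continuous_map_coordinate: "j \<le> N \<Longrightarrow> continuous_map (vectors N) top (\<lambda>x. x j)"
  by (rule continuous_map_product_projection) auto

lemma openin_nonzero_value:
  assumes "continuous_map Z top f" shows "openin Z {x \<in> topspace Z. f x \<noteq> \<zero>\<^bsub>K\<^esub>}"
proof -
  have "openin Z {x \<in> topspace Z. vabs (f x) \<in> - {0}}"
    using continuous_map_vabs[OF assms] by (rule openin_continuous_map_preimage) auto
  moreover have "f x \<in> carrier K" if "x \<in> topspace Z" for x using assms that by (auto simp: continuous_map_top_iff)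
  then have "{x \<in> topspace Z. vabs (f x) \<in> - {0}} = {x \<in> topspace Z. f x \<noteq> \<zero>\<^bsub>K\<^esub>}"
    by auto
  ultimately show ?thesis by simp
qed

lemma openin_NV: "openin (vectors N) (NV N)"
proof -
  have "NV N = (\<Union>j\<in>{..N}. {x \<in> topspace (vectors N). x j \<noteq> \<zero>\<^bsub>K\<^esub>})"
    by (auto simp: nonzero_vectors_def)
  moreover have "openin (vectors N) {x \<in> topspace (vectors N). x j \<noteq> \<zero>\<^bsub>K\<^esub>}" if "j \<le> N" for j
    by (rule openin_nonzero_value[OF continuous_map_coordinate[OF that]])
  ultimately show ?thesis by auto
qed

lemma pc_in_PS: "x \<in> NV N \<Longrightarrow> pc N x \<in> PS N"
  by (simp add: projective_space_def)

lemma PS_cases: assumes "y \<in> PS N" obtains x where "x \<in> NV N" "y = pc N x"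
  using assms by (auto simp: projective_space_def)

lemma topspace_PT [simp]: "topspace (PT N) = PS N"
proof -
  have "{x \<in> NV N. pc N x \<in> PS N} = NV N" by (auto intro: pc_in_PS)
  then have "openin (PT N) (PS N)" unfolding openin_PT using openin_NV by simp
  then show ?thesis using openin_PT[of N "topspace (PT N)"] openin_subset by fastforce
qed

lemma self_in_pc: "x \<in> NV N \<Longrightarrow> x \<in> pc N x"
  by (rule nonzero_vector_in_class[OF field_K])

lemma pc_eqD:
  assumes "x \<in> NV N" "y \<in> NV N" "pc N x = pc N y"
  obtains c where "c \<in> carrier K" "c \<noteq> \<zero>\<^bsub>K\<^esub>" "y = (\<lambda>j\<in>{..N}. c \<otimes>\<^bsub>K\<^esub> x j)"
  using self_in_pc[OF assms(2)] assms(3) that unfolding projective_class_def by blast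

lemma scale_in_NV:
  assumes "x \<in> NV N" "c \<in> carrier K" "c \<noteq> \<zero>\<^bsub>K\<^esub>"
  shows "(\<lambda>j\<in>{..N}. c \<otimes>\<^bsub>K\<^esub> x j) \<in> NV N" "pc N (\<lambda>j\<in>{..N}. c \<otimes>\<^bsub>K\<^esub> x j) = pc N x"
proof -
  show "(\<lambda>j\<in>{..N}. c \<otimes>\<^bsub>K\<^esub> x j) \<in> NV N"
    using assms by (auto simp: nonzero_vectors_def PiE_iff K.integral_iff)
  show "pc N (\<lambda>j\<in>{..N}. c \<otimes>\<^bsub>K\<^esub> x j) = pc N x"
    using assms NV_closed by (intro projective_class_scale[OF field_K _ assms(2,3)]) auto
qed

text \<open>A set of vectors that is stable under scaling is the full preimage of its image.\<close>

lemma openin_PT_image: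
  assumes "A \<subseteq> NV N" "openin (vectors N) A"
    and sat: "\<And>x c. x \<in> A \<Longrightarrow> c \<in> carrier K \<Longrightarrow> c \<noteq> \<zero>\<^bsub>K\<^esub> \<Longrightarrow> (\<lambda>j\<in>{..N}. c \<otimes>\<^bsub>K\<^esub> x j) \<in> A"
  shows "openin (PT N) (pc N ` A)"
proof -
  have "{x \<in> NV N. pc N x \<in> pc N ` A} = A"
  proof (intro antisym subsetI)
    fix y assume y: "y \<in> {x \<in> NV N. pc N x \<in> pc N ` A}"
    then obtain x where x: "x \<in> A" "pc N x = pc N y" by auto
    then obtain c where "c \<in> carrier K" "c \<noteq> \<zero>\<^bsub>K\<^esub>" "y = (\<lambda>j\<in>{..N}. c \<otimes>\<^bsub>K\<^esub> x j)"
      using pc_eqD[of x N y] y assms(1) by blast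
    then show "y \<in> A" using sat x(1) by simp
  qed (use assms(1) in auto)
  then show ?thesis unfolding openin_PT using assms by (auto intro: pc_in_PS)
qed

text \<open>The universal property of the quotient topology; the nonzero vectors are open, so
  preimages among them are open in the space of all vectors.\<close>

lemma continuous_map_PT_real:
  assumes h: "continuous_map (subtopology (vectors N) (NV N)) euclideanreal h"
    and \<phi>: "\<And>x. x \<in> NV N \<Longrightarrow> \<phi> (pc N x) = h x"
  shows "continuous_map (PT N) euclideanreal \<phi>"
  unfolding continuous_map_def
proof (intro conjI allI impI)
  fix U :: "real set" assume U: "openin euclideanreal U"
  have "openin (subtopology (vectors N) (NV N)) {x \<in> topspace (subtopology (vectors N) (NV N)). h x \<in> U}"
    using openin_continuous_map_preimage[OF h U] .
  then have "openin (vectors N) {x \<in> topspace (subtopology (vectors N) (NV N)). h x \<in> U}"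
    using openin_NV openin_trans_full by blast
  moreover have "{x \<in> topspace (subtopology (vectors N) (NV N)). h x \<in> U} = {x \<in> NV N. pc N x \<in> {y \<in> PS N. \<phi> y \<in> U}}"
    using openin_subset[OF openin_NV[of N]] \<phi> pc_in_PS by auto
  ultimately show "openin (PT N) {y \<in> topspace (PT N). \<phi> y \<in> U}" unfolding openin_PT by auto
qed simp

lemma form_value_closed: "x \<in> NV n \<Longrightarrow> t \<in> forms n \<Longrightarrow> form_value v x t \<in> carrier K"
  by (auto simp: form_value_def forms_def NV_closed)

lemma form_value_scale:
  assumes "x \<in> NV n" "t \<in> forms n" "c \<in> carrier K"
  shows "form_value v (\<lambda>j\<in>{..n}. c \<otimes>\<^bsub>K\<^esub> x j) t = c \<otimes>\<^bsub>K\<^esub> form_value v x t"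
  using assms by (auto simp: form_value_def forms_def NV_closed K.r_distr K.m_ac)

lemma Max_mult_left:
  "finite A \<Longrightarrow> A \<noteq> {} \<Longrightarrow> c \<ge> 0 \<Longrightarrow> Max ((\<lambda>a. c * a) ` A) = c * (Max A :: real)"
  by (rule mono_Max_commute[symmetric]) (auto intro: monoI mult_left_mono)

lemma forms_abs_scale:
  assumes x: "x \<in> NV n" and T: "T \<subseteq> forms n" "finite T" and c: "c \<in> carrier K"
  shows "forms_abs v T (\<lambda>j\<in>{..n}. c \<otimes>\<^bsub>K\<^esub> x j) = vabs c * forms_abs v T x"
proof -
  have "vabs (form_value v (\<lambda>j\<in>{..n}. c \<otimes>\<^bsub>K\<^esub> x j) t) = vabs c * vabs (form_value v x t)" if "t \<in> T" for t
    using form_value_scale[OF x subsetD[OF T(1) that] c] form_value_closed[OF x subsetD[OF T(1) that]] c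
    by (simp add: vabs_mult)
  then have "(\<lambda>t. vabs (form_value v (\<lambda>j\<in>{..n}. c \<otimes>\<^bsub>K\<^esub> x j) t)) ` T = (\<lambda>a. vabs c * a) ` (\<lambda>t. vabs (form_value v x t)) ` T"
    unfolding image_image by (intro image_cong refl)
  then show ?thesis unfolding forms_abs_def
    using Max_mult_left[of "insert 0 ((\<lambda>t. vabs (form_value v x t)) ` T)" "vabs c"] c T(2) by simp
qed

lemma max_abs_scale:
  assumes x: "x \<in> NV n" and c: "c \<in> carrier K"
  shows "max_abs v n (\<lambda>j\<in>{..n}. c \<otimes>\<^bsub>K\<^esub> x j) = vabs c * max_abs v n x"
proof -
  have "vabs ((\<lambda>j\<in>{..n}. c \<otimes>\<^bsub>K\<^esub> x j) j) = vabs c * vabs (x j)" if "j \<in> {..n}" for j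
    using that NV_closed[OF x] c by (simp add: vabs_mult)
  then have "(\<lambda>j. vabs ((\<lambda>j\<in>{..n}. c \<otimes>\<^bsub>K\<^esub> x j) j)) ` {..n} = (\<lambda>a. vabs c * a) ` ((\<lambda>j. vabs (x j)) ` {..n})"
    unfolding image_image by (intro image_cong refl)
  then show ?thesis unfolding max_abs_def
    using Max_mult_left[of "(\<lambda>j. vabs (x j)) ` {..n}" "vabs c"] c by simp
qed

lemma max_abs_ge: "x \<in> NV n \<Longrightarrow> j \<le> n \<Longrightarrow> vabs (x j) \<le> max_abs v n x"
  unfolding max_abs_def by (intro Max_ge) auto

lemma max_abs_attained: obtains j where "j \<le> n" "max_abs v n x = vabs (x j)"
proof -
  have "max_abs v n x \<in> (\<lambda>j. vabs (x j)) ` {..n}" unfolding max_abs_def by (intro Max_in) auto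
  then show ?thesis using that by auto
qed

lemma max_abs_pos: assumes "x \<in> NV n" shows "max_abs v n x > 0"
proof -
  obtain j where j: "j \<le> n" "x j \<noteq> \<zero>\<^bsub>K\<^esub>" using assms by (auto simp: nonzero_vectors_def)
  have "vabs (x j) > 0" using j NV_closed[OF assms j(1)] vabs_nonneg[of "x j"] vabs_eq_0_iff[of "x j"] by linarith
  then show ?thesis using max_abs_ge[OF assms j(1)] by linarith
qed

lemma forms_ratio_pc:
  assumes x: "x \<in> NV n" and T: "T \<subseteq> forms n" "finite T"
  shows "forms_ratio v n T (pc n x) = forms_abs v T x / max_abs v n x"
proof -
  let ?y = "SOME y. y \<in> pc n x"
  have "?y \<in> pc n x" using self_in_pc[OF x] by (rule someI[where P = "\<lambda>y. y \<in> pc n x"])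
  then obtain c where c: "c \<in> carrier K" "c \<noteq> \<zero>\<^bsub>K\<^esub>" "?y = (\<lambda>j\<in>{..n}. c \<otimes>\<^bsub>K\<^esub> x j)"
    unfolding projective_class_def by blast
  have "vabs c \<noteq> 0" using c by simp
  then show ?thesis unfolding forms_ratio_def Let_def c(3)
    using forms_abs_scale[OF x T c(1)] max_abs_scale[OF x c(1)] by simp
qed

lemma forms_abs_ge: "finite T \<Longrightarrow> t \<in> T \<Longrightarrow> vabs (form_value v x t) \<le> forms_abs v T x"
  unfolding forms_abs_def by (intro Max_ge) auto

lemma forms_abs_nonneg: "finite T \<Longrightarrow> 0 \<le> forms_abs v T x"
  unfolding forms_abs_def by (intro Max_ge) auto

lemma forms_abs_le_iff: "finite T \<Longrightarrow> forms_abs v T x \<le> r \<longleftrightarrow> 0 \<le> r \<and> (\<forall>t\<in>T. vabs (form_value v x t) \<le> r)"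
  unfolding forms_abs_def by (subst Max_le_iff) auto

lemma forms_abs_insert: "finite T \<Longrightarrow> forms_abs v (insert t T) x = max (vabs (form_value v x t)) (forms_abs v T x)"
  unfolding forms_abs_def image_insert by (subst insert_commute, subst Max_insert) auto

lemma forms_abs_Un: "finite T \<Longrightarrow> finite T' \<Longrightarrow> forms_abs v (T \<union> T') x = max (forms_abs v T x) (forms_abs v T' x)"
proof -
  assume "finite T" "finite T'"
  then have "Max (insert 0 ((\<lambda>t. vabs (form_value v x t)) ` T) \<union> insert 0 ((\<lambda>t. vabs (form_value v x t)) ` T')) =
    max (forms_abs v T x) (forms_abs v T' x)"
    unfolding forms_abs_def by (intro Max_Un) auto
  then show ?thesis unfolding forms_abs_def by (simp add: image_Un)
qed

lemma continuous_map_forms_abs: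
  assumes "finite T" "T \<subseteq> forms n"
  shows "continuous_map (vectors n) euclideanreal (\<lambda>x. forms_abs v T x)"
  using assms
proof (induction T)
  case empty
  then show ?case by (simp add: forms_abs_def)
next
  case (insert t T)
  have "continuous_map (vectors n) top (\<lambda>x. form_value v x t)"
    using insert.prems unfolding form_value_def forms_def
    by (auto simp: case_prod_unfold intro!: continuous_map_add continuous_map_mult continuous_map_const_K continuous_map_coordinate)
  then show ?case unfolding forms_abs_insert[OF insert.hyps(1)]
    using insert by (intro continuous_map_real_max continuous_map_vabs) auto
qed

lemma continuous_map_max_abs: "continuous_map (vectors n) euclideanreal (max_abs v n)"
proof -
  have "continuous_map (vectors n) euclideanreal (\<lambda>x. MAX j\<in>{..m}. vabs (x j))" if "m \<le> n" for m
    using that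
  proof (induction m)
    case 0
    then show ?case using continuous_map_vabs[OF continuous_map_coordinate[of 0 n]] by simp
  next
    case (Suc m)
    have "(MAX j\<in>{..Suc m}. vabs (x j)) = max (vabs (x (Suc m))) (MAX j\<in>{..m}. vabs (x j))" for x
      by (simp add: atMost_Suc)
    then show ?case using Suc
      by (auto intro!: continuous_map_real_max continuous_map_vabs continuous_map_coordinate)
  qed
  then show ?thesis unfolding max_abs_def by blast
qed

lemma continuous_map_forms_ratio:
  assumes "finite T" "T \<subseteq> forms n"
  shows "continuous_map (PT n) euclideanreal (forms_ratio v n T)"
proof (rule continuous_map_PT_real)
  show "continuous_map (subtopology (vectors n) (NV n)) euclideanreal (\<lambda>x. forms_abs v T x / max_abs v n x)"
  proof (rule continuous_map_real_divide)
    show "continuous_map (subtopology (vectors n) (NV n)) euclideanreal (forms_abs v T)"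
      by (intro continuous_map_from_subtopology continuous_map_forms_abs assms)
    show "continuous_map (subtopology (vectors n) (NV n)) euclideanreal (max_abs v n)"
      by (intro continuous_map_from_subtopology continuous_map_max_abs)
    show "\<And>x. x \<in> topspace (subtopology (vectors n) (NV n)) \<Longrightarrow> max_abs v n x \<noteq> 0"
      using max_abs_pos by force
  qed
qed (rule forms_ratio_pc[OF _ assms(2,1)])

lemma continuous_map_into_subtopology_points:
  "topspace (local_points Z v) = points_over Z K (to_completion v)"
  by (auto simp: local_points_def points_over_def)

text \<open>The forms \<open>\<mu> (x\<^sub>j - q\<^sub>j x\<^sub>k)\<close>, where \<open>q\<close> approximates \<open>y\<close> in the affine chart of a coordinate
  \<open>k\<close> of maximal absolute value, are small at \<open>y\<close> and large away from \<open>y\<close>.\<close>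
lemma forms_separate:
  assumes v: "v \<in> places" and U: "openin (PT n) U" "y \<in> U" and M: "M > 0"
  shows "\<exists>T. finite T \<and> T \<subseteq> forms n \<and> forms_ratio v n T y \<le> 1 \<and> (\<forall>z\<in>PS n - U. forms_ratio v n T z \<ge> M)"
proof -
  have "y \<in> PS n" using U openin_PT by blast
  then obtain x0 where x0: "x0 \<in> NV n" "y = pc n x0" by (rule PS_cases)
  obtain k where k: "k \<le> n" "max_abs v n x0 = vabs (x0 k)" by (rule max_abs_attained)
  have x0k: "x0 k \<in> carrier K" "x0 k \<noteq> \<zero>\<^bsub>K\<^esub>" using NV_closed[OF x0(1) k(1)] max_abs_pos[OF x0(1)] k(2) by auto
  then have uk: "x0 k \<in> Units K" by (simp add: K.field_Units)
  define c where "c = inv\<^bsub>K\<^esub> (x0 k)"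
  have c: "c \<in> carrier K" "c \<noteq> \<zero>\<^bsub>K\<^esub>" "c \<otimes>\<^bsub>K\<^esub> x0 k = \<one>\<^bsub>K\<^esub>"
    unfolding c_def using uk K.Units_inv_Units[OF uk] by (auto simp: K.field_Units)
  \<comment> \<open>Normalized so that \<open>x k\<close> is one. As the coordinate \<open>k\<close>
    is of maximal absolute value, all coordinates are then at most 1.\<close>
  define x where "x = (\<lambda>j\<in>{..n}. c \<otimes>\<^bsub>K\<^esub> x0 j)"
  have x: "x \<in> NV n" "y = pc n x" unfolding x_def x0(2) using scale_in_NV[OF x0(1) c(1,2)] by auto
  have xc: "x j \<in> carrier K" if "j \<le> n" for j using NV_closed[OF x(1) that] .
  have xk: "x k = \<one>\<^bsub>K\<^esub>" unfolding x_def using k c by simp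
  have mx: "max_abs v n x = 1"
    unfolding x_def using max_abs_scale[OF x0(1) c(1)] k(2) vabs_mult[OF c(1) x0k(1)] c(3) by simp
  have x1: "vabs (x j) \<le> 1" if "j \<le> n" for j using max_abs_ge[OF x(1) that] mx by simp
  have "openin (vectors n) {x \<in> NV n. pc n x \<in> U}" using U(1) openin_PT by blast
  moreover have "x \<in> {x \<in> NV n. pc n x \<in> U}" using x U(2) by simp
  ultimately have "\<exists>W. finite {j \<in> {..n}. W j \<noteq> topspace top} \<and> (\<forall>j\<in>{..n}. openin top (W j)) \<and>
      x \<in> PiE {..n} W \<and> PiE {..n} W \<subseteq> {x \<in> NV n. pc n x \<in> U}"
    unfolding openin_product_topology_alt by (rule bspec)
  then obtain W where W: "\<And>j. j \<le> n \<Longrightarrow> openin top (W j)" "x \<in> PiE {..n} W" "PiE {..n} W \<subseteq> {x \<in> NV n. pc n x \<in> U}"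
    by auto
  have "\<exists>\<delta>>0. \<forall>w\<in>carrier K. vabs (w \<ominus>\<^bsub>K\<^esub> x j) < \<delta> \<longrightarrow> w \<in> W j" if j: "j \<le> n" for j
  proof -
    have "x j \<in> W j" using W(2) j by auto
    moreover have "openin M.mtopology (W j)" using W(1)[OF j] by (simp add: top_eq)
    ultimately obtain r where r: "r > 0" "M.mball (x j) r \<subseteq> W j" unfolding M.openin_mtopology by blast
    have "w \<in> W j" if w: "w \<in> carrier K" "vabs (w \<ominus>\<^bsub>K\<^esub> x j) < r\<^sup>2" for w
    proof -
      have "sqrt (vabs (w \<ominus>\<^bsub>K\<^esub> x j)) < sqrt (r\<^sup>2)" using w(2) by (intro real_sqrt_less_mono)
      then have "w \<in> M.mball (x j) r" using w(1) xc[OF j] r(1) vabs_minus_commute[OF w(1) xc[OF j]]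
        by (simp add: M.in_mball cdist_def)
      then show ?thesis using r by blast
    qed
    then show ?thesis using r(1) by (intro exI[of _ "r\<^sup>2"]) auto
  qed
  then obtain \<delta>' where \<delta>': "\<And>j. j \<le> n \<Longrightarrow> \<delta>' j > 0" "\<And>j w. j \<le> n \<Longrightarrow> w \<in> carrier K \<Longrightarrow> vabs (w \<ominus>\<^bsub>K\<^esub> x j) < \<delta>' j \<Longrightarrow> w \<in> W j"
    by metis
  define \<delta> where "\<delta> = Min (\<delta>' ` {..n})"
  have \<delta>: "\<delta> > 0" "\<And>j. j \<le> n \<Longrightarrow> \<delta> \<le> \<delta>' j" unfolding \<delta>_def using \<delta>'(1) by auto
  obtain z where z: "v z > 1" using weak_approximation[of "{}" v] v by auto
  \<comment> \<open>Each bound serves one estimate below: \<open>4 * M\<close> for comparing all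
    coordinates of \<open>w\<close> with \<open>w k\<close>, 1 for keeping \<open>q\<close> within
    distance 1 of \<open>x\<close>, and the last one for the final distance. There
    \<open>16 * M\<close> and 1 bound the two error terms multiplied by \<open>v \<mu>\<close>, and
    the 2 in front comes from \<open>vabs_add_le\<close>.\<close>
  define B where "B = max (4 * M) (max 1 (2 * (16 * M + 1) / \<delta> + 1))"
  obtain e where "v z ^ e > B" using real_arch_pow[OF z] by blast
  then obtain \<mu> where \<mu>: "v \<mu> > B" using power[of z e] by metis
  have B: "v \<mu> > 4 * M" "v \<mu> > 1" "v \<mu> > 2 * (16 * M + 1) / \<delta>" using \<mu> unfolding B_def by auto
  have \<mu>0: "\<mu> \<noteq> 0" using B(2) by auto
  have "1 / v \<mu> > 0" using B(2) by (intro divide_pos_pos) linarith+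
  then have "\<exists>a. vabs (x j \<ominus>\<^bsub>K\<^esub> to_completion v a) < 1 / v \<mu>" if "j \<le> n" for j
    using to_completion_dense[OF xc[OF that]] by blast
  then obtain q where q: "\<And>j. j \<le> n \<Longrightarrow> vabs (x j \<ominus>\<^bsub>K\<^esub> to_completion v (q j)) < 1 / v \<mu>" by metis
  define T where "T = (\<lambda>j. (\<mu>, j, - (\<mu> * q j), k)) ` {..n}"
  have T: "finite T" "T \<subseteq> forms n" unfolding T_def forms_def using k by auto
  have neg: "to_completion v (- a) = \<ominus>\<^bsub>K\<^esub> to_completion v a" for a
    using Ka.coeff_add[of "- a" a] by (intro K.minus_equality[symmetric]) auto
  have fv: "vabs (form_value v w (\<mu>, j, - (\<mu> * q j), k)) = v \<mu> * vabs (w j \<ominus>\<^bsub>K\<^esub> to_completion v (q j) \<otimes>\<^bsub>K\<^esub> w k)"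
    if w: "w j \<in> carrier K" "w k \<in> carrier K" for w j
  proof -
    have "form_value v w (\<mu>, j, - (\<mu> * q j), k) = to_completion v \<mu> \<otimes>\<^bsub>K\<^esub> (w j \<ominus>\<^bsub>K\<^esub> to_completion v (q j) \<otimes>\<^bsub>K\<^esub> w k)"
      unfolding form_value_def using w by (simp add: neg Ka.coeff_mult K.minus_eq K.r_distr K.m_assoc K.l_minus K.r_minus)
    then show ?thesis using w by (simp add: vabs_mult)
  qed
  have "vabs (form_value v x (\<mu>, j, - (\<mu> * q j), k)) \<le> 1" if j: "j \<le> n" for j
  proof -
    have "vabs (form_value v x (\<mu>, j, - (\<mu> * q j), k)) = v \<mu> * vabs (x j \<ominus>\<^bsub>K\<^esub> to_completion v (q j))"
      using fv[of x j] xc j k xk by simp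
    also have "\<dots> \<le> v \<mu> * (1 / v \<mu>)" using q[OF j] by (intro mult_left_mono) auto
    finally show ?thesis using \<mu>0 by simp
  qed
  then have "forms_abs v T x \<le> 1"
    unfolding forms_abs_le_iff[OF T(1)] by (auto simp: T_def)
  then have "forms_ratio v n T y \<le> 1" unfolding x(2) forms_ratio_pc[OF x(1) T(2,1)] mx by simp
  \<comment> \<open>If all forms are small at \<open>z\<close>, then \<open>w k\<close> is
    comparable with the largest coordinate of \<open>w\<close>. Dividing by it gives a
    representative of \<open>z\<close> so close to \<open>x\<close> that it lies in the box
    \<open>W\<close>, and hence \<open>z\<close> would lie in \<open>U\<close>.\<close>
  moreover have "forms_ratio v n T z \<ge> M" if z: "z \<in> PS n - U" for z
  proof (rule ccontr)
    assume lt: "\<not> forms_ratio v n T z \<ge> M"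
    obtain w where w: "w \<in> NV n" "z = pc n w" using PS_cases z by blast
    have wc: "w j \<in> carrier K" if "j \<le> n" for j using NV_closed[OF w(1) that] .
    have wk: "w k \<in> carrier K" using wc k by simp
    define m where "m = max_abs v n w"
    have m: "m > 0" unfolding m_def using max_abs_pos[OF w(1)] .
    have "forms_abs v T w < M * m"
      using lt m unfolding w(2) forms_ratio_pc[OF w(1) T(2,1)] m_def by (simp add: pos_le_divide_eq not_le)
    then have lt': "v \<mu> * vabs (w j \<ominus>\<^bsub>K\<^esub> to_completion v (q j) \<otimes>\<^bsub>K\<^esub> w k) < M * m" if "j \<le> n" for j
      using forms_abs_ge[OF T(1), of "(\<mu>, j, - (\<mu> * q j), k)" w] fv[of w j] wc[OF that] wk that unfolding T_def by fastforce
    \<comment> \<open>The constant is \<open>2 * (1 + 1)\<close>: both the distance of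
      \<open>q j\<close> from \<open>x j\<close> and \<open>x j\<close> itself are at most
      1.\<close>
    have qj: "vabs (to_completion v (q j)) \<le> 4" if j: "j \<le> n" for j
    proof -
      have "to_completion v (q j) = (to_completion v (q j) \<ominus>\<^bsub>K\<^esub> x j) \<oplus>\<^bsub>K\<^esub> x j"
        using xc[OF j] by (simp add: K.minus_eq K.a_assoc K.l_neg)
      then have 1: "vabs (to_completion v (q j)) \<le> 2 * (vabs (to_completion v (q j) \<ominus>\<^bsub>K\<^esub> x j) + vabs (x j))"
        using vabs_add_le[of "to_completion v (q j) \<ominus>\<^bsub>K\<^esub> x j" "x j"] xc[OF j] by simp
      have "vabs (to_completion v (q j) \<ominus>\<^bsub>K\<^esub> x j) \<le> 1"
      proof -
        have "1 / v \<mu> \<le> 1" using B(2) by (subst divide_le_eq_1_pos) linarith+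
        then show ?thesis using q[OF j] vabs_minus_commute[OF xc[OF j], of "to_completion v (q j)"] by simp
      qed
      then have "2 * (vabs (to_completion v (q j) \<ominus>\<^bsub>K\<^esub> x j) + vabs (x j)) \<le> 2 * (1 + 1)"
        using x1[OF j] by (intro mult_left_mono add_mono) auto
      from order_trans[OF 1 this] show ?thesis by simp
    qed
    obtain l where l: "l \<le> n" "m = vabs (w l)" unfolding m_def by (rule max_abs_attained)
    \<comment> \<open>With \<open>D\<close> for the value of \<open>w l - q l * w k\<close>, one has
      \<open>m \<le> 2 * (D + 4 * vabs (w k))\<close> and \<open>4 * D < m\<close>, so half of
      \<open>m\<close> is at most \<open>8 * vabs (w k)\<close>.\<close>
    have "m \<le> 16 * vabs (w k)"
    proof -
      have "w l = (w l \<ominus>\<^bsub>K\<^esub> to_completion v (q l) \<otimes>\<^bsub>K\<^esub> w k) \<oplus>\<^bsub>K\<^esub> to_completion v (q l) \<otimes>\<^bsub>K\<^esub> w k"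
        using wc[OF l(1)] wk by (simp add: K.minus_eq K.a_assoc K.l_neg)
      then have "m \<le> 2 * (vabs (w l \<ominus>\<^bsub>K\<^esub> to_completion v (q l) \<otimes>\<^bsub>K\<^esub> w k) + vabs (to_completion v (q l) \<otimes>\<^bsub>K\<^esub> w k))"
        using vabs_add_le[of "w l \<ominus>\<^bsub>K\<^esub> to_completion v (q l) \<otimes>\<^bsub>K\<^esub> w k" "to_completion v (q l) \<otimes>\<^bsub>K\<^esub> w k"] wc[OF l(1)] wk
        unfolding l(2) by simp
      moreover have "vabs (to_completion v (q l) \<otimes>\<^bsub>K\<^esub> w k) \<le> 4 * vabs (w k)"
        using qj[OF l(1)] wk vabs_mult[of "to_completion v (q l)" "w k"] by (simp add: mult_right_mono)
      moreover have "4 * vabs (w l \<ominus>\<^bsub>K\<^esub> to_completion v (q l) \<otimes>\<^bsub>K\<^esub> w k) < m"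
      proof -
        let ?D = "vabs (w l \<ominus>\<^bsub>K\<^esub> to_completion v (q l) \<otimes>\<^bsub>K\<^esub> w k)"
        have D0: "?D \<ge> 0" using wc[OF l(1)] wk by simp
        have "M * (4 * ?D) \<le> v \<mu> * ?D" using mult_right_mono[OF less_imp_le[OF B(1)] D0] by (simp add: mult_ac)
        then have "M * (4 * ?D) < M * m" using lt'[OF l(1)] by linarith
        then show ?thesis using M by simp
      qed
      ultimately show ?thesis by argo
    qed
    then have wk0: "vabs (w k) > 0" using m by linarith
    then have "w k \<noteq> \<zero>\<^bsub>K\<^esub>" by auto
    then have uw: "w k \<in> Units K" using wk by (simp add: K.field_Units)
    define c' where "c' = inv\<^bsub>K\<^esub> (w k)"
    have c': "c' \<in> carrier K" "c' \<noteq> \<zero>\<^bsub>K\<^esub>" "c' \<otimes>\<^bsub>K\<^esub> w k = \<one>\<^bsub>K\<^esub>"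
      unfolding c'_def using uw K.Units_inv_Units[OF uw] by (auto simp: K.field_Units)
    have vc': "vabs c' * vabs (w k) = 1" using vabs_mult[OF c'(1) wk] c'(3) by simp
    define w' where "w' = (\<lambda>j\<in>{..n}. c' \<otimes>\<^bsub>K\<^esub> w j)"
    have w': "w' \<in> NV n" "pc n w' = z" unfolding w'_def w(2) using scale_in_NV[OF w(1) c'(1,2)] by auto
    have "w' j \<in> W j" if j: "j \<le> n" for j
    proof (rule \<delta>'(2)[OF j])
      show w'c: "w' j \<in> carrier K" using NV_closed[OF w'(1) j] .
      let ?D = "vabs (w' j \<ominus>\<^bsub>K\<^esub> to_completion v (q j))"
      have "w' j \<ominus>\<^bsub>K\<^esub> to_completion v (q j) = c' \<otimes>\<^bsub>K\<^esub> (w j \<ominus>\<^bsub>K\<^esub> to_completion v (q j) \<otimes>\<^bsub>K\<^esub> w k)"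
      proof -
        have "c' \<otimes>\<^bsub>K\<^esub> (w j \<ominus>\<^bsub>K\<^esub> to_completion v (q j) \<otimes>\<^bsub>K\<^esub> w k) =
            c' \<otimes>\<^bsub>K\<^esub> w j \<ominus>\<^bsub>K\<^esub> to_completion v (q j) \<otimes>\<^bsub>K\<^esub> (c' \<otimes>\<^bsub>K\<^esub> w k)"
          using c'(1) wc[OF j] wk by (simp add: K.minus_eq K.r_distr K.r_minus K.m_ac)
        then show ?thesis unfolding c'(3) w'_def using j by simp
      qed
      then have D: "?D = vabs c' * vabs (w j \<ominus>\<^bsub>K\<^esub> to_completion v (q j) \<otimes>\<^bsub>K\<^esub> w k)"
        using c'(1) wc[OF j] wk by (simp add: vabs_mult)
      have c'0: "vabs c' > 0" using vc' wk0 by (metis less_irrefl mult_zero_left not_less_iff_gr_or_eq vabs_nonneg c'(1) leD zero_less_one)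
      have "v \<mu> * ?D = vabs c' * (v \<mu> * vabs (w j \<ominus>\<^bsub>K\<^esub> to_completion v (q j) \<otimes>\<^bsub>K\<^esub> w k))" unfolding D by simp
      also have "\<dots> < vabs c' * (M * m)" using lt'[OF j] c'0 by (intro mult_strict_left_mono)
      also have "\<dots> \<le> vabs c' * (M * (16 * vabs (w k)))"
        using \<open>m \<le> 16 * vabs (w k)\<close> M c'0 by (intro mult_left_mono) auto
      also have "\<dots> = 16 * M * (vabs c' * vabs (w k))" by simp
      finally have D16: "v \<mu> * ?D < 16 * M" unfolding vc' by simp
      have "w' j \<ominus>\<^bsub>K\<^esub> x j = (w' j \<ominus>\<^bsub>K\<^esub> to_completion v (q j)) \<oplus>\<^bsub>K\<^esub> (to_completion v (q j) \<ominus>\<^bsub>K\<^esub> x j)"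
        using w'c xc[OF j] by (simp add: K.minus_eq K.a_assoc K.r_neg1)
      then have "vabs (w' j \<ominus>\<^bsub>K\<^esub> x j) \<le> 2 * (?D + vabs (x j \<ominus>\<^bsub>K\<^esub> to_completion v (q j)))"
        using vabs_add_le[of "w' j \<ominus>\<^bsub>K\<^esub> to_completion v (q j)" "to_completion v (q j) \<ominus>\<^bsub>K\<^esub> x j"] w'c xc[OF j]
          vabs_minus_commute[OF xc[OF j], of "to_completion v (q j)"] by simp
      then have "v \<mu> * vabs (w' j \<ominus>\<^bsub>K\<^esub> x j) \<le> v \<mu> * (2 * (?D + vabs (x j \<ominus>\<^bsub>K\<^esub> to_completion v (q j))))"
        using B by (intro mult_left_mono) auto
      also have "\<dots> = 2 * (v \<mu> * ?D + v \<mu> * vabs (x j \<ominus>\<^bsub>K\<^esub> to_completion v (q j)))" by (simp add: algebra_simps)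
      also have "\<dots> < 2 * (16 * M + 1)"
      proof -
        have "v \<mu> * vabs (x j \<ominus>\<^bsub>K\<^esub> to_completion v (q j)) < v \<mu> * (1 / v \<mu>)"
          using q[OF j] B by (intro mult_strict_left_mono) auto
        then show ?thesis using D16 \<mu>0 by simp
      qed
      also have "\<dots> < v \<mu> * \<delta>" using B(3) \<delta>(1) by (simp add: pos_divide_less_eq)
      finally have "vabs (w' j \<ominus>\<^bsub>K\<^esub> x j) < \<delta>" by (rule mult_left_less_imp_less) simp
      then show "vabs (w' j \<ominus>\<^bsub>K\<^esub> x j) < \<delta>' j" using \<delta>(2)[OF j] by linarith
    qed
    then have "w' \<in> PiE {..n} W" unfolding w'_def by (auto simp: PiE_iff)
    then have "z \<in> U" using W(3) w'(2) by blast
    then show False using z by simp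
  qed
  ultimately show ?thesis using T by blast
qed

text \<open>Continuity is local, and near a point the morphism is given by homogeneous polynomials,
  whose values depend continuously on the coordinate vector.\<close>

lemma continuous_map_section_morphism:
  assumes XK: "projective_variety XK" and L: "line_bundle_on XK L"
    and s: "s ` {..n} \<subseteq> global_sections XK L d" "no_common_zeros XK L (s ` {..n})"
  shows "continuous_map (local_points XK v) (local_points (image_variety XK L n s) v)
     (section_morphism XK L n s K (to_completion v))"
proof -
  let ?f = "section_morphism XK L n s K (to_completion v)" and ?N = "ambient XK"
  let ?P = "points_over XK K (to_completion v)"
  have amb: "ambient (image_variety XK L n s) = n" by (simp add: image_variety_def)
  have mp: "morphism_point XK L K (to_completion v) x n d s" if "variety_point XK K (to_completion v) x" for x
  proof -
    interpret variety_point XK K "to_completion v" x by fact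
    show ?thesis using L s by unfold_locales
  qed
  have maps: "?f P \<in> points_over (image_variety XK L n s) K (to_completion v)" if P: "P \<in> ?P" for P
  proof -
    obtain x where x: "P = pc ?N x" "variety_point XK K (to_completion v) x"
      using points_over_cases[OF XK Ka.algebra_over_axioms field_K P] .
    interpret morphism_point XK L K "to_completion v" x n d s by (rule mp[OF x(2)])
    show ?thesis using section_morphism_image x(1) by simp
  qed
  have op: "openin (local_points XK v) {P \<in> ?P. ?f P \<in> U}" if U: "openin (PT n) U" for U
  proof (subst openin_subopen, intro ballI)
    fix P0 assume "P0 \<in> {P \<in> ?P. ?f P \<in> U}"
    then have P0: "P0 \<in> ?P" "?f P0 \<in> U" by auto
    obtain x where x: "P0 = pc ?N x" "variety_point XK K (to_completion v) x"
      using points_over_cases[OF XK Ka.algebra_over_axioms field_K P0(1)] .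
    interpret x: morphism_point XK L K "to_completion v" x n d s by (rule mp[OF x(2)])
    obtain r D m where r: "r \<in> carrier (mpoly_ring ?N)" "\<exists>k. homogeneous k r" "mpoly_eval K (to_completion v) x r \<noteq> \<zero>\<^bsub>K\<^esub>"
      and D: "\<And>j. j \<le> n \<Longrightarrow> D j \<in> carrier (mpoly_ring ?N) \<and> homogeneous m (D j)"
      and loc: "\<And>y. variety_point XK K (to_completion v) y \<Longrightarrow> mpoly_eval K (to_completion v) y r \<noteq> \<zero>\<^bsub>K\<^esub> \<Longrightarrow>
       (\<lambda>j\<in>{..n}. mpoly_eval K (to_completion v) y (D j)) \<in> NV n \<and>
       ?f (pc ?N y) = pc n (\<lambda>j\<in>{..n}. mpoly_eval K (to_completion v) y (D j))"
      using x.section_morphism_locally_polynomial by metis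
    obtain k where k: "homogeneous k r" using r(2) by blast
    let ?D = "\<lambda>y. (\<lambda>j\<in>{..n}. mpoly_eval K (to_completion v) y (D j))"
    \<comment> \<open>Both conditions on \<open>y\<close>, that \<open>r\<close> does not vanish and
      that the polynomial image lies over \<open>U\<close>, are open and invariant under scaling. So
      \<open>A\<close> descends to an open neighbourhood in projective space.\<close>
    define A where "A = NV ?N \<inter> ({y \<in> topspace (vectors ?N). mpoly_eval K (to_completion v) y r \<noteq> \<zero>\<^bsub>K\<^esub>} \<inter>
      {y \<in> topspace (vectors ?N). ?D y \<in> {w \<in> NV n. pc n w \<in> U}})"
    have "openin (vectors ?N) A"
      unfolding A_def
    proof (intro openin_Int openin_NV openin_nonzero_value)
      show "continuous_map (vectors ?N) top (\<lambda>y. mpoly_eval K (to_completion v) y r)"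
        by (intro continuous_map_eval[OF r(1)] continuous_map_coordinate)
      have "continuous_map (vectors ?N) (vectors n) ?D"
        unfolding continuous_map_componentwise
        using D by (auto intro!: continuous_map_eval[of _ ?N] continuous_map_coordinate)
      then show "openin (vectors ?N) {y \<in> topspace (vectors ?N). ?D y \<in> {w \<in> NV n. pc n w \<in> U}}"
        by (rule openin_continuous_map_preimage) (use U openin_PT in blast)
    qed
    moreover have "(\<lambda>j\<in>{..?N}. c \<otimes>\<^bsub>K\<^esub> y j) \<in> A" if y: "y \<in> A" and c: "c \<in> carrier K" "c \<noteq> \<zero>\<^bsub>K\<^esub>" for y c
    proof -
      let ?cy = "\<lambda>j\<in>{..?N}. c \<otimes>\<^bsub>K\<^esub> y j"
      have yN: "y \<in> NV ?N" and yr: "mpoly_eval K (to_completion v) y r \<noteq> \<zero>\<^bsub>K\<^esub>" and yD: "?D y \<in> NV n" "pc n (?D y) \<in> U"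
        using y unfolding A_def by auto
      have yc: "\<forall>j\<le>?N. y j \<in> carrier K" using NV_closed[OF yN] by auto
      have nz: "c [^]\<^bsub>K\<^esub> (i::nat) \<noteq> \<zero>\<^bsub>K\<^esub>" "c [^]\<^bsub>K\<^esub> i \<in> carrier K" for i
        using x.nonzero_pow c by auto
      have cy: "?cy \<in> NV ?N" using scale_in_NV[OF yN c] by simp
      moreover have "?cy \<in> topspace (vectors ?N)" using openin_subset[OF openin_NV] cy by blast
      moreover have "mpoly_eval K (to_completion v) ?cy r \<noteq> \<zero>\<^bsub>K\<^esub>"
        using yr nz[of k] Ka.eval_closed[OF yc r(1)] c by (subst Ka.eval_scale[OF yc r(1) k c(1)]) (auto simp: K.integral_iff)
      moreover have "?D ?cy = (\<lambda>j\<in>{..n}. c [^]\<^bsub>K\<^esub> m \<otimes>\<^bsub>K\<^esub> ?D y j)"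
      proof
        fix j show "?D ?cy j = (\<lambda>j\<in>{..n}. c [^]\<^bsub>K\<^esub> m \<otimes>\<^bsub>K\<^esub> ?D y j) j"
          using Ka.eval_scale[OF yc _ _ c(1), of "D j" m ?cy] D by auto
      qed
      ultimately show ?thesis using scale_in_NV[OF yD(1) nz(2) nz(1), of m] yD(2) unfolding A_def by simp
    qed
    ultimately have opA: "openin (PT ?N) (pc ?N ` A)"
      by (intro openin_PT_image) (auto simp: A_def)
    have "pc ?N ` A \<inter> ?P \<subseteq> {P \<in> ?P. ?f P \<in> U}"
    proof safe
      fix y assume y: "y \<in> A" "pc ?N y \<in> ?P"
      have yN: "y \<in> NV ?N" using y(1) unfolding A_def by simp
      have "mpoly_eval K (to_completion v) y p = \<zero>\<^bsub>K\<^esub>" if "p \<in> ideal_of XK" for p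
        using y(2) self_in_pc[OF yN] that by (auto simp: points_over_def)
      then have "variety_point XK K (to_completion v) y" using yN XK by unfold_locales auto
      then show "?f (pc ?N y) \<in> U" using loc[of y] y(1) unfolding A_def by auto
    qed
    moreover have "P0 \<in> pc ?N ` A \<inter> ?P"
    proof -
      have "x \<in> A" unfolding A_def using x.x_nonzero openin_subset[OF openin_NV[of ?N]] loc[OF x(2) r(3)] r(3) P0(2) x(1) by auto
      then show ?thesis using x(1) P0(1) by blast
    qed
    moreover have "openin (local_points XK v) (pc ?N ` A \<inter> ?P)"
      unfolding local_points_def openin_subtopology using opA by blast
    ultimately show "\<exists>T. openin (local_points XK v) T \<and> P0 \<in> T \<and> T \<subseteq> {P \<in> ?P. ?f P \<in> U}" by blast
  qed
  have "continuous_map (local_points XK v) (PT n) ?f"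
    unfolding continuous_map_def continuous_map_into_subtopology_points
  proof (intro conjI allI impI)
    show "?f \<in> ?P \<rightarrow> topspace (PT n)" using maps by (auto simp: points_over_def amb)
  qed (use op in auto)
  then show ?thesis
    unfolding local_points_def[of "image_variety XK L n s"] amb continuous_map_in_subtopology
    using maps continuous_map_into_subtopology_points[of XK] by auto
qed

end

section \<open>Maxima of sections\<close>

definition lincomb_section ::
  "'k::field projective_scheme \<Rightarrow> 'k line_bundle \<Rightarrow> (nat \<Rightarrow> 'k bundle_section) \<Rightarrow> 'k form \<Rightarrow> 'k bundle_section" where
  "lincomb_section XK L s = (\<lambda>(a, i, b, j). section_lincomb XK L a (s i) b (s j))"

definition scale_form :: "'k::field \<Rightarrow> 'k form \<Rightarrow> 'k form" where
  "scale_form u = (\<lambda>(a, i, b, j). (u * a, i, u * b, j))"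

text \<open>The coordinates themselves, written with a vanishing second term so that they fit the
  type of forms.\<close>

definition unit_forms :: "nat \<Rightarrow> 'k::field form set" where
  "unit_forms n = (\<lambda>i. (1, i, 0, 0)) ` {..n}"

lemma scale_form_forms: "t \<in> forms n \<Longrightarrow> scale_form u t \<in> forms n"
  by (auto simp: forms_def scale_form_def)

lemma unit_forms_subset: "unit_forms n \<subseteq> forms n"
  by (auto simp: unit_forms_def forms_def)

lemma finite_unit_forms [simp]: "finite (unit_forms n)"
  by (simp add: unit_forms_def)

context place_completion
begin

lemma to_completion_inj: "to_completion v a = \<zero>\<^bsub>K\<^esub> \<longleftrightarrow> a = 0"
  using vabs_eq_0_iff[OF Ka.coeff_closed, of a] unfolding vabs_to_completion eq_0_iff by (rule sym)

lemma form_value_scale_form: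
  assumes "w \<in> NV n" "t \<in> forms n"
  shows "vabs (form_value v w (scale_form u t)) = v u * vabs (form_value v w t)"
proof -
  have "form_value v w (scale_form u t) = to_completion v u \<otimes>\<^bsub>K\<^esub> form_value v w t"
    using assms by (auto simp: form_value_def forms_def scale_form_def NV_closed Ka.coeff_mult K.r_distr K.m_assoc)
  then show ?thesis using form_value_closed[OF assms] by (simp add: vabs_mult)
qed

lemma forms_abs_unit_forms:
  assumes "w \<in> NV n" shows "forms_abs v (unit_forms n) w = max_abs v n w"
proof -
  have f: "form_value v w (1, i, 0, 0) = w i" if "i \<le> n" for i
    using NV_closed[OF assms that] NV_closed[OF assms, of 0] by (simp add: form_value_def)
  have "(\<lambda>t. vabs (form_value v w t)) ` unit_forms n = (\<lambda>i. vabs (w i)) ` {..n}"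
    unfolding unit_forms_def image_image using f by (intro image_cong) auto
  then have "forms_abs v (unit_forms n) w = max 0 (max_abs v n w)"
    unfolding forms_abs_def max_abs_def by (subst Max_insert[symmetric]) auto
  then show ?thesis using max_abs_pos[OF assms] by simp
qed

lemma forms_abs_bound:
  assumes "finite T" "T \<subseteq> forms n"
  shows "\<exists>M\<ge>0. \<forall>w\<in>NV n. forms_abs v T w \<le> M * max_abs v n w"
  using assms
proof (induction T)
  case empty
  then show ?case by (intro exI[of _ 0]) (simp add: forms_abs_def)
next
  case (insert t T)
  then obtain M where M: "M \<ge> 0" "\<And>w. w \<in> NV n \<Longrightarrow> forms_abs v T w \<le> M * max_abs v n w" by auto
  obtain a i b j where t: "t = (a, i, b, j)" by (cases t)
  have ij: "i \<le> n" "j \<le> n" using insert.prems t by (auto simp: forms_def)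
  \<comment> \<open>The factor 2 is the one in \<open>vabs_add_le\<close>.\<close>
  let ?M = "max M (2 * (v a + v b))"
  have "forms_abs v (insert t T) w \<le> ?M * max_abs v n w" if w: "w \<in> NV n" for w
  proof -
    have c: "w i \<in> carrier K" "w j \<in> carrier K" using NV_closed[OF w] ij by auto
    have "vabs (form_value v w t) \<le> 2 * (vabs (to_completion v a \<otimes>\<^bsub>K\<^esub> w i) + vabs (to_completion v b \<otimes>\<^bsub>K\<^esub> w j))"
      using vabs_add_le[of "to_completion v a \<otimes>\<^bsub>K\<^esub> w i" "to_completion v b \<otimes>\<^bsub>K\<^esub> w j"] c by (simp add: t form_value_def)
    also have "\<dots> = 2 * (v a * vabs (w i) + v b * vabs (w j))" using c by (simp add: vabs_mult)
    also have "\<dots> \<le> 2 * (v a * max_abs v n w + v b * max_abs v n w)"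
      using max_abs_ge[OF w] ij by (intro mult_left_mono add_mono) auto
    also have "\<dots> = 2 * (v a + v b) * max_abs v n w" by (simp add: algebra_simps)
    also have "\<dots> \<le> ?M * max_abs v n w" using max_abs_pos[OF w] by (intro mult_right_mono) auto
    finally have 1: "vabs (form_value v w t) \<le> ?M * max_abs v n w" .
    have "forms_abs v T w \<le> M * max_abs v n w" by (rule M(2)[OF w])
    also have "\<dots> \<le> ?M * max_abs v n w" using max_abs_pos[OF w] by (intro mult_right_mono) auto
    finally show ?thesis unfolding forms_abs_insert[OF insert.hyps(1)] using 1 by simp
  qed
  then show ?case using M(1) by (intro exI[of _ ?M]) auto
qed

lemma forms_abs_mono: "finite T' \<Longrightarrow> T \<subseteq> T' \<Longrightarrow> forms_abs v T w \<le> forms_abs v T' w"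
  unfolding forms_abs_def by (intro Max_mono) auto

text \<open>The sections scaled by \<open>u v\<close> dominate at \<open>v\<close>.\<close>
lemma max_sections_dominant:
  assumes S: "finite S" "v \<in> S" and T: "\<And>p. p \<in> S \<Longrightarrow> finite (T p) \<and> T p \<subseteq> forms n"
    and w: "w \<in> NV n" and one: "v (u v) \<ge> 1"
    and small: "\<And>p. p \<in> S \<Longrightarrow> p \<noteq> v \<Longrightarrow> v (u p) * forms_abs v (T p \<union> unit_forms n) w \<le> v (u v) * max_abs v n w"
  shows "max (max_abs v n w) (forms_abs v (\<Union>p\<in>S. scale_form (u p) ` (T p \<union> unit_forms n)) w) =
    v (u v) * (max_abs v n w * max 1 (forms_ratio v n (T v) (pc n w)))"
proof -
  let ?T = "\<lambda>p. T p \<union> unit_forms n" and ?m = "max_abs v n w"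
  have Tf: "finite (?T p)" "?T p \<subseteq> forms n" if "p \<in> S" for p using T[OF that] unit_forms_subset by auto
  have m: "?m > 0" by (rule max_abs_pos[OF w])
  \<comment> \<open>The unit forms contribute the maximum of the coordinates; this is where
    \<open>max 1\<close> comes from.\<close>
  have "forms_abs v (?T v) w = max (forms_abs v (T v) w) ?m"
    using T[OF S(2)] by (simp add: forms_abs_Un forms_abs_unit_forms[OF w])
  also have "\<dots> = ?m * max 1 (forms_ratio v n (T v) (pc n w))"
    using T[OF S(2)] m by (simp add: forms_ratio_pc[OF w] max_mult_distrib_left max.commute)
  finally have eq: "forms_abs v (?T v) w = ?m * max 1 (forms_ratio v n (T v) (pc n w))" .
  have fin: "finite (\<Union>p\<in>S. scale_form (u p) ` ?T p)" using S Tf by auto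
  have m_le: "?m \<le> forms_abs v (?T v) w" unfolding forms_abs_unit_forms[OF w, symmetric] using Tf S(2) by (intro forms_abs_mono) auto
  have scaled: "forms_abs v (scale_form (u p) ` ?T p) w = v (u p) * forms_abs v (?T p) w" if "p \<in> S" for p
  proof -
    have "vabs (form_value v w (scale_form (u p) t)) = v (u p) * vabs (form_value v w t)" if "t \<in> ?T p" for t
      using form_value_scale_form[OF w subsetD[OF Tf(2)[OF \<open>p \<in> S\<close>] that]] .
    then have "(\<lambda>t. vabs (form_value v w t)) ` scale_form (u p) ` ?T p = (\<lambda>a. v (u p) * a) ` (\<lambda>t. vabs (form_value v w t)) ` ?T p"
      unfolding image_image by (intro image_cong refl)
    then show ?thesis unfolding forms_abs_def
      using Max_mult_left[of "insert 0 ((\<lambda>t. vabs (form_value v w t)) ` ?T p)" "v (u p)"] Tf[OF that] by simp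
  qed
  have "max ?m (forms_abs v (\<Union>p\<in>S. scale_form (u p) ` ?T p) w) = v (u v) * forms_abs v (?T v) w"
  proof (rule antisym)
    have "?m \<le> v (u v) * forms_abs v (?T v) w"
      using mult_mono[OF one m_le] m by simp
    moreover have "forms_abs v (\<Union>p\<in>S. scale_form (u p) ` ?T p) w \<le> v (u v) * forms_abs v (?T v) w"
      unfolding forms_abs_le_iff[OF fin]
    proof (intro conjI ballI)
      show "0 \<le> v (u v) * forms_abs v (?T v) w" using forms_abs_nonneg[OF Tf(1)[OF S(2)]] by simp
      fix t assume "t \<in> (\<Union>p\<in>S. scale_form (u p) ` ?T p)"
      then obtain p where p: "p \<in> S" "t \<in> scale_form (u p) ` ?T p" by blast
      have "vabs (form_value v w t) \<le> v (u p) * forms_abs v (?T p) w"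
        unfolding scaled[OF p(1), symmetric] using Tf(1)[OF p(1)] by (intro forms_abs_ge p(2)) auto
      also have "\<dots> \<le> v (u v) * forms_abs v (?T v) w"
      proof (cases "p = v")
        case False
        have "v (u p) * forms_abs v (?T p) w \<le> v (u v) * ?m" by (rule small[OF p(1) False])
        also have "\<dots> \<le> v (u v) * forms_abs v (?T v) w" using m_le by (intro mult_left_mono) auto
        finally show ?thesis .
      qed simp
      finally show "vabs (form_value v w t) \<le> v (u v) * forms_abs v (?T v) w" .
    qed
    ultimately show "max ?m (forms_abs v (\<Union>p\<in>S. scale_form (u p) ` ?T p) w) \<le> v (u v) * forms_abs v (?T v) w" by simp
    have "v (u v) * forms_abs v (?T v) w \<le> forms_abs v (\<Union>p\<in>S. scale_form (u p) ` ?T p) w"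
      unfolding scaled[OF S(2), symmetric] using S(2) by (intro forms_abs_mono fin) auto
    then show "v (u v) * forms_abs v (?T v) w \<le> max ?m (forms_abs v (\<Union>p\<in>S. scale_form (u p) ` ?T p) w)" by simp
  qed
  then show ?thesis unfolding eq .
qed

text \<open>By the ultrametric inequality, combinations with integral coefficients do not exceed the
  largest coordinate. This is the situation at the places outside \<open>S\<close>.\<close>

lemma max_sections_integral:
  assumes v: "v \<in> finite_places" and T: "finite T" "T \<subseteq> forms n" and w: "w \<in> NV n"
    and int: "\<And>a i b j. (a, i, b, j) \<in> T \<Longrightarrow> v a \<le> 1 \<and> v b \<le> 1"
  shows "max (max_abs v n w) (forms_abs v T w) = max_abs v n w"
proof -
  let ?m = "max_abs v n w"
  have "forms_abs v T w \<le> ?m"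
    unfolding forms_abs_le_iff[OF T(1)]
  proof (intro conjI ballI)
    show "0 \<le> ?m" using max_abs_pos[OF w] by simp
    fix t assume t: "t \<in> T"
    obtain a i b j where [simp]: "t = (a, i, b, j)" by (cases t)
    have ij: "i \<le> n" "j \<le> n" using T t by (auto simp: forms_def)
    have c: "w i \<in> carrier K" "w j \<in> carrier K" using NV_closed[OF w] ij by auto
    have le: "v a' * vabs (w i') \<le> ?m" if "v a' \<le> 1" "i' \<le> n" for a' i'
      using mult_mono[OF that(1) max_abs_ge[OF w that(2)]] NV_closed[OF w that(2)] by simp
    have "vabs (form_value v w t) \<le> max (vabs (to_completion v a \<otimes>\<^bsub>K\<^esub> w i)) (vabs (to_completion v b \<otimes>\<^bsub>K\<^esub> w j))"
      using vabs_add_le_max[OF v, of "to_completion v a \<otimes>\<^bsub>K\<^esub> w i" "to_completion v b \<otimes>\<^bsub>K\<^esub> w j"] c by (simp add: form_value_def)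
    also have "\<dots> = max (v a * vabs (w i)) (v b * vabs (w j))" using c by (simp add: vabs_mult)
    also have "\<dots> \<le> ?m" using le[of a i] le[of b j] int t ij by auto
    finally show "vabs (form_value v w t) \<le> ?m" .
  qed
  then show ?thesis by simp
qed

text \<open>\<open>h\<close> stands for the absolute value of a section at a rational point or at a
  local point, so heights and height quotients are treated by the same computation.\<close>

lemma Max_sections:
  assumes w: "w \<in> NV n" and T: "finite T"
    and s: "\<And>j. j \<le> n \<Longrightarrow> h (s j) = vabs (w j)"
    and t: "\<And>t. t \<in> T \<Longrightarrow> h (lincomb_section XK L s t) = vabs (form_value v w t)"
  shows "Max (h ` (s ` {..n} \<union> lincomb_section XK L s ` T)) = max (max_abs v n w) (forms_abs v T w)"
proof -
  have 1: "h ` s ` {..n} = (\<lambda>j. vabs (w j)) ` {..n}" unfolding image_image using s by (intro image_cong) auto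
  have 2: "h ` lincomb_section XK L s ` T = (\<lambda>t. vabs (form_value v w t)) ` T" unfolding image_image using t by (intro image_cong) auto
  have "max (max_abs v n w) (forms_abs v T w) = max (max_abs v n w) (Max (insert 0 ((\<lambda>t. vabs (form_value v w t)) ` T)))"
    by (simp add: forms_abs_def)
  also have "\<dots> = Max ((\<lambda>j. vabs (w j)) ` {..n} \<union> (\<lambda>t. vabs (form_value v w t)) ` T)"
  proof (cases "T = {}")
    case True
    then show ?thesis using max_abs_pos[OF w] by (simp add: max_abs_def)
  next
    case False
    then show ?thesis using T max_abs_pos[OF w] by (simp add: Max_Un max_abs_def[symmetric])
  qed
  finally show ?thesis by (simp add: image_Un 1 2)
qed

end

section \<open>Rational and local points under the morphism\<close>

lemma type_algebra_simps:
  "carrier ring_of_type_algebra = UNIV" "mult ring_of_type_algebra = (*)" "add ring_of_type_algebra = (+)"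
  "one ring_of_type_algebra = 1" "zero ring_of_type_algebra = 0"
  by (simp_all add: ring_of_type_algebra_def)

lemma field_type_algebra: "field (ring_of_type_algebra :: 'k::field ring)"
  by (rule field_from_type_algebra)

lemma algebra_over_type_algebra: "algebra_over (ring_of_type_algebra :: 'k::field ring) (\<lambda>a. a)"
proof -
  interpret cring "ring_of_type_algebra :: 'k ring" by (rule cring_from_type_algebra)
  show ?thesis by unfold_locales (simp_all add: type_algebra_simps)
qed

locale rational_morphism_point =
  morphism_point XK L "ring_of_type_algebra :: 'k::number_field ring" "\<lambda>a. a" x n d s + place_completion v
  for XK :: "'k::number_field projective_scheme" and L x n d s and v :: "'k \<Rightarrow> real"
begin

text \<open>For the identity as coefficient map these rules would rewrite plain \<open>0\<close> and
  \<open>1\<close> into the constants of the ring record, against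
  \<open>type_algebra_simps\<close>.\<close>

declare coeff_zero [simp del] coeff_one [simp del]

abbreviation vals where "vals j \<equiv> section_value XK L ring_of_type_algebra (\<lambda>a. a) (s j) point"
abbreviation w where "w \<equiv> \<lambda>j\<in>{..n}. to_completion v (vals j)"

lemma w_NV: "w \<in> NV n"
proof -
  obtain j where j: "j \<le> n" "vals j \<noteq> 0"
    using image_vector_nonzero by (auto simp: nonzero_vectors_def type_algebra_simps)
  then have "w j \<noteq> \<zero>\<^bsub>K\<^esub>" using to_completion_inj[of "vals j"] by (metis atMost_iff restrict_apply')
  moreover have "w \<in> (\<Pi>\<^sub>E j\<in>{..n}. carrier K)" by (intro restrict_PiE_iff[THEN iffD2] ballI Ka.coeff_closed)
  ultimately show ?thesis unfolding nonzero_vectors_def using j(1) by blast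
qed

lemma lincomb_value:
  assumes "t \<in> forms n"
  shows "to_completion v (section_value XK L ring_of_type_algebra (\<lambda>a. a) (lincomb_section XK L s t) point) = form_value v w t"
proof -
  obtain a i b j where t: "t = (a, i, b, j)" by (cases t)
  have ij: "i \<le> n" "j \<le> n" using assms t by (auto simp: forms_def)
  show ?thesis unfolding t lincomb_section_def form_value_def
    using ij section_value_lincomb[OF s_global[OF ij(1)] s_global[OF ij(2)], of a b]
    by (simp add: type_algebra_simps Ka.coeff_add Ka.coeff_mult)
qed

text \<open>The representative picked by \<open>to_local_point\<close> differs from the vector of
  section values by a nonzero scalar of the number field, which disappears in the projective space
  over the completion.\<close>

lemma to_local_point_eq:
  "to_local_point n v (section_morphism XK L n s ring_of_type_algebra (\<lambda>a. a) point) = pc n w"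
proof -
  let ?P = "projective_class ring_of_type_algebra n image_vector"
  let ?y = "SOME y. y \<in> ?P"
  have "image_vector \<in> ?P"
    by (rule nonzero_vector_in_class[OF field_type_algebra image_vector_nonzero])
  then have "?y \<in> ?P" by (rule someI[where P = "\<lambda>y. y \<in> ?P"])
  then obtain c where c: "c \<noteq> 0" "?y = (\<lambda>j\<in>{..n}. c * image_vector j)"
    unfolding projective_class_def by (auto simp: type_algebra_simps)
  have "pc n (\<lambda>j\<in>{..n}. to_completion v (?y j)) = pc n w"
    using c to_completion_inj[of c] by (intro projective_class_scale[OF field_K, where c = "to_completion v c"]) (auto simp: Ka.coeff_mult)
  then show ?thesis unfolding to_local_point_def section_morphism_eq .
qed

text \<open>The rational image point satisfies the equations of the image variety, and the embedding
  into the completion commutes with evaluation.\<close>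

lemma local_image_point:
  "pc n w \<in> points_over (image_variety XK L n s) K (to_completion v)"
proof -
  let ?R = "ring_of_type_algebra :: 'k ring"
  have amb: "ambient (image_variety XK L n s) = n" by (simp add: image_variety_def)
  have "mpoly_eval K (to_completion v) y G = \<zero>\<^bsub>K\<^esub>" if y: "y \<in> pc n w" and G: "G \<in> ideal_of (image_variety XK L n s)" for y G
  proof -
    have GC: "G \<in> carrier (mpoly_ring n)" using G by (auto simp: image_variety_def)
    have wc: "\<forall>j\<le>n. w j \<in> carrier K" using NV_closed[OF w_NV] by blast
    have ev0: "mpoly_eval F (constant_function XK) y 0 = \<zero>\<^bsub>F\<^esub>" for y by (simp add: mpoly_eval_def)
    \<comment> \<open>The ideal of the image is defined by conditions on homogeneous components, so
      it contains the components of its members.\<close>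
    have Gm: "homogeneous_component m G \<in> ideal_of (image_variety XK L n s)" for m
      using G by (simp add: image_variety_def mpoly_carrier_homogeneous_component ev0
          homogeneous_component_of_homogeneous[OF homogeneous_homogeneous_component])
    have iv: "image_vector \<in> projective_class ?R n image_vector"
      by (rule nonzero_vector_in_class[OF field_type_algebra image_vector_nonzero])
    have G0: "mpoly_eval ?R (\<lambda>a. a) image_vector (homogeneous_component m G) = 0" for m
      using section_morphism_image Gm[of m] iv unfolding section_morphism_eq points_over_def
      by (auto simp: type_algebra_simps)
    have Gw: "mpoly_eval K (to_completion v) w (homogeneous_component m G) = \<zero>\<^bsub>K\<^esub>" for m
    proof -
      have "mpoly_eval K (to_completion v) w (homogeneous_component m G) =
         to_completion v (mpoly_eval ?R (\<lambda>a. a) image_vector (homogeneous_component m G))"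
        by (rule mpoly_eval_related[where rel = "\<lambda>x y. y = to_completion v x", OF algebra_over_type_algebra Ka.algebra_over_axioms])
          (use GC in \<open>auto simp: type_algebra_simps Ka.coeff_add Ka.coeff_mult mpoly_carrier_closed\<close>)
      then show ?thesis unfolding G0 by simp
    qed
    obtain c where c: "c \<in> carrier K" "c \<noteq> \<zero>\<^bsub>K\<^esub>" "y = (\<lambda>j\<in>{..n}. c \<otimes>\<^bsub>K\<^esub> w j)" using y unfolding projective_class_def by blast
    have yc: "\<forall>j\<le>n. y j \<in> carrier K" unfolding c(3) using c(1) wc by simp
    show ?thesis
    proof (rule Ka.eval_eq_zero_of_components[OF yc GC])
      fix m
      show "mpoly_eval K (to_completion v) y (homogeneous_component m G) = \<zero>\<^bsub>K\<^esub>"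
      proof -
        have "mpoly_eval K (to_completion v) y (homogeneous_component m G) = c [^]\<^bsub>K\<^esub> m \<otimes>\<^bsub>K\<^esub> \<zero>\<^bsub>K\<^esub>"
          unfolding Gw[of m, symmetric]
          by (rule Ka.eval_scale[OF wc mpoly_carrier_homogeneous_component[OF GC] homogeneous_homogeneous_component c(1)])
            (simp add: c(3))
        then show ?thesis using c(1) by simp
      qed
    qed
  qed
  then show ?thesis using pc_in_PS[OF w_NV] by (auto simp: points_over_def amb)
qed

lemma Max_values:
  assumes "finite T" "T \<subseteq> forms n"
  shows "(MAX t\<in>s ` {..n} \<union> lincomb_section XK L s ` T. v (section_value XK L ring_of_type_algebra (\<lambda>a. a) t point)) =
    max (max_abs v n w) (forms_abs v T w)"
proof (rule Max_sections[OF w_NV assms(1)])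
  fix t assume "t \<in> T"
  then show "v (section_value XK L ring_of_type_algebra (\<lambda>a. a) (lincomb_section XK L s t) point) = vabs (form_value v w t)"
    using lincomb_value[OF subsetD[OF assms(2)]] vabs_to_completion by metis
qed simp

end

locale local_morphism_point =
  place_completion v + morphism_point XK L "completion v" "to_completion v" x n d s
  for v :: "'k::number_field \<Rightarrow> real" and XK :: "'k projective_scheme" and L x n d s
begin

lemma local_maximum_eq:
  assumes "finite T" "T \<subseteq> forms n"
  shows "local_maximum XK L (s ` {..n} \<union> lincomb_section XK L s ` T) v point =
    max (max_abs v n image_vector) (forms_abs v T image_vector)"
  unfolding local_maximum_def
proof (rule Max_sections[OF image_vector_nonzero assms(1)])
  fix t assume t: "t \<in> T"
  obtain a i b j where tt: "t = (a, i, b, j)" by (cases t)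
  have ij: "i \<le> n" "j \<le> n" using assms(2) t tt by (auto simp: forms_def)
  show "vabs (section_value XK L K (to_completion v) (lincomb_section XK L s t) point) = vabs (form_value v image_vector t)"
    unfolding tt lincomb_section_def form_value_def
    using ij section_value_lincomb[OF s_global[OF ij(1)] s_global[OF ij(2)], of a b] by simp
qed simp

end

text \<open>Coefficient functions matter only on the finite set \<open>B\<close>, and their
  restrictions to it are countably many.\<close>

lemma countable_number_field: "countable (UNIV :: 'k::number_field set)"
proof -
  obtain B :: "'k set" where B: "finite B" "\<And>x. \<exists>q :: 'k \<Rightarrow> rat. x = (\<Sum>b\<in>B. of_rat (q b) * b)"
    using finite_over_rat by blast
  have "x \<in> (\<lambda>q. \<Sum>b\<in>B. of_rat (q b) * b) ` (\<Pi>\<^sub>E b\<in>B. UNIV)" for x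
  proof -
    obtain q where "x = (\<Sum>b\<in>B. of_rat (q b) * b)" using B(2) by blast
    then have "x = (\<Sum>b\<in>B. of_rat (restrict q B b) * b)" by simp
    then show ?thesis by (intro image_eqI[of _ _ "restrict q B"]) auto
  qed
  then have "UNIV \<subseteq> (\<lambda>q. \<Sum>b\<in>B. of_rat (q b) * b) ` (\<Pi>\<^sub>E b\<in>B. UNIV :: rat set)" by blast
  moreover have "countable ((\<lambda>q. \<Sum>b\<in>B. of_rat (q b) * b) ` (\<Pi>\<^sub>E b\<in>B. UNIV :: rat set))"
    using B(1) by (intro countable_image countable_PiE) auto
  ultimately show ?thesis using countable_subset by blast
qed

lemma countable_forms: "countable (forms n :: 'k::number_field form set)"
  unfolding forms_def by (intro countable_SIGMA countable_number_field) auto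

section \<open>Equidistribution\<close>

lemma space_borel_of [simp]: "space (borel_of Z) = topspace Z"
  unfolding borel_of_def by (intro space_measure_of) (auto dest: openin_subset)

lemma sets_borel_of: "sets (borel_of Z) = sigma_sets (topspace Z) {U. openin Z U}"
  unfolding borel_of_def by (intro sets_measure_of) (auto dest: openin_subset)

lemma openin_sets_borel_of: "openin Z U \<Longrightarrow> U \<in> sets (borel_of Z)"
  by (auto simp: sets_borel_of)

lemma continuous_map_measurable:
  assumes "continuous_map Z Z' f" shows "f \<in> borel_of Z \<rightarrow>\<^sub>M borel_of Z'"
  unfolding borel_of_def[of Z']
proof (rule measurable_measure_of)
  show "{U. openin Z' U} \<subseteq> Pow (topspace Z')" by (auto dest: openin_subset)
  show "f \<in> space (borel_of Z) \<rightarrow> topspace Z'" using assms by (auto simp: continuous_map_def)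
  fix U assume "U \<in> {U. openin Z' U}"
  then have "openin Z {x \<in> topspace Z. f x \<in> U}" using assms by (auto simp: continuous_map_def)
  moreover have "f -` U \<inter> space (borel_of Z) = {x \<in> topspace Z. f x \<in> U}" by auto
  ultimately show "f -` U \<inter> space (borel_of Z) \<in> sets (borel_of Z)" by (simp add: openin_sets_borel_of)
qed

lemma continuous_map_real_measurable:
  assumes "continuous_map Z euclideanreal f" shows "f \<in> borel_measurable (borel_of Z)"
proof (rule borel_measurableI)
  fix U :: "real set" assume "open U"
  then have "openin Z {x \<in> topspace Z. f x \<in> U}" using assms by (auto simp: continuous_map_def)
  moreover have "f -` U \<inter> space (borel_of Z) = {x \<in> topspace Z. f x \<in> U}" by auto
  ultimately show "f -` U \<inter> space (borel_of Z) \<in> sets (borel_of Z)" by (simp add: openin_sets_borel_of)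
qed

lemma place_prod_superset:
  assumes "finite A" "A \<subseteq> places" "{v \<in> places. G v \<noteq> 1} \<subseteq> A"
  shows "place_prod G = (\<Prod>v\<in>A. G v)"
  unfolding place_prod_def using assms by (intro prod.mono_neutral_left) auto

text \<open>\<open>place_prod\<close> runs over the places with a nontrivial factor, and this set is
  different for \<open>G\<close> and for \<open>G'\<close>. Both products are extended to one finite
  set before they are compared.\<close>

lemma place_prod_factor:
  assumes G: "finite {v \<in> places. G v \<noteq> 1}" and S: "finite S" "S \<subseteq> places"
    and eq: "\<And>v. v \<in> places \<Longrightarrow> v \<notin> S \<Longrightarrow> G' v = G v" "\<And>v. v \<in> S \<Longrightarrow> G' v = G v * f v"
  shows "place_prod G' = place_prod G * (\<Prod>v\<in>S. f v)"
proof -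
  let ?A = "S \<union> {v \<in> places. G v \<noteq> 1}"
  have A: "finite ?A" "?A \<subseteq> places" using G S by auto
  have "place_prod G' = (\<Prod>v\<in>?A. G' v)" using eq(1) by (intro place_prod_superset[OF A]) force
  also have "\<dots> = (\<Prod>v\<in>?A. G v * (if v \<in> S then f v else 1))"
    using eq S(2) by (intro prod.cong) auto
  also have "\<dots> = (\<Prod>v\<in>?A. G v) * (\<Prod>v\<in>?A. if v \<in> S then f v else 1)" by (rule prod.distrib)
  also have "(\<Prod>v\<in>?A. G v) = place_prod G" by (intro place_prod_superset[OF A, symmetric]) auto
  also have "(\<Prod>v\<in>?A. if v \<in> S then f v else 1) = (\<Prod>v\<in>S. f v)"
    using A(1) by (intro prod.mono_neutral_cong_right) auto
  finally show ?thesis .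
qed

lemma place_completion_places: "v \<in> places \<Longrightarrow> place_completion v"
  unfolding place_completion_def by (rule place_value_places)

text \<open>High powers of the dominant \<open>S\<close>-integers separate the places in \<open>S\<close>.\<close>
lemma dominant_multipliers:
  fixes S :: "('k::number_field \<Rightarrow> real) set"
  assumes S: "finite S" "S \<subseteq> places" "archimedean_places \<subseteq> S"
    and T: "\<And>v. v \<in> S \<Longrightarrow> finite (T v) \<and> T v \<subseteq> forms n"
  obtains u where
    "\<And>v a i b j. v \<in> S \<Longrightarrow> (a, i, b, j) \<in> T v \<Longrightarrow> u v * a \<in> S_integers S \<and> u v * b \<in> S_integers S"
    "\<And>v. v \<in> S \<Longrightarrow> v (u v) \<ge> 1"
    "\<And>v p w. v \<in> S \<Longrightarrow> p \<in> S \<Longrightarrow> p \<noteq> v \<Longrightarrow> w \<in> nonzero_vectors (completion v) n \<Longrightarrow>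
       v (u p) * forms_abs v (T p) w \<le> v (u v) * max_abs v n w"
proof -
  obtain e where e: "\<And>v. v \<in> S \<Longrightarrow> e v \<in> S_integers S" "\<And>v. v \<in> S \<Longrightarrow> v (e v) > 1"
    "\<And>v w. v \<in> S \<Longrightarrow> w \<in> S \<Longrightarrow> w \<noteq> v \<Longrightarrow> v (e w) < v (e v)"
    using dominant_S_integers[OF S] by blast
  define coeffs where "coeffs = (\<Union>v\<in>S. (\<lambda>(a, i, b, j). a) ` T v \<union> (\<lambda>(a, i, b, j). b) ` T v)"
  have "finite coeffs" unfolding coeffs_def using S(1) T by auto
  then obtain D where D: "D > 0" "\<And>x. x \<in> coeffs \<Longrightarrow> of_nat D * x \<in> S_integers S"
    using S_integral_multiple[OF _ S(3)] by blast
  have pv: "place_completion v" if "v \<in> S" for v using place_completion_places that S(2) by blast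
  have "\<exists>M\<ge>0. \<forall>w\<in>nonzero_vectors (completion v) n. forms_abs v (T p) w \<le> M * max_abs v n w"
    if "v \<in> S" "p \<in> S" for v p
    using place_completion.forms_abs_bound[OF pv[OF that(1)]] T[OF that(2)] by blast
  then obtain M where M: "\<And>v p. v \<in> S \<Longrightarrow> p \<in> S \<Longrightarrow> M v p \<ge> 0"
    "\<And>v p w. v \<in> S \<Longrightarrow> p \<in> S \<Longrightarrow> w \<in> nonzero_vectors (completion v) n \<Longrightarrow> forms_abs v (T p) w \<le> M v p * max_abs v n w"
    by metis
  have Dpos: "v (of_nat D) > 0" if "v \<in> S" for v
  proof -
    interpret place_completion v by (rule pv[OF that])
    show ?thesis using D(1) by simp
  qed
  \<comment> \<open>\<open>D\<close> may be small at finite places of \<open>S\<close>; a large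
    power of \<open>e v\<close> outweighs this.\<close>
  have ev1: "\<forall>\<^sub>F m in sequentially. \<forall>v\<in>S. v (e v) ^ m * v (of_nat D) \<ge> 1"
  proof (intro eventually_ball_finite[OF S(1)] ballI)
    fix v assume v: "v \<in> S"
    obtain m0 where "1 / v (of_nat D) < v (e v) ^ m0" using real_arch_pow[OF e(2)[OF v]] by blast
    then have "1 \<le> v (e v) ^ m0 * v (of_nat D)" using Dpos[OF v] by (simp add: pos_divide_less_eq)
    moreover have "v (e v) ^ m0 * v (of_nat D) \<le> v (e v) ^ m * v (of_nat D)" if "m \<ge> m0" for m
      using power_increasing[OF that, of "v (e v)"] e(2)[OF v] Dpos[OF v] by (intro mult_right_mono) auto
    ultimately have "v (e v) ^ m * v (of_nat D) \<ge> 1" if "m \<ge> m0" for m using that order_trans by blast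
    then show "\<forall>\<^sub>F m in sequentially. v (e v) ^ m * v (of_nat D) \<ge> 1" by (auto simp: eventually_sequentially)
  qed
  \<comment> \<open>Powers amplify the strict inequality between \<open>v (e p)\<close> and
    \<open>v (e v)\<close> until it beats the bound \<open>M v p\<close> for the forms belonging to
    \<open>p\<close>.\<close>
  have ev2: "\<forall>\<^sub>F m in sequentially. \<forall>v\<in>S. \<forall>p\<in>S - {v}. (v (e p) / v (e v)) ^ m * M v p < 1"
  proof (intro eventually_ball_finite[OF S(1)] ballI, intro eventually_ball_finite ballI)
    fix v p assume vp: "v \<in> S" "p \<in> S - {v}"
    interpret place_completion v by (rule pv[OF vp(1)])
    have "v (e p) / v (e v) < 1" "v (e p) / v (e v) \<ge> 0"
      using e(2)[OF vp(1)] e(3)[OF vp(1), of p] vp by (simp_all add: divide_less_eq_1)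
    then have "(\<lambda>m. (v (e p) / v (e v)) ^ m * M v p) \<longlonglongrightarrow> 0 * M v p"
      by (intro tendsto_mult LIMSEQ_realpow_zero tendsto_const)
    then show "\<forall>\<^sub>F m in sequentially. (v (e p) / v (e v)) ^ m * M v p < 1" by (intro order_tendstoD) auto
  qed (use S(1) in auto)
  obtain m where m: "\<forall>v\<in>S. v (e v) ^ m * v (of_nat D) \<ge> 1"
    "\<forall>v\<in>S. \<forall>p\<in>S - {v}. (v (e p) / v (e v)) ^ m * M v p < 1"
    using eventually_happens'[OF _ eventually_conj[OF ev1 ev2]] by auto
  show ?thesis
  \<comment> \<open>\<open>D\<close> clears the denominators of all coefficients. Being the same for
    all places, it cancels when \<open>u p\<close> is compared with \<open>u v\<close>.\<close>
  proof (rule that[of "\<lambda>v. e v ^ m * of_nat D"])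
    fix v a i b j assume v: "v \<in> S" "(a, i, b, j) \<in> T v"
    have "a \<in> coeffs" "b \<in> coeffs" unfolding coeffs_def using v by force+
    then show "e v ^ m * of_nat D * a \<in> S_integers S \<and> e v ^ m * of_nat D * b \<in> S_integers S"
      unfolding mult.assoc using S_integers_mult[OF S_integers_power[OF e(1)[OF v(1)]] D(2)] by blast
  next
    fix v assume v: "v \<in> S"
    interpret place_completion v by (rule pv[OF v])
    show "v (e v ^ m * of_nat D) \<ge> 1" using m(1) v by (simp add: mult power)
  next
    fix v p w assume v: "v \<in> S" and p: "p \<in> S" "p \<noteq> v" and w: "w \<in> nonzero_vectors (completion v) n"
    interpret place_completion v by (rule pv[OF v])
    have pos: "v (e v) ^ m > 0" by (rule zero_less_power[OF less_trans[OF zero_less_one e(2)[OF v]]])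
    have "(v (e p) / v (e v)) ^ m * M v p < 1" using m(2) v p by blast
    then have le: "v (e p) ^ m * M v p \<le> v (e v) ^ m"
      using pos by (simp add: power_divide pos_divide_less_eq less_imp_le)
    have "v (e p ^ m * of_nat D) * forms_abs v (T p) w \<le> v (e p ^ m * of_nat D) * (M v p * max_abs v n w)"
      using M(2)[OF v p(1) w] by (intro mult_left_mono) auto
    also have "\<dots> = (v (e p) ^ m * M v p) * (v (of_nat D) * max_abs v n w)" by (simp add: mult power)
    also have "\<dots> \<le> v (e v) ^ m * (v (of_nat D) * max_abs v n w)"
      using le max_abs_pos[OF w] by (intro mult_right_mono) auto
    finally show "v (e p ^ m * of_nat D) * forms_abs v (T p) w \<le> v (e v ^ m * of_nat D) * max_abs v n w"
      by (simp add: mult power mult.assoc)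
  qed
qed

section \<open>Heights of rational points and the map to the local image points\<close>

locale height_counting = bundled_variety XK L
  for XK :: "'k::number_field projective_scheme" and L :: "'k line_bundle" +
  fixes d n :: nat and V :: "(nat \<Rightarrow> 'k) set set" and a b c :: real and S :: "('k \<Rightarrow> real) set"
    and s :: "nat \<Rightarrow> 'k bundle_section" and \<tau> :: "'k adelic_point measure"
  assumes d: "d > 0" and V: "V \<subseteq> rational_points XK"
    and a: "a > 0" and c: "c > 0"
    and S: "finite S" "S \<subseteq> places" "archimedean_places \<subseteq> S"
    and sections: "s ` {..n} \<subseteq> global_sections XK L d" and nonvanishing: "no_common_zeros XK L (s ` {..n})"
    and \<tau>: "finite_measure \<tau>" "sets \<tau> = sets (borel_of (adelic_points XK))" "emeasure \<tau> (space \<tau>) \<noteq> 0"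
    and asymptotics: "\<And>P'. finite P' \<Longrightarrow> P' \<subseteq> global_sections XK L d \<Longrightarrow> s ` {..n} \<subseteq> P' \<Longrightarrow>
           (\<forall>t\<in>P' - s ` {..n}. \<exists>u\<in>S_integers S. \<exists>u'\<in>S_integers S. \<exists>h\<in>s ` {..n}. \<exists>h'\<in>s ` {..n}.
              t = section_lincomb XK L u h u' h') \<Longrightarrow>
           counting_function V (height XK L d P') \<sim>[at_top]
             (\<lambda>B. c * measure (height_measure XK L d a (s ` {..n}) \<tau> P') (topspace (adelic_points XK))
                    * B powr a * ln B powr (b - 1))"
begin

abbreviation P where "P \<equiv> s ` {..n}"
abbreviation Y where "Y \<equiv> image_points XK L n s S"
abbreviation H where "H \<equiv> height XK L d P"
abbreviation g where "g \<equiv> diagonal_image XK L n s S"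
abbreviation ad where "ad \<equiv> adelic_image XK L n s S"
abbreviation \<mu> where "\<mu> \<equiv> distr \<tau> (borel_of Y) ad"

definition rational_vector :: "('k \<Rightarrow> real) \<Rightarrow> (nat \<Rightarrow> 'k) set \<Rightarrow> nat \<Rightarrow> (nat \<Rightarrow> 'k) set" where
  "rational_vector v x = (\<lambda>j\<in>{..n}. to_completion v (section_value XK L ring_of_type_algebra (\<lambda>a. a) (s j) x))"

definition local_vector :: "('k \<Rightarrow> real) \<Rightarrow> (nat \<Rightarrow> (nat \<Rightarrow> 'k) set) set \<Rightarrow> nat \<Rightarrow> (nat \<Rightarrow> 'k) set" where
  "local_vector v x = (\<lambda>j\<in>{..n}. section_value XK L (completion v) (to_completion v) (s j) x)"

lemma topspace_Y: "topspace Y = (\<Pi>\<^sub>E v\<in>S. points_over (image_variety XK L n s) (completion v) (to_completion v))"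
proof -
  have "topspace (local_points (image_variety XK L n s) v) = points_over (image_variety XK L n s) (completion v) (to_completion v)"
    if "v \<in> S" for v
    using place_completion.continuous_map_into_subtopology_points[OF place_completion_places] that S(2) by blast
  then show ?thesis by (simp add: image_points_def cong: PiE_cong)
qed

lemma points_subset_PS:
  assumes "v \<in> S" "y \<in> topspace Y" shows "y v \<in> projective_space (completion v) n"
proof -
  have "y v \<in> points_over (image_variety XK L n s) (completion v) (to_completion v)"
    using assms unfolding topspace_Y by blast
  then show ?thesis by (simp add: points_over_def image_variety_def)
qed

lemma rational_point_cases:
  assumes "x \<in> rational_points XK" "v \<in> places"
  obtains z where "x = projective_class ring_of_type_algebra (ambient XK) z" "rational_morphism_point XK L z n d s v"
proof -
  obtain z where z: "x = projective_class ring_of_type_algebra (ambient XK) z" "variety_point XK ring_of_type_algebra (\<lambda>a. a) z"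
    using points_over_cases[OF variety algebra_over_type_algebra field_type_algebra] assms(1) unfolding rational_points_def by blast
  interpret variety_point XK "ring_of_type_algebra" "\<lambda>a. a" z by (rule z(2))
  interpret place_completion v by (rule place_completion_places[OF assms(2)])
  have "rational_morphism_point XK L z n d s v"
    by unfold_locales (rule sections nonvanishing)+
  then show ?thesis using that z(1) by blast
qed

lemma rational_vector:
  assumes "x \<in> rational_points XK" "v \<in> places"
  shows "rational_vector v x \<in> nonzero_vectors (completion v) n"
    and "to_local_point n v (section_morphism XK L n s ring_of_type_algebra (\<lambda>a. a) x) = projective_class (completion v) n (rational_vector v x)"
    and "projective_class (completion v) n (rational_vector v x) \<in> points_over (image_variety XK L n s) (completion v) (to_completion v)"
    and "finite T \<Longrightarrow> T \<subseteq> forms n \<Longrightarrow>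
      (MAX t\<in>P \<union> lincomb_section XK L s ` T. v (section_value XK L ring_of_type_algebra (\<lambda>a. a) t x)) =
      max (max_abs v n (rational_vector v x)) (forms_abs v T (rational_vector v x))"
proof -
  obtain z where z: "x = projective_class ring_of_type_algebra (ambient XK) z" "rational_morphism_point XK L z n d s v"
    using rational_point_cases[OF assms] .
  interpret rational_morphism_point XK L z n d s v by (rule z(2))
  show "rational_vector v x \<in> nonzero_vectors (completion v) n"
    unfolding rational_vector_def z(1) by (rule w_NV)
  show "to_local_point n v (section_morphism XK L n s ring_of_type_algebra (\<lambda>a. a) x) = projective_class (completion v) n (rational_vector v x)"
    unfolding rational_vector_def z(1) by (rule to_local_point_eq)
  show "projective_class (completion v) n (rational_vector v x) \<in> points_over (image_variety XK L n s) (completion v) (to_completion v)"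
    unfolding rational_vector_def z(1) by (rule local_image_point)
  show "finite T \<Longrightarrow> T \<subseteq> forms n \<Longrightarrow>
      (MAX t\<in>P \<union> lincomb_section XK L s ` T. v (section_value XK L ring_of_type_algebra (\<lambda>a. a) t x)) =
      max (max_abs v n (rational_vector v x)) (forms_abs v T (rational_vector v x))"
    unfolding rational_vector_def z(1) by (rule Max_values)
qed

lemma local_vector:
  assumes "x \<in> points_over XK (completion v) (to_completion v)" "v \<in> places"
  shows "local_vector v x \<in> nonzero_vectors (completion v) n"
    and "section_morphism XK L n s (completion v) (to_completion v) x = projective_class (completion v) n (local_vector v x)"
    and "finite T \<Longrightarrow> T \<subseteq> forms n \<Longrightarrow> local_maximum XK L (P \<union> lincomb_section XK L s ` T) v x =
      max (max_abs v n (local_vector v x)) (forms_abs v T (local_vector v x))"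
proof -
  interpret place_completion v by (rule place_completion_places[OF assms(2)])
  obtain z where z: "x = projective_class (completion v) (ambient XK) z" "variety_point XK (completion v) (to_completion v) z"
    using points_over_cases[OF variety Ka.algebra_over_axioms field_K assms(1)] .
  interpret variety_point XK "completion v" "to_completion v" z by (rule z(2))
  interpret local_morphism_point v XK L z n d s by unfold_locales (rule sections nonvanishing)+
  show "local_vector v x \<in> nonzero_vectors (completion v) n"
    unfolding local_vector_def z(1) by (rule image_vector_nonzero)
  show "section_morphism XK L n s (completion v) (to_completion v) x = projective_class (completion v) n (local_vector v x)"
    unfolding local_vector_def z(1) by (rule section_morphism_eq)
  show "finite T \<Longrightarrow> T \<subseteq> forms n \<Longrightarrow> local_maximum XK L (P \<union> lincomb_section XK L s ` T) v x =
      max (max_abs v n (local_vector v x)) (forms_abs v T (local_vector v x))"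
    unfolding local_vector_def z(1) by (rule local_maximum_eq)
qed

lemma max_abs_le: "v \<in> places \<Longrightarrow> w \<in> nonzero_vectors (completion v) n \<Longrightarrow> max (max_abs v n w) (forms_abs v {} w) = max_abs v n w"
  using place_completion.max_abs_pos[OF place_completion_places] by (fastforce simp: forms_abs_def)

lemma rational_max:
  assumes "x \<in> rational_points XK" "v \<in> places"
  shows "(MAX t\<in>P. v (section_value XK L ring_of_type_algebra (\<lambda>a. a) t x)) = max_abs v n (rational_vector v x)"
  using rational_vector(4)[OF assms, of "{}"] max_abs_le[OF assms(2) rational_vector(1)[OF assms]] by simp

lemma local_max:
  assumes "x \<in> points_over XK (completion v) (to_completion v)" "v \<in> places"
  shows "local_maximum XK L P v x = max_abs v n (local_vector v x)"
  using local_vector(3)[OF assms, of "{}"] max_abs_le[OF assms(2) local_vector(1)[OF assms]] by simp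

lemma finite_archimedean: "finite (archimedean_places :: ('k \<Rightarrow> real) set)"
  using S finite_subset by blast

text \<open>Away from finitely many places all nonzero values of the sections at \<open>x\<close>
  are units, and some value is nonzero. Finiteness matters because products over infinite sets
  default to 1, so that \<open>place_prod\<close> would not multiply anything.\<close>

lemma finite_nontrivial_max:
  assumes x: "x \<in> rational_points XK"
  shows "finite {v \<in> places. (max_abs v n (rational_vector v x)) powr (1 / real d) \<noteq> 1}"
proof -
  let ?val = "\<lambda>j. section_value XK L ring_of_type_algebra (\<lambda>a. a) (s j) x"
  have "{v \<in> places. (max_abs v n (rational_vector v x)) powr (1 / real d) \<noteq> 1} \<subseteq>
      (\<Union>j\<in>{j. j \<le> n \<and> ?val j \<noteq> 0}. {v \<in> places. v (?val j) \<noteq> 1})"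
  proof (rule subsetI, rule ccontr)
    fix v assume v: "v \<in> {v \<in> places. (max_abs v n (rational_vector v x)) powr (1 / real d) \<noteq> 1}"
      and n: "v \<notin> (\<Union>j\<in>{j. j \<le> n \<and> ?val j \<noteq> 0}. {v \<in> places. v (?val j) \<noteq> 1})"
    interpret place_completion v using v by (intro place_completion_places) auto
    have w: "rational_vector v x \<in> NV n" using rational_vector(1)[OF x] v by auto
    obtain j where j: "j \<le> n" "max_abs v n (rational_vector v x) = vabs (rational_vector v x j)" by (rule max_abs_attained)
    have e: "vabs (rational_vector v x j) = v (?val j)" using j(1) by (simp add: rational_vector_def)
    have "?val j \<noteq> 0" using max_abs_pos[OF w] j e by auto
    then have "v (?val j) = 1" using n j(1) v by blast
    then have "max_abs v n (rational_vector v x) = 1" using j e by simp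
    then show False using v by simp
  qed
  then show ?thesis
    by (rule finite_subset) (auto intro: finite_nonunit_places finite_archimedean)
qed

lemma height_eq:
  assumes "x \<in> rational_points XK"
  shows "H x = place_prod (\<lambda>v. (max_abs v n (rational_vector v x)) powr (1 / real d))"
proof -
  have "H x = place_prod (\<lambda>v. (MAX t\<in>P. v (section_value XK L ring_of_type_algebra (\<lambda>a. a) t x)) powr (1 / real d))"
    by (simp add: height_def)
  also have "\<dots> = place_prod (\<lambda>v. (max_abs v n (rational_vector v x)) powr (1 / real d))"
    unfolding place_prod_def using rational_max[OF assms] by (intro prod.cong) auto
  finally show ?thesis .
qed

lemma height_pos:
  assumes x: "x \<in> rational_points XK" shows "H x > 0"
  unfolding height_eq[OF x] place_prod_def
proof (intro prod_pos ballI)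
  fix v assume "v \<in> {v \<in> places. max_abs v n (rational_vector v x) powr (1 / real d) \<noteq> 1}"
  then have v: "v \<in> places" by simp
  show "0 < max_abs v n (rational_vector v x) powr (1 / real d)"
    using place_completion.max_abs_pos[OF place_completion_places[OF v] rational_vector(1)[OF x v]] by simp
qed

lemma diagonal_image_eq:
  "x \<in> rational_points XK \<Longrightarrow> v \<in> S \<Longrightarrow> g x v = projective_class (completion v) n (rational_vector v x)"
  using rational_vector(2) S(2) by (auto simp: diagonal_image_def)

lemma diagonal_image_Y: "x \<in> rational_points XK \<Longrightarrow> g x \<in> topspace Y"
  unfolding topspace_Y using rational_vector(2,3) S(2) by (auto simp: diagonal_image_def subset_iff)

lemma topspace_adelic: "topspace (adelic_points XK) = (\<Pi>\<^sub>E v\<in>places. points_over XK (completion v) (to_completion v))"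
proof -
  have "topspace (local_points XK v) = points_over XK (completion v) (to_completion v)" if v: "v \<in> places" for v
    by (rule place_completion.continuous_map_into_subtopology_points[OF place_completion_places[OF v]])
  then show ?thesis by (simp add: adelic_points_def cong: PiE_cong)
qed

lemma continuous_adelic_image: "continuous_map (adelic_points XK) Y ad"
  unfolding image_points_def continuous_map_componentwise
proof (intro conjI ballI)
  show "ad ` topspace (adelic_points XK) \<subseteq> extensional S" by (auto simp: adelic_image_def)
  fix v assume v: "v \<in> S"
  then have vp: "v \<in> places" using S by auto
  have "continuous_map (adelic_points XK) (local_points XK v) (\<lambda>x. x v)"
    unfolding adelic_points_def by (rule continuous_map_product_projection[OF vp])
  from continuous_map_compose[OF this place_completion.continuous_map_section_morphism[OF place_completion_places[OF vp] variety line_bundle sections nonvanishing]]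
  show "continuous_map (adelic_points XK) (local_points (image_variety XK L n s) v) (\<lambda>x. ad x v)"
    using v by (simp add: adelic_image_def comp_def)
qed

lemma space_\<tau>: "space \<tau> = topspace (adelic_points XK)"
  using sets_eq_imp_space_eq[OF \<tau>(2)] by simp

lemma measurable_adelic_image: "ad \<in> \<tau> \<rightarrow>\<^sub>M borel_of Y"
  using continuous_map_measurable[OF continuous_adelic_image] measurable_cong_sets[OF \<tau>(2) refl] by blast

text \<open>The root of order \<open>d\<close> is the one in the heights. The default 0 outside the
  space makes identities such as \<open>ratio_fun_Un\<close> hold for all arguments, so
  \<open>ratio_funs\<close> is closed under maxima as a set of functions.\<close>

definition ratio_fun :: "('k \<Rightarrow> real) \<Rightarrow> 'k form set \<Rightarrow> 'k adelic_point \<Rightarrow> real" where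
  "ratio_fun v T y = (if y \<in> topspace Y then forms_ratio v n T (y v) powr (1 / real d) else 0)"

lemma continuous_ratio_local:
  assumes "v \<in> places" "finite T" "T \<subseteq> forms n"
  shows "continuous_map (projective_topology v n) euclideanreal (\<lambda>z. forms_ratio v n T z powr (1 / real d))"
proof -
  interpret place_completion v by (rule place_completion_places[OF assms(1)])
  have "continuous_map (PT n) (top_of_set {0..}) (forms_ratio v n T)"
    unfolding continuous_map_in_subtopology
  proof
    show "continuous_map (PT n) euclidean (forms_ratio v n T)" by (rule continuous_map_forms_ratio[OF assms(2,3)])
    show "forms_ratio v n T \<in> topspace (PT n) \<rightarrow> {0..}"
    proof
      fix z assume "z \<in> topspace (PT n)"
      then obtain w where w: "w \<in> NV n" "z = pc n w" using PS_cases by auto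
      show "forms_ratio v n T z \<in> {0..}"
        unfolding w(2) forms_ratio_pc[OF w(1) assms(3,2)]
        using max_abs_pos[OF w(1)] forms_abs_nonneg[OF assms(2), of w] by simp
    qed
  qed
  moreover have "continuous_on {0..} (\<lambda>t::real. t powr (1 / real d))"
    using d by (intro continuous_on_powr') auto
  ultimately have "continuous_map (PT n) euclidean ((\<lambda>t. t powr (1 / real d)) \<circ> forms_ratio v n T)"
    by (intro continuous_map_compose[where X' = "top_of_set {0..}"]) (auto simp: continuous_map_iff_continuous)
  then show ?thesis by (simp add: comp_def)
qed

lemma continuous_Y_coordinate:
  assumes "v \<in> S" shows "continuous_map Y (projective_topology v n) (\<lambda>y. y v)"
proof -
  have amb: "ambient (image_variety XK L n s) = n" by (simp add: image_variety_def)
  have "continuous_map Y (local_points (image_variety XK L n s) v) (\<lambda>y. y v)"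
    unfolding image_points_def by (rule continuous_map_product_projection[OF assms])
  then show ?thesis unfolding local_points_def amb by (simp add: continuous_map_in_subtopology)
qed

lemma measurable_ratio_fun:
  assumes "v \<in> S" "finite T" "T \<subseteq> forms n" shows "ratio_fun v T \<in> borel_measurable \<mu>"
proof -
  have "continuous_map Y euclideanreal (\<lambda>y. forms_ratio v n T (y v) powr (1 / real d))"
    using continuous_map_compose[OF continuous_Y_coordinate[OF assms(1)] continuous_ratio_local[OF _ assms(2,3)]] assms(1) S(2)
    by (auto simp: comp_def)
  then have "(\<lambda>y. forms_ratio v n T (y v) powr (1 / real d)) \<in> borel_measurable (borel_of Y)"
    by (rule continuous_map_real_measurable)
  also have "?this \<longleftrightarrow> ratio_fun v T \<in> borel_measurable (borel_of Y)"
    by (intro measurable_cong) (simp add: ratio_fun_def)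
  finally show ?thesis by simp
qed

lemma finite_\<mu>: "finite_measure \<mu>"
  using finite_measure.finite_measure_distr[OF \<tau>(1) measurable_adelic_image] .

lemma emeasure_\<mu>_space: "emeasure \<mu> (space \<mu>) = emeasure \<tau> (space \<tau>)"
proof -
  have "ad -` topspace Y \<inter> space \<tau> = space \<tau>" using measurable_space[OF measurable_adelic_image] by auto
  then show ?thesis
    using emeasure_distr[OF measurable_adelic_image openin_sets_borel_of[OF openin_topspace]] by simp
qed

section \<open>Heights after adding scaled combinations of sections\<close>

definition scaled_forms :: "(('k \<Rightarrow> real) \<Rightarrow> 'k) \<Rightarrow> (('k \<Rightarrow> real) \<Rightarrow> 'k form set) \<Rightarrow> 'k form set" where
  "scaled_forms u T = (\<Union>p\<in>S. scale_form (u p) ` (T p \<union> unit_forms n))"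

text \<open>The assumptions on \<open>u\<close> are what \<open>dominant_multipliers\<close>
  provides for the forms \<open>T v\<close> enlarged by the unit forms.\<close>

context
  fixes T :: "('k \<Rightarrow> real) \<Rightarrow> 'k form set" and u :: "('k \<Rightarrow> real) \<Rightarrow> 'k"
  assumes T: "\<And>v. v \<in> S \<Longrightarrow> finite (T v) \<and> T v \<subseteq> forms n"
    and u_int: "\<And>v a i b j. v \<in> S \<Longrightarrow> (a, i, b, j) \<in> T v \<union> unit_forms n \<Longrightarrow> u v * a \<in> S_integers S \<and> u v * b \<in> S_integers S"
    and u_ge: "\<And>v. v \<in> S \<Longrightarrow> v (u v) \<ge> 1"
    and u_dom: "\<And>v p w. v \<in> S \<Longrightarrow> p \<in> S \<Longrightarrow> p \<noteq> v \<Longrightarrow> w \<in> nonzero_vectors (completion v) n \<Longrightarrow>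
       v (u p) * forms_abs v (T p \<union> unit_forms n) w \<le> v (u v) * max_abs v n w"
begin

abbreviation P' where "P' \<equiv> P \<union> lincomb_section XK L s ` scaled_forms u T"
abbreviation G where "G \<equiv> \<lambda>y. \<Prod>v\<in>S. 1 / max 1 (ratio_fun v (T v) y)"

text \<open>The part of the change of height that is the same for all points; it will be absorbed by
  rescaling \<open>B\<close>.\<close>

definition \<kappa> :: real where "\<kappa> = (\<Prod>v\<in>S. v (u v) powr (1 / real d))"

lemma \<kappa>_pos: "\<kappa> > 0"
  unfolding \<kappa>_def using u_ge by (intro prod_pos) force

lemma scaled_forms: "finite (scaled_forms u T)" "scaled_forms u T \<subseteq> forms n"
  unfolding scaled_forms_def using S(1) T unit_forms_subset scale_form_forms by (auto, blast+)

lemma scaled_forms_integral: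
  assumes t: "(q, i, q', j) \<in> scaled_forms u T"
  shows "q \<in> S_integers S \<and> q' \<in> S_integers S \<and> i \<le> n \<and> j \<le> n"
proof -
  have "i \<le> n \<and> j \<le> n" using t scaled_forms(2) by (auto simp: forms_def)
  moreover obtain p t0 where p: "p \<in> S" "t0 \<in> T p \<union> unit_forms n" "(q, i, q', j) = scale_form (u p) t0"
    using t unfolding scaled_forms_def by blast
  obtain q1 i1 q2 j1 where "t0 = (q1, i1, q2, j1)" by (cases t0)
  then have "q = u p * q1" "q' = u p * q2" "(q1, i1, q2, j1) \<in> T p \<union> unit_forms n"
    using p(2,3) by (simp_all add: scale_form_def)
  ultimately show ?thesis using u_int[OF p(1)] by blast
qed

lemma max_scaled_forms:
  assumes v: "v \<in> S" and w: "w \<in> nonzero_vectors (completion v) n"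
  shows "max (max_abs v n w) (forms_abs v (scaled_forms u T) w) =
    v (u v) * (max_abs v n w * max 1 (forms_ratio v n (T v) (projective_class (completion v) n w)))"
proof -
  interpret place_completion v using v S(2) by (intro place_completion_places) auto
  show ?thesis unfolding scaled_forms_def
    by (rule max_sections_dominant[where S = S and T = T and u = u])
      (use S(1) v T w u_ge[OF v] u_dom[OF v _ _ w] in auto)
qed

lemma max_scaled_forms_outside:
  assumes v: "v \<in> places" "v \<notin> S" and w: "w \<in> nonzero_vectors (completion v) n"
  shows "max (max_abs v n w) (forms_abs v (scaled_forms u T) w) = max_abs v n w"
proof -
  interpret place_completion v using v by (intro place_completion_places)
  have "v \<in> finite_places" using v S(3) by (auto simp: places_def)
  then show ?thesis
    using scaled_forms_integral v by (intro max_sections_integral scaled_forms w) (auto simp: S_integers_def)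
qed

text \<open>The vector \<open>w\<close> is arbitrary over the point \<open>y v\<close>, so the
  formula applies to images of rational points in heights and to images of adelic points in height
  quotients.\<close>

lemma local_factor:
  assumes "v \<in> S" "w \<in> nonzero_vectors (completion v) n" "y \<in> topspace Y" "y v = projective_class (completion v) n w"
  shows "(max (max_abs v n w) (forms_abs v (scaled_forms u T) w)) powr (1 / real d) =
    max_abs v n w powr (1 / real d) * (v (u v) powr (1 / real d) * max 1 (ratio_fun v (T v) y))"
proof -
  interpret place_completion v using assms(1) S(2) by (intro place_completion_places) auto
  let ?r = "forms_ratio v n (T v) (pc n w)"
  have m: "max_abs v n w > 0" by (rule max_abs_pos[OF assms(2)])
  have r: "?r \<ge> 0" using T[OF assms(1)] m forms_abs_nonneg[of "T v" w] by (simp add: forms_ratio_pc[OF assms(2)])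
  \<comment> \<open>The root is increasing on nonnegative numbers and fixes 1, so it commutes with
    this maximum.\<close>
  have "max 1 ?r powr (1 / real d) = max 1 (?r powr (1 / real d))"
  proof (cases "?r \<le> 1")
    case True
    then show ?thesis using r powr_le1[of "1 / real d" ?r] by (simp add: max_def)
  next
    case False
    then show ?thesis using ge_one_powr_ge_zero[of ?r "1 / real d"] by (simp add: max_def)
  qed
  then show ?thesis
    unfolding max_scaled_forms[OF assms(1,2)] ratio_fun_def assms(4)
    using assms(3) m by (simp add: powr_mult)
qed

lemma height_P':
  assumes x: "x \<in> rational_points XK"
  shows "height XK L d P' x = H x * (\<kappa> / G (g x))"
proof -
  have gY: "g x \<in> topspace Y" by (rule diagonal_image_Y[OF x])
  have "height XK L d P' x = place_prod (\<lambda>v. (MAX t\<in>P'. v (section_value XK L ring_of_type_algebra (\<lambda>a. a) t x)) powr (1 / real d))"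
    by (simp add: height_def)
  also have "\<dots> = place_prod (\<lambda>v. (max_abs v n (rational_vector v x)) powr (1 / real d)) *
     (\<Prod>v\<in>S. v (u v) powr (1 / real d) * max 1 (ratio_fun v (T v) (g x)))"
  proof (rule place_prod_factor[OF finite_nontrivial_max[OF x] S(1,2)])
    fix v assume v: "v \<in> places" "v \<notin> S"
    show "(MAX t\<in>P'. v (section_value XK L ring_of_type_algebra (\<lambda>a. a) t x)) powr (1 / real d) = max_abs v n (rational_vector v x) powr (1 / real d)"
      unfolding rational_vector(4)[OF x v(1) scaled_forms] max_scaled_forms_outside[OF v rational_vector(1)[OF x v(1)]] ..
  next
    fix v assume v: "v \<in> S"
    then have vp: "v \<in> places" using S by auto
    show "(MAX t\<in>P'. v (section_value XK L ring_of_type_algebra (\<lambda>a. a) t x)) powr (1 / real d) = max_abs v n (rational_vector v x) powr (1 / real d) *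
        (v (u v) powr (1 / real d) * max 1 (ratio_fun v (T v) (g x)))"
      unfolding rational_vector(4)[OF x vp scaled_forms]
      by (rule local_factor[OF v rational_vector(1)[OF x vp] gY diagonal_image_eq[OF x v]])
  qed
  also have "\<dots> = H x * (\<kappa> / G (g x))"
    unfolding height_eq[OF x] \<kappa>_def by (simp add: prod.distrib prod_dividef)
  finally show ?thesis .
qed

lemma G_bounds: "0 < G y" "G y \<le> 1"
proof -
  show "0 < G y" by (intro prod_pos) auto
  show "G y \<le> 1" by (intro prod_le_1) auto
qed

text \<open>The local computation is that of \<open>height_P'\<close>. The old height now stands in
  the numerator, so the same factor appears inverted, with the adelic image in place of the diagonal
  one.\<close>

lemma height_ratio_P':
  assumes x: "x \<in> topspace (adelic_points XK)"
  shows "height_ratio XK L d P P' x = G (ad x) / \<kappa>"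
proof -
  have adY: "ad x \<in> topspace Y" using continuous_adelic_image x by (auto simp: continuous_map_def)
  have xv: "x v \<in> points_over XK (completion v) (to_completion v)" if "v \<in> places" for v
    using x that unfolding topspace_adelic by blast
  have pos: "max_abs v n (local_vector v (x v)) > 0" if "v \<in> places" for v
    using place_completion.max_abs_pos[OF place_completion_places[OF that] local_vector(1)[OF xv[OF that] that]] .
  let ?F = "\<lambda>v. (local_maximum XK L P v (x v) / local_maximum XK L P' v (x v)) powr (1 / real d)"
  have off: "?F v = 1" if v: "v \<in> places" "v \<notin> S" for v
  proof -
    show "(local_maximum XK L P v (x v) / local_maximum XK L P' v (x v)) powr (1 / real d) = 1"
      unfolding local_vector(3)[OF xv[OF v(1)] v(1) scaled_forms] max_scaled_forms_outside[OF v local_vector(1)[OF xv[OF v(1)] v(1)]]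
        local_max[OF xv[OF v(1)] v(1)]
      using pos[OF v(1)] by simp
  qed
  have on: "?F v = 1 / (v (u v) powr (1 / real d) * max 1 (ratio_fun v (T v) (ad x)))" if v: "v \<in> S" for v
  proof -
    have vp: "v \<in> places" using v S by auto
    let ?m = "max_abs v n (local_vector v (x v))"
    let ?m' = "max ?m (forms_abs v (scaled_forms u T) (local_vector v (x v)))"
    have adv: "ad x v = projective_class (completion v) n (local_vector v (x v))"
      using v local_vector(2)[OF xv[OF vp] vp] by (simp add: adelic_image_def)
    have "?m' powr (1 / real d) = ?m powr (1 / real d) * (v (u v) powr (1 / real d) * max 1 (ratio_fun v (T v) (ad x)))"
      by (rule local_factor[OF v local_vector(1)[OF xv[OF vp] vp] adY adv])
    then show "?F v = 1 / (v (u v) powr (1 / real d) * max 1 (ratio_fun v (T v) (ad x)))"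
      unfolding local_vector(3)[OF xv[OF vp] vp scaled_forms] local_max[OF xv[OF vp] vp]
      using pos[OF vp] by (simp add: powr_divide)
  qed
  have "height_ratio XK L d P P' x = (\<Prod>v\<in>S. ?F v)"
    unfolding height_ratio_def using off by (intro place_prod_superset[OF S(1,2)]) blast
  also have "\<dots> = (\<Prod>v\<in>S. 1 / (v (u v) powr (1 / real d) * max 1 (ratio_fun v (T v) (ad x))))"
    using on by (intro prod.cong refl)
  finally show ?thesis by (simp add: \<kappa>_def prod.distrib prod_dividef)
qed

lemma P'_admissible:
  "finite P'" "P' \<subseteq> global_sections XK L d" "P \<subseteq> P'"
  "\<forall>t\<in>P' - P. \<exists>u\<in>S_integers S. \<exists>u'\<in>S_integers S. \<exists>h\<in>P. \<exists>h'\<in>P. t = section_lincomb XK L u h u' h'"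
proof -
  have l: "\<exists>u\<in>S_integers S. \<exists>u'\<in>S_integers S. \<exists>h\<in>P. \<exists>h'\<in>P. t = section_lincomb XK L u h u' h'"
    if t: "t \<in> lincomb_section XK L s ` scaled_forms u T" for t
  proof -
    obtain a i b j where ab: "(a, i, b, j) \<in> scaled_forms u T" "t = section_lincomb XK L a (s i) b (s j)"
      using t by (auto simp: lincomb_section_def)
    then show ?thesis using scaled_forms_integral[OF ab(1)] by blast
  qed
  show "finite P'" using scaled_forms by simp
  show "P' \<subseteq> global_sections XK L d"
  proof
    fix t assume "t \<in> P'"
    then show "t \<in> global_sections XK L d"
    proof
      assume "t \<in> P" then show ?thesis using sections by (rule rev_subsetD)
    next
      assume "t \<in> lincomb_section XK L s ` scaled_forms u T"
      from l[OF this] obtain q q' h h' where t: "t = section_lincomb XK L q h q' h'" "h \<in> P" "h' \<in> P" by (elim bexE)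
      show ?thesis unfolding t(1) by (rule section_lincomb_global[OF rev_subsetD[OF t(2) sections] rev_subsetD[OF t(3) sections]])
    qed
  qed
  show "P \<subseteq> P'" by (rule Un_upper1)
  show "\<forall>t\<in>P' - P. \<exists>u\<in>S_integers S. \<exists>u'\<in>S_integers S. \<exists>h\<in>P. \<exists>h'\<in>P. t = section_lincomb XK L u h u' h'"
  proof
    fix t assume "t \<in> P' - P"
    then have "t \<in> lincomb_section XK L s ` scaled_forms u T" by (elim DiffE UnE) (rule notE)
    then show "\<exists>u\<in>S_integers S. \<exists>u'\<in>S_integers S. \<exists>h\<in>P. \<exists>h'\<in>P. t = section_lincomb XK L u h u' h'" by (rule l)
  qed
qed

lemma measurable_G: "G \<in> borel_measurable \<mu>"
  using measurable_ratio_fun T by (intro borel_measurable_prod borel_measurable_divide borel_measurable_max borel_measurable_const) auto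

lemma integrable_G: "integrable \<mu> (\<lambda>y. G y powr a)"
proof -
  interpret finite_measure \<mu> by (rule finite_\<mu>)
  show ?thesis
  proof (rule integrable_const_bound[where B = 1])
    show "AE y in \<mu>. norm (G y powr a) \<le> 1"
    proof (rule AE_I2)
      fix y
      have "\<bar>G y\<bar> \<le> 1" using G_bounds[of y] by (simp only: abs_of_pos)
      then show "norm (G y powr a) \<le> 1" using powr_le1[OF less_imp_le[OF a]] by (simp only: real_norm_def abs_of_nonneg powr_ge_zero)
    qed
    show "(\<lambda>y. G y powr a) \<in> borel_measurable \<mu>"
      by (rule powr_real_measurable[OF measurable_G borel_measurable_const])
  qed
qed

text \<open>The density depends on an adelic point only through its image, so its integral can be
  computed for the push-forward \<open>\<mu>\<close>.\<close>

lemma measure_P':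
  "measure (height_measure XK L d a P \<tau> P') (topspace (adelic_points XK)) = (1 / \<kappa>) powr a * (\<integral>y. G y powr a \<partial>\<mu>)"
proof -
  interpret finite_measure \<tau> by (rule \<tau>(1))
  let ?h = "\<lambda>x. height_ratio XK L d P P' x powr a"
  have h: "?h x = (1 / \<kappa>) powr a * G (ad x) powr a" if "x \<in> space \<tau>" for x
    using that G_bounds(1)[of "ad x"] \<kappa>_pos
    by (simp only: height_ratio_P'[OF that[unfolded space_\<tau>]] powr_divide powr_one_eq_one less_imp_le) simp
  have m1: "(\<lambda>y. G y powr a) \<in> borel_measurable (borel_of Y)" using integrable_G by simp
  have m2: "(\<lambda>x. (1 / \<kappa>) powr a * G (ad x) powr a) \<in> borel_measurable \<tau>"
    using measurable_compose[OF measurable_adelic_image m1] by (intro borel_measurable_times) auto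
  have mh: "?h \<in> borel_measurable \<tau>" by (rule measurable_cong[THEN iffD2, OF _ m2]) (rule h)
  have i2: "integrable \<tau> (\<lambda>x. (1 / \<kappa>) powr a * G (ad x) powr a)"
    using integrable_G integrable_distr_eq[OF measurable_adelic_image m1] by simp
  have "emeasure (height_measure XK L d a P \<tau> P') (space \<tau>) = (\<integral>\<^sup>+x. ennreal (?h x) * indicator (space \<tau>) x \<partial>\<tau>)"
    unfolding height_measure_def using mh by (intro emeasure_density) auto
  also have "\<dots> = (\<integral>\<^sup>+x. ennreal ((1 / \<kappa>) powr a * G (ad x) powr a) \<partial>\<tau>)"
    using h by (intro nn_integral_cong) auto
  also have "\<dots> = ennreal (\<integral>x. (1 / \<kappa>) powr a * G (ad x) powr a \<partial>\<tau>)"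
    by (rule nn_integral_eq_integral[OF i2]) auto
  also have "(\<integral>x. (1 / \<kappa>) powr a * G (ad x) powr a \<partial>\<tau>) = (1 / \<kappa>) powr a * (\<integral>x. G (ad x) powr a \<partial>\<tau>)" by simp
  also have "(\<integral>x. G (ad x) powr a \<partial>\<tau>) = (\<integral>y. G y powr a \<partial>\<mu>)"
    by (rule integral_distr[OF measurable_adelic_image m1, symmetric])
  finally have "emeasure (height_measure XK L d a P \<tau> P') (space \<tau>) = ennreal ((1 / \<kappa>) powr a * (\<integral>y. G y powr a \<partial>\<mu>))" .
  moreover have "0 \<le> (1 / \<kappa>) powr a * (\<integral>y. G y powr a \<partial>\<mu>)" by simp
  ultimately show ?thesis unfolding space_\<tau>[symmetric] measure_def by (simp only: enn2real_ennreal)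
qed

text \<open>\<open>G\<close> vanishes nowhere and \<open>\<mu>\<close> is not the zero measure. A
  positive leading coefficient turns the asymptotic equivalence into a limit of quotients and later
  forces the counted sets to be finite.\<close>

lemma integral_G_pos: "(\<integral>y. G y powr a \<partial>\<mu>) > 0"
proof -
  have "(\<integral>y. G y powr a \<partial>\<mu>) \<noteq> 0"
  proof
    assume "(\<integral>y. G y powr a \<partial>\<mu>) = 0"
    then have "AE y in \<mu>. G y powr a = 0"
      using integral_nonneg_eq_0_iff_AE[OF integrable_G] by simp
    moreover have "G y powr a \<noteq> 0" for y using G_bounds(1)[of y] by simp
    ultimately have "AE y in \<mu>. False" by (simp only:)
    then have "emeasure \<mu> (space \<mu>) = 0"
      by (intro AE_iff_measurable[THEN iffD1, of "space \<mu>" \<mu> "\<lambda>_. False"] sets.top) simp_all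
    then show False using emeasure_\<mu>_space \<tau>(3) by simp
  qed
  moreover have "(\<integral>y. G y powr a \<partial>\<mu>) \<ge> 0" by simp
  ultimately show ?thesis by linarith
qed

lemma count_P':
  "((\<lambda>B. counting_function V (height XK L d P') B / (c * B powr a * ln B powr (b - 1)))
     \<longlongrightarrow> (1 / \<kappa>) powr a * (\<integral>y. G y powr a \<partial>\<mu>)) at_top"
proof -
  define M where "M = (1 / \<kappa>) powr a * (\<integral>y. G y powr a \<partial>\<mu>)"
  define f where "f = counting_function V (height XK L d P')"
  define r where "r = (\<lambda>B. c * B powr a * ln B powr (b - 1))"
  have M: "M > 0" unfolding M_def using integral_G_pos \<kappa>_pos by simp
  have eq: "c * M * B powr a * ln B powr (b - 1) = M * r B" for B by (simp add: r_def)
  have "f \<sim>[at_top] (\<lambda>B. M * r B)"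
    using asymptotics[OF P'_admissible] unfolding measure_P' f_def[symmetric] M_def[symmetric] eq .
  moreover have "\<forall>\<^sub>F B in at_top. f B \<noteq> 0 \<or> M * r B \<noteq> 0"
    using eventually_gt_at_top[of 1]
  proof eventually_elim
    case (elim B)
    then have "r B > 0" unfolding r_def using c by simp
    then show ?case using M by simp
  qed
  ultimately have "((\<lambda>B. f B / (M * r B)) \<longlongrightarrow> 1) at_top" by (rule asymp_equivD_strong)
  from tendsto_mult[OF tendsto_const[of M] this] have "((\<lambda>B. f B / r B) \<longlongrightarrow> M) at_top"
    using M by simp
  then show ?thesis unfolding f_def M_def r_def .
qed

end

text \<open>The multipliers \<open>u\<close> are chosen here and hidden again; all that remains of
  them is the constant \<open>k\<close>.\<close>

lemma counting_limit:
  assumes T: "\<And>v. v \<in> S \<Longrightarrow> finite (T v) \<and> T v \<subseteq> forms n"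
  obtains k where "k > 0" "(\<integral>y. G T y powr a \<partial>\<mu>) > 0"
    "((\<lambda>B. real (card {x \<in> V. H x * (k / G T (g x)) \<le> B}) / (c * B powr a * ln B powr (b - 1)))
      \<longlongrightarrow> (1 / k) powr a * (\<integral>y. G T y powr a \<partial>\<mu>)) at_top"
proof -
  have T': "finite (T v \<union> unit_forms n) \<and> T v \<union> unit_forms n \<subseteq> forms n" if "v \<in> S" for v
    using T[OF that] unit_forms_subset by auto
  obtain u where u: "\<And>v q i q' j. v \<in> S \<Longrightarrow> (q, i, q', j) \<in> T v \<union> unit_forms n \<Longrightarrow> u v * q \<in> S_integers S \<and> u v * q' \<in> S_integers S"
    "\<And>v. v \<in> S \<Longrightarrow> v (u v) \<ge> 1"
    "\<And>v p w. v \<in> S \<Longrightarrow> p \<in> S \<Longrightarrow> p \<noteq> v \<Longrightarrow> w \<in> nonzero_vectors (completion v) n \<Longrightarrow>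
       v (u p) * forms_abs v (T p \<union> unit_forms n) w \<le> v (u v) * max_abs v n w"
    using dominant_multipliers[OF S, of "\<lambda>v. T v \<union> unit_forms n" n, OF T'] by blast
  have h: "height XK L d (P' T u) x = H x * (\<kappa> u / G T (g x))" if "x \<in> V" for x
    by (rule height_P'[where T = T and u = u]) (fact T u | rule subsetD[OF V that])+
  have "counting_function V (height XK L d (P' T u)) B = real (card {x \<in> V. H x * (\<kappa> u / G T (g x)) \<le> B})" for B
    unfolding counting_function_def
    by (intro arg_cong[of _ _ "\<lambda>A. real (card A)"] Collect_cong conj_cong refl) (simp only: h)
  moreover have "\<kappa> u > 0" by (rule \<kappa>_pos[where T = T and u = u]) (fact T u)+
  moreover have "(\<integral>y. G T y powr a \<partial>\<mu>) > 0" by (rule integral_G_pos[where T = T and u = u]) (fact T u)+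
  moreover have "((\<lambda>B. counting_function V (height XK L d (P' T u)) B / (c * B powr a * ln B powr (b - 1)))
      \<longlongrightarrow> (1 / \<kappa> u) powr a * (\<integral>y. G T y powr a \<partial>\<mu>)) at_top"
    by (rule count_P'[where T = T and u = u]) (fact T u)+
  ultimately show ?thesis by (intro that) (simp_all only:)
qed

lemma ratio_fun_empty [simp]: "ratio_fun v {} y = 0"
  by (simp add: ratio_fun_def forms_ratio_def forms_abs_def Let_def)

text \<open>With a positive limit the cardinalities are nonzero for large bounds, and an infinite
  set would have cardinality 0.\<close>

lemma finite_bounded_height: "finite {x \<in> V. H x \<le> B}"
proof -
  \<comment> \<open>Even without chosen forms the scaled unit forms are added to \<open>P\<close>,
    so the constant \<open>k\<close> is present while the weight is 1.\<close>
  have G: "G (\<lambda>_. {}) y = 1" for y by simp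
  obtain k where k: "k > 0" "(\<integral>y. 1 powr a \<partial>\<mu>) > 0"
    "((\<lambda>B. real (card {x \<in> V. H x * k \<le> B}) / (c * B powr a * ln B powr (b - 1)))
      \<longlongrightarrow> (1 / k) powr a * (\<integral>y. 1 powr a \<partial>\<mu>)) at_top"
    by (rule counting_limit[of "\<lambda>_. {}", unfolded G div_by_1]) auto
  have "(1 / k) powr a * (\<integral>y. 1 powr a \<partial>\<mu>) > 0"
    using k(1,2) by (intro mult_pos_pos) auto
  then have "\<forall>\<^sub>F B in at_top. 0 < real (card {x \<in> V. H x * k \<le> B}) / (c * B powr a * ln B powr (b - 1))"
    by (rule order_tendstoD(1)[OF k(3)])
  from eventually_happens'[OF trivial_limit_at_top_linorder eventually_conj[OF this eventually_ge_at_top[of "B * k"]]]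
  obtain B' where B': "0 < real (card {x \<in> V. H x * k \<le> B'}) / (c * B' powr a * ln B' powr (b - 1))"
    "B * k \<le> B'" by (elim exE conjE) (rule that)
  have "card {x \<in> V. H x * k \<le> B'} \<noteq> 0"
  proof
    assume z: "card {x \<in> V. H x * k \<le> B'} = 0"
    show False using B'(1) unfolding z by (simp only: of_nat_0 div_0 less_irrefl)
  qed
  then have "finite {x \<in> V. H x * k \<le> B'}" by (rule card_ge_0_finite[OF neq0_conv[THEN iffD1]])
  moreover have "H x * k \<le> B'" if "H x \<le> B" for x
    using mult_right_mono[OF that less_imp_le[OF k(1)]] B'(2) by (rule order_trans)
  then have "{x \<in> V. H x \<le> B} \<subseteq> {x \<in> V. H x * k \<le> B'}" by (intro Collect_mono impI conjI) (simp_all only:)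
  ultimately show ?thesis by (rule rev_finite_subset)
qed

sublocale counting: weighted_counting \<mu> V H g a b c
proof -
  interpret finite_measure \<mu> by (rule finite_\<mu>)
  show "weighted_counting \<mu> V H g a c"
    by unfold_locales (use a c height_pos diagonal_image_Y finite_bounded_height V in auto)
qed

text \<open>The hypothesis counts with the weight \<open>1 / k * G T\<close>; scaling by
  \<open>k\<close> removes the constant from the weight, and its power from the limit.\<close>

lemma good_G:
  assumes T: "\<And>v. v \<in> S \<Longrightarrow> finite (T v) \<and> T v \<subseteq> forms n"
  shows "counting.good (G T)"
proof -
  obtain k where k: "k > 0" "(\<integral>y. G T y powr a \<partial>\<mu>) > 0"
    "((\<lambda>B. real (card {x \<in> V. H x * (k / G T (g x)) \<le> B}) / (c * B powr a * ln B powr (b - 1)))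
      \<longlongrightarrow> (1 / k) powr a * (\<integral>y. G T y powr a \<partial>\<mu>)) at_top"
    by (rule counting_limit[OF T])
  have G: "G T y > 0" for y by (intro prod_pos) auto
  have "h * (k / t) \<le> B \<longleftrightarrow> h \<le> B * (1 / k * t)" if "t > 0" for h t B :: real
    using k(1) that by (simp add: field_simps)
  then have "H x * (k / G T (g x)) \<le> B \<longleftrightarrow> H x \<le> B * (1 / k * G T (g x))" for x B using G by blast
  then have "((\<lambda>B. counting.weighted_count (\<lambda>y. 1 / k * G T y) B / counting.rate B)
      \<longlongrightarrow> (1 / k) powr a * (\<integral>y. G T y powr a \<partial>\<mu>)) at_top"
    using k(3) unfolding counting.weighted_count_def counting.rate_def by (simp only:)
  from counting.weighted_count_scale[OF this k(1)]
  have "((\<lambda>B. counting.weighted_count (\<lambda>y. k * (1 / k * G T y)) B / counting.rate B)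
      \<longlongrightarrow> k powr a * ((1 / k) powr a * (\<integral>y. G T y powr a \<partial>\<mu>))) at_top" .
  moreover have "k * (1 / k * t) = t" "k powr a * ((1 / k) powr a * t) = t" for t
    using k(1) by (simp_all add: powr_divide)
  ultimately show ?thesis unfolding counting.good_def by (simp only:)
qed

section \<open>Separating functions on the local image points and the conclusion\<close>

definition ratio_funs :: "('k \<Rightarrow> real) \<Rightarrow> ('k adelic_point \<Rightarrow> real) set" where
  "ratio_funs v = ratio_fun v ` {T. finite T \<and> T \<subseteq> forms n}"

lemma countable_ratio_funs: "countable (ratio_funs v)"
  unfolding ratio_funs_def by (intro countable_image countable_Collect_finite_subset countable_forms)

lemma forms_ratio_nonneg:
  assumes "v \<in> S" "finite T" "T \<subseteq> forms n" "y \<in> topspace Y"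
  shows "forms_ratio v n T (y v) \<ge> 0"
proof -
  interpret place_completion v using assms(1) S(2) by (intro place_completion_places) auto
  obtain w where w: "w \<in> NV n" "y v = pc n w" using PS_cases[OF points_subset_PS[OF assms(1,4)]] .
  show ?thesis
    unfolding w(2) forms_ratio_pc[OF w(1) assms(3,2)]
    by (intro divide_nonneg_nonneg forms_abs_nonneg[OF assms(2)] less_imp_le[OF max_abs_pos[OF w(1)]])
qed

lemma ratio_fun_Un:
  assumes v: "v \<in> S" and T: "finite T" "T \<subseteq> forms n" "finite T'" "T' \<subseteq> forms n"
  shows "ratio_fun v (T \<union> T') y = max (ratio_fun v T y) (ratio_fun v T' y)"
proof (cases "y \<in> topspace Y")
  case True
  interpret place_completion v using v S(2) by (intro place_completion_places) auto
  obtain w where w: "w \<in> NV n" "y v = pc n w" using PS_cases[OF points_subset_PS[OF v True]] .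
  have U: "finite (T \<union> T')" "T \<union> T' \<subseteq> forms n" using T by auto
  have "forms_ratio v n (T \<union> T') (y v) = max (forms_ratio v n T (y v)) (forms_ratio v n T' (y v))"
    unfolding w(2) forms_ratio_pc[OF w(1) U(2,1)] forms_ratio_pc[OF w(1) T(2,1)] forms_ratio_pc[OF w(1) T(4,3)] forms_abs_Un[OF T(1,3)]
    using max_abs_pos[OF w(1)] by (simp only: max_divide_distrib_right less_imp_le if_True)
  moreover have "max p q powr (1 / real d) = max (p powr (1 / real d)) (q powr (1 / real d))" if "p \<ge> 0" "q \<ge> 0" for p q :: real
    using powr_mono2[of "1 / real d" p q] powr_mono2[of "1 / real d" q p] that by (cases "p \<le> q") (simp_all add: max_def)
  ultimately show ?thesis
    using True forms_ratio_nonneg[OF v T(1,2) True] forms_ratio_nonneg[OF v T(3,4) True] by (simp only: ratio_fun_def if_True)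
qed (simp add: ratio_fun_def)

lemma ratio_funs_separate:
  assumes v: "v \<in> S" and U: "openin (projective_topology v n) U" and y: "y \<in> topspace Y" "y v \<in> U" and M: "M > 0"
  shows "\<exists>f\<in>ratio_funs v. f y \<le> 1 \<and> (\<forall>z\<in>topspace Y. z v \<notin> U \<longrightarrow> f z \<ge> M)"
proof -
  have vp: "v \<in> places" using v S(2) by auto
  interpret place_completion v by (rule place_completion_places[OF vp])
  \<comment> \<open>Asking for \<open>M powr d\<close> compensates for the root of order
    \<open>d\<close> in \<open>ratio_fun\<close>.\<close>
  have "M powr d > 0" using M by simp
  from forms_separate[OF vp U y(2) this] obtain T where T: "finite T" "T \<subseteq> forms n" "forms_ratio v n T (y v) \<le> 1"
    "\<And>z. z \<in> PS n - U \<Longrightarrow> forms_ratio v n T z \<ge> M powr d" by blast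
  have "forms_ratio v n T (y v) powr (1 / real d) \<le> 1 powr (1 / real d)"
    using forms_ratio_nonneg[OF v T(1,2) y(1)] T(3) by (intro powr_mono2) auto
  then have "ratio_fun v T y \<le> 1" using y(1) by (simp add: ratio_fun_def)
  moreover have "ratio_fun v T z \<ge> M" if z: "z \<in> topspace Y" "z v \<notin> U" for z
  proof -
    have "M = (M powr d) powr (1 / real d)" using M d by (simp add: powr_powr)
    also have "\<dots> \<le> forms_ratio v n T (z v) powr (1 / real d)"
      using points_subset_PS[OF v z(1)] z(2) by (intro powr_mono2 T(4)) auto
    finally show ?thesis using z(1) by (simp add: ratio_fun_def)
  qed
  ultimately show ?thesis using T(1,2) unfolding ratio_funs_def by blast
qed

lemma openin_ratio_level:
  assumes "v \<in> S" "finite T" "T \<subseteq> forms n" "open A"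
  shows "openin (projective_topology v n) {z \<in> topspace (projective_topology v n). forms_ratio v n T z powr (1 / real d) \<in> A}"
  using openin_continuous_map_preimage[OF continuous_ratio_local[OF _ assms(2,3)]] assms(1,4) S(2) by auto

lemma point_in_topspace: "v \<in> S \<Longrightarrow> y \<in> topspace Y \<Longrightarrow> y v \<in> topspace (projective_topology v n)"
  using points_subset_PS place_completion.topspace_PT[OF place_completion_places] S(2) by blast

text \<open>The preimage of \<open>A\<close> comes from an open set of the projective space at the
  single place \<open>v\<close>. Separation therefore takes place there, and the new function
  belongs to the same place.\<close>

lemma ratio_funs_level:
  assumes v: "v \<in> S" and f: "f \<in> ratio_funs v" and A: "open A" and y: "y \<in> topspace Y" "f y \<in> A" and M: "M > 0"
  shows "\<exists>f'\<in>ratio_funs v. f' y \<le> 1 \<and> (\<forall>z\<in>topspace Y. f z \<notin> A \<longrightarrow> f' z \<ge> M)"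
proof -
  obtain T where T: "finite T" "T \<subseteq> forms n" "f = ratio_fun v T" using f unfolding ratio_funs_def by blast
  let ?U = "{z \<in> topspace (projective_topology v n). forms_ratio v n T z powr (1 / real d) \<in> A}"
  have iff: "z v \<in> ?U \<longleftrightarrow> f z \<in> A" if "z \<in> topspace Y" for z
    using point_in_topspace[OF v that] that by (simp add: T(3) ratio_fun_def)
  have "\<exists>f'\<in>ratio_funs v. f' y \<le> 1 \<and> (\<forall>z\<in>topspace Y. z v \<notin> ?U \<longrightarrow> f' z \<ge> M)"
    by (rule ratio_funs_separate[OF v openin_ratio_level[OF v T(1,2) A] y(1) iff[OF y(1), THEN iffD2, OF y(2)] M])
  then show ?thesis using iff by (simp only: cong: ball_cong)
qed

text \<open>Around \<open>y\<close> an open set contains a product of local neighbourhoods, and at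
  each place a separating function is at least 2 outside its neighbourhood. The gap between the
  bounds 1 and 2 leaves room for the choice of a null level.\<close>

lemma ratio_funs_basis:
  assumes U: "openin Y U" "y \<in> U"
  shows "\<exists>\<phi>. (\<forall>v\<in>S. \<phi> v \<in> ratio_funs v \<and> \<phi> v y \<le> 1) \<and> {z \<in> topspace Y. \<forall>v\<in>S. \<phi> v z < 2} \<subseteq> U"
proof -
  let ?Z = "image_variety XK L n s"
  have y: "y \<in> topspace Y" using U openin_subset by blast
  from bspec[OF U(1)[unfolded image_points_def openin_product_topology_alt] U(2)]
  obtain A where A: "\<forall>v\<in>S. openin (local_points ?Z v) (A v)" "y \<in> Pi\<^sub>E S A" "Pi\<^sub>E S A \<subseteq> U"
    by (elim exE conjE) (rule that)
  have "\<exists>f\<in>ratio_funs v. f y \<le> 1 \<and> (\<forall>z\<in>topspace Y. z v \<notin> A v \<longrightarrow> f z \<ge> 2)" if v: "v \<in> S" for v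
  proof -
    let ?pts = "points_over ?Z (completion v) (to_completion v)"
    have e: "local_points ?Z v = subtopology (projective_topology v n) ?pts"
      by (simp add: local_points_def image_variety_def)
    from bspec[OF A(1) v, unfolded e openin_subtopology]
    obtain A' where A': "openin (projective_topology v n) A'" "A v = A' \<inter> ?pts" by (elim exE conjE) (rule that)
    have "y v \<in> A'" using PiE_mem[OF A(2) v] unfolding A'(2) by (rule IntD1)
    from ratio_funs_separate[OF v A'(1) y this, of 2, OF zero_less_numeral]
    obtain f where f: "f \<in> ratio_funs v" "f y \<le> 1" "\<forall>z\<in>topspace Y. z v \<notin> A' \<longrightarrow> f z \<ge> 2"
      by (elim bexE conjE) (rule that)
    have n: "z v \<notin> A'" if z: "z \<in> topspace Y" "z v \<notin> A v" for z
    proof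
      assume "z v \<in> A'"
      then have "z v \<in> A v" unfolding A'(2) using PiE_mem[OF z(1)[unfolded topspace_Y] v] by (rule IntI)
      with z(2) show False by (rule notE)
    qed
    have "\<forall>z\<in>topspace Y. z v \<notin> A v \<longrightarrow> f z \<ge> 2" by (intro ballI impI) (rule f(3)[THEN bspec, THEN mp, OF _ n])
    with f(1,2) show ?thesis by (intro bexI[of _ f] conjI)
  qed
  then have "\<forall>v\<in>S. \<exists>f. f \<in> ratio_funs v \<and> f y \<le> 1 \<and> (\<forall>z\<in>topspace Y. z v \<notin> A v \<longrightarrow> f z \<ge> 2)"
    unfolding Bex_def by (rule ballI)
  from bchoice[OF this] obtain \<phi> where \<phi>: "\<forall>v\<in>S. \<phi> v \<in> ratio_funs v \<and> \<phi> v y \<le> 1 \<and>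
    (\<forall>z\<in>topspace Y. z v \<notin> A v \<longrightarrow> \<phi> v z \<ge> 2)" by (elim exE) (rule that)
  have zU: "z \<in> U" if z: "z \<in> topspace Y" "\<forall>v\<in>S. \<phi> v z < 2" for z
  proof -
    have "z v \<in> A v" if v: "v \<in> S" for v
    proof (rule ccontr)
      assume "z v \<notin> A v"
      then have "\<phi> v z \<ge> 2" using \<phi> v z(1) by simp
      then show False using bspec[OF z(2) v] by (rule leD[THEN notE])
    qed
    moreover have "z \<in> extensional S" using z(1) unfolding topspace_Y by (simp only: PiE_iff)
    ultimately have "z \<in> Pi\<^sub>E S A" by (simp add: PiE_iff)
    then show ?thesis using A(3) by (rule rev_subsetD)
  qed
  have sub: "{z \<in> topspace Y. \<forall>v\<in>S. \<phi> v z < 2} \<subseteq> U"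
    by (rule subsetI, elim CollectE conjE, rule zU)
  have "\<forall>v\<in>S. \<phi> v \<in> ratio_funs v \<and> \<phi> v y \<le> 1" using \<phi> by simp
  from this sub show ?thesis by (intro exI[of _ \<phi>] conjI)
qed

lemma good_indicator:
  assumes W: "W \<in> sets \<mu>" "measure \<mu> (Y frontier_of W) = 0"
  shows "counting.good (indicator W)"
proof (rule counting.good_of_frontier_null[where F = ratio_funs and S = S and Y = Y])
  show "topspace Y = space \<mu>" by simp
  show "U \<in> sets \<mu>" if "openin Y U" for U using openin_sets_borel_of[OF that] by simp
  show "finite S" by (rule S(1))
  show "countable (ratio_funs v)" for v by (rule countable_ratio_funs)
  show "(\<lambda>y. max (f y) (f' y)) \<in> ratio_funs v" if "v \<in> S" "f \<in> ratio_funs v" "f' \<in> ratio_funs v" for v f f'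
  proof -
    obtain T T' where T: "finite T" "T \<subseteq> forms n" "f = ratio_fun v T" "finite T'" "T' \<subseteq> forms n" "f' = ratio_fun v T'"
      using \<open>f \<in> ratio_funs v\<close> \<open>f' \<in> ratio_funs v\<close> unfolding ratio_funs_def by blast
    have "(\<lambda>y. max (f y) (f' y)) = ratio_fun v (T \<union> T')"
      unfolding T(3,6) ratio_fun_Un[OF \<open>v \<in> S\<close> T(1,2,4,5)] ..
    then show ?thesis unfolding ratio_funs_def using T(1,2,4,5) by (simp only:) (intro imageI, blast)
  qed
  show "(\<lambda>_. 0) \<in> ratio_funs v" for v
    unfolding ratio_funs_def by (rule image_eqI[of _ _ "{}"]) auto
  show "f \<in> borel_measurable \<mu>" if "v \<in> S" "f \<in> ratio_funs v" for v f
    using that measurable_ratio_fun unfolding ratio_funs_def by blast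
  show "counting.good (\<lambda>y. \<Prod>v\<in>S. 1 / max 1 (\<phi> v y))" if \<phi>: "\<And>v. v \<in> S \<Longrightarrow> \<phi> v \<in> ratio_funs v" for \<phi>
  proof -
    have "\<forall>v\<in>S. \<exists>T. finite T \<and> T \<subseteq> forms n \<and> \<phi> v = ratio_fun v T" using \<phi> unfolding ratio_funs_def by blast
    then obtain T where T: "\<And>v. v \<in> S \<Longrightarrow> finite (T v) \<and> T v \<subseteq> forms n" "\<And>v. v \<in> S \<Longrightarrow> \<phi> v = ratio_fun v (T v)"
      unfolding bchoice_iff by blast
    have "(\<lambda>y. \<Prod>v\<in>S. 1 / max 1 (\<phi> v y)) = G T" using T(2) by (intro ext prod.cong) auto
    then show ?thesis using good_G[OF T(1)] by (simp only:)
  qed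
  show "\<exists>f'\<in>ratio_funs v. f' y \<le> 1 \<and> (\<forall>z\<in>space \<mu>. f z \<ge> r \<longrightarrow> f' z \<ge> M)"
    if "v \<in> S" "f \<in> ratio_funs v" "y \<in> space \<mu>" "f y < r" "M > 0" for v f y M r
    using ratio_funs_level[of v f "{..<r}" y M] that by (simp add: not_less)
  show "\<exists>f'\<in>ratio_funs v. f' y \<le> 1 \<and> (\<forall>z\<in>space \<mu>. f z \<le> r \<longrightarrow> f' z \<ge> M)"
    if "v \<in> S" "f \<in> ratio_funs v" "y \<in> space \<mu>" "f y > r" "M > 0" for v f y M r
    using ratio_funs_level[of v f "{r<..}" y M] that by (simp add: not_less)
  show "\<exists>\<phi>. (\<forall>v\<in>S. \<phi> v \<in> ratio_funs v \<and> \<phi> v y \<le> 1) \<and> {z \<in> space \<mu>. \<forall>v\<in>S. \<phi> v z < 2} \<subseteq> U"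
    if "openin Y U" "y \<in> U" for U y
    using ratio_funs_basis[OF that] by simp
  show "W \<in> sets \<mu>" by (rule W(1))
  show "measure \<mu> (Y frontier_of W) = 0" by (rule W(2))
qed

lemma counting_indicator_limit:
  assumes W: "W \<in> sets \<mu>" "measure \<mu> (Y frontier_of W) = 0"
  shows "((\<lambda>B. counting_function {x \<in> V. g x \<in> W} H B / counting.rate B) \<longlongrightarrow> measure \<mu> W) at_top"
proof -
  have "((\<lambda>B. counting.weighted_count (indicator W) B / counting.rate B) \<longlongrightarrow> measure \<mu> W) at_top"
    using good_indicator[OF W] unfolding counting.good_def counting.integral_indicator_powr[OF W(1)] .
  moreover have "\<forall>\<^sub>F B in at_top. counting.weighted_count (indicator W) B / counting.rate B =
      counting_function {x \<in> V. g x \<in> W} H B / counting.rate B"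
    using eventually_gt_at_top[of 0]
    by eventually_elim (simp add: counting.weighted_count_indicator counting_function_def conj_assoc)
  ultimately show ?thesis by (rule Lim_transform_eventually)
qed

lemma measure_normalized:
  "measure \<mu> (space \<mu>) > 0" "measure (normalized \<mu>) A = measure \<mu> A / measure \<mu> (space \<mu>)" "prob_space (normalized \<mu>)"
proof -
  let ?m = "measure \<mu> (space \<mu>)"
  have E: "emeasure \<mu> A = ennreal (measure \<mu> A)" for A by (rule counting.emeasure_eq_measure)
  have "emeasure \<mu> (space \<mu>) \<noteq> 0" using emeasure_\<mu>_space \<tau>(3) by simp
  then have "?m \<noteq> 0" by (auto simp only: E ennreal_0)
  then show m: "?m > 0" using measure_nonneg[of \<mu> "space \<mu>"] by (simp only: order_le_neq_trans not_sym)
  have "1 / emeasure \<mu> (space \<mu>) = ennreal (1 / ?m)"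
    unfolding E using divide_ennreal[OF zero_le_one m] by (simp only: ennreal_1)
  then have e: "emeasure (normalized \<mu>) A = ennreal (measure \<mu> A / ?m)" for A
    unfolding normalized_def emeasure_scale_measure E using ennreal_mult[of "1 / ?m" "measure \<mu> A"] by simp
  then show "measure (normalized \<mu>) A = measure \<mu> A / ?m" by (simp add: measure_def[of "normalized \<mu>"])
  show "prob_space (normalized \<mu>)"
  proof
    have "space (normalized \<mu>) = space \<mu>" by (simp only: normalized_def space_scale_measure)
    then show "emeasure (normalized \<mu>) (space (normalized \<mu>)) = 1" using e m by simp
  qed
qed

text \<open>Numerator and denominator are compared with the same \<open>rate\<close>, which cancels.
  The denominator is the case of the whole space, whose frontier is empty; its limit, the total
  mass, is the normalizing constant.\<close>

theorem equidistributed_normalized: "equidistributed V g H Y (normalized \<mu>)"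
  unfolding equidistributed_def
proof (intro conjI ballI impI)
  show "prob_space (normalized \<mu>)" by (rule measure_normalized)
  show s: "sets (normalized \<mu>) = sets (borel_of Y)" by (simp add: normalized_def)
  fix W assume W: "W \<in> sets (normalized \<mu>)" "measure (normalized \<mu>) (Y frontier_of W) = 0"
  note m = measure_normalized(1)
  have W': "W \<in> sets \<mu>" using W(1) unfolding s by simp
  have "measure \<mu> (Y frontier_of W) = 0" using W(2) m unfolding measure_normalized(2) by simp
  note limW = counting_indicator_limit[OF W' this]
  have "((\<lambda>B. counting_function {x \<in> V. g x \<in> topspace Y} H B / counting.rate B) \<longlongrightarrow> measure \<mu> (topspace Y)) at_top"
    by (rule counting_indicator_limit) (simp_all add: openin_sets_borel_of frontier_of_topspace)
  moreover have "{x \<in> V. g x \<in> topspace Y} = V" using diagonal_image_Y V by blast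
  ultimately have "((\<lambda>B. counting_function V H B / counting.rate B) \<longlongrightarrow> measure \<mu> (space \<mu>)) at_top" by simp
  from tendsto_divide[OF limW this]
  have "((\<lambda>B. (counting_function {x \<in> V. g x \<in> W} H B / counting.rate B) / (counting_function V H B / counting.rate B))
      \<longlongrightarrow> measure (normalized \<mu>) W) at_top"
    using m unfolding measure_normalized(2) by simp
  moreover have "\<forall>\<^sub>F B in at_top. (counting_function {x \<in> V. g x \<in> W} H B / counting.rate B) / (counting_function V H B / counting.rate B)
      = counting_function {x \<in> V. g x \<in> W} H B / counting_function V H B"
    using counting.eventually_rate_pos by eventually_elim simp
  ultimately show "((\<lambda>B. counting_function {x \<in> V. g x \<in> W} H B / counting_function V H B) \<longlongrightarrow> measure (normalized \<mu>) W) at_top"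
    by (rule Lim_transform_eventually)
qed

end

theorem theorem1p1:
  fixes XK :: "'k::number_field projective_scheme"
    and L :: "'k line_bundle"
    and d n :: nat
    and V :: "(nat \<Rightarrow> 'k) set set"
    and a b c :: real
    and S :: "('k \<Rightarrow> real) set"
    and s :: "nat \<Rightarrow> 'k bundle_section"
    and P :: "'k bundle_section set"
    and \<tau> :: "'k adelic_point measure"
  assumes "projective_variety XK"
    and "line_bundle_on XK L" and "big XK L" and "semiample XK L"
    and "d > 0" and "base_point_free XK L d"
    and "V \<subseteq> rational_points XK"
    and "a > 0" and "b \<ge> 1" and "c > 0"
    and "finite S" and "S \<subseteq> places" and "archimedean_places \<subseteq> S"
    and "P = s ` {..n}" and "P \<subseteq> global_sections XK L d" and "no_common_zeros XK L P"
    and "finite_measure \<tau>" and "sets \<tau> = sets (borel_of (adelic_points XK))"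
    and "emeasure \<tau> (space \<tau>) \<noteq> 0"
    and "\<And>P'. finite P' \<Longrightarrow> P' \<subseteq> global_sections XK L d \<Longrightarrow> P \<subseteq> P' \<Longrightarrow>
           (\<forall>t\<in>P' - P. \<exists>u\<in>S_integers S. \<exists>u'\<in>S_integers S. \<exists>h\<in>P. \<exists>h'\<in>P.
              t = section_lincomb XK L u h u' h') \<Longrightarrow>
           counting_function V (height XK L d P') \<sim>[at_top]
             (\<lambda>B. c * measure (height_measure XK L d a P \<tau> P') (topspace (adelic_points XK))
                    * B powr a * ln B powr (b - 1))"
  shows "equidistributed V (diagonal_image XK L n s S) (height XK L d P) (image_points XK L n s S)
           (normalized (distr \<tau> (borel_of (image_points XK L n s S)) (adelic_image XK L n s S)))"
proof -
  note P = \<open>P = s ` {..n}\<close>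
  interpret height_counting XK L d n V a b c S s \<tau>
    by (intro height_counting.intro bundled_variety.intro variety.intro bundled_variety_axioms.intro height_counting_axioms.intro)
      (rule assms[unfolded P]; assumption)+
  show ?thesis unfolding P by (rule equidistributed_normalized)
qed

end
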